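(* Let $\Bbbk$ be an algebraically closed field of characteristic $p>0$ and let $H=H({\bf d_s},{\bf b_s},{\bf c_{s,t}})$ be a 2-step iterated Hopf Ore extension as described in the context. (1) $S^2$ is the identity of $H$, where $S$ is the antipode. (2) $H$ is commutative if and only if ${\bf d_s}={\bf 0}$. (3) $H$ is cocommutative if and only if ${\bf c_{s,t}}={\bf 0}$ or $p=2$. (4) Suppose that $H$ is not commutative. Then the center of $H$ is $\Bbbk[X_1^p,\,X_2^p-d_0^{p-1}X_2]$. Hence the PI-degree of $H$ is $p$. (5) The Nakayama automorphism $\mu$ of $H$ is determined by $\mu(X_1)=X_1$ and $\mu(X_2)=X_2+d_0$. Hence $H$ is Calabi-Yau if and only if $d_0=0$. (6) The left homological integral $\int^l_H$ of $H$ is the one-dimensional $H$-bimodule which is trivial as a left module and with $\int^l_H\cong H/(X_1,X_2-d_0)$ as a right module.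
   Context: Let ${\bf d_s}=\{d_s\}_{s\ge0}$, ${\bf b_s}=\{b_s\}_{s\ge0}$ and ${\bf c_{s,t}}=\{c_{s,t}\}_{0\le s<t}$ be sequences of scalars in $\Bbbk$ with only finitely many nonzero elements. $H({\bf d_s},{\bf b_s},{\bf c_{s,t}})$ denotes the Hopf algebra whose underlying algebra is the Ore extension $\Bbbk[X_1][X_2;\mathrm{Id},\delta]$, i.e. is generated by $X_1,X_2$ with the relation $X_2X_1-X_1X_2=\delta(X_1)=\sum_{s\ge0}d_sX_1^{p^s}$, with $\epsilon(X_1)=\epsilon(X_2)=0$, $\Delta(X_1)=X_1\otimes1+1\otimes X_1$ and $\Delta(X_2)=X_2\otimes1+1\otimes X_2+w$, where $$w=\sum_{s\ge0}b_s\Big(\sum_{i=1}^{p-1}\tfrac{(p-1)!}{i!(p-i)!}(X_1^{p^s})^i\otimes(X_1^{p^s})^{p-i}\Big)+\sum_{0\le s<t}c_{s,t}\big(X_1^{p^s}\otimes X_1^{p^t}-X_1^{p^t}\otimes X_1^{p^s}\big).$$ The PI-degree of a prime PI ring $R$ with total quotient ring $Q(R)$ is $d$ where $d^2=\dim_{Z(Q(R))}Q(R)$. The Nakayama automorphism $\mu$ of $H$ is the algebra automorphism with $\mathrm{Ext}^2_{H^e}(H,H^e)\cong{}^1H^\mu$ as bimodules (right action twisted by $\mu$, i.e. $m\cdot h=m\mu(h)$), other $\mathrm{Ext}^i_{H^e}(H,H^e)$ being zero, where $H^e=H\otimes H^{op}$; it is unique up to inner automorphisms, hence unique here, since the units of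 $H$ are scalars. $H$ is Calabi-Yau if $\mu$ is inner (equivalently here, the identity). The left homological integral is $\int^l_H=\mathrm{Ext}^2_H({}_H\Bbbk,{}_HH)$, where $\Bbbk$ is the trivial module and $2$ is the injective dimension of $H$, with its natural $H$-bimodule structure. *)

theory Defs
  imports
    "HOL-Library.Poly_Mapping"
    "HOL-Computational_Algebra.Computational_Algebra"
    "HOL-Algebra.QuotRing"
    "HOL-Algebra.Module"
    "HOL-Algebra.Generated_Rings"
    "HOL-Algebra.Embedded_Algebras"
begin

section \<open>Algebras over a field and tensor products\<close>

text \<open>
  The ground field is a type \<open>'k :: field\<close>. The library locale \<^locale>\<open>algebra\<close> is commutative,
  so associative unital algebras are introduced here, on the library record
  \<^typ>\<open>('k, 'a) module\<close>.
\<close>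

locale k_algebra = ring A for A :: "('k::field, 'a, 'z) module_scheme" (structure) +
  assumes scal_closed: "x \<in> carrier A \<Longrightarrow> r \<odot> x \<in> carrier A"
    and scal_add_left: "x \<in> carrier A \<Longrightarrow> (r + s) \<odot> x = r \<odot> x \<oplus> s \<odot> x"
    and scal_add_right: "\<lbrakk>x \<in> carrier A; y \<in> carrier A\<rbrakk> \<Longrightarrow> r \<odot> (x \<oplus> y) = r \<odot> x \<oplus> r \<odot> y"
    and scal_scal: "x \<in> carrier A \<Longrightarrow> r \<odot> (s \<odot> x) = (r * s) \<odot> x"
    and scal_one: "x \<in> carrier A \<Longrightarrow> 1 \<odot> x = x"
    and scal_mult_left: "\<lbrakk>x \<in> carrier A; y \<in> carrier A\<rbrakk> \<Longrightarrow> (r \<odot> x) \<otimes> y = r \<odot> (x \<otimes> y)"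
    and scal_mult_right: "\<lbrakk>x \<in> carrier A; y \<in> carrier A\<rbrakk> \<Longrightarrow> x \<otimes> (r \<odot> y) = r \<odot> (x \<otimes> y)"

definition alg_hom :: "('k::field, 'a, 'x) module_scheme \<Rightarrow> ('k, 'b, 'y) module_scheme \<Rightarrow> ('a \<Rightarrow> 'b) set"
  where "alg_hom A B = {f \<in> ring_hom A B. \<forall>r. \<forall>x \<in> carrier A. f (r \<odot>\<^bsub>A\<^esub> x) = r \<odot>\<^bsub>B\<^esub> f x}"

definition alg_automorphisms :: "('k::field, 'a, 'x) module_scheme \<Rightarrow> ('a \<Rightarrow> 'a) set"
  where "alg_automorphisms A = {f \<in> alg_hom A A. bij_betw f (carrier A) (carrier A)}"

definition opposite_algebra :: "('k::field, 'a, 'x) module_scheme \<Rightarrow> ('k, 'a, 'x) module_scheme"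
  where "opposite_algebra A = A\<lparr>mult := \<lambda>x y. y \<otimes>\<^bsub>A\<^esub> x\<rparr>"

text \<open>
  \<open>A \<otimes> B\<close> is the algebra with basis the product monoid \<open>A \<times> B\<close>, modulo the ideal generated
  by the bilinearity relations. (The set of relations is stable under multiplication by pairs,
  so that the ideal is just their linear span.)
\<close>

definition pair_algebra ::
    "('k::field, 'a, 'x) module_scheme \<Rightarrow> ('k, 'b, 'y) module_scheme \<Rightarrow> ('a \<times> 'b \<Rightarrow>\<^sub>0 'k) ring"
  where "pair_algebra A B =
    \<lparr>carrier = {f. Poly_Mapping.keys f \<subseteq> carrier A \<times> carrier B},
     mult = (\<lambda>f g. \<Sum>u \<in> Poly_Mapping.keys f. \<Sum>v \<in> Poly_Mapping.keys g.
        Poly_Mapping.single (fst u \<otimes>\<^bsub>A\<^esub> fst v, snd u \<otimes>\<^bsub>B\<^esub> snd v)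
          (Poly_Mapping.lookup f u * Poly_Mapping.lookup g v)),
     one = Poly_Mapping.single (\<one>\<^bsub>A\<^esub>, \<one>\<^bsub>B\<^esub>) 1,
     zero = 0,
     add = (+)\<rparr>"

definition bilinear_relators ::
    "('k::field, 'a, 'x) module_scheme \<Rightarrow> ('k, 'b, 'y) module_scheme \<Rightarrow> ('a \<times> 'b \<Rightarrow>\<^sub>0 'k) set"
  where "bilinear_relators A B =
    {Poly_Mapping.single (a \<oplus>\<^bsub>A\<^esub> a', b) 1 - Poly_Mapping.single (a, b) 1
        - Poly_Mapping.single (a', b) 1 | a a' b.
        a \<in> carrier A \<and> a' \<in> carrier A \<and> b \<in> carrier B}
    \<union> {Poly_Mapping.single (a, b \<oplus>\<^bsub>B\<^esub> b') 1 - Poly_Mapping.single (a, b) 1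
        - Poly_Mapping.single (a, b') 1 | a b b'.
        a \<in> carrier A \<and> b \<in> carrier B \<and> b' \<in> carrier B}
    \<union> {Poly_Mapping.single (r \<odot>\<^bsub>A\<^esub> a, b) 1 - Poly_Mapping.single (a, b) r | r a b.
        a \<in> carrier A \<and> b \<in> carrier B}
    \<union> {Poly_Mapping.single (a, r \<odot>\<^bsub>B\<^esub> b) 1 - Poly_Mapping.single (a, b) r | r a b.
        a \<in> carrier A \<and> b \<in> carrier B}"

definition tensor_ideal ::
    "('k::field, 'a, 'x) module_scheme \<Rightarrow> ('k, 'b, 'y) module_scheme \<Rightarrow> ('a \<times> 'b \<Rightarrow>\<^sub>0 'k) set"
  where "tensor_ideal A B = genideal (pair_algebra A B) (bilinear_relators A B)"

definition pure ::
    "('k::field, 'a, 'x) module_scheme \<Rightarrow> ('k, 'b, 'y) module_scheme \<Rightarrow> 'a \<Rightarrow> 'b \<Rightarrow> ('a \<times> 'b \<Rightarrow>\<^sub>0 'k) set"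
  where "pure A B a b = tensor_ideal A B +>\<^bsub>pair_algebra A B\<^esub> Poly_Mapping.single (a, b) 1"

definition tensor ::
    "('k::field, 'a, 'x) module_scheme \<Rightarrow> ('k, 'b, 'y) module_scheme \<Rightarrow> ('k, ('a \<times> 'b \<Rightarrow>\<^sub>0 'k) set) module"
  where "tensor A B =
    (let Q = pair_algebra A B Quot tensor_ideal A B
     in ring.extend Q (module.fields (\<lambda>r X. pure A B (r \<odot>\<^bsub>A\<^esub> \<one>\<^bsub>A\<^esub>) \<one>\<^bsub>B\<^esub> \<otimes>\<^bsub>Q\<^esub> X)))"

text \<open>
  The linear map \<open>A \<otimes> B \<rightarrow> C\<close> induced by a bilinear map \<open>\<phi> : A \<times> B \<rightarrow> C\<close>; for bilinear \<open>\<phi>\<close>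
  the value does not depend on the chosen representative.
\<close>

definition tensor_lift ::
    "('k::field, 'c, 'z) module_scheme \<Rightarrow> ('a \<Rightarrow> 'b \<Rightarrow> 'c) \<Rightarrow> ('a \<times> 'b \<Rightarrow>\<^sub>0 'k) set \<Rightarrow> 'c"
  where "tensor_lift C \<phi> X =
    (let u = (SOME u. u \<in> X) in
      \<Oplus>\<^bsub>C\<^esub>v \<in> Poly_Mapping.keys u. Poly_Mapping.lookup u v \<odot>\<^bsub>C\<^esub> \<phi> (fst v) (snd v))"

section \<open>Hopf algebras\<close>

locale hopf_algebra = k_algebra A for A :: "('k::field, 'a) module" (structure) +
  fixes \<Delta> :: "'a \<Rightarrow> ('a \<times> 'a \<Rightarrow>\<^sub>0 'k) set" and \<epsilon> :: "'a \<Rightarrow> 'k" and S :: "'a \<Rightarrow> 'a"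
  assumes comult_hom: "\<Delta> \<in> alg_hom A (tensor A A)"
    and counit_add: "\<lbrakk>x \<in> carrier A; y \<in> carrier A\<rbrakk> \<Longrightarrow> \<epsilon> (x \<oplus> y) = \<epsilon> x + \<epsilon> y"
    and counit_mult: "\<lbrakk>x \<in> carrier A; y \<in> carrier A\<rbrakk> \<Longrightarrow> \<epsilon> (x \<otimes> y) = \<epsilon> x * \<epsilon> y"
    and counit_one: "\<epsilon> \<one> = 1"
    and counit_scal: "x \<in> carrier A \<Longrightarrow> \<epsilon> (r \<odot> x) = r * \<epsilon> x"
    and coassociative: "x \<in> carrier A \<Longrightarrow>
      tensor_lift (tensor A (tensor A A)) (\<lambda>a b. pure A (tensor A A) a (\<Delta> b)) (\<Delta> x) =
      tensor_lift (tensor A (tensor A A))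
        (\<lambda>a b. tensor_lift (tensor A (tensor A A))
           (\<lambda>a' a''. pure A (tensor A A) a' (pure A A a'' b)) (\<Delta> a)) (\<Delta> x)"
    and counit_left: "x \<in> carrier A \<Longrightarrow> tensor_lift A (\<lambda>a b. \<epsilon> a \<odot> b) (\<Delta> x) = x"
    and counit_right: "x \<in> carrier A \<Longrightarrow> tensor_lift A (\<lambda>a b. \<epsilon> b \<odot> a) (\<Delta> x) = x"
    and antipode_closed: "x \<in> carrier A \<Longrightarrow> S x \<in> carrier A"
    and antipode_add: "\<lbrakk>x \<in> carrier A; y \<in> carrier A\<rbrakk> \<Longrightarrow> S (x \<oplus> y) = S x \<oplus> S y"
    and antipode_scal: "x \<in> carrier A \<Longrightarrow> S (r \<odot> x) = r \<odot> S x"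
    and antipode_left: "x \<in> carrier A \<Longrightarrow> tensor_lift A (\<lambda>a b. S a \<otimes> b) (\<Delta> x) = \<epsilon> x \<odot> \<one>"
    and antipode_right: "x \<in> carrier A \<Longrightarrow> tensor_lift A (\<lambda>a b. a \<otimes> S b) (\<Delta> x) = \<epsilon> x \<odot> \<one>"

definition cocommutative :: "('k::field, 'a) module \<Rightarrow> ('a \<Rightarrow> ('a \<times> 'a \<Rightarrow>\<^sub>0 'k) set) \<Rightarrow> bool"
  where "cocommutative A \<Delta> \<longleftrightarrow>
    (\<forall>x \<in> carrier A. tensor_lift (tensor A A) (\<lambda>a b. pure A A b a) (\<Delta> x) = \<Delta> x)"

section \<open>Ore extensions and the Hopf algebras \<open>H(d,b,c)\<close>\<close>

text \<open>
  The Ore extension \<open>R[Y;\<sigma>,\<delta>]\<close> is the free left \<open>R\<close>-module on the powers of \<open>Y\<close> (coefficients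
  are written on the left) with \<open>Y r = \<sigma>(r) Y + \<delta>(r)\<close>. \<open>ore_shift\<close> is left multiplication by \<open>Y\<close>.
\<close>

definition ore_shift :: "('r::comm_ring_1 \<Rightarrow> 'r) \<Rightarrow> ('r \<Rightarrow> 'r) \<Rightarrow> 'r poly \<Rightarrow> 'r poly"
  where "ore_shift \<sigma> \<delta> g = pCons 0 (map_poly \<sigma> g) + map_poly \<delta> g"

definition ore_extension :: "('r::comm_ring_1 \<Rightarrow> 'r) \<Rightarrow> ('r \<Rightarrow> 'r) \<Rightarrow> 'r poly ring"
  where "ore_extension \<sigma> \<delta> =
    \<lparr>carrier = UNIV,
     mult = (\<lambda>f g. \<Sum>i\<le>degree f. Polynomial.smult (poly.coeff f i) ((ore_shift \<sigma> \<delta> ^^ i) g)),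
     one = 1, zero = 0, add = (+)\<rparr>"

text \<open>
  The derivation of \<open>k[X1]\<close> with \<open>\<delta>(X1) = \<Sum>s. d s * X1 ^ (p ^ s)\<close>, where \<open>p = CHAR('k)\<close>.
\<close>

definition hoe_derivation :: "(nat \<Rightarrow> 'k::field) \<Rightarrow> 'k poly \<Rightarrow> 'k poly"
  where "hoe_derivation d f =
    pderiv f * (\<Sum>s \<in> {s. d s \<noteq> 0}. Polynomial.monom (d s) (CHAR('k) ^ s))"

text \<open>In \<^typ>\<open>'k poly poly\<close> the inner variable is \<open>X1\<close> and the outer one is \<open>X2\<close>.\<close>

definition hoe_algebra :: "(nat \<Rightarrow> 'k::field) \<Rightarrow> ('k, 'k poly poly) module"
  where "hoe_algebra d =
    ring.extend (ore_extension id (hoe_derivation d)) (module.fields (\<lambda>a. Polynomial.smult [:a:]))"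

definition X1 :: "'k::field poly poly" where "X1 = [:[:0, 1:]:]"

definition X2 :: "'k::field poly poly" where "X2 = [:0, 1:]"

definition hoe_w ::
    "(nat \<Rightarrow> 'k::field) \<Rightarrow> (nat \<Rightarrow> 'k) \<Rightarrow> (nat \<Rightarrow> nat \<Rightarrow> 'k) \<Rightarrow> ('k poly poly \<times> 'k poly poly \<Rightarrow>\<^sub>0 'k) set"
  where "hoe_w d b c =
    (let H = hoe_algebra d; T = tensor H H; p = CHAR('k); Y = (\<lambda>s::nat. X1 [^]\<^bsub>H\<^esub> (p ^ s)) in
      (\<Oplus>\<^bsub>T\<^esub>s \<in> {s. b s \<noteq> 0}. b s \<odot>\<^bsub>T\<^esub>
         (\<Oplus>\<^bsub>T\<^esub>i \<in> {1..p - 1}. (of_nat (fact (p - 1)) / of_nat (fact i * fact (p - i)))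
            \<odot>\<^bsub>T\<^esub> pure H H (Y s [^]\<^bsub>H\<^esub> i) (Y s [^]\<^bsub>H\<^esub> (p - i))))
      \<oplus>\<^bsub>T\<^esub>
      (\<Oplus>\<^bsub>T\<^esub>j \<in> {(s, t). s < t \<and> c s t \<noteq> 0}. case j of (s, t) \<Rightarrow> c s t \<odot>\<^bsub>T\<^esub>
         (pure H H (Y s) (Y t) \<ominus>\<^bsub>T\<^esub> pure H H (Y t) (Y s))))"

text \<open>
  The Hopf algebra structure of \<open>H(d,b,c)\<close>. Only the \<open>c s t\<close> with \<open>s < t\<close> are parameters.
\<close>

locale hoe_hopf = hopf_algebra "hoe_algebra d" \<Delta> \<epsilon> S
  for d :: "nat \<Rightarrow> 'k::field" and \<Delta> \<epsilon> S +
  fixes b :: "nat \<Rightarrow> 'k" and c :: "nat \<Rightarrow> nat \<Rightarrow> 'k"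
  assumes finite_d: "finite {s. d s \<noteq> 0}"
    and finite_b: "finite {s. b s \<noteq> 0}"
    and finite_c: "finite {(s, t). s < t \<and> c s t \<noteq> 0}"
    and counit_X1: "\<epsilon> X1 = 0"
    and counit_X2: "\<epsilon> X2 = 0"
    and comult_X1: "\<Delta> X1 =
      pure (hoe_algebra d) (hoe_algebra d) X1 \<one>\<^bsub>hoe_algebra d\<^esub>
      \<oplus>\<^bsub>tensor (hoe_algebra d) (hoe_algebra d)\<^esub>
      pure (hoe_algebra d) (hoe_algebra d) \<one>\<^bsub>hoe_algebra d\<^esub> X1"
    and comult_X2: "\<Delta> X2 =
      pure (hoe_algebra d) (hoe_algebra d) X2 \<one>\<^bsub>hoe_algebra d\<^esub>
      \<oplus>\<^bsub>tensor (hoe_algebra d) (hoe_algebra d)\<^esub>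
      pure (hoe_algebra d) (hoe_algebra d) \<one>\<^bsub>hoe_algebra d\<^esub> X2
      \<oplus>\<^bsub>tensor (hoe_algebra d) (hoe_algebra d)\<^esub> hoe_w d b c"

section \<open>Centers and PI-degree\<close>

definition ring_center :: "('a, 'z) ring_scheme \<Rightarrow> 'a set"
  where "ring_center R = {z \<in> carrier R. \<forall>x \<in> carrier R. z \<otimes>\<^bsub>R\<^esub> x = x \<otimes>\<^bsub>R\<^esub> z}"

definition generated_subalgebra :: "('k::field, 'a, 'z) module_scheme \<Rightarrow> 'a set \<Rightarrow> 'a set"
  where "generated_subalgebra A G = generate_ring A (range (\<lambda>r. r \<odot>\<^bsub>A\<^esub> \<one>\<^bsub>A\<^esub>) \<union> G)"

definition prime_ring :: "('a, 'z) ring_scheme \<Rightarrow> bool"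
  where "prime_ring R \<longleftrightarrow> ring R \<and> \<one>\<^bsub>R\<^esub> \<noteq> \<zero>\<^bsub>R\<^esub> \<and>
    (\<forall>a \<in> carrier R. \<forall>b \<in> carrier R.
      (\<forall>x \<in> carrier R. a \<otimes>\<^bsub>R\<^esub> x \<otimes>\<^bsub>R\<^esub> b = \<zero>\<^bsub>R\<^esub>) \<longrightarrow> a = \<zero>\<^bsub>R\<^esub> \<or> b = \<zero>\<^bsub>R\<^esub>)"

text \<open>
  Elements of the free ring \<open>\<int>\<langle>x\<^sub>0, x\<^sub>1, \<dots>\<rangle>\<close> are finitely supported functions on words. A PI ring
  satisfies an element which is monic, i.e. in which some word of maximal length has coefficient 1.
\<close>

definition free_ring_eval :: "('a, 'z) ring_scheme \<Rightarrow> (nat \<Rightarrow> 'a) \<Rightarrow> (nat list \<Rightarrow>\<^sub>0 int) \<Rightarrow> 'a"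
  where "free_ring_eval R x f =
    (\<Oplus>\<^bsub>R\<^esub>w \<in> Poly_Mapping.keys f.
      [Poly_Mapping.lookup f w] \<cdot>\<^bsub>R\<^esub> foldr (\<lambda>i a. x i \<otimes>\<^bsub>R\<^esub> a) w \<one>\<^bsub>R\<^esub>)"

definition PI_ring :: "('a, 'z) ring_scheme \<Rightarrow> bool"
  where "PI_ring R \<longleftrightarrow> ring R \<and>
    (\<exists>f. (\<exists>w. Poly_Mapping.lookup f w = 1 \<and> (\<forall>v \<in> Poly_Mapping.keys f. length v \<le> length w)) \<and>
       (\<forall>x. range x \<subseteq> carrier R \<longrightarrow> free_ring_eval R x f = \<zero>\<^bsub>R\<^esub>))"

definition regular_elements :: "('a, 'z) ring_scheme \<Rightarrow> 'a set"
  where "regular_elements R = {s \<in> carrier R. \<forall>x \<in> carrier R.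
    (s \<otimes>\<^bsub>R\<^esub> x = \<zero>\<^bsub>R\<^esub> \<longrightarrow> x = \<zero>\<^bsub>R\<^esub>) \<and> (x \<otimes>\<^bsub>R\<^esub> s = \<zero>\<^bsub>R\<^esub> \<longrightarrow> x = \<zero>\<^bsub>R\<^esub>)}"

definition total_quotient_ring :: "('a, 'y) ring_scheme \<Rightarrow> ('q, 'z) ring_scheme \<Rightarrow> ('a \<Rightarrow> 'q) \<Rightarrow> bool"
  where "total_quotient_ring R Q \<iota> \<longleftrightarrow> ring Q \<and> \<iota> \<in> ring_hom R Q \<and> inj_on \<iota> (carrier R) \<and>
    (\<forall>s \<in> regular_elements R. \<iota> s \<in> Units Q) \<and>
    (\<forall>q \<in> carrier Q. \<exists>a \<in> carrier R. \<exists>s \<in> regular_elements R. q = \<iota> a \<otimes>\<^bsub>Q\<^esub> inv\<^bsub>Q\<^esub> (\<iota> s)) \<and>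
    (\<forall>q \<in> carrier Q. \<exists>a \<in> carrier R. \<exists>s \<in> regular_elements R. q = inv\<^bsub>Q\<^esub> (\<iota> s) \<otimes>\<^bsub>Q\<^esub> \<iota> a)"

text \<open>
  The type of \<open>Q\<close>, sets of pairs, is large enough for the classes of fractions of \<open>R\<close>, and \<open>Q\<close> is
  unique up to isomorphism over \<open>R\<close>.
\<close>

definition has_PI_degree :: "('a, 'z) ring_scheme \<Rightarrow> nat \<Rightarrow> bool"
  where "has_PI_degree R n \<longleftrightarrow> prime_ring R \<and> PI_ring R \<and>
    (\<exists>(Q :: ('a \<times> 'a) set ring) \<iota>. total_quotient_ring R Q \<iota> \<and>
       subfield (ring_center Q) Q \<and> ring.dimension Q (n\<^sup>2) (ring_center Q) (carrier Q))"

section \<open>Ext\<close>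

locale left_module = R?: ring R + M?: abelian_group M
  for R :: "('r, 'y) ring_scheme" (structure) and M :: "('r, 'm, 'z) module_scheme" (structure) +
  assumes act_closed: "\<lbrakk>a \<in> carrier R; x \<in> carrier M\<rbrakk> \<Longrightarrow> a \<odot>\<^bsub>M\<^esub> x \<in> carrier M"
    and act_add_left: "\<lbrakk>a \<in> carrier R; b \<in> carrier R; x \<in> carrier M\<rbrakk> \<Longrightarrow>
      (a \<oplus>\<^bsub>R\<^esub> b) \<odot>\<^bsub>M\<^esub> x = a \<odot>\<^bsub>M\<^esub> x \<oplus>\<^bsub>M\<^esub> b \<odot>\<^bsub>M\<^esub> x"
    and act_add_right: "\<lbrakk>a \<in> carrier R; x \<in> carrier M; y \<in> carrier M\<rbrakk> \<Longrightarrow>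
      a \<odot>\<^bsub>M\<^esub> (x \<oplus>\<^bsub>M\<^esub> y) = a \<odot>\<^bsub>M\<^esub> x \<oplus>\<^bsub>M\<^esub> a \<odot>\<^bsub>M\<^esub> y"
    and act_act: "\<lbrakk>a \<in> carrier R; b \<in> carrier R; x \<in> carrier M\<rbrakk> \<Longrightarrow>
      (a \<otimes>\<^bsub>R\<^esub> b) \<odot>\<^bsub>M\<^esub> x = a \<odot>\<^bsub>M\<^esub> (b \<odot>\<^bsub>M\<^esub> x)"
    and act_one: "x \<in> carrier M \<Longrightarrow> \<one>\<^bsub>R\<^esub> \<odot>\<^bsub>M\<^esub> x = x"

definition module_hom ::
    "('r, 'y) ring_scheme \<Rightarrow> ('r, 'm, 'z) module_scheme \<Rightarrow> ('r, 'n, 'w) module_scheme \<Rightarrow> ('m \<Rightarrow> 'n) set"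
  where "module_hom R M N = {f \<in> carrier M \<rightarrow>\<^sub>E carrier N.
    (\<forall>x \<in> carrier M. \<forall>y \<in> carrier M. f (x \<oplus>\<^bsub>M\<^esub> y) = f x \<oplus>\<^bsub>N\<^esub> f y) \<and>
    (\<forall>a \<in> carrier R. \<forall>x \<in> carrier M. f (a \<odot>\<^bsub>M\<^esub> x) = a \<odot>\<^bsub>N\<^esub> f x)}"

definition free_module :: "('r, 'y) ring_scheme \<Rightarrow> ('r, 'm, 'z) module_scheme \<Rightarrow> bool"
  where "free_module R M \<longleftrightarrow> left_module R M \<and>
    (\<exists>B \<subseteq> carrier M. \<forall>x \<in> carrier M. \<exists>!r. r \<in> B \<rightarrow>\<^sub>E carrier R \<and> finite {b \<in> B. r b \<noteq> \<zero>\<^bsub>R\<^esub>} \<and>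
       x = (\<Oplus>\<^bsub>M\<^esub>b \<in> {b \<in> B. r b \<noteq> \<zero>\<^bsub>R\<^esub>}. r b \<odot>\<^bsub>M\<^esub> b))"

text \<open>A resolution \<open>\<dots> \<rightarrow> F 2 \<rightarrow> F 1 \<rightarrow> F 0 \<rightarrow> M \<rightarrow> 0\<close> with differentials \<open>D n : F (n+1) \<rightarrow> F n\<close>.\<close>

definition free_resolution ::
    "('r, 'y) ring_scheme \<Rightarrow> ('r, 'm, 'z) module_scheme \<Rightarrow>
     (nat \<Rightarrow> ('r, 'u) module) \<Rightarrow> (nat \<Rightarrow> 'u \<Rightarrow> 'u) \<Rightarrow> ('u \<Rightarrow> 'm) \<Rightarrow> bool"
  where "free_resolution R M F D \<eta> \<longleftrightarrow>
    (\<forall>n. free_module R (F n)) \<and>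
    (\<forall>n. D n \<in> module_hom R (F (Suc n)) (F n)) \<and>
    \<eta> \<in> module_hom R (F 0) M \<and>
    \<eta> ` carrier (F 0) = carrier M \<and>
    D 0 ` carrier (F 1) = {x \<in> carrier (F 0). \<eta> x = \<zero>\<^bsub>M\<^esub>} \<and>
    (\<forall>n. D (Suc n) ` carrier (F (Suc (Suc n))) =
       {x \<in> carrier (F (Suc n)). D n x = \<zero>\<^bsub>F n\<^esub>})"

text \<open>
  Ext is computed from a chosen free (hence projective) resolution. Lists over \<open>'m + 'r\<close> are
  sufficiently many to carry one for any module \<open>M\<close>: every \<open>M\<close> has a free resolution by modules
  of cardinality at most the maximum of \<open>card M\<close>, \<open>card R\<close> and aleph-zero.
\<close>

definition chosen_resolution ::
    "('r, 'y) ring_scheme \<Rightarrow> ('r, 'm, 'z) module_scheme \<Rightarrow>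
     (nat \<Rightarrow> ('r, ('m + 'r) list) module) \<times> (nat \<Rightarrow> ('m + 'r) list \<Rightarrow> ('m + 'r) list) \<times>
     (('m + 'r) list \<Rightarrow> 'm)"
  where "chosen_resolution R M = (SOME (F, D, \<eta>). free_resolution R M F D \<eta>)"

definition res_module ::
    "('r, 'y) ring_scheme \<Rightarrow> ('r, 'm, 'z) module_scheme \<Rightarrow> nat \<Rightarrow> ('r, ('m + 'r) list) module"
  where "res_module R M = fst (chosen_resolution R M)"

definition res_diff ::
    "('r, 'y) ring_scheme \<Rightarrow> ('r, 'm, 'z) module_scheme \<Rightarrow> nat \<Rightarrow> ('m + 'r) list \<Rightarrow> ('m + 'r) list"
  where "res_diff R M = fst (snd (chosen_resolution R M))"

definition res_aug ::
    "('r, 'y) ring_scheme \<Rightarrow> ('r, 'm, 'z) module_scheme \<Rightarrow> ('m + 'r) list \<Rightarrow> 'm"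
  where "res_aug R M = snd (snd (chosen_resolution R M))"

text \<open>The abelian group of homomorphisms; the multiplicative part of the record is irrelevant.\<close>

definition Hom_group ::
    "('r, 'y) ring_scheme \<Rightarrow> ('r, 'm, 'z) module_scheme \<Rightarrow> ('r, 'n, 'w) module_scheme \<Rightarrow> ('m \<Rightarrow> 'n) ring"
  where "Hom_group R M N =
    \<lparr>carrier = module_hom R M N, mult = undefined, one = undefined,
     zero = (\<lambda>x \<in> carrier M. \<zero>\<^bsub>N\<^esub>),
     add = (\<lambda>f g. \<lambda>x \<in> carrier M. f x \<oplus>\<^bsub>N\<^esub> g x)\<rparr>"

definition Ext_cochains ::
    "('r, 'y) ring_scheme \<Rightarrow> nat \<Rightarrow> ('r, 'm, 'z) module_scheme \<Rightarrow> ('r, 'n, 'w) module_scheme \<Rightarrow>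
     (('m + 'r) list \<Rightarrow> 'n) ring"
  where "Ext_cochains R n M N = Hom_group R (res_module R M n) N"

definition Ext_cocycles ::
    "('r, 'y) ring_scheme \<Rightarrow> nat \<Rightarrow> ('r, 'm, 'z) module_scheme \<Rightarrow> ('r, 'n, 'w) module_scheme \<Rightarrow>
     (('m + 'r) list \<Rightarrow> 'n) set"
  where "Ext_cocycles R n M N = {f \<in> carrier (Ext_cochains R n M N).
    compose (carrier (res_module R M (Suc n))) f (res_diff R M n) = \<zero>\<^bsub>Ext_cochains R (Suc n) M N\<^esub>}"

definition Ext_coboundaries ::
    "('r, 'y) ring_scheme \<Rightarrow> nat \<Rightarrow> ('r, 'm, 'z) module_scheme \<Rightarrow> ('r, 'n, 'w) module_scheme \<Rightarrow>
     (('m + 'r) list \<Rightarrow> 'n) set"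
  where "Ext_coboundaries R n M N = (case n of
      0 \<Rightarrow> {\<zero>\<^bsub>Ext_cochains R 0 M N\<^esub>}
    | Suc m \<Rightarrow> (\<lambda>f. compose (carrier (res_module R M n)) f (res_diff R M m))
        ` carrier (Ext_cochains R m M N))"

definition Ext_class ::
    "('r, 'y) ring_scheme \<Rightarrow> nat \<Rightarrow> ('r, 'm, 'z) module_scheme \<Rightarrow> ('r, 'n, 'w) module_scheme \<Rightarrow>
     (('m + 'r) list \<Rightarrow> 'n) \<Rightarrow> (('m + 'r) list \<Rightarrow> 'n) set"
  where "Ext_class R n M N f = Ext_coboundaries R n M N +>\<^bsub>Ext_cochains R n M N\<^esub> f"

definition Ext ::
    "('r, 'y) ring_scheme \<Rightarrow> nat \<Rightarrow> ('r, 'm, 'z) module_scheme \<Rightarrow> ('r, 'n, 'w) module_scheme \<Rightarrow>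
     (('m + 'r) list \<Rightarrow> 'n) set ring"
  where "Ext R n M N =
    \<lparr>carrier = Ext_class R n M N ` Ext_cocycles R n M N, mult = undefined, one = undefined,
     zero = Ext_coboundaries R n M N, add = set_add (Ext_cochains R n M N)\<rparr>"

text \<open>Functoriality: \<open>Ext(M,g)\<close> for \<open>g : N \<rightarrow> N'\<close>, and \<open>Ext(h,N)\<close> for \<open>h : M' \<rightarrow> M\<close>.\<close>

definition Ext_map_right ::
    "('r, 'y) ring_scheme \<Rightarrow> nat \<Rightarrow> ('r, 'm, 'z) module_scheme \<Rightarrow> ('r, 'n, 'w) module_scheme \<Rightarrow>
     ('l \<Rightarrow> 'n) \<Rightarrow> (('m + 'r) list \<Rightarrow> 'l) set \<Rightarrow> (('m + 'r) list \<Rightarrow> 'n) set"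
  where "Ext_map_right R n M N' g X =
    (\<Union>f \<in> X. Ext_class R n M N' (compose (carrier (res_module R M n)) g f))"

definition chain_lifts ::
    "('r, 'y) ring_scheme \<Rightarrow> ('r, 'l, 'w) module_scheme \<Rightarrow> ('r, 'm, 'z) module_scheme \<Rightarrow>
     ('l \<Rightarrow> 'm) \<Rightarrow> (nat \<Rightarrow> ('l + 'r) list \<Rightarrow> ('m + 'r) list) set"
  where "chain_lifts R M' M h = {\<phi>.
    (\<forall>n. \<phi> n \<in> module_hom R (res_module R M' n) (res_module R M n)) \<and>
    (\<forall>x \<in> carrier (res_module R M' 0). res_aug R M (\<phi> 0 x) = h (res_aug R M' x)) \<and>
    (\<forall>n. \<forall>x \<in> carrier (res_module R M' (Suc n)).
       res_diff R M n (\<phi> (Suc n) x) = \<phi> n (res_diff R M' n x))}"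

definition Ext_map_left ::
    "('r, 'y) ring_scheme \<Rightarrow> nat \<Rightarrow> ('r, 'l, 'v) module_scheme \<Rightarrow> ('r, 'm, 'z) module_scheme \<Rightarrow>
     ('r, 'n, 'w) module_scheme \<Rightarrow> ('l \<Rightarrow> 'm) \<Rightarrow> (('m + 'r) list \<Rightarrow> 'n) set \<Rightarrow> (('l + 'r) list \<Rightarrow> 'n) set"
  where "Ext_map_left R n M' M N h X =
    (\<Union>f \<in> X. \<Union>\<phi> \<in> chain_lifts R M' M h.
       Ext_class R n M' N (compose (carrier (res_module R M' n)) f (\<phi> n)))"

section \<open>Bimodules, Nakayama automorphisms and homological integrals\<close>

record ('r, 'm, 's) bimodule = "('r, 'm) module" +
  rsmult :: "'m \<Rightarrow> 's \<Rightarrow> 'm"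

definition with_action :: "('m, 'z) ring_scheme \<Rightarrow> ('r \<Rightarrow> 'm \<Rightarrow> 'm) \<Rightarrow> ('r, 'm) module"
  where "with_action M l = ring.extend (ring.truncate M) (module.fields l)"

definition with_actions ::
    "('m, 'z) ring_scheme \<Rightarrow> ('r \<Rightarrow> 'm \<Rightarrow> 'm) \<Rightarrow> ('m \<Rightarrow> 's \<Rightarrow> 'm) \<Rightarrow> ('r, 'm, 's) bimodule"
  where "with_actions M l r = module.extend (with_action M l) (bimodule.fields r)"

definition bimodule_iso ::
    "('r, 'x) ring_scheme \<Rightarrow> ('s, 'y) ring_scheme \<Rightarrow> ('r, 'm, 's) bimodule \<Rightarrow> ('r, 'n, 's) bimodule \<Rightarrow> bool"
  where "bimodule_iso R T M N \<longleftrightarrow> (\<exists>\<phi>. bij_betw \<phi> (carrier M) (carrier N) \<and>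
    (\<forall>x \<in> carrier M. \<forall>y \<in> carrier M. \<phi> (x \<oplus>\<^bsub>M\<^esub> y) = \<phi> x \<oplus>\<^bsub>N\<^esub> \<phi> y) \<and>
    (\<forall>a \<in> carrier R. \<forall>x \<in> carrier M. \<phi> (a \<odot>\<^bsub>M\<^esub> x) = a \<odot>\<^bsub>N\<^esub> \<phi> x) \<and>
    (\<forall>a \<in> carrier T. \<forall>x \<in> carrier M. \<phi> (rsmult M x a) = rsmult N (\<phi> x) a))"

definition right_module_iso ::
    "('s, 'y) ring_scheme \<Rightarrow> ('r, 'm, 's) bimodule \<Rightarrow> ('q, 'n, 's) bimodule \<Rightarrow> bool"
  where "right_module_iso T M N \<longleftrightarrow> (\<exists>\<phi>. bij_betw \<phi> (carrier M) (carrier N) \<and>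
    (\<forall>x \<in> carrier M. \<forall>y \<in> carrier M. \<phi> (x \<oplus>\<^bsub>M\<^esub> y) = \<phi> x \<oplus>\<^bsub>N\<^esub> \<phi> y) \<and>
    (\<forall>a \<in> carrier T. \<forall>x \<in> carrier M. \<phi> (rsmult M x a) = rsmult N (\<phi> x) a))"

definition enveloping_algebra ::
    "('k::field, 'a) module \<Rightarrow> ('k, ('a \<times> 'a \<Rightarrow>\<^sub>0 'k) set) module"
  where "enveloping_algebra A = tensor A (opposite_algebra A)"

text \<open>\<open>A\<close> as a left module over its enveloping algebra: \<open>(x \<otimes> y) m = x m y\<close>.\<close>

definition env_module :: "('k::field, 'a) module \<Rightarrow> (('a \<times> 'a \<Rightarrow>\<^sub>0 'k) set, 'a) module"
  where "env_module A =
    with_action A (\<lambda>X m. tensor_lift A (\<lambda>x y. x \<otimes>\<^bsub>A\<^esub> m \<otimes>\<^bsub>A\<^esub> y) X)"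

definition regular_module :: "('a, 'z) ring_scheme \<Rightarrow> ('a, 'a) module"
  where "regular_module R = with_action R (mult R)"

text \<open>
  \<open>Ext\<^sup>n(A, A\<^sup>e)\<close> over \<open>A\<^sup>e\<close>, with the bimodule structure coming from the right multiplication of
  \<open>A\<^sup>e\<close> on itself: in \<open>A\<^sup>e\<close> one has \<open>(u \<otimes> v)(x \<otimes> y) = u x \<otimes> y v\<close>, so \<open>y \<cdot> \<xi> \<cdot> x = \<xi> (x \<otimes> y)\<close>.
\<close>

definition Ext_env ::
    "nat \<Rightarrow> ('k::field, 'a) module \<Rightarrow>
     ('a, (('a + ('a \<times> 'a \<Rightarrow>\<^sub>0 'k) set) list \<Rightarrow> ('a \<times> 'a \<Rightarrow>\<^sub>0 'k) set) set, 'a) bimodule"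
  where "Ext_env n A =
    (let E = enveloping_algebra A; M = env_module A; N = regular_module E;
         rmul = (\<lambda>x y u. u \<otimes>\<^bsub>E\<^esub> pure A (opposite_algebra A) x y)
     in with_actions (Ext E n M N)
          (\<lambda>y. Ext_map_right E n M N (rmul \<one>\<^bsub>A\<^esub> y))
          (\<lambda>\<xi> x. Ext_map_right E n M N (rmul x \<one>\<^bsub>A\<^esub>) \<xi>))"

definition twisted_bimodule :: "('k::field, 'a) module \<Rightarrow> ('a \<Rightarrow> 'a) \<Rightarrow> ('a, 'a, 'a) bimodule"
  where "twisted_bimodule A \<mu> = with_actions A (mult A) (\<lambda>m a. m \<otimes>\<^bsub>A\<^esub> \<mu> a)"

definition nakayama_automorphism :: "nat \<Rightarrow> ('k::field, 'a) module \<Rightarrow> ('a \<Rightarrow> 'a) \<Rightarrow> bool"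
  where "nakayama_automorphism n A \<mu> \<longleftrightarrow> \<mu> \<in> alg_automorphisms A \<and>
    (\<forall>i. i \<noteq> n \<longrightarrow> carrier (Ext_env i A) = {\<zero>\<^bsub>Ext_env i A\<^esub>}) \<and>
    bimodule_iso A A (Ext_env n A) (twisted_bimodule A \<mu>)"

definition inner_automorphism :: "('a, 'z) ring_scheme \<Rightarrow> ('a \<Rightarrow> 'a) \<Rightarrow> bool"
  where "inner_automorphism A \<mu> \<longleftrightarrow>
    (\<exists>u \<in> Units A. \<forall>x \<in> carrier A. \<mu> x = u \<otimes>\<^bsub>A\<^esub> x \<otimes>\<^bsub>A\<^esub> inv\<^bsub>A\<^esub> u)"

definition calabi_yau :: "nat \<Rightarrow> ('k::field, 'a) module \<Rightarrow> bool"
  where "calabi_yau n A \<longleftrightarrow> (\<exists>\<mu>. nakayama_automorphism n A \<mu> \<and> inner_automorphism A \<mu>)"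

definition trivial_module :: "('k::field, 'a) module \<Rightarrow> ('a \<Rightarrow> 'k) \<Rightarrow> ('a, 'k) module"
  where "trivial_module A \<epsilon> =
    \<lparr>carrier = UNIV, mult = (*), one = 1, zero = 0, add = (+), smult = (\<lambda>h x. \<epsilon> h * x)\<rparr>"

text \<open>
  \<open>Ext\<^sup>n\<close> of the trivial left module \<open>k\<close> and \<open>A\<close>. The left action comes from the right action of \<open>A\<close>
  on \<open>k\<close>, the right action from right multiplication on \<open>A\<close>.
\<close>

definition left_homological_integral ::
    "nat \<Rightarrow> ('k::field, 'a) module \<Rightarrow> ('a \<Rightarrow> 'k) \<Rightarrow> ('a, (('k + 'a) list \<Rightarrow> 'a) set, 'a) bimodule"
  where "left_homological_integral n A \<epsilon> =
    (let K = trivial_module A \<epsilon>; N = regular_module A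
     in with_actions (Ext A n K N)
          (\<lambda>h. Ext_map_left A n K K N (\<lambda>x. x * \<epsilon> h))
          (\<lambda>\<xi> h. Ext_map_right A n K N (\<lambda>a. a \<otimes>\<^bsub>A\<^esub> h) \<xi>))"

definition quotient_bimodule :: "('k::field, 'a) module \<Rightarrow> 'a set \<Rightarrow> ('a, 'a set, 'a) bimodule"
  where "quotient_bimodule A I =
    (let Q = A Quot I in with_actions Q
       (\<lambda>h X. (I +>\<^bsub>A\<^esub> h) \<otimes>\<^bsub>Q\<^esub> X) (\<lambda>X h. X \<otimes>\<^bsub>Q\<^esub> (I +>\<^bsub>A\<^esub> h)))"

text \<open>Scalars act on a bimodule through the unit of \<open>A\<close> (from the right).\<close>

definition one_dimensional ::
    "('k::field, 'a) module \<Rightarrow> ('a, 'm, 'a) bimodule \<Rightarrow> bool"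
  where "one_dimensional A M \<longleftrightarrow> (\<exists>v \<in> carrier M. v \<noteq> \<zero>\<^bsub>M\<^esub> \<and>
    carrier M = range (\<lambda>r. rsmult M v (r \<odot>\<^bsub>A\<^esub> \<one>\<^bsub>A\<^esub>)))"

definition left_trivial ::
    "('k::field, 'a) module \<Rightarrow> ('a \<Rightarrow> 'k) \<Rightarrow> ('a, 'm, 'a) bimodule \<Rightarrow> bool"
  where "left_trivial A \<epsilon> M \<longleftrightarrow>
    (\<forall>h \<in> carrier A. \<forall>v \<in> carrier M. h \<odot>\<^bsub>M\<^esub> v = rsmult M v (\<epsilon> h \<odot>\<^bsub>A\<^esub> \<one>\<^bsub>A\<^esub>))"

end

theory Submission
  imports Defs
begin

text \<open>
  Write \<open>\<delta>(X\<^sub>1) = X\<^sub>1 q\<close> with \<open>q \<in> k[X\<^sub>1]\<close>, so that \<open>q(0) = d\<^sub>0\<close>. The pair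
  \<open>X\<^sub>1, X\<^sub>2\<close> satisfies \<open>(X\<^sub>2 - q) X\<^sub>1 = X\<^sub>1 X\<^sub>2\<close> and gives a Koszul-type free resolution
  \<open>H \<rightarrow> H\<^sup>2 \<rightarrow> H\<close> of the trivial module, whence \<open>Ext\<^sup>2(k, H) = H / ((X\<^sub>2 - q) H + X\<^sub>1 H)\<close>, which
  is \<open>H / (X\<^sub>1, X\<^sub>2 - d\<^sub>0)\<close>. As \<open>\<delta>(X\<^sub>1)\<close> is an additive polynomial, the elements
  \<open>\<alpha>\<^sub>k = X\<^sub>k \<otimes> 1 - 1 \<otimes> X\<^sub>k\<close> of the enveloping algebra satisfy the same relation, and they resolve \<open>H\<close>
  in the same way. Hence \<open>Ext\<^sup>2(H, H\<^sup>e)\<close> is \<open>H\<^sup>e\<close> modulo the right ideal generated by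
  \<open>\<alpha>\<^sub>1\<close> and \<open>\<alpha>\<^sub>2 - d\<^sub>0\<close>, the kernel of \<open>u \<otimes> v \<mapsto> v \<mu>(u)\<close> with \<open>\<mu>(X\<^sub>2) = X\<^sub>2 + d\<^sub>0\<close>.

  A central element is reduced by its leading term to a polynomial in \<open>X\<^sub>1\<^sup>p\<close> and
  \<open>X\<^sub>2\<^sup>p - d\<^sub>0\<^bsup>p-1\<^esup> X\<^sub>2\<close>; over this center \<open>H\<close> is free of rank \<open>p\<^sup>2\<close>. The antipode maps
  \<open>X\<^sub>2\<close> to \<open>- X\<^sub>2 - u\<close>, where \<open>u\<close> is \<open>\<Sum>\<^sub>i (-1)\<^sup>i (p-1)!/(i!(p-i)!)\<close> times an odd polynomial in
  \<open>X\<^sub>1\<close>, and the substitution \<open>i \<mapsto> p - i\<close> shows that \<open>u = - u\<close>.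
\<close>

subsection \<open>Left modules and homomorphisms\<close>

text \<open>\<open>Ext\<close> is taken over one resolution picked by choice, of which nothing is
  known but exactness. The Koszul complex therefore has two tasks: it witnesses that a free
  resolution exists on the prescribed type, and by comparison up to homotopy it computes the result.
  A class in degree two is then a single ring element, the value of a cocycle at the generator,
  modulo a right ideal. The obstacle over H^e is exactness, since the \<alpha>'s do not lie in one
  tensor factor. It is overcome by a linear map to H \<otimes> H under which they act as X1
  \<otimes> 1 and X2 \<otimes> 1. The constant in the center arises as follows: \<delta>(X1) has
  constant derivative d_0, so \<delta>^p(X1) = d_0^(p-1) \<delta>(X1), while in characteristic p the
  commutator of X2^p with X1 is \<delta>^p(X1). A polynomial identity is not taken from matrices but
  obtained by elimination from the dependence of p^2 + 1 elements over the center. Uniqueness of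
  \<mu> rests on the units being scalars.\<close>

lemma (in abelian_group) minus_eq_zero_iff:
  "\<lbrakk>x \<in> carrier G; y \<in> carrier G\<rbrakk> \<Longrightarrow> x \<ominus> y = \<zero> \<longleftrightarrow> x = y"
  by (metis a_inv_closed a_minus_def minus_equality minus_minus r_neg)

text \<open>Stated for bare additive maps, so that one induction serves module actions,
  homomorphisms, scalar multiplications and the linear maps on H \<otimes> H.\<close>

lemma additive_finsum:
  assumes "abelian_group M" "abelian_group N"
    and f: "\<And>x. x \<in> carrier M \<Longrightarrow> f x \<in> carrier N"
    and add: "\<And>x y. \<lbrakk>x \<in> carrier M; y \<in> carrier M\<rbrakk> \<Longrightarrow> f (x \<oplus>\<^bsub>M\<^esub> y) = f x \<oplus>\<^bsub>N\<^esub> f y"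
    and "finite A" and g: "\<And>i. i \<in> A \<Longrightarrow> g i \<in> carrier M"
  shows "f (finsum M g A) = finsum N (\<lambda>i. f (g i)) A"
proof -
  interpret M: abelian_group M by fact
  interpret N: abelian_group N by fact
  have f0: "f \<zero>\<^bsub>M\<^esub> = \<zero>\<^bsub>N\<^esub>"
    using add[of "\<zero>\<^bsub>M\<^esub>" "\<zero>\<^bsub>M\<^esub>"] f[of "\<zero>\<^bsub>M\<^esub>"]
    by (metis M.zero_closed M.l_zero N.add.r_cancel_one')
  show ?thesis
    using \<open>finite A\<close> g
  proof (induction A rule: finite_induct)
    case empty
    then show ?case by (simp add: f0)
  next
    case (insert x A)
    then have "g \<in> A \<rightarrow> carrier M" "(\<lambda>i. f (g i)) \<in> A \<rightarrow> carrier N" using f by auto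
    then show ?case using insert by (simp add: add f)
  qed
qed

context left_module
begin

lemma act_zero_left [simp]: "x \<in> carrier M \<Longrightarrow> \<zero> \<odot>\<^bsub>M\<^esub> x = \<zero>\<^bsub>M\<^esub>"
  using act_add_left[of \<zero> \<zero> x] act_closed[of \<zero> x] by (simp add: M.add.r_cancel_one')

lemma act_zero_right [simp]: "a \<in> carrier R \<Longrightarrow> a \<odot>\<^bsub>M\<^esub> \<zero>\<^bsub>M\<^esub> = \<zero>\<^bsub>M\<^esub>"
  using act_add_right[of a "\<zero>\<^bsub>M\<^esub>" "\<zero>\<^bsub>M\<^esub>"] act_closed[of a "\<zero>\<^bsub>M\<^esub>"]
  by (simp add: M.add.r_cancel_one')

lemma act_minus_right: "\<lbrakk>a \<in> carrier R; x \<in> carrier M\<rbrakk> \<Longrightarrow> a \<odot>\<^bsub>M\<^esub> (\<ominus>\<^bsub>M\<^esub> x) = \<ominus>\<^bsub>M\<^esub> (a \<odot>\<^bsub>M\<^esub> x)"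
  by (rule M.minus_equality[symmetric])
    (auto simp: act_closed act_add_right[symmetric] M.l_neg)

lemma act_finsum:
  "\<lbrakk>a \<in> carrier R; finite A; \<And>i. i \<in> A \<Longrightarrow> g i \<in> carrier M\<rbrakk> \<Longrightarrow>
    a \<odot>\<^bsub>M\<^esub> finsum M g A = finsum M (\<lambda>i. a \<odot>\<^bsub>M\<^esub> g i) A"
  by (rule additive_finsum[OF M.abelian_group_axioms M.abelian_group_axioms])
    (auto simp: act_closed act_add_right)

end

lemma module_homI:
  assumes "f \<in> extensional (carrier M)" "\<And>x. x \<in> carrier M \<Longrightarrow> f x \<in> carrier N"
    "\<And>x y. \<lbrakk>x \<in> carrier M; y \<in> carrier M\<rbrakk> \<Longrightarrow> f (x \<oplus>\<^bsub>M\<^esub> y) = f x \<oplus>\<^bsub>N\<^esub> f y"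
    "\<And>a x. \<lbrakk>a \<in> carrier R; x \<in> carrier M\<rbrakk> \<Longrightarrow> f (a \<odot>\<^bsub>M\<^esub> x) = a \<odot>\<^bsub>N\<^esub> f x"
  shows "f \<in> module_hom R M N"
  using assms unfolding module_hom_def by (auto simp: PiE_def)

text \<open>\<open>module_hom\<close> consists of extensional functions, so a map given by a formula
  has to be cut down to the carrier before it is a homomorphism.\<close>

lemma module_hom_restrictI:
  assumes "left_module R M" "\<And>x. x \<in> carrier M \<Longrightarrow> f x \<in> carrier N"
    "\<And>x y. \<lbrakk>x \<in> carrier M; y \<in> carrier M\<rbrakk> \<Longrightarrow> f (x \<oplus>\<^bsub>M\<^esub> y) = f x \<oplus>\<^bsub>N\<^esub> f y"
    "\<And>a x. \<lbrakk>a \<in> carrier R; x \<in> carrier M\<rbrakk> \<Longrightarrow> f (a \<odot>\<^bsub>M\<^esub> x) = a \<odot>\<^bsub>N\<^esub> f x"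
  shows "restrict f (carrier M) \<in> module_hom R M N"
proof -
  interpret left_module R M by fact
  show ?thesis
    by (rule module_homI) (use assms in \<open>auto simp: act_closed\<close>)
qed

lemma module_hom_closed: "\<lbrakk>f \<in> module_hom R M N; x \<in> carrier M\<rbrakk> \<Longrightarrow> f x \<in> carrier N"
  by (auto simp: module_hom_def)

lemma module_hom_add:
  "\<lbrakk>f \<in> module_hom R M N; x \<in> carrier M; y \<in> carrier M\<rbrakk> \<Longrightarrow> f (x \<oplus>\<^bsub>M\<^esub> y) = f x \<oplus>\<^bsub>N\<^esub> f y"
  by (auto simp: module_hom_def)

lemma module_hom_act:
  "\<lbrakk>f \<in> module_hom R M N; a \<in> carrier R; x \<in> carrier M\<rbrakk> \<Longrightarrow> f (a \<odot>\<^bsub>M\<^esub> x) = a \<odot>\<^bsub>N\<^esub> f x"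
  by (auto simp: module_hom_def)

lemma module_hom_extensional: "f \<in> module_hom R M N \<Longrightarrow> f \<in> extensional (carrier M)"
  by (auto simp: module_hom_def PiE_def)

lemma module_hom_zero:
  assumes "f \<in> module_hom R M N" "left_module R M" "left_module R N"
  shows "f \<zero>\<^bsub>M\<^esub> = \<zero>\<^bsub>N\<^esub>"
proof -
  interpret M: left_module R M by fact
  interpret N: left_module R N by fact
  show ?thesis
    using module_hom_add[OF assms(1), of "\<zero>\<^bsub>M\<^esub>" "\<zero>\<^bsub>M\<^esub>"] module_hom_closed[OF assms(1), of "\<zero>\<^bsub>M\<^esub>"]
    by (metis M.M.zero_closed M.M.l_zero N.M.add.r_cancel_one')
qed

lemma module_hom_minus:
  assumes "f \<in> module_hom R M N" "left_module R M" "left_module R N" "x \<in> carrier M"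
  shows "f (\<ominus>\<^bsub>M\<^esub> x) = \<ominus>\<^bsub>N\<^esub> f x"
proof -
  interpret M: left_module R M by fact
  interpret N: left_module R N by fact
  have "f (\<ominus>\<^bsub>M\<^esub> x) \<oplus>\<^bsub>N\<^esub> f x = \<zero>\<^bsub>N\<^esub>"
    using module_hom_add[OF assms(1), of "\<ominus>\<^bsub>M\<^esub> x" x] assms(4) module_hom_zero[OF assms(1-3)]
    by (simp add: M.M.l_neg)
  then show ?thesis
    using assms(4) module_hom_closed[OF assms(1)] by (simp add: N.M.minus_equality)
qed

lemma module_hom_diff:
  assumes "f \<in> module_hom R M N" "left_module R M" "left_module R N" "x \<in> carrier M" "y \<in> carrier M"
  shows "f (x \<ominus>\<^bsub>M\<^esub> y) = f x \<ominus>\<^bsub>N\<^esub> f y"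
proof -
  interpret M: left_module R M by fact
  interpret N: left_module R N by fact
  show ?thesis
    using module_hom_add[OF assms(1), of x "\<ominus>\<^bsub>M\<^esub> y"] module_hom_minus[OF assms(1-3)] assms(4,5)
    by (simp add: a_minus_def)
qed

lemma module_hom_finsum:
  assumes "f \<in> module_hom R M N" "left_module R M" "left_module R N" "finite A"
    "\<And>i. i \<in> A \<Longrightarrow> g i \<in> carrier M"
  shows "f (finsum M g A) = finsum N (\<lambda>i. f (g i)) A"
proof -
  interpret M: left_module R M by fact
  interpret N: left_module R N by fact
  show ?thesis
    by (rule additive_finsum[OF M.M.abelian_group_axioms N.M.abelian_group_axioms])
      (use assms in \<open>auto simp: module_hom_add module_hom_closed\<close>)
qed

lemma module_hom_compose:
  assumes "f \<in> module_hom R L M" "g \<in> module_hom R M N" "left_module R L"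
  shows "compose (carrier L) g f \<in> module_hom R L N"
  unfolding compose_def
  by (rule module_hom_restrictI[OF assms(3)])
    (use assms in \<open>auto simp: module_hom_add module_hom_closed module_hom_act\<close>)

lemma module_hom_sum:
  assumes "f \<in> module_hom R M N" "g \<in> module_hom R M N" "left_module R M" "left_module R N"
  shows "(\<lambda>x \<in> carrier M. f x \<oplus>\<^bsub>N\<^esub> g x) \<in> module_hom R M N"
proof -
  interpret N: left_module R N by fact
  show ?thesis
    by (rule module_hom_restrictI[OF assms(3)])
      (use assms in \<open>auto simp: module_hom_add module_hom_closed module_hom_act N.M.a_ac N.act_add_right\<close>)
qed

lemma module_hom_difference:
  assumes "f \<in> module_hom R M N" "g \<in> module_hom R M N" "left_module R M" "left_module R N"
  shows "(\<lambda>x \<in> carrier M. f x \<ominus>\<^bsub>N\<^esub> g x) \<in> module_hom R M N"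
proof -
  interpret N: left_module R N by fact
  show ?thesis
    by (rule module_hom_restrictI[OF assms(3)])
      (use assms in \<open>auto simp: module_hom_add module_hom_closed module_hom_act N.M.a_ac
        N.act_add_right N.act_minus_right N.M.minus_add a_minus_def\<close>)
qed

lemma module_hom_zero_map:
  assumes "left_module R M" "left_module R N"
  shows "(\<lambda>x \<in> carrier M. \<zero>\<^bsub>N\<^esub>) \<in> module_hom R M N"
proof -
  interpret N: left_module R N by fact
  show ?thesis by (rule module_hom_restrictI[OF assms(1)]) auto
qed

subsection \<open>Free modules are projective\<close>

text \<open>\<open>free_module\<close> sums over the exact support of the coordinates. Supports move
  under addition and scaling, so two such sums can only be compared over a common finite
  superset.\<close>

lemma (in left_module) finsum_support_superset:
  assumes "finite T" "T \<subseteq> B" "{b \<in> B. r b \<noteq> \<zero>} \<subseteq> T" "\<And>b. b \<in> B \<Longrightarrow> r b \<in> carrier R"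
    and "\<And>b. b \<in> B \<Longrightarrow> h b \<in> carrier M"
  shows "(\<Oplus>\<^bsub>M\<^esub>b \<in> {b \<in> B. r b \<noteq> \<zero>}. r b \<odot>\<^bsub>M\<^esub> h b) = (\<Oplus>\<^bsub>M\<^esub>b \<in> T. r b \<odot>\<^bsub>M\<^esub> h b)"
  by (rule M.add.finprod_mono_neutral_cong_left) (use assms act_closed in auto)

text \<open>Uniqueness of coordinates makes them linear: the pointwise sum of the coordinates of x
  and y represents x + y, hence is the coordinate family of x + y.\<close>

lemma free_module_coordinates:
  assumes "free_module R F"
  obtains B r where "B \<subseteq> carrier F"
    and "\<And>x b. \<lbrakk>x \<in> carrier F; b \<in> B\<rbrakk> \<Longrightarrow> r x b \<in> carrier R"
    and "\<And>x. x \<in> carrier F \<Longrightarrow> finite {b \<in> B. r x b \<noteq> \<zero>\<^bsub>R\<^esub>}"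
    and "\<And>x. x \<in> carrier F \<Longrightarrow> x = (\<Oplus>\<^bsub>F\<^esub>b \<in> {b \<in> B. r x b \<noteq> \<zero>\<^bsub>R\<^esub>}. r x b \<odot>\<^bsub>F\<^esub> b)"
    and "\<And>x y b. \<lbrakk>x \<in> carrier F; y \<in> carrier F; b \<in> B\<rbrakk> \<Longrightarrow> r (x \<oplus>\<^bsub>F\<^esub> y) b = r x b \<oplus>\<^bsub>R\<^esub> r y b"
    and "\<And>a x b. \<lbrakk>a \<in> carrier R; x \<in> carrier F; b \<in> B\<rbrakk> \<Longrightarrow> r (a \<odot>\<^bsub>F\<^esub> x) b = a \<otimes>\<^bsub>R\<^esub> r x b"
proof -
  interpret left_module R F using assms by (simp add: free_module_def)
  define P where "P B x r \<longleftrightarrow> r \<in> B \<rightarrow>\<^sub>E carrier R \<and> finite {b \<in> B. r b \<noteq> \<zero>\<^bsub>R\<^esub>} \<and>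
       x = (\<Oplus>\<^bsub>F\<^esub>b \<in> {b \<in> B. r b \<noteq> \<zero>\<^bsub>R\<^esub>}. r b \<odot>\<^bsub>F\<^esub> b)" for B x r
  obtain B where B: "B \<subseteq> carrier F" and ex1: "\<And>x. x \<in> carrier F \<Longrightarrow> \<exists>!r. P B x r"
    using assms unfolding free_module_def P_def by auto
  define r where "r x = (THE r. P B x r)" for x
  have r: "P B x (r x)" if "x \<in> carrier F" for x
    unfolding r_def by (rule theI'[OF ex1[OF that]])
  have r_eq: "r x = s" if "x \<in> carrier F" "P B x s" for x s
    using ex1[OF that(1)] that(2) r[OF that(1)] by auto
  have rc: "r x b \<in> carrier R" if "x \<in> carrier F" "b \<in> B" for x b
    using r[OF that(1)] that(2) unfolding P_def by auto
  have rf: "finite {b \<in> B. r x b \<noteq> \<zero>\<^bsub>R\<^esub>}" if "x \<in> carrier F" for x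
    using r[OF that(1)] unfolding P_def by auto
  have rx: "x = (\<Oplus>\<^bsub>F\<^esub>b \<in> {b \<in> B. r x b \<noteq> \<zero>\<^bsub>R\<^esub>}. r x b \<odot>\<^bsub>F\<^esub> b)" if "x \<in> carrier F" for x
    using r[OF that(1)] unfolding P_def by auto
  have Bc: "b \<in> carrier F" if "b \<in> B" for b using B that by auto
  have radd: "r (x \<oplus>\<^bsub>F\<^esub> y) = (\<lambda>b\<in>B. r x b \<oplus>\<^bsub>R\<^esub> r y b)" if x: "x \<in> carrier F" and y: "y \<in> carrier F" for x y
  proof (rule r_eq)
    let ?s = "\<lambda>b\<in>B. r x b \<oplus>\<^bsub>R\<^esub> r y b"
    \<comment> \<open>Cancellation may shrink the support of the sum, so everything is expanded over
      the union of both supports.\<close>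
    let ?T = "{b \<in> B. r x b \<noteq> \<zero>\<^bsub>R\<^esub>} \<union> {b \<in> B. r y b \<noteq> \<zero>\<^bsub>R\<^esub>}"
    have T: "finite ?T" "?T \<subseteq> B" using rf x y by auto
    have sub: "{b \<in> B. ?s b \<noteq> \<zero>\<^bsub>R\<^esub>} \<subseteq> ?T" using x y rc by auto
    have "x \<oplus>\<^bsub>F\<^esub> y = (\<Oplus>\<^bsub>F\<^esub>b \<in> ?T. r x b \<odot>\<^bsub>F\<^esub> b) \<oplus>\<^bsub>F\<^esub> (\<Oplus>\<^bsub>F\<^esub>b \<in> ?T. r y b \<odot>\<^bsub>F\<^esub> b)"
      using rx[OF x] rx[OF y] finsum_support_superset[OF T, of "r x" "\<lambda>b. b"]
        finsum_support_superset[OF T, of "r y" "\<lambda>b. b"] rc x y Bc by simp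
    also have "\<dots> = (\<Oplus>\<^bsub>F\<^esub>b \<in> ?T. r x b \<odot>\<^bsub>F\<^esub> b \<oplus>\<^bsub>F\<^esub> r y b \<odot>\<^bsub>F\<^esub> b)"
      by (rule M.finsum_addf[symmetric]) (use T(2) act_closed rc x y Bc in auto)
    also have "\<dots> = (\<Oplus>\<^bsub>F\<^esub>b \<in> ?T. ?s b \<odot>\<^bsub>F\<^esub> b)"
      by (rule M.finsum_cong') (use T(2) act_closed act_add_left rc x y Bc in auto)
    also have "\<dots> = (\<Oplus>\<^bsub>F\<^esub>b \<in> {b \<in> B. ?s b \<noteq> \<zero>\<^bsub>R\<^esub>}. ?s b \<odot>\<^bsub>F\<^esub> b)"
      by (rule finsum_support_superset[OF T sub, symmetric]) (use rc x y Bc in auto)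
    finally show "P B (x \<oplus>\<^bsub>F\<^esub> y) ?s"
      unfolding P_def using finite_subset[OF sub T(1)] rc x y by auto
  qed (use x y in auto)
  have ract: "r (a \<odot>\<^bsub>F\<^esub> x) = (\<lambda>b\<in>B. a \<otimes>\<^bsub>R\<^esub> r x b)" if a: "a \<in> carrier R" and x: "x \<in> carrier F" for a x
  proof (rule r_eq)
    let ?s = "\<lambda>b\<in>B. a \<otimes>\<^bsub>R\<^esub> r x b"
    let ?T = "{b \<in> B. r x b \<noteq> \<zero>\<^bsub>R\<^esub>}"
    have T: "finite ?T" "?T \<subseteq> B" using rf x by auto
    have sub: "{b \<in> B. ?s b \<noteq> \<zero>\<^bsub>R\<^esub>} \<subseteq> ?T" using x a rc by auto
    have "a \<odot>\<^bsub>F\<^esub> x = (\<Oplus>\<^bsub>F\<^esub>b \<in> ?T. a \<odot>\<^bsub>F\<^esub> (r x b \<odot>\<^bsub>F\<^esub> b))"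
      by (subst rx[OF x], rule act_finsum) (use a T act_closed rc x Bc in auto)
    also have "\<dots> = (\<Oplus>\<^bsub>F\<^esub>b \<in> ?T. ?s b \<odot>\<^bsub>F\<^esub> b)"
      by (rule M.finsum_cong') (use T(2) act_closed act_act rc a x Bc in auto)
    also have "\<dots> = (\<Oplus>\<^bsub>F\<^esub>b \<in> {b \<in> B. ?s b \<noteq> \<zero>\<^bsub>R\<^esub>}. ?s b \<odot>\<^bsub>F\<^esub> b)"
      by (rule finsum_support_superset[OF T sub, symmetric]) (use rc a x Bc in auto)
    finally show "P B (a \<odot>\<^bsub>F\<^esub> x) ?s"
      unfolding P_def using finite_subset[OF sub T(1)] rc a x by auto
  qed (use a x act_closed in auto)
  show thesis
    by (rule that[of B r]) (use B rc rf rx radd ract in auto)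
qed

text \<open>Choose preimages of the basis elements and extend linearly. Only the values of f have to
  lie in the image of g; this is the form in which exactness of a resolution delivers
  surjectivity.\<close>

lemma free_module_lift:
  assumes F: "free_module R F" and A: "left_module R A" and C: "left_module R C"
    and g: "g \<in> module_hom R A C" and f: "f \<in> module_hom R F C"
    and img: "\<And>x. x \<in> carrier F \<Longrightarrow> f x \<in> g ` carrier A"
  obtains k where "k \<in> module_hom R F A" "\<And>x. x \<in> carrier F \<Longrightarrow> g (k x) = f x"
proof -
  interpret F: left_module R F using F by (simp add: free_module_def)
  interpret A: left_module R A by fact
  interpret C: left_module R C by fact
  obtain B r where B: "B \<subseteq> carrier F"
    and rc: "\<And>x b. \<lbrakk>x \<in> carrier F; b \<in> B\<rbrakk> \<Longrightarrow> r x b \<in> carrier R"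
    and rf: "\<And>x. x \<in> carrier F \<Longrightarrow> finite {b \<in> B. r x b \<noteq> \<zero>\<^bsub>R\<^esub>}"
    and rx: "\<And>x. x \<in> carrier F \<Longrightarrow> x = (\<Oplus>\<^bsub>F\<^esub>b \<in> {b \<in> B. r x b \<noteq> \<zero>\<^bsub>R\<^esub>}. r x b \<odot>\<^bsub>F\<^esub> b)"
    and radd: "\<And>x y b. \<lbrakk>x \<in> carrier F; y \<in> carrier F; b \<in> B\<rbrakk> \<Longrightarrow> r (x \<oplus>\<^bsub>F\<^esub> y) b = r x b \<oplus>\<^bsub>R\<^esub> r y b"
    and ract: "\<And>a x b. \<lbrakk>a \<in> carrier R; x \<in> carrier F; b \<in> B\<rbrakk> \<Longrightarrow> r (a \<odot>\<^bsub>F\<^esub> x) b = a \<otimes>\<^bsub>R\<^esub> r x b"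
    by (fact free_module_coordinates[OF F])
  have Bc: "b \<in> carrier F" if "b \<in> B" for b using B that by auto
  have "\<forall>b\<in>B. \<exists>a. a \<in> carrier A \<and> g a = f b" using img Bc by (metis imageE)
  then obtain h where hc: "\<And>b. b \<in> B \<Longrightarrow> h b \<in> carrier A" and h: "\<And>b. b \<in> B \<Longrightarrow> g (h b) = f b"
    by metis
  define k where "k x = (\<Oplus>\<^bsub>A\<^esub>b \<in> {b \<in> B. r x b \<noteq> \<zero>\<^bsub>R\<^esub>}. r x b \<odot>\<^bsub>A\<^esub> h b)" for x
  have kT: "k x = (\<Oplus>\<^bsub>A\<^esub>b \<in> T. r x b \<odot>\<^bsub>A\<^esub> h b)"
    if "x \<in> carrier F" "finite T" "T \<subseteq> B" "{b \<in> B. r x b \<noteq> \<zero>\<^bsub>R\<^esub>} \<subseteq> T" for x T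
    unfolding k_def by (rule A.finsum_support_superset) (use that rc hc in auto)
  have kc: "k x \<in> carrier A" if "x \<in> carrier F" for x
    unfolding k_def by (rule A.M.finsum_closed) (use that rc hc A.act_closed in auto)
  have kadd: "k (x \<oplus>\<^bsub>F\<^esub> y) = k x \<oplus>\<^bsub>A\<^esub> k y" if x: "x \<in> carrier F" and y: "y \<in> carrier F" for x y
  proof -
    let ?T = "{b \<in> B. r x b \<noteq> \<zero>\<^bsub>R\<^esub>} \<union> {b \<in> B. r y b \<noteq> \<zero>\<^bsub>R\<^esub>}"
    have T: "finite ?T" "?T \<subseteq> B" using rf x y by auto
    have "{b \<in> B. r (x \<oplus>\<^bsub>F\<^esub> y) b \<noteq> \<zero>\<^bsub>R\<^esub>} \<subseteq> ?T" using x y rc radd by auto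
    then have "k (x \<oplus>\<^bsub>F\<^esub> y) = (\<Oplus>\<^bsub>A\<^esub>b \<in> ?T. r (x \<oplus>\<^bsub>F\<^esub> y) b \<odot>\<^bsub>A\<^esub> h b)"
      using kT[of "x \<oplus>\<^bsub>F\<^esub> y" ?T] T x y by auto
    also have "\<dots> = (\<Oplus>\<^bsub>A\<^esub>b \<in> ?T. r x b \<odot>\<^bsub>A\<^esub> h b \<oplus>\<^bsub>A\<^esub> r y b \<odot>\<^bsub>A\<^esub> h b)"
      by (rule A.M.finsum_cong') (use T(2) A.act_closed A.act_add_left radd rc x y hc in auto)
    also have "\<dots> = (\<Oplus>\<^bsub>A\<^esub>b \<in> ?T. r x b \<odot>\<^bsub>A\<^esub> h b) \<oplus>\<^bsub>A\<^esub> (\<Oplus>\<^bsub>A\<^esub>b \<in> ?T. r y b \<odot>\<^bsub>A\<^esub> h b)"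
      by (rule A.M.finsum_addf) (use T(2) A.act_closed rc x y hc in auto)
    finally show ?thesis using kT[OF x T] kT[OF y T] by auto
  qed
  have kact: "k (a \<odot>\<^bsub>F\<^esub> x) = a \<odot>\<^bsub>A\<^esub> k x" if a: "a \<in> carrier R" and x: "x \<in> carrier F" for a x
  proof -
    let ?T = "{b \<in> B. r x b \<noteq> \<zero>\<^bsub>R\<^esub>}"
    have T: "finite ?T" "?T \<subseteq> B" using rf x by auto
    have "{b \<in> B. r (a \<odot>\<^bsub>F\<^esub> x) b \<noteq> \<zero>\<^bsub>R\<^esub>} \<subseteq> ?T" using x a rc ract by auto
    then have "k (a \<odot>\<^bsub>F\<^esub> x) = (\<Oplus>\<^bsub>A\<^esub>b \<in> ?T. r (a \<odot>\<^bsub>F\<^esub> x) b \<odot>\<^bsub>A\<^esub> h b)"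
      using kT[of "a \<odot>\<^bsub>F\<^esub> x" ?T] T x a F.act_closed by auto
    also have "\<dots> = (\<Oplus>\<^bsub>A\<^esub>b \<in> ?T. a \<odot>\<^bsub>A\<^esub> (r x b \<odot>\<^bsub>A\<^esub> h b))"
      by (rule A.M.finsum_cong') (use T(2) A.act_closed A.act_act ract rc x a hc in auto)
    also have "\<dots> = a \<odot>\<^bsub>A\<^esub> (\<Oplus>\<^bsub>A\<^esub>b \<in> ?T. r x b \<odot>\<^bsub>A\<^esub> h b)"
      by (rule A.act_finsum[symmetric]) (use a T A.act_closed rc x hc in auto)
    finally show ?thesis using kT[OF x T] by auto
  qed
  have gk: "g (k x) = f x" if x: "x \<in> carrier F" for x
  proof -
    have "g (k x) = (\<Oplus>\<^bsub>C\<^esub>b \<in> {b \<in> B. r x b \<noteq> \<zero>\<^bsub>R\<^esub>}. g (r x b \<odot>\<^bsub>A\<^esub> h b))"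
      unfolding k_def by (rule module_hom_finsum[OF g A C]) (use rf x rc hc A.act_closed in auto)
    also have "\<dots> = (\<Oplus>\<^bsub>C\<^esub>b \<in> {b \<in> B. r x b \<noteq> \<zero>\<^bsub>R\<^esub>}. f (r x b \<odot>\<^bsub>F\<^esub> b))"
      by (rule C.M.finsum_cong')
        (use module_hom_act[OF g] module_hom_act[OF f] module_hom_closed[OF f] h hc rc x Bc F.act_closed C.act_closed in auto)
    also have "\<dots> = f (\<Oplus>\<^bsub>F\<^esub>b \<in> {b \<in> B. r x b \<noteq> \<zero>\<^bsub>R\<^esub>}. r x b \<odot>\<^bsub>F\<^esub> b)"
      by (rule module_hom_finsum[OF f F.left_module_axioms C, symmetric]) (use rf x rc Bc F.act_closed in auto)
    finally show ?thesis using rx[OF x] by simp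
  qed
  show thesis
  proof (rule that[of "restrict k (carrier F)"])
    show "restrict k (carrier F) \<in> module_hom R F A"
      by (rule module_hom_restrictI[OF F.left_module_axioms]) (use kc kadd kact in auto)
  qed (use gk in auto)
qed

subsection \<open>Comparison of free resolutions\<close>

lemma free_resolutionD:
  assumes "free_resolution R M F D \<eta>"
  shows "free_module R (F n)" "left_module R (F n)" "D n \<in> module_hom R (F (Suc n)) (F n)"
    "\<eta> \<in> module_hom R (F 0) M" "\<eta> ` carrier (F 0) = carrier M"
    "x \<in> carrier (F (Suc 0)) \<Longrightarrow> \<eta> (D 0 x) = \<zero>\<^bsub>M\<^esub>"
    "x \<in> carrier (F (Suc (Suc n))) \<Longrightarrow> D n (D (Suc n) x) = \<zero>\<^bsub>F n\<^esub>"
    "\<lbrakk>y \<in> carrier (F 0); \<eta> y = \<zero>\<^bsub>M\<^esub>\<rbrakk> \<Longrightarrow> y \<in> D 0 ` carrier (F (Suc 0))"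
    "\<lbrakk>y \<in> carrier (F (Suc n)); D n y = \<zero>\<^bsub>F n\<^esub>\<rbrakk> \<Longrightarrow> y \<in> D (Suc n) ` carrier (F (Suc (Suc n)))"
proof -
  have D: "D (Suc n) ` carrier (F (Suc (Suc n))) = {x \<in> carrier (F (Suc n)). D n x = \<zero>\<^bsub>F n\<^esub>}" for n
    using assms unfolding free_resolution_def by blast
  then show "x \<in> carrier (F (Suc (Suc n))) \<Longrightarrow> D n (D (Suc n) x) = \<zero>\<^bsub>F n\<^esub>"
    "\<lbrakk>y \<in> carrier (F (Suc n)); D n y = \<zero>\<^bsub>F n\<^esub>\<rbrakk> \<Longrightarrow> y \<in> D (Suc n) ` carrier (F (Suc (Suc n)))"
    by blast+
qed (use assms in \<open>unfold free_resolution_def One_nat_def free_module_def, blast+\<close>)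

text \<open>\<open>chain_lifts\<close> speaks of chosen resolutions only; this version is for
  arbitrary ones, so that the chosen resolution and the Koszul complex can be compared in both
  directions.\<close>

definition chain_map ::
    "('r, 'y) ring_scheme \<Rightarrow> (nat \<Rightarrow> ('r, 'u) module) \<Rightarrow> (nat \<Rightarrow> 'u \<Rightarrow> 'u) \<Rightarrow> ('u \<Rightarrow> 'l) \<Rightarrow>
     (nat \<Rightarrow> ('r, 'v) module) \<Rightarrow> (nat \<Rightarrow> 'v \<Rightarrow> 'v) \<Rightarrow> ('v \<Rightarrow> 'm) \<Rightarrow> ('l \<Rightarrow> 'm) \<Rightarrow> (nat \<Rightarrow> 'u \<Rightarrow> 'v) \<Rightarrow> bool"
  where "chain_map R F D \<eta> G D' \<eta>' h \<phi> \<longleftrightarrow>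
    (\<forall>n. \<phi> n \<in> module_hom R (F n) (G n)) \<and>
    (\<forall>x \<in> carrier (F 0). \<eta>' (\<phi> 0 x) = h (\<eta> x)) \<and>
    (\<forall>n. \<forall>x \<in> carrier (F (Suc n)). D' n (\<phi> (Suc n) x) = \<phi> n (D n x))"

text \<open>The comparison theorem. Each map is lifted through the next differential by
  projectivity, and the sequence is assembled by dependent choice.\<close>

lemma chain_map_exists:
  assumes F: "free_resolution R L F D \<eta>" and G: "free_resolution R M G D' \<eta>'"
    and L: "left_module R L" and M: "left_module R M" and h: "h \<in> module_hom R L M"
  shows "\<exists>\<phi>. chain_map R F D \<eta> G D' \<eta>' h \<phi>"
proof -
  note Fl = free_resolutionD(2)[OF F] and Gl = free_resolutionD(2)[OF G]
  note Dh = free_resolutionD(3)[OF F] and Dh' = free_resolutionD(3)[OF G]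
  \<comment> \<open>The last conjunct is what the next step consumes: \<phi> after the differential
    lands in the image of D', so it can be lifted.\<close>
  define P where "P n \<phi> \<longleftrightarrow> \<phi> \<in> module_hom R (F n) (G n) \<and>
    (n = 0 \<longrightarrow> (\<forall>x \<in> carrier (F 0). \<eta>' (\<phi> x) = h (\<eta> x))) \<and>
    (\<forall>x \<in> carrier (F (Suc n)). \<phi> (D n x) \<in> D' n ` carrier (G (Suc n)))" for n \<phi>
  define Q where "Q n \<phi> \<phi>' \<longleftrightarrow> (\<forall>x \<in> carrier (F (Suc n)). D' n (\<phi>' x) = \<phi> (D n x))"
    for n \<phi> \<phi>'
  have base: "\<exists>\<phi>. P 0 \<phi>"
  proof -
    have h\<eta>: "compose (carrier (F 0)) h \<eta> \<in> module_hom R (F 0) M"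
      by (rule module_hom_compose[OF free_resolutionD(4)[OF F] h Fl])
    obtain k where k: "k \<in> module_hom R (F 0) (G 0)"
      "\<And>x. x \<in> carrier (F 0) \<Longrightarrow> \<eta>' (k x) = compose (carrier (F 0)) h \<eta> x"
      by (rule free_module_lift[OF free_resolutionD(1)[OF F] Gl M free_resolutionD(4)[OF G] h\<eta>])
        (use module_hom_closed[OF h\<eta>] free_resolutionD(5)[OF G] in auto)
    have "k (D 0 x) \<in> D' 0 ` carrier (G (Suc 0))" if x: "x \<in> carrier (F (Suc 0))" for x
    proof (rule free_resolutionD(8)[OF G])
      have Dx: "D 0 x \<in> carrier (F 0)" using module_hom_closed[OF Dh x] .
      show "k (D 0 x) \<in> carrier (G 0)" using module_hom_closed[OF k(1) Dx] .
      show "\<eta>' (k (D 0 x)) = \<zero>\<^bsub>M\<^esub>"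
        using k(2)[OF Dx] Dx free_resolutionD(6)[OF F x] module_hom_zero[OF h L M]
        by (simp add: compose_eq)
    qed
    then show ?thesis unfolding P_def using k by (intro exI[of _ k]) (auto simp: compose_eq)
  qed
  have step: "\<exists>\<phi>'. P (Suc n) \<phi>' \<and> Q n \<phi> \<phi>'" if P: "P n \<phi>" for n \<phi>
  proof -
    have \<phi>: "\<phi> \<in> module_hom R (F n) (G n)" using P by (simp add: P_def)
    have \<phi>D: "compose (carrier (F (Suc n))) \<phi> (D n) \<in> module_hom R (F (Suc n)) (G n)"
      by (rule module_hom_compose[OF Dh \<phi> Fl])
    obtain k where k: "k \<in> module_hom R (F (Suc n)) (G (Suc n))"
      "\<And>x. x \<in> carrier (F (Suc n)) \<Longrightarrow> D' n (k x) = compose (carrier (F (Suc n))) \<phi> (D n) x"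
      by (rule free_module_lift[OF free_resolutionD(1)[OF F] Gl Gl Dh' \<phi>D])
        (use P in \<open>auto simp: P_def compose_eq\<close>)
    have "k (D (Suc n) x) \<in> D' (Suc n) ` carrier (G (Suc (Suc n)))"
      if x: "x \<in> carrier (F (Suc (Suc n)))" for x
    proof (rule free_resolutionD(9)[OF G])
      have Dx: "D (Suc n) x \<in> carrier (F (Suc n))" using module_hom_closed[OF Dh x] .
      show "k (D (Suc n) x) \<in> carrier (G (Suc n))" using module_hom_closed[OF k(1) Dx] .
      show "D' n (k (D (Suc n) x)) = \<zero>\<^bsub>G n\<^esub>"
        using k(2)[OF Dx] Dx free_resolutionD(7)[OF F x] module_hom_zero[OF \<phi> Fl Gl]
        by (simp add: compose_eq)
    qed
    then show ?thesis unfolding P_def Q_def using k by (intro exI[of _ k]) (auto simp: compose_eq)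
  qed
  obtain \<phi> where "\<And>n. P n (\<phi> n)" "\<And>n. Q n (\<phi> n) (\<phi> (Suc n))"
    using dependent_nat_choice[of P Q] base step by metis
  then show ?thesis
    unfolding chain_map_def P_def Q_def by (intro exI[of _ \<phi>]) auto
qed

text \<open>The difference of two lifts of the same map lifts zero; the homotopy is built degree by
  degree, each time lifting a cycle to a preimage under the differential.\<close>

lemma chain_map_homotopy:
  assumes F: "free_resolution R L F D \<eta>" and G: "free_resolution R M G D' \<eta>'"
    and L: "left_module R L" and M: "left_module R M"
    and \<phi>: "chain_map R F D \<eta> G D' \<eta>' h \<phi>" and \<psi>: "chain_map R F D \<eta> G D' \<eta>' h \<psi>"
  shows "\<exists>s. (\<forall>n. s n \<in> module_hom R (F n) (G (Suc n))) \<and>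
    (\<forall>x \<in> carrier (F 0). \<phi> 0 x \<ominus>\<^bsub>G 0\<^esub> \<psi> 0 x = D' 0 (s 0 x)) \<and>
    (\<forall>n. \<forall>x \<in> carrier (F (Suc n)).
      \<phi> (Suc n) x \<ominus>\<^bsub>G (Suc n)\<^esub> \<psi> (Suc n) x = D' (Suc n) (s (Suc n) x) \<oplus>\<^bsub>G (Suc n)\<^esub> s n (D n x))"
proof -
  note Fl = free_resolutionD(2)[OF F] and Gl = free_resolutionD(2)[OF G]
  note Dh = free_resolutionD(3)[OF F] and Dh' = free_resolutionD(3)[OF G]
  have \<phi>h: "\<phi> n \<in> module_hom R (F n) (G n)" and \<psi>h: "\<psi> n \<in> module_hom R (F n) (G n)" for n
    using \<phi> \<psi> by (auto simp: chain_map_def)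
  define \<chi> where "\<chi> n = (\<lambda>x \<in> carrier (F n). \<phi> n x \<ominus>\<^bsub>G n\<^esub> \<psi> n x)" for n
  have \<chi>h: "\<chi> n \<in> module_hom R (F n) (G n)" for n
    unfolding \<chi>_def by (rule module_hom_difference[OF \<phi>h \<psi>h Fl Gl])
  have ab: "abelian_group (G n)" for n using Gl[of n] by (simp add: left_module_def)
  have \<chi>D: "D' n (\<chi> (Suc n) x) = \<chi> n (D n x)" if x: "x \<in> carrier (F (Suc n))" for n x
  proof -
    have "D' n (\<chi> (Suc n) x) = D' n (\<phi> (Suc n) x) \<ominus>\<^bsub>G n\<^esub> D' n (\<psi> (Suc n) x)"
      using x by (simp add: \<chi>_def module_hom_diff[OF Dh' Gl Gl] module_hom_closed[OF \<phi>h] module_hom_closed[OF \<psi>h])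
    then show ?thesis using \<phi> \<psi> x module_hom_closed[OF Dh x] by (simp add: chain_map_def \<chi>_def)
  qed
  \<comment> \<open>The invariant says that \<chi> in degree n + 1 minus s after the differential is
    a cycle; exactness turns it into a boundary, which defines the next s.\<close>
  define P where "P n s \<longleftrightarrow> s \<in> module_hom R (F n) (G (Suc n)) \<and>
    (n = 0 \<longrightarrow> (\<forall>x \<in> carrier (F 0). \<chi> 0 x = D' 0 (s x))) \<and>
    (\<forall>x \<in> carrier (F (Suc n)). D' n (\<chi> (Suc n) x \<ominus>\<^bsub>G (Suc n)\<^esub> s (D n x)) = \<zero>\<^bsub>G n\<^esub>)" for n s
  define Q where "Q n s s' \<longleftrightarrow>
    (\<forall>x \<in> carrier (F (Suc n)). \<chi> (Suc n) x = D' (Suc n) (s' x) \<oplus>\<^bsub>G (Suc n)\<^esub> s (D n x))"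
    for n s s'
  have base: "\<exists>s. P 0 s"
  proof -
    obtain s where s: "s \<in> module_hom R (F 0) (G (Suc 0))" "\<And>x. x \<in> carrier (F 0) \<Longrightarrow> D' 0 (s x) = \<chi> 0 x"
    proof (rule free_module_lift[OF free_resolutionD(1)[OF F] Gl Gl Dh' \<chi>h])
      fix x assume x: "x \<in> carrier (F 0)"
      show "\<chi> 0 x \<in> D' 0 ` carrier (G (Suc 0))"
      proof (rule free_resolutionD(8)[OF G])
        show "\<chi> 0 x \<in> carrier (G 0)" using module_hom_closed[OF \<chi>h x] .
        interpret M: left_module R M by fact
        have "\<eta>' (\<phi> 0 x) \<in> carrier M"
          using module_hom_closed[OF free_resolutionD(4)[OF G]] module_hom_closed[OF \<phi>h x] by auto
        then show "\<eta>' (\<chi> 0 x) = \<zero>\<^bsub>M\<^esub>"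
          using x \<phi> \<psi> module_hom_closed[OF \<phi>h x] module_hom_closed[OF \<psi>h x]
          by (simp add: \<chi>_def module_hom_diff[OF free_resolutionD(4)[OF G] Gl M] chain_map_def M.M.minus_eq_zero_iff)
      qed
    qed auto
    have "D' 0 (\<chi> (Suc 0) x \<ominus>\<^bsub>G (Suc 0)\<^esub> s (D 0 x)) = \<zero>\<^bsub>G 0\<^esub>" if x: "x \<in> carrier (F (Suc 0))" for x
    proof -
      interpret G0: abelian_group "G 0" by (rule ab)
      have Dx: "D 0 x \<in> carrier (F 0)" using module_hom_closed[OF Dh x] .
      show ?thesis
        using x Dx s(2)[OF Dx] module_hom_closed[OF \<chi>h x] module_hom_closed[OF s(1) Dx] module_hom_closed[OF \<chi>h Dx]
        by (simp add: module_hom_diff[OF Dh' Gl Gl] \<chi>D G0.minus_eq_zero_iff)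
    qed
    then show ?thesis unfolding P_def using s by (intro exI[of _ s]) auto
  qed
  have step: "\<exists>s'. P (Suc n) s' \<and> Q n s s'" if P: "P n s" for n s
  proof -
    have s: "s \<in> module_hom R (F n) (G (Suc n))" using P by (simp add: P_def)
    interpret G1: abelian_group "G (Suc n)" by (rule ab)
    have sD: "compose (carrier (F (Suc n))) s (D n) \<in> module_hom R (F (Suc n)) (G (Suc n))"
      by (rule module_hom_compose[OF Dh s Fl])
    let ?k = "\<lambda>x \<in> carrier (F (Suc n)). \<chi> (Suc n) x \<ominus>\<^bsub>G (Suc n)\<^esub> compose (carrier (F (Suc n))) s (D n) x"
    have k: "?k \<in> module_hom R (F (Suc n)) (G (Suc n))"
      by (rule module_hom_difference[OF \<chi>h sD Fl Gl])
    obtain s' where s': "s' \<in> module_hom R (F (Suc n)) (G (Suc (Suc n)))"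
      "\<And>x. x \<in> carrier (F (Suc n)) \<Longrightarrow> D' (Suc n) (s' x) = ?k x"
    proof (rule free_module_lift[OF free_resolutionD(1)[OF F] Gl Gl Dh' k])
      fix x assume x: "x \<in> carrier (F (Suc n))"
      show "?k x \<in> D' (Suc n) ` carrier (G (Suc (Suc n)))"
        by (rule free_resolutionD(9)[OF G]) (use module_hom_closed[OF k x] P x in \<open>auto simp: P_def compose_eq\<close>)
    qed auto
    have Q: "\<chi> (Suc n) x = D' (Suc n) (s' x) \<oplus>\<^bsub>G (Suc n)\<^esub> s (D n x)" if x: "x \<in> carrier (F (Suc n))" for x
      using s'(2)[OF x] x module_hom_closed[OF \<chi>h x] module_hom_closed[OF s module_hom_closed[OF Dh x]]
      by (simp add: compose_eq a_minus_def G1.a_assoc G1.l_neg)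
    have "D' (Suc n) (\<chi> (Suc (Suc n)) x \<ominus>\<^bsub>G (Suc (Suc n))\<^esub> s' (D (Suc n) x)) = \<zero>\<^bsub>G (Suc n)\<^esub>"
      if x: "x \<in> carrier (F (Suc (Suc n)))" for x
    proof -
      have Dx: "D (Suc n) x \<in> carrier (F (Suc n))" using module_hom_closed[OF Dh x] .
      have "D' (Suc n) (s' (D (Suc n) x)) = \<chi> (Suc n) (D (Suc n) x)"
        using Q[OF Dx] free_resolutionD(7)[OF F x] module_hom_zero[OF s Fl Gl]
          module_hom_closed[OF Dh' module_hom_closed[OF s'(1) Dx]] by simp
      then show ?thesis
        using x module_hom_closed[OF \<chi>h x] module_hom_closed[OF s'(1) Dx] module_hom_closed[OF \<chi>h Dx]
        by (simp add: module_hom_diff[OF Dh' Gl Gl] \<chi>D G1.minus_eq_zero_iff)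
    qed
    then show ?thesis unfolding P_def Q_def using s' Q by (intro exI[of _ s']) auto
  qed
  obtain s where "\<And>n. P n (s n)" "\<And>n. Q n (s n) (s (Suc n))"
    using dependent_nat_choice[of P Q] base step by metis
  then show ?thesis
    unfolding P_def Q_def \<chi>_def by (intro exI[of _ s]) auto
qed

lemma chain_map_compose:
  assumes "free_resolution R L F D \<eta>"
    and \<phi>: "chain_map R F D \<eta> G D' \<eta>' h \<phi>" and \<psi>: "chain_map R G D' \<eta>' K D'' \<eta>'' k \<psi>"
    and G: "free_resolution R M G D' \<eta>'"
  shows "chain_map R F D \<eta> K D'' \<eta>'' (\<lambda>x. k (h x)) (\<lambda>n. compose (carrier (F n)) (\<psi> n) (\<phi> n))"
proof -
  note Fl = free_resolutionD(2)[OF assms(1)] and Dh = free_resolutionD(3)[OF assms(1)]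
  have \<phi>h: "\<phi> n \<in> module_hom R (F n) (G n)" and \<psi>h: "\<psi> n \<in> module_hom R (G n) (K n)" for n
    using \<phi> \<psi> by (auto simp: chain_map_def)
  show ?thesis
    unfolding chain_map_def
    using \<phi> \<psi> module_hom_closed[OF \<phi>h] module_hom_closed[OF Dh]
    by (auto intro!: module_hom_compose[OF \<phi>h \<psi>h Fl] simp: compose_eq chain_map_def)
qed

lemma chain_map_ident:
  assumes "free_resolution R M F D \<eta>"
  shows "chain_map R F D \<eta> F D \<eta> (\<lambda>x. x) (\<lambda>n. \<lambda>x \<in> carrier (F n). x)"
  unfolding chain_map_def
  using module_hom_closed[OF free_resolutionD(3)[OF assms]]
  by (auto intro!: module_hom_restrictI free_resolutionD(2)[OF assms])

text \<open>Applying the cocycle f to D's + sD leaves only f s D, because f vanishes on the image of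
  D'. In degree zero there is no term s D, so the two pullbacks agree exactly.\<close>

lemma cocycle_homotopic:
  assumes F: "free_resolution R L F D \<eta>" and G: "free_resolution R M G D' \<eta>'"
    and L: "left_module R L" and M: "left_module R M" and N: "left_module R N"
    and \<phi>: "chain_map R F D \<eta> G D' \<eta>' h \<phi>" and \<psi>: "chain_map R F D \<eta> G D' \<eta>' h \<psi>"
    and f: "f \<in> module_hom R (G n) N"
    and coc: "\<And>x. x \<in> carrier (G (Suc n)) \<Longrightarrow> f (D' n x) = \<zero>\<^bsub>N\<^esub>"
  shows "case n of 0 \<Rightarrow> \<forall>x \<in> carrier (F 0). f (\<phi> 0 x) = f (\<psi> 0 x)
    | Suc m \<Rightarrow> \<exists>e \<in> module_hom R (F m) N. \<forall>x \<in> carrier (F (Suc m)). f (\<phi> (Suc m) x) = e (D m x) \<oplus>\<^bsub>N\<^esub> f (\<psi> (Suc m) x)"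
proof -
  note Fl = free_resolutionD(2)[OF F] and Gl = free_resolutionD(2)[OF G]
  note Dh = free_resolutionD(3)[OF F] and Dh' = free_resolutionD(3)[OF G]
  interpret N: left_module R N by fact
  obtain s where s: "\<And>n. s n \<in> module_hom R (F n) (G (Suc n))"
    and s0: "\<And>x. x \<in> carrier (F 0) \<Longrightarrow> \<phi> 0 x \<ominus>\<^bsub>G 0\<^esub> \<psi> 0 x = D' 0 (s 0 x)"
    and sS: "\<And>n x. x \<in> carrier (F (Suc n)) \<Longrightarrow>
      \<phi> (Suc n) x \<ominus>\<^bsub>G (Suc n)\<^esub> \<psi> (Suc n) x = D' (Suc n) (s (Suc n) x) \<oplus>\<^bsub>G (Suc n)\<^esub> s n (D n x)"
    using chain_map_homotopy[OF F G L M \<phi> \<psi>] by metis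
  have \<phi>c: "\<phi> n x \<in> carrier (G n)" and \<psi>c: "\<psi> n x \<in> carrier (G n)" if "x \<in> carrier (F n)" for n x
    using \<phi> \<psi> that by (auto simp: chain_map_def dest: module_hom_closed)
  have fc: "f y \<in> carrier N" if "y \<in> carrier (G n)" for y using module_hom_closed[OF f that] .
  show ?thesis
  proof (cases n)
    case 0
    have "f (\<phi> 0 x) = f (\<psi> 0 x)" if x: "x \<in> carrier (F 0)" for x
    proof -
      have "f (\<phi> 0 x) \<ominus>\<^bsub>N\<^esub> f (\<psi> 0 x) = f (D' 0 (s 0 x))"
        using module_hom_diff[OF f Gl N, of "\<phi> 0 x" "\<psi> 0 x"] \<phi>c[OF x] \<psi>c[OF x] s0[OF x] 0 by simp
      also have "\<dots> = \<zero>\<^bsub>N\<^esub>" using coc module_hom_closed[OF s x] 0 by simp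
      finally show ?thesis using fc \<phi>c[OF x] \<psi>c[OF x] 0 by (simp add: N.M.minus_eq_zero_iff)
    qed
    then show ?thesis using 0 by simp
  next
    case (Suc m)
    have "f (\<phi> (Suc m) x) = compose (carrier (F m)) f (s m) (D m x) \<oplus>\<^bsub>N\<^esub> f (\<psi> (Suc m) x)"
      if x: "x \<in> carrier (F (Suc m))" for x
    proof -
      have Dx: "D m x \<in> carrier (F m)" using module_hom_closed[OF Dh x] .
      have sD: "s m (D m x) \<in> carrier (G (Suc m))" using module_hom_closed[OF s Dx] .
      have sx: "s (Suc m) x \<in> carrier (G (Suc (Suc m)))" using module_hom_closed[OF s x] .
      have "f (\<phi> (Suc m) x) \<ominus>\<^bsub>N\<^esub> f (\<psi> (Suc m) x) =
          f (D' (Suc m) (s (Suc m) x) \<oplus>\<^bsub>G (Suc m)\<^esub> s m (D m x))"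
        using module_hom_diff[OF f Gl N, of "\<phi> (Suc m) x" "\<psi> (Suc m) x"] \<phi>c[OF x] \<psi>c[OF x] sS[OF x] Suc by simp
      also have "\<dots> = f (s m (D m x))"
        using module_hom_add[OF f, of "D' (Suc m) (s (Suc m) x)" "s m (D m x)"] coc[of "s (Suc m) x"]
          module_hom_closed[OF Dh' sx] sx sD fc Suc by simp
      finally have "f (\<phi> (Suc m) x) \<ominus>\<^bsub>N\<^esub> f (\<psi> (Suc m) x) = f (s m (D m x))" .
      then have "f (\<phi> (Suc m) x) = f (s m (D m x)) \<oplus>\<^bsub>N\<^esub> f (\<psi> (Suc m) x)"
        using fc[of "\<phi> (Suc m) x"] fc[of "\<psi> (Suc m) x"] \<phi>c[OF x] \<psi>c[OF x] Suc
        by (metis N.M.minus_closed N.M.add.inv_solve_right a_minus_def)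
      then show ?thesis using Dx by (simp add: compose_eq)
    qed
    moreover have "compose (carrier (F m)) f (s m) \<in> module_hom R (F m) N"
      using module_hom_compose[OF s _ Fl] f Suc by blast
    ultimately show ?thesis using Suc by auto
  qed
qed

subsection \<open>The groups of cochains and Ext\<close>

lemma abelian_group_Hom:
  assumes M: "left_module R M" and N: "left_module R N"
  shows "abelian_group (Hom_group R M N)"
proof -
  interpret M: left_module R M by fact
  interpret N: left_module R N by fact
  let ?H = "Hom_group R M N"
  show ?thesis
  proof (rule abelian_groupI)
    fix f g assume fg: "f \<in> carrier ?H" "g \<in> carrier ?H"
    then show "f \<oplus>\<^bsub>?H\<^esub> g \<in> carrier ?H"
      by (simp add: Hom_group_def module_hom_sum[OF _ _ M N])
    from fg show "f \<oplus>\<^bsub>?H\<^esub> g = g \<oplus>\<^bsub>?H\<^esub> f"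
      by (auto simp: Hom_group_def N.M.a_comm module_hom_closed intro!: restrict_ext)
  next
    show "\<zero>\<^bsub>?H\<^esub> \<in> carrier ?H"
      using module_hom_zero_map[OF M N] by (simp add: Hom_group_def)
  next
    fix f g k assume "f \<in> carrier ?H" "g \<in> carrier ?H" "k \<in> carrier ?H"
    then show "f \<oplus>\<^bsub>?H\<^esub> g \<oplus>\<^bsub>?H\<^esub> k = f \<oplus>\<^bsub>?H\<^esub> (g \<oplus>\<^bsub>?H\<^esub> k)"
      by (auto simp: Hom_group_def N.M.a_assoc module_hom_closed intro!: restrict_ext)
  next
    fix f assume f: "f \<in> carrier ?H"
    then show "\<zero>\<^bsub>?H\<^esub> \<oplus>\<^bsub>?H\<^esub> f = f"
      by (auto simp: Hom_group_def module_hom_closed intro!: extensionalityI[OF _ module_hom_extensional])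
    let ?m = "\<lambda>x \<in> carrier M. \<ominus>\<^bsub>N\<^esub> f x"
    have "?m \<in> carrier ?H"
      using f by (auto simp: Hom_group_def module_hom_closed module_hom_add module_hom_act
          N.M.minus_add N.act_minus_right intro!: module_hom_restrictI[OF M])
    moreover have "?m \<oplus>\<^bsub>?H\<^esub> f = \<zero>\<^bsub>?H\<^esub>"
      using f by (auto simp: Hom_group_def module_hom_closed N.M.l_neg intro!: restrict_ext)
    ultimately show "\<exists>g \<in> carrier ?H. g \<oplus>\<^bsub>?H\<^esub> f = \<zero>\<^bsub>?H\<^esub>" by blast
  qed
qed

lemma left_module_regular: "ring R \<Longrightarrow> left_module R (regular_module R)"
proof -
  assume "ring R"
  then interpret ring R .
  have "abelian_group (regular_module R)"
    by (rule abelian_groupI)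
      (auto simp: regular_module_def with_action_def ring.defs module.defs a_ac
        intro: l_neg intro!: bexI[of _ "\<ominus>\<^bsub>R\<^esub> _"])
  then show ?thesis
    unfolding left_module_def left_module_axioms_def
    by (auto simp: ring_axioms regular_module_def with_action_def ring.defs module.defs l_distr r_distr m_assoc)
qed

lemma regular_module_simps [simp]:
  "carrier (regular_module R) = carrier R" "add (regular_module R) = add R"
  "zero (regular_module R) = zero R" "smult (regular_module R) = mult R"
  by (simp_all add: regular_module_def with_action_def ring.defs module.defs fun_eq_iff)

text \<open>\<open>a_minus\<close> depends on the whole record and not only on its carrier and
  addition, so it does not pass from the regular module to the ring by unfolding these
  fields.\<close>

lemma left_module_minus_regular: 
  assumes "ring R" "x \<in> carrier R" "y \<in> carrier R"
  shows "x \<ominus>\<^bsub>regular_module R\<^esub> y = x \<ominus>\<^bsub>R\<^esub> y"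
proof -
  interpret ring R by fact
  interpret N: left_module R "regular_module R" by (rule left_module_regular) fact
  have "\<ominus>\<^bsub>regular_module R\<^esub> y = \<ominus>\<^bsub>R\<^esub> y"
    by (rule N.M.minus_equality) (use assms l_neg in auto)
  then show ?thesis by (simp add: a_minus_def)
qed

text \<open>
  Everything about \<open>Ext R n M N\<close> is relative to the resolution chosen by \<open>chosen_resolution\<close>, which
  is a free resolution as soon as one exists on the type of lists over \<open>'m + 'r\<close>.
\<close>

locale Ext_setup = M: left_module R M + N: left_module R N
  for R :: "('r, 'y) ring_scheme" (structure)
    and M :: "('r, 'm, 'z) module_scheme" and N :: "('r, 'n, 'w) module_scheme" +
  fixes G :: "nat \<Rightarrow> ('r, ('m + 'r) list) module" and D' :: "nat \<Rightarrow> ('m + 'r) list \<Rightarrow> ('m + 'r) list"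
    and \<eta>' :: "('m + 'r) list \<Rightarrow> 'm"
  assumes G: "free_resolution R M G D' \<eta>'"
begin

abbreviation "F \<equiv> res_module R M"
abbreviation "D \<equiv> res_diff R M"
abbreviation "\<eta> \<equiv> res_aug R M"

lemma F: "free_resolution R M F D \<eta>"
proof -
  have "case chosen_resolution R M of (f, d, e) \<Rightarrow> free_resolution R M f d e"
    unfolding chosen_resolution_def
    by (rule someI[of "\<lambda>(f, d, e). free_resolution R M f d e" "(G, D', \<eta>')"]) (simp add: G)
  then show ?thesis by (simp add: res_module_def res_diff_def res_aug_def split: prod.splits)
qed

lemmas M_module = M.left_module_axioms
lemmas N_module = N.left_module_axioms
lemmas F_module = free_resolutionD(2)[OF F]
lemmas D_hom = free_resolutionD(3)[OF F]
lemmas D_closed = module_hom_closed[OF free_resolutionD(3)[OF F]]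

lemma cochains_carrier: "carrier (Ext_cochains R n M N) = module_hom R (F n) N"
  by (simp add: Ext_cochains_def Hom_group_def)

lemma cochains_zero: "\<zero>\<^bsub>Ext_cochains R n M N\<^esub> = (\<lambda>x \<in> carrier (F n). \<zero>\<^bsub>N\<^esub>)"
  by (simp add: Ext_cochains_def Hom_group_def)

lemma cochains_add: "f \<oplus>\<^bsub>Ext_cochains R n M N\<^esub> g = (\<lambda>x \<in> carrier (F n). f x \<oplus>\<^bsub>N\<^esub> g x)"
  by (simp add: Ext_cochains_def Hom_group_def)

lemma cochains_group: "abelian_group (Ext_cochains R n M N)"
  unfolding Ext_cochains_def by (rule abelian_group_Hom[OF F_module N_module])

lemma cocycle_iff: "f \<in> Ext_cocycles R n M N \<longleftrightarrow>
    f \<in> module_hom R (F n) N \<and> (\<forall>x \<in> carrier (F (Suc n)). f (D n x) = \<zero>\<^bsub>N\<^esub>)"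
proof -
  have "compose (carrier (F (Suc n))) f (D n) = (\<lambda>x \<in> carrier (F (Suc n)). \<zero>\<^bsub>N\<^esub>) \<longleftrightarrow>
      (\<forall>x \<in> carrier (F (Suc n)). f (D n x) = \<zero>\<^bsub>N\<^esub>)"
    by (auto simp: compose_def fun_eq_iff restrict_def)
  then show ?thesis
    unfolding Ext_cocycles_def by (simp add: cochains_carrier cochains_zero)
qed

lemma cocycle_hom: "f \<in> Ext_cocycles R n M N \<Longrightarrow> f \<in> module_hom R (F n) N"
  by (simp add: cocycle_iff)

lemma coboundaries_Suc: "Ext_coboundaries R (Suc m) M N =
    {f. \<exists>e \<in> module_hom R (F m) N. f = (\<lambda>x \<in> carrier (F (Suc m)). e (D m x))}"
  by (auto simp: Ext_coboundaries_def cochains_carrier compose_def)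

lemma coboundaries_0: "Ext_coboundaries R 0 M N = {\<lambda>x \<in> carrier (F 0). \<zero>\<^bsub>N\<^esub>}"
  by (simp add: Ext_coboundaries_def cochains_zero)

lemma coboundary_hom: "f \<in> Ext_coboundaries R n M N \<Longrightarrow> f \<in> module_hom R (F n) N"
proof (cases n)
  case 0
  then show "f \<in> Ext_coboundaries R n M N \<Longrightarrow> f \<in> module_hom R (F n) N"
    using module_hom_zero_map[OF F_module N_module] by (simp add: coboundaries_0)
next
  case (Suc m)
  then show "f \<in> Ext_coboundaries R n M N \<Longrightarrow> f \<in> module_hom R (F n) N"
    using module_hom_compose[OF D_hom _ F_module] by (auto simp: coboundaries_Suc compose_def)
qed

lemma coboundaries_subgroup: "subgroup (Ext_coboundaries R n M N) (add_monoid (Ext_cochains R n M N))"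
proof -
  interpret C: abelian_group "Ext_cochains R n M N" by (rule cochains_group)
  show ?thesis
  proof (cases n)
    case 0
    then show ?thesis
      using C.add.triv_subgroup by (simp add: coboundaries_0 cochains_zero)
  next
    case (Suc m)
    show ?thesis
    proof (rule C.add.subgroupI)
      show "Ext_coboundaries R n M N \<subseteq> carrier (Ext_cochains R n M N)"
        using coboundary_hom by (auto simp: cochains_carrier)
      show "Ext_coboundaries R n M N \<noteq> {}"
        using module_hom_zero_map[OF F_module N_module] Suc by (auto simp: coboundaries_Suc)
    next
      fix f assume f: "f \<in> Ext_coboundaries R n M N"
      then obtain e where e: "e \<in> module_hom R (F m) N" "f = (\<lambda>x \<in> carrier (F (Suc m)). e (D m x))"
        using Suc by (auto simp: coboundaries_Suc)
      let ?e = "\<lambda>x \<in> carrier (F m). \<ominus>\<^bsub>N\<^esub> e x"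
      have e': "?e \<in> module_hom R (F m) N"
        using e by (auto simp: module_hom_closed module_hom_add module_hom_act
          N.M.minus_add N.act_minus_right intro!: module_hom_restrictI[OF F_module])
      have "\<ominus>\<^bsub>Ext_cochains R n M N\<^esub> f = (\<lambda>x \<in> carrier (F (Suc m)). ?e (D m x))"
      proof (rule C.minus_equality)
        show "(\<lambda>x \<in> carrier (F (Suc m)). ?e (D m x)) \<oplus>\<^bsub>Ext_cochains R n M N\<^esub> f = \<zero>\<^bsub>Ext_cochains R n M N\<^esub>"
          using e D_closed Suc by (auto simp: cochains_add cochains_zero module_hom_closed N.M.l_neg intro!: restrict_ext)
        show "f \<in> carrier (Ext_cochains R n M N)"
          using coboundary_hom[OF f] by (simp add: cochains_carrier)
        show "(\<lambda>x \<in> carrier (F (Suc m)). ?e (D m x)) \<in> carrier (Ext_cochains R n M N)"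
          using module_hom_compose[OF D_hom e' F_module] Suc by (simp add: cochains_carrier compose_def)
      qed
      then show "\<ominus>\<^bsub>Ext_cochains R n M N\<^esub> f \<in> Ext_coboundaries R n M N"
        unfolding Suc coboundaries_Suc using e' by blast
    next
      fix f g assume f: "f \<in> Ext_coboundaries R n M N" and g: "g \<in> Ext_coboundaries R n M N"
      obtain e where e: "e \<in> module_hom R (F m) N" "f = (\<lambda>x \<in> carrier (F (Suc m)). e (D m x))"
        using f Suc by (auto simp: coboundaries_Suc)
      obtain e' where e': "e' \<in> module_hom R (F m) N" "g = (\<lambda>x \<in> carrier (F (Suc m)). e' (D m x))"
        using g Suc by (auto simp: coboundaries_Suc)
      have "f \<oplus>\<^bsub>Ext_cochains R n M N\<^esub> g =
          (\<lambda>x \<in> carrier (F (Suc m)). (\<lambda>x \<in> carrier (F m). e x \<oplus>\<^bsub>N\<^esub> e' x) (D m x))"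
        using e(2) e'(2) D_closed Suc by (auto simp: cochains_add intro!: restrict_ext)
      then show "f \<oplus>\<^bsub>Ext_cochains R n M N\<^esub> g \<in> Ext_coboundaries R n M N"
        unfolding Suc coboundaries_Suc using module_hom_sum[OF e(1) e'(1) F_module N_module] by blast
    qed
  qed
qed

lemma Ext_class_eq: "Ext_class R n M N f =
    {\<lambda>x \<in> carrier (F n). b x \<oplus>\<^bsub>N\<^esub> f x | b. b \<in> Ext_coboundaries R n M N}"
  by (auto simp: Ext_class_def a_r_coset_def r_coset_def cochains_add)

lemma coboundary_cocycle: "b \<in> Ext_coboundaries R n M N \<Longrightarrow> b \<in> Ext_cocycles R n M N"
proof (cases n)
  case 0
  then show "b \<in> Ext_coboundaries R n M N \<Longrightarrow> b \<in> Ext_cocycles R n M N"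
    using module_hom_zero_map[OF F_module N_module] D_closed[of _ 0]
    by (simp add: coboundaries_0 cocycle_iff)
next
  case (Suc m)
  assume b: "b \<in> Ext_coboundaries R n M N"
  obtain e where e: "e \<in> module_hom R (F m) N" "b = (\<lambda>x \<in> carrier (F (Suc m)). e (D m x))"
    using b Suc by (auto simp: coboundaries_Suc)
  then show ?thesis
    using coboundary_hom[OF b] D_closed free_resolutionD(7)[OF F] module_hom_zero[OF e(1) F_module N_module] Suc
    by (auto simp: cocycle_iff)
qed

lemma cocycle_add:
  assumes f: "f \<in> Ext_cocycles R n M N" and g: "g \<in> Ext_cocycles R n M N"
  shows "(\<lambda>x \<in> carrier (F n). f x \<oplus>\<^bsub>N\<^esub> g x) \<in> Ext_cocycles R n M N"
  using module_hom_sum[OF cocycle_hom[OF f] cocycle_hom[OF g] F_module N_module] f g D_closed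
  by (auto simp: cocycle_iff)

lemma Ext_class_self: "f \<in> Ext_cocycles R n M N \<Longrightarrow> f \<in> Ext_class R n M N f"
proof -
  interpret C: abelian_group "Ext_cochains R n M N" by (rule cochains_group)
  assume "f \<in> Ext_cocycles R n M N"
  then show ?thesis
    unfolding Ext_class_def a_r_coset_def
    by (intro C.add.rcos_self[OF _ coboundaries_subgroup]) (simp add: cocycle_iff cochains_carrier)
qed

lemma Ext_class_cocycles: "\<lbrakk>f \<in> Ext_cocycles R n M N; g \<in> Ext_class R n M N f\<rbrakk> \<Longrightarrow> g \<in> Ext_cocycles R n M N"
  by (auto simp: Ext_class_eq intro: cocycle_add coboundary_cocycle)

lemma Ext_class_repr:
  assumes f: "f \<in> Ext_cocycles R n M N" and g: "g \<in> Ext_class R n M N f"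
  shows "Ext_class R n M N g = Ext_class R n M N f"
proof -
  interpret C: abelian_group "Ext_cochains R n M N" by (rule cochains_group)
  show ?thesis
    using C.add.repr_independence[OF _ _ coboundaries_subgroup, of g f] f g
    by (simp add: Ext_class_def a_r_coset_def cocycle_iff cochains_carrier)
qed

lemma Ext_class_add:
  assumes f: "f \<in> Ext_cocycles R n M N" and g: "g \<in> Ext_cocycles R n M N"
  shows "Ext_class R n M N f \<oplus>\<^bsub>Ext R n M N\<^esub> Ext_class R n M N g =
    Ext_class R n M N (\<lambda>x \<in> carrier (F n). f x \<oplus>\<^bsub>N\<^esub> g x)"
proof -
  interpret C: abelian_group "Ext_cochains R n M N" by (rule cochains_group)
  have "normal (Ext_coboundaries R n M N) (add_monoid (Ext_cochains R n M N))"
    by (rule comm_group.normal_iff_subgroup[THEN iffD2, OF C.a_comm_group coboundaries_subgroup])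
  from normal.rcos_sum[OF this, of f g] f g show ?thesis
    by (simp add: Ext_def Ext_class_def a_r_coset_def set_add_def cocycle_iff cochains_carrier cochains_add)
qed

lemma Ext_carrier: "carrier (Ext R n M N) = Ext_class R n M N ` Ext_cocycles R n M N"
  by (simp add: Ext_def)

lemma Ext_class_coboundary:
  assumes f: "f \<in> Ext_coboundaries R n M N"
  shows "Ext_class R n M N f = Ext_coboundaries R n M N"
proof -
  interpret C: abelian_group "Ext_cochains R n M N" by (rule cochains_group)
  show ?thesis
    unfolding Ext_class_def a_r_coset_def
    using C.add.coset_join2[OF _ coboundaries_subgroup] f coboundary_hom[OF f] by (simp add: cochains_carrier)
qed

lemma Ext_trivialI:
  assumes "\<And>f. f \<in> Ext_cocycles R n M N \<Longrightarrow> f \<in> Ext_coboundaries R n M N"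
  shows "carrier (Ext R n M N) = {\<zero>\<^bsub>Ext R n M N\<^esub>}"
proof -
  have z: "\<zero>\<^bsub>Ext_cochains R n M N\<^esub> \<in> Ext_coboundaries R n M N"
    using subgroup.one_closed[OF coboundaries_subgroup] by simp
  have "Ext_class R n M N ` Ext_cocycles R n M N = {Ext_coboundaries R n M N}"
    using coboundary_cocycle[OF z] Ext_class_coboundary assms by auto
  then show ?thesis by (simp add: Ext_def)
qed

text \<open>\<open>Ext_map_right\<close> is a union over all representatives of a class. It
  collapses to one class because composition with g turns the coboundary e D into the coboundary of
  g e.\<close>

lemma Ext_map_right_class:
  assumes g: "g \<in> module_hom R N N" and f: "f \<in> Ext_cocycles R n M N"
  shows "Ext_map_right R n M N g (Ext_class R n M N f) = Ext_class R n M N (compose (carrier (F n)) g f)"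
    and "compose (carrier (F n)) g f \<in> Ext_cocycles R n M N"
proof -
  have gc: "compose (carrier (F n)) g f' \<in> Ext_cocycles R n M N" if "f' \<in> Ext_cocycles R n M N" for f'
    using that module_hom_compose[OF cocycle_hom[OF that] g F_module] D_closed
      module_hom_zero[OF g N_module N_module]
    by (auto simp: cocycle_iff compose_eq)
  have "Ext_class R n M N (compose (carrier (F n)) g f') = Ext_class R n M N (compose (carrier (F n)) g f)"
    if f': "f' \<in> Ext_class R n M N f" for f'
  proof (rule Ext_class_repr)
    obtain b where b: "b \<in> Ext_coboundaries R n M N" "f' = (\<lambda>x \<in> carrier (F n). b x \<oplus>\<^bsub>N\<^esub> f x)"
      using f' by (auto simp: Ext_class_eq)
    have "compose (carrier (F n)) g b \<in> Ext_coboundaries R n M N"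
    proof (cases n)
      case 0
      then show ?thesis using b module_hom_zero[OF g N_module N_module]
        by (auto simp: coboundaries_0 compose_def intro!: restrict_ext)
    next
      case (Suc m)
      then obtain e where e: "e \<in> module_hom R (F m) N" "b = (\<lambda>x \<in> carrier (F (Suc m)). e (D m x))"
        using b by (auto simp: coboundaries_Suc)
      have "compose (carrier (F n)) g b = (\<lambda>x \<in> carrier (F (Suc m)). compose (carrier (F m)) g e (D m x))"
        using e(2) D_closed Suc by (auto simp: compose_def intro!: restrict_ext)
      then show ?thesis
        using module_hom_compose[OF e(1) g F_module] Suc by (auto simp: coboundaries_Suc)
    qed
    moreover have "compose (carrier (F n)) g f' =
        (\<lambda>x \<in> carrier (F n). compose (carrier (F n)) g b x \<oplus>\<^bsub>N\<^esub> compose (carrier (F n)) g f x)"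
      using b(2) module_hom_add[OF g] module_hom_closed[OF coboundary_hom[OF b(1)]] module_hom_closed[OF cocycle_hom[OF f]]
      by (auto simp: compose_def intro!: restrict_ext)
    ultimately show "compose (carrier (F n)) g f' \<in> Ext_class R n M N (compose (carrier (F n)) g f)"
      unfolding Ext_class_eq by blast
  qed (rule gc[OF f])
  then show "Ext_map_right R n M N g (Ext_class R n M N f) = Ext_class R n M N (compose (carrier (F n)) g f)"
    unfolding Ext_map_right_def using Ext_class_self[OF f] by blast
  show "compose (carrier (F n)) g f \<in> Ext_cocycles R n M N" by (rule gc[OF f])
qed

lemma cocycle_cohomologous:
  assumes \<phi>: "chain_map R F D \<eta> F D \<eta> h \<phi>" and \<psi>: "chain_map R F D \<eta> F D \<eta> h \<psi>"
    and f: "f \<in> Ext_cocycles R n M N"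
  shows "\<exists>b \<in> Ext_coboundaries R n M N. \<forall>x \<in> carrier (F n). f (\<phi> n x) = b x \<oplus>\<^bsub>N\<^esub> f (\<psi> n x)"
proof -
  note * = cocycle_homotopic[OF F F M_module M_module N_module \<phi> \<psi> cocycle_hom[OF f]]
  have fc: "f (\<psi> n x) \<in> carrier N" if "x \<in> carrier (F n)" for x
  proof -
    have "\<psi> n \<in> module_hom R (F n) (F n)" using \<psi> by (simp add: chain_map_def)
    from module_hom_closed[OF cocycle_hom[OF f] module_hom_closed[OF this that]] show ?thesis .
  qed
  show ?thesis
  proof (cases n)
    case 0
    then show ?thesis using * f fc by (auto simp: coboundaries_0 cocycle_iff)
  next
    case (Suc m)
    then obtain e where "e \<in> module_hom R (F m) N"
      "\<forall>x \<in> carrier (F (Suc m)). f (\<phi> (Suc m) x) = e (D m x) \<oplus>\<^bsub>N\<^esub> f (\<psi> (Suc m) x)"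
      using * f by (auto simp: cocycle_iff)
    then show ?thesis using Suc by (auto simp: coboundaries_Suc intro!: exI[of _ "\<lambda>x \<in> carrier (F (Suc m)). e (D m x)"])
  qed
qed

lemma Ext_class_cohomologous:
  assumes "f \<in> Ext_cocycles R n M N" "g \<in> module_hom R (F n) N"
    and "b \<in> Ext_coboundaries R n M N" "\<And>x. x \<in> carrier (F n) \<Longrightarrow> g x = b x \<oplus>\<^bsub>N\<^esub> f x"
  shows "Ext_class R n M N g = Ext_class R n M N f"
proof (rule Ext_class_repr[OF assms(1)])
  have "g = (\<lambda>x \<in> carrier (F n). b x \<oplus>\<^bsub>N\<^esub> f x)"
    by (rule extensionalityI[OF module_hom_extensional[OF assms(2)]]) (auto simp: assms(4))
  then show "g \<in> Ext_class R n M N f" using assms(3) by (auto simp: Ext_class_eq)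
qed

text \<open>A central element acts on every module of the resolution by homomorphisms, and these
  form a lift of its action on M. All lifts are homotopic to this one, and linearity of cocycles
  moves the element to the target. This computes the left action on the homological
  integral.\<close>

lemma Ext_map_left_central:
  assumes e: "e \<in> carrier R" and central: "\<And>a. a \<in> carrier R \<Longrightarrow> e \<otimes> a = a \<otimes> e"
    and h: "\<And>x. x \<in> carrier M \<Longrightarrow> h x = e \<odot>\<^bsub>M\<^esub> x"
    and g: "g \<in> module_hom R N N" "\<And>y. y \<in> carrier N \<Longrightarrow> g y = e \<odot>\<^bsub>N\<^esub> y"
    and X: "X \<in> carrier (Ext R n M N)"
  shows "Ext_map_left R n M M N h X = Ext_map_right R n M N g X"
proof -
  obtain f where f: "f \<in> Ext_cocycles R n M N" and X: "X = Ext_class R n M N f"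
    using X by (auto simp: Ext_carrier)
  have lifts: "chain_lifts R M M h = {\<phi>. chain_map R F D \<eta> F D \<eta> h \<phi>}"
    by (simp add: chain_lifts_def chain_map_def)
  \<comment> \<open>Multiplication by e on each module of the resolution; it is linear exactly
    because e commutes with the ring.\<close>
  define \<psi> where "\<psi> n = (\<lambda>x \<in> carrier (F n). e \<odot>\<^bsub>F n\<^esub> x)" for n
  have \<psi>h: "\<psi> n \<in> module_hom R (F n) (F n)" for n
  proof -
    interpret Fn: left_module R "F n" by (rule F_module)
    show ?thesis
      unfolding \<psi>_def using e Fn.act_closed Fn.act_add_right
      by (auto intro!: module_hom_restrictI[OF F_module] simp: Fn.act_act[symmetric] central)
  qed
  have Fc: "e \<odot>\<^bsub>F n\<^esub> x \<in> carrier (F n)" if "x \<in> carrier (F n)" for n x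
    using left_module.act_closed[OF F_module e that] .
  have \<psi>: "chain_map R F D \<eta> F D \<eta> h \<psi>"
    unfolding chain_map_def
    using \<psi>h e Fc D_closed module_hom_act[OF D_hom] module_hom_act[OF free_resolutionD(4)[OF F]]
      module_hom_closed[OF free_resolutionD(4)[OF F]]
    by (auto simp: \<psi>_def h)
  \<comment> \<open>\<open>Ext_map_left\<close> is a union over representatives and over lifts, so
    independence of both is needed for the union to be a single class.\<close>
  have main: "Ext_class R n M N (compose (carrier (F n)) f' (\<phi> n)) = Ext_class R n M N (compose (carrier (F n)) g f)"
    if f': "f' \<in> Ext_class R n M N f" and \<phi>: "chain_map R F D \<eta> F D \<eta> h \<phi>" for f' \<phi>
  proof -
    have f'c: "f' \<in> Ext_cocycles R n M N" using Ext_class_cocycles[OF f f'] .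
    obtain b where b: "b \<in> Ext_coboundaries R n M N" "\<forall>x \<in> carrier (F n). f' (\<phi> n x) = b x \<oplus>\<^bsub>N\<^esub> f' (\<psi> n x)"
      using cocycle_cohomologous[OF \<phi> \<psi> f'c] by blast
    have "Ext_class R n M N (compose (carrier (F n)) f' (\<phi> n)) = Ext_class R n M N (compose (carrier (F n)) g f')"
    proof (rule Ext_class_cohomologous[OF _ _ b(1)])
      show "compose (carrier (F n)) f' (\<phi> n) \<in> module_hom R (F n) N"
        using \<phi> by (auto simp: chain_map_def intro!: module_hom_compose[OF _ cocycle_hom[OF f'c] F_module])
      show "compose (carrier (F n)) g f' \<in> Ext_cocycles R n M N"
        by (rule Ext_map_right_class(2)[OF g(1) f'c])
      show "compose (carrier (F n)) f' (\<phi> n) x = b x \<oplus>\<^bsub>N\<^esub> compose (carrier (F n)) g f' x"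
        if "x \<in> carrier (F n)" for x
        using that b(2) e g(2) module_hom_closed[OF cocycle_hom[OF f'c]] module_hom_act[OF cocycle_hom[OF f'c]]
        by (simp add: compose_eq \<psi>_def)
    qed
    also have "\<dots> = Ext_class R n M N (compose (carrier (F n)) g f)"
      using Ext_map_right_class(1)[OF g(1) f] Ext_map_right_class(1)[OF g(1) f'c] Ext_class_repr[OF f f'] by simp
    finally show ?thesis .
  qed
  have "Ext_map_left R n M M N h X = Ext_class R n M N (compose (carrier (F n)) g f)"
    unfolding Ext_map_left_def X lifts using main \<psi> Ext_class_self[OF f] by blast
  then show ?thesis using Ext_map_right_class(1)[OF g(1) f] X by simp
qed

end

subsection \<open>Free modules of lists\<close>

text \<open>The free module of rank k, coded by lists of length k with entries in the right summand,
  so that it inhabits the type over which \<open>chosen_resolution\<close> ranges.\<close>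

definition list_module :: "('r, 'y) ring_scheme \<Rightarrow> nat \<Rightarrow> ('r, ('m + 'r) list) module"
  where "list_module R k =
    \<lparr>carrier = map Inr ` {xs. length xs = k \<and> set xs \<subseteq> carrier R}, mult = undefined, one = undefined,
     zero = replicate k (Inr \<zero>\<^bsub>R\<^esub>),
     add = (\<lambda>xs ys. map2 (\<lambda>x y. Inr (projr x \<oplus>\<^bsub>R\<^esub> projr y)) xs ys),
     smult = (\<lambda>a. map (\<lambda>x. Inr (a \<otimes>\<^bsub>R\<^esub> projr x)))\<rparr>"

lemma list_module_add: "length xs = length ys \<Longrightarrow>
    map Inr xs \<oplus>\<^bsub>list_module R k\<^esub> map Inr ys = map Inr (map2 (\<lambda>x y. x \<oplus>\<^bsub>R\<^esub> y) xs ys)"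
  by (rule nth_equalityI) (auto simp: list_module_def)

lemma list_module_act: "a \<odot>\<^bsub>list_module R k\<^esub> map Inr xs = map Inr (map (\<lambda>x. a \<otimes>\<^bsub>R\<^esub> x) xs)"
  by (rule nth_equalityI) (auto simp: list_module_def)

lemma list_module_carrier: "X \<in> carrier (list_module R k) \<longleftrightarrow>
    (\<exists>xs. X = map Inr xs \<and> length xs = k \<and> set xs \<subseteq> carrier R)"
  by (auto simp: list_module_def)

lemma list_module_zero: "\<zero>\<^bsub>list_module R k\<^esub> = map Inr (replicate k \<zero>\<^bsub>R\<^esub>)"
  by (simp add: list_module_def)

lemma left_module_list:
  assumes "ring R"
  shows "left_module R (list_module R k :: ('r, ('m + 'r) list) module)"
proof -
  interpret ring R by fact
  let ?L = "list_module R k :: ('r, ('m + 'r) list) module"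
  have nc: "xs ! i \<in> carrier R" if "set xs \<subseteq> carrier R" "i < length xs" for xs i
    using that nth_mem by blast
  have "abelian_group ?L"
  proof (rule abelian_groupI)
    fix X assume "X \<in> carrier ?L"
    then obtain xs where X: "X = map Inr xs" "length xs = k" "set xs \<subseteq> carrier R"
      by (auto simp: list_module_carrier)
    let ?ys = "map (a_inv R) xs"
    have "map Inr ?ys \<in> carrier ?L" using X unfolding list_module_carrier by (intro exI[of _ ?ys]) auto
    moreover have "map Inr ?ys \<oplus>\<^bsub>?L\<^esub> X = \<zero>\<^bsub>?L\<^esub>"
      using X nc by (auto simp: list_module_add list_module_zero l_neg simp del: map_map intro!: nth_equalityI)
    ultimately show "\<exists>y \<in> carrier ?L. y \<oplus>\<^bsub>?L\<^esub> X = \<zero>\<^bsub>?L\<^esub>" by blast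
  next
    show "\<zero>\<^bsub>?L\<^esub> \<in> carrier ?L"
      unfolding list_module_carrier list_module_zero by (intro exI[of _ "replicate k \<zero>\<^bsub>R\<^esub>"]) auto
  next
    fix X Y assume "X \<in> carrier ?L" "Y \<in> carrier ?L"
    then obtain xs ys where X: "X = map Inr xs" "length xs = k" "set xs \<subseteq> carrier R"
      and Y: "Y = map Inr ys" "length ys = k" "set ys \<subseteq> carrier R"
      by (auto simp: list_module_carrier)
    let ?zs = "map2 (\<lambda>x y. x \<oplus>\<^bsub>R\<^esub> y) xs ys"
    have "set ?zs \<subseteq> carrier R" using X Y nc by (auto simp: set_zip)
    then show "X \<oplus>\<^bsub>?L\<^esub> Y \<in> carrier ?L"
      unfolding list_module_carrier using X Y by (intro exI[of _ ?zs]) (simp add: list_module_add del: map_map)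
    show "X \<oplus>\<^bsub>?L\<^esub> Y = Y \<oplus>\<^bsub>?L\<^esub> X"
      using X Y nc by (simp add: list_module_add del: map_map) (auto intro!: nth_equalityI simp: a_comm)
  next
    fix X assume "X \<in> carrier ?L"
    then obtain xs where X: "X = map Inr xs" "length xs = k" "set xs \<subseteq> carrier R"
      by (auto simp: list_module_carrier)
    then show "\<zero>\<^bsub>?L\<^esub> \<oplus>\<^bsub>?L\<^esub> X = X"
      using nc by (simp add: list_module_add list_module_zero del: map_map map_replicate) (auto intro!: nth_equalityI)
  next
    fix X Y Z assume "X \<in> carrier ?L" "Y \<in> carrier ?L" "Z \<in> carrier ?L"
    then obtain xs ys zs where "X = map Inr xs" "length xs = k" "set xs \<subseteq> carrier R"
      "Y = map Inr ys" "length ys = k" "set ys \<subseteq> carrier R"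
      "Z = map Inr zs" "length zs = k" "set zs \<subseteq> carrier R"
      by (auto simp: list_module_carrier)
    then show "X \<oplus>\<^bsub>?L\<^esub> Y \<oplus>\<^bsub>?L\<^esub> Z = X \<oplus>\<^bsub>?L\<^esub> (Y \<oplus>\<^bsub>?L\<^esub> Z)"
      using nc by (simp add: list_module_add del: map_map) (auto intro!: nth_equalityI simp: a_assoc)
  qed
  moreover have "left_module_axioms R ?L"
    unfolding left_module_axioms_def
  proof (intro conjI allI impI)
    fix a X assume "a \<in> carrier R" "X \<in> carrier ?L"
    then obtain xs where X: "X = map Inr xs" "length xs = k" "set xs \<subseteq> carrier R" "a \<in> carrier R"
      by (auto simp: list_module_carrier)
    then show "a \<odot>\<^bsub>?L\<^esub> X \<in> carrier ?L"
      unfolding list_module_carrier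
      by (intro exI[of _ "map (\<lambda>x. a \<otimes>\<^bsub>R\<^esub> x) xs"]) (auto simp: list_module_act)
    fix b assume "b \<in> carrier R"
    with X show "(a \<oplus>\<^bsub>R\<^esub> b) \<odot>\<^bsub>?L\<^esub> X = a \<odot>\<^bsub>?L\<^esub> X \<oplus>\<^bsub>?L\<^esub> b \<odot>\<^bsub>?L\<^esub> X"
      "(a \<otimes>\<^bsub>R\<^esub> b) \<odot>\<^bsub>?L\<^esub> X = a \<odot>\<^bsub>?L\<^esub> (b \<odot>\<^bsub>?L\<^esub> X)"
      using nc by (simp_all add: list_module_act list_module_add del: map_map)
        (auto intro!: nth_equalityI simp: l_distr m_assoc)
  next
    fix a X Y assume "a \<in> carrier R" "X \<in> carrier ?L" "Y \<in> carrier ?L"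
    then obtain xs ys where "X = map Inr xs" "length xs = k" "set xs \<subseteq> carrier R"
      "Y = map Inr ys" "length ys = k" "set ys \<subseteq> carrier R" "a \<in> carrier R"
      by (auto simp: list_module_carrier)
    then show "a \<odot>\<^bsub>?L\<^esub> (X \<oplus>\<^bsub>?L\<^esub> Y) = a \<odot>\<^bsub>?L\<^esub> X \<oplus>\<^bsub>?L\<^esub> a \<odot>\<^bsub>?L\<^esub> Y"
      using nc by (simp add: list_module_act list_module_add del: map_map)
        (auto intro!: nth_equalityI simp: r_distr)
  next
    fix X assume "X \<in> carrier ?L"
    then obtain xs where "X = map Inr xs" "length xs = k" "set xs \<subseteq> carrier R"
      by (auto simp: list_module_carrier)
    then show "\<one>\<^bsub>R\<^esub> \<odot>\<^bsub>?L\<^esub> X = X"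
      using nc by (simp add: list_module_act del: map_map) (auto intro!: nth_equalityI)
  qed
  ultimately show ?thesis by (simp add: left_module_def ring_axioms)
qed

lemma list_module_carrier_0: "X \<in> carrier (list_module R 0) \<longleftrightarrow> X = []"
  by (auto simp: list_module_carrier)

lemma list_module_carrier_1: "X \<in> carrier (list_module R (Suc 0)) \<longleftrightarrow> (\<exists>a \<in> carrier R. X = [Inr a])"
  by (auto simp: list_module_carrier length_Suc_conv intro: exI[of _ "[_]"])

lemma list_module_carrier_2: "X \<in> carrier (list_module R 2) \<longleftrightarrow>
    (\<exists>a \<in> carrier R. \<exists>b \<in> carrier R. X = [Inr a, Inr b])"
  by (auto simp: list_module_carrier length_Suc_conv numeral_2_eq_2 intro: exI[of _ "[_, _]"])

lemma list_module_1_simps: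
  "[Inr a] \<oplus>\<^bsub>list_module R (Suc 0)\<^esub> [Inr b] = [Inr (a \<oplus>\<^bsub>R\<^esub> b)]"
  "a \<odot>\<^bsub>list_module R (Suc 0)\<^esub> [Inr b] = [Inr (a \<otimes>\<^bsub>R\<^esub> b)]"
  "\<zero>\<^bsub>list_module R (Suc 0)\<^esub> = [Inr \<zero>\<^bsub>R\<^esub>]"
  by (simp_all add: list_module_def)

lemma list_module_2_simps:
  "[Inr a, Inr b] \<oplus>\<^bsub>list_module R 2\<^esub> [Inr a', Inr b'] = [Inr (a \<oplus>\<^bsub>R\<^esub> a'), Inr (b \<oplus>\<^bsub>R\<^esub> b')]"
  "c \<odot>\<^bsub>list_module R 2\<^esub> [Inr a, Inr b] = [Inr (c \<otimes>\<^bsub>R\<^esub> a), Inr (c \<otimes>\<^bsub>R\<^esub> b)]"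
  "\<zero>\<^bsub>list_module R 2\<^esub> = [Inr \<zero>\<^bsub>R\<^esub>, Inr \<zero>\<^bsub>R\<^esub>]"
  by (simp_all add: list_module_def numeral_2_eq_2)

lemma free_module_finiteI:
  assumes "left_module R F" "finite B" "B \<subseteq> carrier F"
    and ex1: "\<And>x. x \<in> carrier F \<Longrightarrow> \<exists>!r. r \<in> B \<rightarrow>\<^sub>E carrier R \<and> x = (\<Oplus>\<^bsub>F\<^esub>b \<in> B. r b \<odot>\<^bsub>F\<^esub> b)"
  shows "free_module R F"
proof -
  interpret left_module R F by fact
  have "(\<Oplus>\<^bsub>F\<^esub>b \<in> {b \<in> B. r b \<noteq> \<zero>\<^bsub>R\<^esub>}. r b \<odot>\<^bsub>F\<^esub> b) = (\<Oplus>\<^bsub>F\<^esub>b \<in> B. r b \<odot>\<^bsub>F\<^esub> b)"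
    if "r \<in> B \<rightarrow>\<^sub>E carrier R" for r
    by (rule finsum_support_superset) (use that assms(2,3) in auto)
  then have "(r \<in> B \<rightarrow>\<^sub>E carrier R \<and> finite {b \<in> B. r b \<noteq> \<zero>\<^bsub>R\<^esub>} \<and>
       x = (\<Oplus>\<^bsub>F\<^esub>b \<in> {b \<in> B. r b \<noteq> \<zero>\<^bsub>R\<^esub>}. r b \<odot>\<^bsub>F\<^esub> b)) \<longleftrightarrow>
     (r \<in> B \<rightarrow>\<^sub>E carrier R \<and> x = (\<Oplus>\<^bsub>F\<^esub>b \<in> B. r b \<odot>\<^bsub>F\<^esub> b))" for r x
    using assms(2) by auto
  then show ?thesis
    unfolding free_module_def using assms by (intro conjI exI[of _ B]) auto
qed

lemma free_list_module_0:
  assumes "ring R"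
  shows "free_module R (list_module R 0 :: ('r, ('m + 'r) list) module)"
proof (rule free_module_finiteI[of _ _ "{}"])
  let ?L = "list_module R 0 :: ('r, ('m + 'r) list) module"
  interpret L: left_module R ?L by (rule left_module_list) fact
  show "left_module R ?L" ..
  fix X assume "X \<in> carrier ?L"
  then show "\<exists>!r. r \<in> {} \<rightarrow>\<^sub>E carrier R \<and> X = (\<Oplus>\<^bsub>?L\<^esub>b \<in> {}. r b \<odot>\<^bsub>?L\<^esub> b)"
    by (auto simp: list_module_carrier_0 list_module_zero)
qed auto

lemma free_list_module_1:
  assumes "ring R"
  shows "free_module R (list_module R (Suc 0) :: ('r, ('m + 'r) list) module)"
proof (rule free_module_finiteI[of _ _ "{[Inr \<one>\<^bsub>R\<^esub>]}"])
  interpret ring R by fact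
  let ?L = "list_module R (Suc 0) :: ('r, ('m + 'r) list) module"
  interpret L: left_module R ?L by (rule left_module_list) fact
  let ?e = "[Inr \<one>\<^bsub>R\<^esub>] :: ('m + 'r) list"
  show "left_module R ?L" ..
  show "{?e} \<subseteq> carrier ?L" by (auto simp: list_module_carrier_1)
  fix X assume "X \<in> carrier ?L"
  then obtain a where a: "a \<in> carrier R" "X = [Inr a]" by (auto simp only: list_module_carrier_1)
  have sum: "(\<Oplus>\<^bsub>?L\<^esub>b \<in> {?e}. r b \<odot>\<^bsub>?L\<^esub> b) = [Inr (r ?e)]" if "r ?e \<in> carrier R" for r
    using that by (simp add: list_module_1_simps list_module_carrier_1)
  show "\<exists>!r. r \<in> {?e} \<rightarrow>\<^sub>E carrier R \<and> X = (\<Oplus>\<^bsub>?L\<^esub>b \<in> {?e}. r b \<odot>\<^bsub>?L\<^esub> b)"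
  proof (rule ex1I[of _ "\<lambda>b \<in> {?e}. a"])
    show "(\<lambda>b \<in> {?e}. a) \<in> {?e} \<rightarrow>\<^sub>E carrier R \<and>
        X = (\<Oplus>\<^bsub>?L\<^esub>b \<in> {?e}. (\<lambda>b \<in> {?e}. a) b \<odot>\<^bsub>?L\<^esub> b)"
      by (subst sum) (use a in auto)
  next
    fix r assume r: "r \<in> {?e} \<rightarrow>\<^sub>E carrier R \<and> X = (\<Oplus>\<^bsub>?L\<^esub>b \<in> {?e}. r b \<odot>\<^bsub>?L\<^esub> b)"
    then have "r ?e \<in> carrier R" by auto
    with sum[of r, OF this] r a have "r ?e = a" by simp
    then show "r = (\<lambda>b \<in> {?e}. a)" using r by (auto simp: fun_eq_iff PiE_def extensional_def)
  qed
qed simp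

lemma free_list_module_2:
  assumes "ring R" "\<one>\<^bsub>R\<^esub> \<noteq> \<zero>\<^bsub>R\<^esub>"
  shows "free_module R (list_module R 2 :: ('r, ('m + 'r) list) module)"
proof (rule free_module_finiteI[of _ _ "{[Inr \<one>\<^bsub>R\<^esub>, Inr \<zero>\<^bsub>R\<^esub>], [Inr \<zero>\<^bsub>R\<^esub>, Inr \<one>\<^bsub>R\<^esub>]}"])
  interpret ring R by fact
  let ?L = "list_module R 2 :: ('r, ('m + 'r) list) module"
  interpret L: left_module R ?L by (rule left_module_list) fact
  let ?e = "[Inr \<one>\<^bsub>R\<^esub>, Inr \<zero>\<^bsub>R\<^esub>] :: ('m + 'r) list" and ?f = "[Inr \<zero>\<^bsub>R\<^esub>, Inr \<one>\<^bsub>R\<^esub>] :: ('m + 'r) list"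
  show "left_module R ?L" ..
  show "{?e, ?f} \<subseteq> carrier ?L" by (auto simp: list_module_carrier_2)
  fix X assume "X \<in> carrier ?L"
  then obtain a b where a: "a \<in> carrier R" "b \<in> carrier R" "X = [Inr a, Inr b]"
    by (auto simp: list_module_carrier_2)
  \<comment> \<open>Distinctness of the two unit vectors makes the sum over the basis set have two
    summands.\<close>
  have ne: "?e \<noteq> ?f" using assms(2) by simp
  have sum: "(\<Oplus>\<^bsub>?L\<^esub>b \<in> {?e, ?f}. r b \<odot>\<^bsub>?L\<^esub> b) = [Inr (r ?e), Inr (r ?f)]"
    if "r ?e \<in> carrier R" "r ?f \<in> carrier R" for r
  proof -
    have "(\<Oplus>\<^bsub>?L\<^esub>b \<in> {?e, ?f}. r b \<odot>\<^bsub>?L\<^esub> b) = r ?e \<odot>\<^bsub>?L\<^esub> ?e \<oplus>\<^bsub>?L\<^esub> (\<Oplus>\<^bsub>?L\<^esub>b \<in> {?f}. r b \<odot>\<^bsub>?L\<^esub> b)"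
      by (rule L.M.finsum_insert) (use ne that L.act_closed in \<open>auto simp: list_module_carrier_2\<close>)
    also have "(\<Oplus>\<^bsub>?L\<^esub>b \<in> {?f}. r b \<odot>\<^bsub>?L\<^esub> b) = r ?f \<odot>\<^bsub>?L\<^esub> ?f"
      using that by (simp add: list_module_2_simps list_module_carrier_2)
    finally show ?thesis using that by (simp add: list_module_2_simps)
  qed
  show "\<exists>!r. r \<in> {?e, ?f} \<rightarrow>\<^sub>E carrier R \<and> X = (\<Oplus>\<^bsub>?L\<^esub>b \<in> {?e, ?f}. r b \<odot>\<^bsub>?L\<^esub> b)"
  proof (rule ex1I[of _ "\<lambda>x \<in> {?e, ?f}. if x = ?e then a else b"])
    show "(\<lambda>x \<in> {?e, ?f}. if x = ?e then a else b) \<in> {?e, ?f} \<rightarrow>\<^sub>E carrier R \<and>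
        X = (\<Oplus>\<^bsub>?L\<^esub>y \<in> {?e, ?f}. (\<lambda>x \<in> {?e, ?f}. if x = ?e then a else b) y \<odot>\<^bsub>?L\<^esub> y)"
      by (subst sum) (use a ne in auto)
  next
    fix r assume r: "r \<in> {?e, ?f} \<rightarrow>\<^sub>E carrier R \<and> X = (\<Oplus>\<^bsub>?L\<^esub>b \<in> {?e, ?f}. r b \<odot>\<^bsub>?L\<^esub> b)"
    then have c: "r ?e \<in> carrier R" "r ?f \<in> carrier R" by auto
    with sum[of r, OF this] r a have "r ?e = a" "r ?f = b" by simp_all
    then show "r = (\<lambda>x \<in> {?e, ?f}. if x = ?e then a else b)"
      using r ne by (auto simp: fun_eq_iff PiE_def extensional_def)
  qed
qed simp

subsection \<open>Ext from a Koszul-type resolution of length two\<close>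

text \<open>The complex R \<rightarrow> R^2 \<rightarrow> R \<rightarrow> M with c \<mapsto> (c
  \<beta>1, c \<beta>2), (a, b) \<mapsto> a \<alpha>1 + b \<alpha>2 and 1 \<mapsto> m0. The
  \<open>exact\<close> assumptions make it a resolution; the \<open>coexact\<close> ones state
  exactness of the dual complex r \<mapsto> (\<alpha>1 r, \<alpha>2 r), (a, b) \<mapsto> \<beta>1 a
  + \<beta>2 b in degrees zero and one. The two instances are the trivial module over H and H over
  its enveloping algebra.\<close>

locale koszul = M: left_module R M for R :: "('r, 'y) ring_scheme" (structure)
    and M :: "('r, 'm, 'z) module_scheme" +
  fixes m0 :: 'm and \<alpha>1 \<alpha>2 \<beta>1 \<beta>2 :: 'r
  assumes one_not_zero: "\<one> \<noteq> \<zero>"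
    and m0: "m0 \<in> carrier M"
    and elems [simp]: "\<alpha>1 \<in> carrier R" "\<alpha>2 \<in> carrier R" "\<beta>1 \<in> carrier R" "\<beta>2 \<in> carrier R"
    and generates: "x \<in> carrier M \<Longrightarrow> \<exists>a \<in> carrier R. x = a \<odot>\<^bsub>M\<^esub> m0"
    and annihilates: "\<alpha>1 \<odot>\<^bsub>M\<^esub> m0 = \<zero>\<^bsub>M\<^esub>" "\<alpha>2 \<odot>\<^bsub>M\<^esub> m0 = \<zero>\<^bsub>M\<^esub>"
    and annihilator: "\<lbrakk>a \<in> carrier R; a \<odot>\<^bsub>M\<^esub> m0 = \<zero>\<^bsub>M\<^esub>\<rbrakk> \<Longrightarrow>
      \<exists>u \<in> carrier R. \<exists>v \<in> carrier R. a = u \<otimes> \<alpha>1 \<oplus> v \<otimes> \<alpha>2"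
    and relation: "\<beta>1 \<otimes> \<alpha>1 \<oplus> \<beta>2 \<otimes> \<alpha>2 = \<zero>"
    and exact_1: "\<lbrakk>a \<in> carrier R; b \<in> carrier R; a \<otimes> \<alpha>1 \<oplus> b \<otimes> \<alpha>2 = \<zero>\<rbrakk> \<Longrightarrow>
      \<exists>c \<in> carrier R. a = c \<otimes> \<beta>1 \<and> b = c \<otimes> \<beta>2"
    and exact_2: "\<lbrakk>c \<in> carrier R; c \<otimes> \<beta>1 = \<zero>; c \<otimes> \<beta>2 = \<zero>\<rbrakk> \<Longrightarrow> c = \<zero>"
    and coexact_0: "\<lbrakk>r \<in> carrier R; \<alpha>1 \<otimes> r = \<zero>; \<alpha>2 \<otimes> r = \<zero>\<rbrakk> \<Longrightarrow> r = \<zero>"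
    and coexact_1: "\<lbrakk>a \<in> carrier R; b \<in> carrier R; \<beta>1 \<otimes> a \<oplus> \<beta>2 \<otimes> b = \<zero>\<rbrakk> \<Longrightarrow>
      \<exists>n \<in> carrier R. a = \<alpha>1 \<otimes> n \<and> b = \<alpha>2 \<otimes> n"
begin

definition K_module :: "nat \<Rightarrow> ('r, ('m + 'r) list) module"
  where "K_module n = list_module R (if n = 0 then 1 else if n = 1 then 2 else if n = 2 then 1 else 0)"

definition K_diff :: "nat \<Rightarrow> ('m + 'r) list \<Rightarrow> ('m + 'r) list"
  where "K_diff n = (\<lambda>X \<in> carrier (K_module (Suc n)).
    if n = 0 then [Inr (projr (X ! 0) \<otimes> \<alpha>1 \<oplus> projr (X ! 1) \<otimes> \<alpha>2)]
    else if n = 1 then [Inr (projr (X ! 0) \<otimes> \<beta>1), Inr (projr (X ! 0) \<otimes> \<beta>2)]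
    else \<zero>\<^bsub>K_module n\<^esub>)"

definition K_aug :: "('m + 'r) list \<Rightarrow> 'm"
  where "K_aug = (\<lambda>X \<in> carrier (K_module 0). projr (X ! 0) \<odot>\<^bsub>M\<^esub> m0)"

lemma K_module_simps: "K_module 0 = list_module R (Suc 0)" "K_module (Suc 0) = list_module R 2"
  "K_module 2 = list_module R (Suc 0)" "K_module (Suc (Suc 0)) = list_module R (Suc 0)" "K_module (Suc (Suc (Suc n))) = list_module R 0"
  by (simp_all add: K_module_def)

lemma K_left_module: "left_module R (K_module n)"
  unfolding K_module_def by (rule left_module_list[OF M.R.ring_axioms])

lemma K_diff_0: "\<lbrakk>a \<in> carrier R; b \<in> carrier R\<rbrakk> \<Longrightarrow> K_diff 0 [Inr a, Inr b] = [Inr (a \<otimes> \<alpha>1 \<oplus> b \<otimes> \<alpha>2)]"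
  by (simp add: K_diff_def K_module_simps list_module_carrier_2)

lemma K_diff_1: "a \<in> carrier R \<Longrightarrow> K_diff (Suc 0) [Inr a] = [Inr (a \<otimes> \<beta>1), Inr (a \<otimes> \<beta>2)]"
  by (simp add: K_diff_def K_module_simps list_module_carrier_1)

lemma K_diff_high: "X \<in> carrier (K_module (Suc (Suc (Suc n)))) \<Longrightarrow> K_diff (Suc (Suc n)) X = \<zero>\<^bsub>K_module (Suc (Suc n))\<^esub>"
  by (simp add: K_diff_def)

lemma K_aug: "a \<in> carrier R \<Longrightarrow> K_aug [Inr a] = a \<odot>\<^bsub>M\<^esub> m0"
  by (simp add: K_aug_def K_module_simps list_module_carrier_1)

lemmas K_carriers = list_module_carrier_0 list_module_carrier_1 list_module_carrier_2
lemmas K_ops = list_module_1_simps list_module_2_simps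

lemma K_diff_hom: "K_diff n \<in> module_hom R (K_module (Suc n)) (K_module n)"
proof -
  consider "n = 0" | "n = Suc 0" | m where "n = Suc (Suc m)"
    by (metis nat.exhaust)
  then show ?thesis
  proof cases
    case 1
    have "K_diff 0 \<in> extensional (carrier (K_module (Suc 0)))" by (simp add: K_diff_def)
    then show ?thesis unfolding 1
      by (rule module_homI)
        (auto simp: K_module_simps K_carriers K_ops K_diff_0 M.R.l_distr M.R.r_distr M.R.m_assoc M.R.a_ac)
  next
    case 2
    have "K_diff (Suc 0) \<in> extensional (carrier (K_module (Suc (Suc 0))))" by (simp add: K_diff_def)
    then show ?thesis unfolding 2
      by (rule module_homI)
        (auto simp: K_module_simps K_carriers K_ops K_diff_1 M.R.l_distr M.R.r_distr M.R.m_assoc M.R.a_ac)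
  next
    case 3
    show ?thesis
      using module_hom_zero_map[OF K_left_module[of "Suc n"] K_left_module[of n]] 3 by (simp add: K_diff_def)
  qed
qed

lemma K_aug_hom: "K_aug \<in> module_hom R (K_module 0) M"
  by (rule module_homI)
    (auto simp: K_aug_def K_module_simps K_carriers K_ops m0 M.act_closed M.act_add_left M.act_act)

lemma K_free: "free_module R (K_module n)"
  unfolding K_module_def
  by (simp add: free_list_module_0 free_list_module_1 free_list_module_2 M.R.ring_axioms one_not_zero)

lemma relation_left:
  assumes "c \<in> carrier R"
  shows "c \<otimes> \<beta>1 \<otimes> \<alpha>1 \<oplus> c \<otimes> \<beta>2 \<otimes> \<alpha>2 = \<zero>"
proof -
  have "c \<otimes> \<beta>1 \<otimes> \<alpha>1 \<oplus> c \<otimes> \<beta>2 \<otimes> \<alpha>2 = c \<otimes> (\<beta>1 \<otimes> \<alpha>1 \<oplus> \<beta>2 \<otimes> \<alpha>2)"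
    using assms by (simp add: M.R.m_assoc M.R.r_distr)
  then show ?thesis using assms relation by simp
qed

lemma K_resolution: "free_resolution R M K_module K_diff K_aug"
  unfolding free_resolution_def
proof (intro conjI allI)
  show "K_aug ` carrier (K_module 0) = carrier M"
  proof (intro Set.set_eqI iffI)
    fix x assume "x \<in> carrier M"
    then obtain a where "a \<in> carrier R" "x = K_aug [Inr a]" using generates K_aug by metis
    then show "x \<in> K_aug ` carrier (K_module 0)" by (simp add: K_module_simps K_carriers)
  qed (use module_hom_closed[OF K_aug_hom] in auto)
  show "K_diff 0 ` carrier (K_module 1) = {X \<in> carrier (K_module 0). K_aug X = \<zero>\<^bsub>M\<^esub>}"
  proof (intro Set.set_eqI iffI)
    fix X assume "X \<in> K_diff 0 ` carrier (K_module 1)"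
    then show "X \<in> {X \<in> carrier (K_module 0). K_aug X = \<zero>\<^bsub>M\<^esub>}"
      by (auto simp: K_module_simps K_carriers K_diff_0 K_aug M.act_add_left M.act_act annihilates m0)
  next
    fix X assume "X \<in> {X \<in> carrier (K_module 0). K_aug X = \<zero>\<^bsub>M\<^esub>}"
    then obtain a where a: "a \<in> carrier R" "X = [Inr a]" "a \<odot>\<^bsub>M\<^esub> m0 = \<zero>\<^bsub>M\<^esub>"
      by (auto simp: K_module_simps K_carriers K_aug)
    obtain u v where "u \<in> carrier R" "v \<in> carrier R" "a = u \<otimes> \<alpha>1 \<oplus> v \<otimes> \<alpha>2"
      using annihilator[OF a(1,3)] by blast
    with a show "X \<in> K_diff 0 ` carrier (K_module 1)"
      by (auto simp: K_module_simps K_carriers K_diff_0 image_iff intro!: bexI[of _ "[Inr u, Inr v]"])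
  qed
  fix n
  show "K_diff (Suc n) ` carrier (K_module (Suc (Suc n))) =
      {X \<in> carrier (K_module (Suc n)). K_diff n X = \<zero>\<^bsub>K_module n\<^esub>}" (is "?A = ?B")
  proof -
    consider "n = 0" | "n = Suc 0" | m where "n = Suc (Suc m)"
      by (metis nat.exhaust)
    then show ?thesis
    proof cases
      case 1
      show ?thesis unfolding 1
      proof (intro Set.set_eqI iffI)
        fix X assume "X \<in> K_diff (Suc 0) ` carrier (K_module (Suc (Suc 0)))"
        then show "X \<in> {X \<in> carrier (K_module (Suc 0)). K_diff 0 X = \<zero>\<^bsub>K_module 0\<^esub>}"
          by (auto simp: K_module_simps K_carriers K_diff_1 K_diff_0 K_ops relation_left)
      next
        fix X assume "X \<in> {X \<in> carrier (K_module (Suc 0)). K_diff 0 X = \<zero>\<^bsub>K_module 0\<^esub>}"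
        then obtain a b where ab: "a \<in> carrier R" "b \<in> carrier R" "X = [Inr a, Inr b]" "a \<otimes> \<alpha>1 \<oplus> b \<otimes> \<alpha>2 = \<zero>"
          by (auto simp: K_module_simps K_carriers K_diff_0 K_ops)
        obtain c where "c \<in> carrier R" "a = c \<otimes> \<beta>1" "b = c \<otimes> \<beta>2"
          using exact_1[OF ab(1,2,4)] by blast
        with ab show "X \<in> K_diff (Suc 0) ` carrier (K_module (Suc (Suc 0)))"
          by (auto simp: K_module_simps K_carriers K_diff_1 image_iff intro!: bexI[of _ "[Inr c]"])
      qed
    next
      case 2
      \<comment> \<open>Nothing sits in degree three, so exactness here means injectivity of the
        last differential, which is \<open>exact_2\<close>.\<close>
      have "?B = {[Inr \<zero>]}"
      proof (intro Set.set_eqI iffI)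
        fix X assume "X \<in> ?B"
        then obtain c where "c \<in> carrier R" "X = [Inr c]" "c \<otimes> \<beta>1 = \<zero>" "c \<otimes> \<beta>2 = \<zero>"
          by (auto simp: 2 K_module_simps K_carriers K_diff_1 K_ops)
        then show "X \<in> {[Inr \<zero>]}" using exact_2 by blast
      qed (auto simp: 2 K_module_simps K_carriers K_diff_1 K_ops)
      moreover have c: "carrier (K_module (Suc (Suc (Suc 0)))) = {[]}"
        by (auto simp: K_module_simps(5) K_carriers)
      have "K_diff (Suc (Suc 0)) [] = [Inr \<zero>]"
        using K_diff_high[of "[]" 0] c by (simp add: K_module_simps(4) K_ops)
      then have "?A = {[Inr \<zero>]}" by (simp add: 2 c)
      ultimately show ?thesis by simp
    next
      case (3 m)
      have z: "\<zero>\<^bsub>list_module R 0\<^esub> = ([] :: ('m + 'r) list)" by (simp add: list_module_zero)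
      have "carrier (list_module R 0) = {[] :: ('m + 'r) list}" by (auto simp: K_carriers)
      then show ?thesis
        using module_hom_closed[OF K_diff_hom, of "[]" "Suc n"] module_hom_zero[OF K_diff_hom K_left_module K_left_module, of n]
        by (auto simp: 3 K_module_simps z)
    qed
  qed
qed (auto intro: K_free K_diff_hom K_aug_hom)

text \<open>The Koszul complex is the witness that makes the choice in
  \<open>chosen_resolution\<close> yield a free resolution.\<close>

sublocale E: Ext_setup R M "regular_module R" K_module K_diff K_aug
  by (intro Ext_setup.intro Ext_setup_axioms.intro M.left_module_axioms left_module_regular
      M.R.ring_axioms K_resolution)

abbreviation "N \<equiv> regular_module R"

section \<open>Comparison of the chosen resolution with the Koszul complex\<close>

definition to_koszul :: "nat \<Rightarrow> ('m + 'r) list \<Rightarrow> ('m + 'r) list"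
  where "to_koszul = (SOME \<phi>. chain_map R E.F E.D E.\<eta> K_module K_diff K_aug (\<lambda>x. x) \<phi>)"

definition from_koszul :: "nat \<Rightarrow> ('m + 'r) list \<Rightarrow> ('m + 'r) list"
  where "from_koszul = (SOME \<phi>. chain_map R K_module K_diff K_aug E.F E.D E.\<eta> (\<lambda>x. x) \<phi>)"

lemma ident_lifts:
  assumes "free_resolution R M F D \<eta>" "free_resolution R M G D' \<eta>'"
  shows "\<exists>\<phi>. chain_map R F D \<eta> G D' \<eta>' (\<lambda>x. x) \<phi>"
proof -
  have h: "(\<lambda>x \<in> carrier M. x) \<in> module_hom R M M"
    by (rule module_hom_restrictI[OF E.M_module]) auto
  obtain \<phi> where "chain_map R F D \<eta> G D' \<eta>' (\<lambda>x \<in> carrier M. x) \<phi>"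
    using chain_map_exists[OF assms E.M_module E.M_module h] by blast
  then have "chain_map R F D \<eta> G D' \<eta>' (\<lambda>x. x) \<phi>"
    using module_hom_closed[OF free_resolutionD(4)[OF assms(1)]] by (simp add: chain_map_def)
  then show ?thesis by blast
qed

lemma to_koszul: "chain_map R E.F E.D E.\<eta> K_module K_diff K_aug (\<lambda>x. x) to_koszul"
  unfolding to_koszul_def by (rule someI_ex[OF ident_lifts[OF E.F K_resolution]])

lemma from_koszul: "chain_map R K_module K_diff K_aug E.F E.D E.\<eta> (\<lambda>x. x) from_koszul"
  unfolding from_koszul_def by (rule someI_ex[OF ident_lifts[OF K_resolution E.F]])

lemma to_koszul_hom: "to_koszul n \<in> module_hom R (E.F n) (K_module n)"
  and to_koszul_diff: "x \<in> carrier (E.F (Suc n)) \<Longrightarrow> K_diff n (to_koszul (Suc n) x) = to_koszul n (E.D n x)"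
  using to_koszul by (auto simp: chain_map_def)

lemma from_koszul_hom: "from_koszul n \<in> module_hom R (K_module n) (E.F n)"
  and from_koszul_diff: "x \<in> carrier (K_module (Suc n)) \<Longrightarrow> E.D n (from_koszul (Suc n) x) = from_koszul n (K_diff n x)"
  using from_koszul by (auto simp: chain_map_def)

lemmas to_koszul_closed = module_hom_closed[OF to_koszul_hom]
lemmas from_koszul_closed = module_hom_closed[OF from_koszul_hom]

text \<open>The round trip through the Koszul complex and the identity both lift the identity of M,
  so they pull f back to cohomologous cocycles.\<close>

lemma cocycle_via_koszul:
  assumes f: "f \<in> Ext_cocycles R n M N"
  shows "\<exists>b \<in> Ext_coboundaries R n M N. \<forall>x \<in> carrier (E.F n). f x = b x \<oplus> f (from_koszul n (to_koszul n x))"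
proof -
  have "chain_map R E.F E.D E.\<eta> E.F E.D E.\<eta> (\<lambda>x. x) (\<lambda>n. compose (carrier (E.F n)) (from_koszul n) (to_koszul n))"
    using chain_map_compose[OF E.F to_koszul from_koszul K_resolution] by simp
  from E.cocycle_cohomologous[OF chain_map_ident[OF E.F] this f]
  show ?thesis by (auto simp: compose_eq)
qed

text \<open>A cocycle may be tested for being a coboundary on the Koszul complex. By compatibility
  of \<open>to_koszul\<close> with the differentials, a primitive e found there gives the primitive
  e after \<open>to_koszul\<close> on the chosen resolution, up to the coboundary of the round
  trip.\<close>

lemma koszul_coboundaryI:
  assumes f: "f \<in> Ext_cocycles R n M N" and n: "n = Suc m"
    and e: "e \<in> module_hom R (K_module m) N"
    and eq: "\<And>X. X \<in> carrier (K_module n) \<Longrightarrow> f (from_koszul n X) = e (K_diff m X)"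
  shows "f \<in> Ext_coboundaries R n M N"
proof -
  obtain b where b: "b \<in> Ext_coboundaries R n M N"
    "\<And>x. x \<in> carrier (E.F n) \<Longrightarrow> f x = b x \<oplus> f (from_koszul n (to_koszul n x))"
    using cocycle_via_koszul[OF f] by blast
  obtain e' where e': "e' \<in> module_hom R (E.F m) N" "b = (\<lambda>x \<in> carrier (E.F n). e' (E.D m x))"
    using b(1) by (auto simp: n E.coboundaries_Suc)
  let ?e = "compose (carrier (E.F m)) e (to_koszul m)"
  have eh: "?e \<in> module_hom R (E.F m) N"
    by (rule module_hom_compose[OF to_koszul_hom e E.F_module])
  let ?s = "\<lambda>x \<in> carrier (E.F m). e' x \<oplus>\<^bsub>N\<^esub> ?e x"
  have "?s \<in> module_hom R (E.F m) N"
    by (rule module_hom_sum[OF e'(1) eh E.F_module E.N_module])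
  moreover have "f = (\<lambda>x \<in> carrier (E.F n). ?s (E.D m x))"
  proof (rule extensionalityI[OF module_hom_extensional[OF E.cocycle_hom[OF f]]])
    fix x assume x: "x \<in> carrier (E.F n)"
    show "f x = (\<lambda>x \<in> carrier (E.F n). ?s (E.D m x)) x"
      using b(2)[OF x] eq[OF to_koszul_closed[OF x]] x e'(2) E.D_closed[of x m] to_koszul_diff[of x m]
      by (simp add: n compose_eq)
  qed auto
  ultimately show ?thesis unfolding n E.coboundaries_Suc by blast
qed

lemma from_koszul_cocycle:
  assumes f: "f \<in> Ext_cocycles R n M N" and X: "X \<in> carrier (K_module (Suc n))"
  shows "f (from_koszul n (K_diff n X)) = \<zero>"
proof -
  have "f (E.D n (from_koszul (Suc n) X)) = \<zero>"
    using f from_koszul_closed[OF X] by (simp add: E.cocycle_iff)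
  then show ?thesis using from_koszul_diff[OF X] by simp
qed

lemma pullback_hom: "f \<in> Ext_cocycles R n M N \<Longrightarrow> compose (carrier (K_module n)) f (from_koszul n) \<in> module_hom R (K_module n) N"
  by (rule module_hom_compose[OF from_koszul_hom E.cocycle_hom K_left_module])

lemma pullback_closed: "\<lbrakk>f \<in> Ext_cocycles R n M N; X \<in> carrier (K_module n)\<rbrakk> \<Longrightarrow> f (from_koszul n X) \<in> carrier R"
  using module_hom_closed[OF E.cocycle_hom from_koszul_closed] by fastforce

lemma pullback_act: "\<lbrakk>f \<in> Ext_cocycles R n M N; X \<in> carrier (K_module n); a \<in> carrier R\<rbrakk> \<Longrightarrow>
    f (from_koszul n (a \<odot>\<^bsub>K_module n\<^esub> X)) = a \<otimes> f (from_koszul n X)"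
  using module_hom_act[OF pullback_hom, of f n a X] left_module.act_closed[OF K_left_module[of n], of a X]
  by (simp add: compose_eq)

lemma pullback_add: "\<lbrakk>f \<in> Ext_cocycles R n M N; X \<in> carrier (K_module n); Y \<in> carrier (K_module n)\<rbrakk> \<Longrightarrow>
    f (from_koszul n (X \<oplus>\<^bsub>K_module n\<^esub> Y)) = f (from_koszul n X) \<oplus> f (from_koszul n Y)"
  using module_hom_add[OF from_koszul_hom, of X n Y] module_hom_add[OF E.cocycle_hom, of f n] from_koszul_closed
  by simp

lemma pullback_1:
  assumes "f \<in> Ext_cocycles R n M N" "K_module n = list_module R (Suc 0)" "a \<in> carrier R"
  shows "f (from_koszul n [Inr a]) = a \<otimes> f (from_koszul n [Inr \<one>])"
  using pullback_act[OF assms(1), of "[Inr \<one>]" a] assms(2,3) by (simp add: K_carriers K_ops)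

lemma pullback_2:
  assumes f: "f \<in> Ext_cocycles R (Suc 0) M N" and a: "a \<in> carrier R" and b: "b \<in> carrier R"
  shows "f (from_koszul (Suc 0) [Inr a, Inr b]) =
    a \<otimes> f (from_koszul (Suc 0) [Inr \<one>, Inr \<zero>]) \<oplus> b \<otimes> f (from_koszul (Suc 0) [Inr \<zero>, Inr \<one>])"
  using pullback_act[OF f, of "[Inr \<one>, Inr \<zero>]" a] pullback_act[OF f, of "[Inr \<zero>, Inr \<one>]" b]
    pullback_add[OF f, of "[Inr a, Inr \<zero>]" "[Inr \<zero>, Inr b]"] a b
  by (simp add: K_module_simps K_carriers K_ops)

section \<open>Cohomology read off from the Koszul complex\<close>

lemma eval_hom: "r \<in> carrier R \<Longrightarrow> K_module n = list_module R (Suc 0) \<Longrightarrow>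
    (\<lambda>X \<in> carrier (K_module n). projr (X ! 0) \<otimes> r) \<in> module_hom R (K_module n) N"
  by (rule module_hom_restrictI[OF K_left_module])
    (auto simp: K_carriers K_ops M.R.l_distr M.R.m_assoc)

text \<open>Degrees zero and one are \<open>coexact_0\<close> and \<open>coexact_1\<close>; above
  two the Koszul modules are zero.\<close>

lemma Ext_vanishes:
  assumes "n \<noteq> 2"
  shows "carrier (Ext R n M N) = {\<zero>\<^bsub>Ext R n M N\<^esub>}"
proof (rule E.Ext_trivialI)
  fix f assume f: "f \<in> Ext_cocycles R n M N"
  consider "n = 0" | "n = Suc 0" | m where "n = Suc (Suc (Suc m))"
    using assms by (metis nat.exhaust numeral_2_eq_2)
  then show "f \<in> Ext_coboundaries R n M N"
  proof cases
    case 1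
    let ?r = "f (from_koszul 0 [Inr \<one>])"
    have f0: "f \<in> Ext_cocycles R 0 M N" using f 1 by simp
    have r: "?r \<in> carrier R"
      using pullback_closed[OF f0, of "[Inr \<one>]"] by (simp add: K_module_simps K_carriers)
    have "\<alpha>1 \<otimes> ?r = \<zero>" "\<alpha>2 \<otimes> ?r = \<zero>"
      using from_koszul_cocycle[OF f0, of "[Inr \<one>, Inr \<zero>]"] from_koszul_cocycle[OF f0, of "[Inr \<zero>, Inr \<one>]"]
        pullback_1[OF f0, of \<alpha>1] pullback_1[OF f0, of \<alpha>2]
      by (simp_all add: K_module_simps K_carriers K_diff_0)
    then have r0: "?r = \<zero>" using coexact_0 r by blast
    have k0: "f (from_koszul 0 X) = \<zero>" if "X \<in> carrier (K_module 0)" for X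
      using that pullback_1[OF f0] r0 by (auto simp: K_module_simps K_carriers)
    obtain b where b: "b \<in> Ext_coboundaries R 0 M N"
      "\<And>x. x \<in> carrier (E.F 0) \<Longrightarrow> f x = b x \<oplus> f (from_koszul 0 (to_koszul 0 x))"
      using cocycle_via_koszul[OF f0] by blast
    have "f = (\<lambda>x \<in> carrier (E.F 0). \<zero>)"
      by (rule extensionalityI[OF module_hom_extensional[OF E.cocycle_hom[OF f0]]])
        (use b k0 to_koszul_closed in \<open>auto simp: E.coboundaries_0\<close>)
    then show ?thesis by (simp add: 1 E.coboundaries_0)
  next
    case 2
    have f1: "f \<in> Ext_cocycles R (Suc 0) M N" using f 2 by simp
    let ?a = "f (from_koszul (Suc 0) [Inr \<one>, Inr \<zero>])" and ?b = "f (from_koszul (Suc 0) [Inr \<zero>, Inr \<one>])"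
    have ab: "?a \<in> carrier R" "?b \<in> carrier R"
      using pullback_closed[OF f1, of "[Inr \<one>, Inr \<zero>]"] pullback_closed[OF f1, of "[Inr \<zero>, Inr \<one>]"]
      by (simp_all add: K_module_simps K_carriers)
    have "\<beta>1 \<otimes> ?a \<oplus> \<beta>2 \<otimes> ?b = \<zero>"
      using from_koszul_cocycle[OF f1, of "[Inr \<one>]"] pullback_2[OF f1, of \<beta>1 \<beta>2]
      by (simp add: K_module_simps K_carriers K_diff_1)
    then obtain r where r: "r \<in> carrier R" "?a = \<alpha>1 \<otimes> r" "?b = \<alpha>2 \<otimes> r"
      using coexact_1[OF ab] by blast
    show ?thesis
    proof (rule koszul_coboundaryI[OF f 2 eval_hom[OF r(1)]])
      fix X assume "X \<in> carrier (K_module n)"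
      then obtain x y where X: "X = [Inr x, Inr y]" "x \<in> carrier R" "y \<in> carrier R"
        by (auto simp: 2 K_module_simps K_carriers)
      then show "f (from_koszul n X) = (\<lambda>X \<in> carrier (K_module 0). projr (X ! 0) \<otimes> r) (K_diff 0 X)"
        using r pullback_2[OF f1, of x y]
        by (simp add: 2 K_module_simps K_carriers K_diff_0 M.R.l_distr M.R.m_assoc)
    qed (simp add: K_module_simps)
  next
    case (3 m)
    show ?thesis
    proof (rule koszul_coboundaryI[OF f 3 module_hom_zero_map[OF K_left_module E.N_module]])
      fix X assume X: "X \<in> carrier (K_module n)"
      then have "X = \<zero>\<^bsub>K_module n\<^esub>" by (simp add: 3 K_module_simps K_carriers list_module_zero)
      then have "f (from_koszul n X) = \<zero>"
        using module_hom_zero[OF pullback_hom[OF f] K_left_module E.N_module] X by (simp add: compose_eq)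
      then show "f (from_koszul n X) = (\<lambda>x \<in> carrier (K_module (Suc (Suc m))). \<zero>\<^bsub>N\<^esub>) (K_diff (Suc (Suc m)) X)"
        using module_hom_closed[OF K_diff_hom, of X "Suc (Suc m)"] X 3 by simp
    qed
  qed
qed

text \<open>On the Koszul complex a cochain of degree two is a left linear map R \<rightarrow> R,
  that is, right multiplication by this element. Coboundaries contribute precisely the elements of
  \<beta>1 R + \<beta>2 R, as the next two lemmas show.\<close>

definition cocycle_value :: "(('m + 'r) list \<Rightarrow> 'r) \<Rightarrow> 'r"
  where "cocycle_value f = f (from_koszul 2 [Inr \<one>])"

lemma cocycle_value_closed: "f \<in> Ext_cocycles R 2 M N \<Longrightarrow> cocycle_value f \<in> carrier R"
  unfolding cocycle_value_def by (rule pullback_closed) (auto simp: K_module_simps K_carriers)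

lemma generator_closed: "from_koszul 2 [Inr \<one>] \<in> carrier (E.F 2)"
  by (rule from_koszul_closed) (simp add: K_module_simps K_carriers)

lemma cocycle_value_coboundary:
  assumes f: "f \<in> Ext_coboundaries R 2 M N"
  shows "\<exists>a \<in> carrier R. \<exists>b \<in> carrier R. cocycle_value f = \<beta>1 \<otimes> a \<oplus> \<beta>2 \<otimes> b"
proof -
  obtain e where e: "e \<in> module_hom R (E.F (Suc 0)) N" "f = (\<lambda>x \<in> carrier (E.F 2). e (E.D (Suc 0) x))"
    using f by (auto simp: numeral_2_eq_2 E.coboundaries_Suc)
  let ?u = "from_koszul (Suc 0) [Inr \<one>, Inr \<zero>]" and ?v = "from_koszul (Suc 0) [Inr \<zero>, Inr \<one>]"
  have uv: "?u \<in> carrier (E.F (Suc 0))" "?v \<in> carrier (E.F (Suc 0))"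
    by (rule from_koszul_closed; simp add: K_module_simps K_carriers)+
  interpret F1: left_module R "E.F (Suc 0)" by (rule E.F_module)
  have "from_koszul (Suc 0) [Inr \<beta>1, Inr \<beta>2] = \<beta>1 \<odot>\<^bsub>E.F (Suc 0)\<^esub> ?u \<oplus>\<^bsub>E.F (Suc 0)\<^esub> \<beta>2 \<odot>\<^bsub>E.F (Suc 0)\<^esub> ?v"
    using module_hom_act[OF from_koszul_hom, of \<beta>1 "[Inr \<one>, Inr \<zero>]" "Suc 0"]
      module_hom_act[OF from_koszul_hom, of \<beta>2 "[Inr \<zero>, Inr \<one>]" "Suc 0"]
      module_hom_add[OF from_koszul_hom, of "[Inr \<beta>1, Inr \<zero>]" "Suc 0" "[Inr \<zero>, Inr \<beta>2]"]
    by (simp add: K_module_simps K_carriers K_ops)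
  moreover have "E.D (Suc 0) (from_koszul 2 [Inr \<one>]) = from_koszul (Suc 0) [Inr \<beta>1, Inr \<beta>2]"
    using from_koszul_diff[of "[Inr \<one>]" "Suc 0"] by (simp add: numeral_2_eq_2 K_module_simps K_carriers K_diff_1)
  ultimately have "cocycle_value f = \<beta>1 \<otimes> e ?u \<oplus> \<beta>2 \<otimes> e ?v"
    using e uv generator_closed F1.act_closed
    by (simp add: cocycle_value_def module_hom_add[OF e(1)] module_hom_act[OF e(1)])
  then show ?thesis using module_hom_closed[OF e(1)] uv by auto
qed

lemma coboundary_if_value:
  assumes f: "f \<in> Ext_cocycles R 2 M N" and ab: "a \<in> carrier R" "b \<in> carrier R"
    and v: "cocycle_value f = \<beta>1 \<otimes> a \<oplus> \<beta>2 \<otimes> b"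
  shows "f \<in> Ext_coboundaries R 2 M N"
proof -
  let ?e = "\<lambda>X \<in> carrier (K_module (Suc 0)). projr (X ! 0) \<otimes> a \<oplus> projr (X ! 1) \<otimes> b"
  have e: "?e \<in> module_hom R (K_module (Suc 0)) N"
    by (rule module_hom_restrictI[OF K_left_module])
      (use ab in \<open>auto simp: K_module_simps K_carriers K_ops M.R.l_distr M.R.r_distr M.R.m_assoc M.R.a_ac\<close>)
  show ?thesis
  proof (rule koszul_coboundaryI[OF f numeral_2_eq_2 e])
    fix X assume "X \<in> carrier (K_module 2)"
    then obtain x where X: "X = [Inr x]" "x \<in> carrier R" by (auto simp: K_module_simps K_carriers)
    then have "f (from_koszul 2 X) = x \<otimes> (\<beta>1 \<otimes> a \<oplus> \<beta>2 \<otimes> b)"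
      using pullback_1[OF f K_module_simps(3) X(2)] v by (simp add: cocycle_value_def)
    then show "f (from_koszul 2 X) = ?e (K_diff (Suc 0) X)"
      using X ab by (simp add: K_diff_1 K_module_simps K_carriers M.R.r_distr M.R.m_assoc)
  qed
qed

text \<open>The cocycle is right multiplication by r, transported along \<open>to_koszul\<close>.
  Going to the chosen resolution and back is only homotopic to the identity of the Koszul complex,
  so the value r is recovered up to an element of the right ideal.\<close>

lemma cocycle_with_value:
  assumes r: "r \<in> carrier R"
  shows "\<exists>f \<in> Ext_cocycles R 2 M N. \<exists>a \<in> carrier R. \<exists>b \<in> carrier R. r = (\<beta>1 \<otimes> a \<oplus> \<beta>2 \<otimes> b) \<oplus> cocycle_value f"
proof -
  let ?k = "\<lambda>X \<in> carrier (K_module 2). projr (X ! 0) \<otimes> r"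
  have k: "?k \<in> module_hom R (K_module 2) N" by (rule eval_hom[OF r]) (simp add: K_module_simps)
  \<comment> \<open>The Koszul module in degree three is zero, so every homomorphism in degree two
    is a cocycle there.\<close>
  have kz: "?k (K_diff 2 X) = \<zero>" if X: "X \<in> carrier (K_module (Suc 2))" for X
    using K_diff_high[of X 0] X r by (simp add: numeral_2_eq_2 K_module_simps K_ops K_carriers)
  let ?f = "compose (carrier (E.F 2)) ?k (to_koszul 2)"
  have f: "?f \<in> Ext_cocycles R 2 M N"
    unfolding E.cocycle_iff
  proof (intro conjI ballI)
    show "?f \<in> module_hom R (E.F 2) N" by (rule module_hom_compose[OF to_koszul_hom k E.F_module])
    fix x assume x: "x \<in> carrier (E.F (Suc 2))"
    show "?f (E.D 2 x) = \<zero>\<^bsub>N\<^esub>"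
      using E.D_closed[OF x] to_koszul_diff[OF x] kz[OF to_koszul_closed[OF x]]
      by (simp add: compose_eq del: restrict_apply)
  qed
  have *: "chain_map R K_module K_diff K_aug K_module K_diff K_aug (\<lambda>x. x)
      (\<lambda>n. compose (carrier (K_module n)) (to_koszul n) (from_koszul n))"
    using chain_map_compose[OF K_resolution from_koszul to_koszul E.F] by simp
  have g: "[Inr \<one>] \<in> carrier (K_module 2)" by (simp add: K_module_simps K_carriers)
  from cocycle_homotopic[OF K_resolution K_resolution E.M_module E.M_module E.N_module chain_map_ident[OF K_resolution] * k]
  obtain e where e1: "e \<in> module_hom R (K_module (Suc 0)) N"
    and e2: "\<forall>X \<in> carrier (K_module 2). ?k ((\<lambda>x \<in> carrier (K_module 2). x) X) =
      e (K_diff (Suc 0) X) \<oplus> ?k (to_koszul 2 (from_koszul 2 X))"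
    using kz by (auto simp: numeral_2_eq_2 compose_eq simp del: restrict_apply)
  have e: "e \<in> module_hom R (K_module (Suc 0)) N"
    "?k [Inr \<one>] = e (K_diff (Suc 0) [Inr \<one>]) \<oplus> ?k (to_koszul 2 (from_koszul 2 [Inr \<one>]))"
    using e1 bspec[OF e2 g] unfolding restrict_apply'[OF g] by simp_all
  have "e [Inr \<beta>1, Inr \<beta>2] = \<beta>1 \<otimes> e [Inr \<one>, Inr \<zero>] \<oplus> \<beta>2 \<otimes> e [Inr \<zero>, Inr \<one>]"
    using module_hom_act[OF e(1), of \<beta>1 "[Inr \<one>, Inr \<zero>]"] module_hom_act[OF e(1), of \<beta>2 "[Inr \<zero>, Inr \<one>]"]
      module_hom_add[OF e(1), of "[Inr \<beta>1, Inr \<zero>]" "[Inr \<zero>, Inr \<beta>2]"]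
    by (simp add: K_module_simps K_carriers K_ops)
  moreover have ec: "e [Inr \<one>, Inr \<zero>] \<in> carrier R" "e [Inr \<zero>, Inr \<one>] \<in> carrier R"
    using module_hom_closed[OF e(1)] by (simp_all add: K_module_simps K_carriers)
  moreover have "?k [Inr \<one>] = r" using g r by simp
  moreover have "cocycle_value ?f = ?k (to_koszul 2 (from_koszul 2 [Inr \<one>]))"
    unfolding cocycle_value_def using generator_closed by (simp add: compose_eq del: restrict_apply)
  ultimately have "r = (\<beta>1 \<otimes> e [Inr \<one>, Inr \<zero>] \<oplus> \<beta>2 \<otimes> e [Inr \<zero>, Inr \<one>]) \<oplus> cocycle_value ?f"
    using e(2) by (simp add: K_diff_1)
  then show ?thesis using f ec by blast
qed

lemma cocycle_value_add:
  "cocycle_value (\<lambda>x \<in> carrier (E.F 2). f x \<oplus>\<^bsub>N\<^esub> g x) = cocycle_value f \<oplus> cocycle_value g"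
  using generator_closed by (simp add: cocycle_value_def)

text \<open>\<kappa> presents L as R modulo the right ideal \<beta>1 R + \<beta>2 R. Only additivity
  of \<kappa> is asked, so that L may be a quotient ring in one application and H itself in the
  other. The third conclusion computes the action of g on a class through any representative r of
  its value; applied to right multiplications it yields the module structures.\<close>

lemma Ext_two:
  assumes L: "abelian_group L"
    and \<kappa>_closed: "\<And>a. a \<in> carrier R \<Longrightarrow> \<kappa> a \<in> carrier L"
    and \<kappa>_add: "\<And>a b. \<lbrakk>a \<in> carrier R; b \<in> carrier R\<rbrakk> \<Longrightarrow> \<kappa> (a \<oplus> b) = \<kappa> a \<oplus>\<^bsub>L\<^esub> \<kappa> b"
    and \<kappa>_surj: "\<And>y. y \<in> carrier L \<Longrightarrow> \<exists>a \<in> carrier R. \<kappa> a = y"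
    and \<kappa>_kernel: "\<And>a. a \<in> carrier R \<Longrightarrow> \<kappa> a = \<zero>\<^bsub>L\<^esub> \<longleftrightarrow>
      (\<exists>x \<in> carrier R. \<exists>y \<in> carrier R. a = \<beta>1 \<otimes> x \<oplus> \<beta>2 \<otimes> y)"
  obtains \<Phi> where "bij_betw \<Phi> (carrier (Ext R 2 M N)) (carrier L)"
    and "\<And>X Y. \<lbrakk>X \<in> carrier (Ext R 2 M N); Y \<in> carrier (Ext R 2 M N)\<rbrakk> \<Longrightarrow>
      \<Phi> (X \<oplus>\<^bsub>Ext R 2 M N\<^esub> Y) = \<Phi> X \<oplus>\<^bsub>L\<^esub> \<Phi> Y"
    and "\<And>g X r. \<lbrakk>g \<in> module_hom R N N; X \<in> carrier (Ext R 2 M N); r \<in> carrier R; \<Phi> X = \<kappa> r\<rbrakk> \<Longrightarrow>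
      Ext_map_right R 2 M N g X \<in> carrier (Ext R 2 M N) \<and> \<Phi> (Ext_map_right R 2 M N g X) = \<kappa> (g r)"
    and "\<Phi> \<zero>\<^bsub>Ext R 2 M N\<^esub> = \<zero>\<^bsub>L\<^esub>"
proof -
  interpret L: abelian_group L by fact
  note vc = cocycle_value_closed
  define \<Phi> where "\<Phi> X = \<kappa> (cocycle_value (SOME f. f \<in> X))" for X
  have diff: "\<exists>x \<in> carrier R. \<exists>y \<in> carrier R. a \<ominus> b = \<beta>1 \<otimes> x \<oplus> \<beta>2 \<otimes> y"
    if a: "a \<in> carrier R" and b: "b \<in> carrier R" and eq: "\<kappa> a = \<kappa> b" for a b
  proof -
    have "\<kappa> (a \<ominus> b) \<oplus>\<^bsub>L\<^esub> \<kappa> b = \<kappa> b"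
      using \<kappa>_add[of "a \<ominus> b" b] a b eq by (simp add: a_minus_def M.R.a_assoc M.R.l_neg)
    then have "\<kappa> (a \<ominus> b) = \<zero>\<^bsub>L\<^esub>"
      using a b \<kappa>_closed by (metis L.add.l_cancel_one' L.a_comm M.R.minus_closed)
    then show ?thesis using \<kappa>_kernel a b by simp
  qed
  \<comment> \<open>Two members of a class differ by a coboundary, whose value \<kappa> kills; hence
    the arbitrary member picked by \<open>SOME\<close> is harmless.\<close>
  have \<Phi>: "\<Phi> (Ext_class R 2 M N f) = \<kappa> (cocycle_value f)" if f: "f \<in> Ext_cocycles R 2 M N" for f
  proof -
    let ?g = "SOME g. g \<in> Ext_class R 2 M N f"
    have "?g \<in> Ext_class R 2 M N f"
      by (rule someI[of "\<lambda>g. g \<in> Ext_class R 2 M N f"]) (rule E.Ext_class_self[OF f])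
    then obtain b where b: "b \<in> Ext_coboundaries R 2 M N" "?g = (\<lambda>x \<in> carrier (E.F 2). b x \<oplus>\<^bsub>N\<^esub> f x)"
      unfolding E.Ext_class_eq by blast
    have bc: "cocycle_value b \<in> carrier R" using vc[OF E.coboundary_cocycle[OF b(1)]] .
    have "\<kappa> (cocycle_value b) = \<zero>\<^bsub>L\<^esub>"
      using \<kappa>_kernel[OF bc] cocycle_value_coboundary[OF b(1)] by simp
    then show ?thesis
      unfolding \<Phi>_def b(2) cocycle_value_add using \<kappa>_add bc vc[OF f] \<kappa>_closed by simp
  qed
  have zero: "\<zero>\<^bsub>Ext_cochains R 2 M N\<^esub> \<in> Ext_coboundaries R 2 M N"
    using subgroup.one_closed[OF E.coboundaries_subgroup] by simp
  show thesis
  proof (rule that[of \<Phi>])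
    have "\<zero>\<^bsub>Ext R 2 M N\<^esub> = Ext_class R 2 M N \<zero>\<^bsub>Ext_cochains R 2 M N\<^esub>"
      using E.Ext_class_coboundary[OF zero] by (simp add: Ext_def)
    moreover have "cocycle_value \<zero>\<^bsub>Ext_cochains R 2 M N\<^esub> = \<zero>"
      using generator_closed by (simp add: cocycle_value_def E.cochains_zero)
    moreover have "\<kappa> \<zero> = \<zero>\<^bsub>L\<^esub>"
      using \<kappa>_add[of \<zero> \<zero>] \<kappa>_closed[of \<zero>] by (simp add: L.add.r_cancel_one')
    ultimately show "\<Phi> \<zero>\<^bsub>Ext R 2 M N\<^esub> = \<zero>\<^bsub>L\<^esub>"
      using \<Phi>[OF E.coboundary_cocycle[OF zero]] by simp
  next
    show "bij_betw \<Phi> (carrier (Ext R 2 M N)) (carrier L)"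
      unfolding bij_betw_def
    proof (intro conjI inj_onI)
      fix X Y assume X: "X \<in> carrier (Ext R 2 M N)" and Y: "Y \<in> carrier (Ext R 2 M N)" and eq: "\<Phi> X = \<Phi> Y"
      obtain f where f: "f \<in> Ext_cocycles R 2 M N" "X = Ext_class R 2 M N f" using X by (auto simp: E.Ext_carrier)
      obtain g where g: "g \<in> Ext_cocycles R 2 M N" "Y = Ext_class R 2 M N g" using Y by (auto simp: E.Ext_carrier)
      let ?h = "\<lambda>x \<in> carrier (E.F 2). f x \<ominus>\<^bsub>N\<^esub> g x"
      have fc: "f x \<in> carrier R" "g x \<in> carrier R" if "x \<in> carrier (E.F 2)" for x
        using module_hom_closed[OF E.cocycle_hom] f(1) g(1) that by fastforce+
      have h: "?h \<in> Ext_cocycles R 2 M N"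
        using module_hom_difference[OF E.cocycle_hom[OF f(1)] E.cocycle_hom[OF g(1)] E.F_module E.N_module] f(1) g(1) E.D_closed[of _ 2]
        by (auto simp: E.cocycle_iff left_module_minus_regular[OF M.R.ring_axioms] M.R.minus_eq_zero_iff)
      have "cocycle_value ?h = cocycle_value f \<ominus> cocycle_value g"
        using generator_closed fc by (simp add: cocycle_value_def left_module_minus_regular[OF M.R.ring_axioms])
      then have "\<exists>x \<in> carrier R. \<exists>y \<in> carrier R. cocycle_value ?h = \<beta>1 \<otimes> x \<oplus> \<beta>2 \<otimes> y"
        using diff[OF vc[OF f(1)] vc[OF g(1)]] eq \<Phi> f g by simp
      then have "?h \<in> Ext_coboundaries R 2 M N"
        using coboundary_if_value[OF h] by blast
      moreover have "f x = ?h x \<oplus>\<^bsub>N\<^esub> g x" if "x \<in> carrier (E.F 2)" for x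
      proof -
        have "f x = (f x \<ominus> g x) \<oplus> g x"
          using fc[OF that] by (simp add: a_minus_def M.R.a_assoc M.R.l_neg)
        then show ?thesis
          using fc[OF that] that by (simp add: left_module_minus_regular[OF M.R.ring_axioms])
      qed
      ultimately show "X = Y"
        using E.Ext_class_cohomologous[OF g(1) E.cocycle_hom[OF f(1)]] f(2) g(2) by blast
    next
      show "\<Phi> ` carrier (Ext R 2 M N) = carrier L"
      proof (intro Set.set_eqI iffI)
        fix y assume "y \<in> \<Phi> ` carrier (Ext R 2 M N)"
        then show "y \<in> carrier L" using \<Phi> \<kappa>_closed[OF vc] by (auto simp: E.Ext_carrier)
      next
        fix y assume y: "y \<in> carrier L"
        then obtain r where r: "r \<in> carrier R" "\<kappa> r = y" using \<kappa>_surj by blast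
        obtain f a b where f: "f \<in> Ext_cocycles R 2 M N" and ab: "a \<in> carrier R" "b \<in> carrier R"
          and eq: "r = (\<beta>1 \<otimes> a \<oplus> \<beta>2 \<otimes> b) \<oplus> cocycle_value f"
          using cocycle_with_value[OF r(1)] by blast
        have "\<kappa> (\<beta>1 \<otimes> a \<oplus> \<beta>2 \<otimes> b) = \<zero>\<^bsub>L\<^esub>" using \<kappa>_kernel ab by auto
        then have "\<kappa> r = \<kappa> (cocycle_value f)"
          using \<kappa>_add[of "\<beta>1 \<otimes> a \<oplus> \<beta>2 \<otimes> b" "cocycle_value f"] ab vc[OF f] \<kappa>_closed eq by simp
        then show "y \<in> \<Phi> ` carrier (Ext R 2 M N)" using r \<Phi>[OF f] f by (force simp: E.Ext_carrier)
      qed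
    qed
  next
    fix X Y assume X: "X \<in> carrier (Ext R 2 M N)" and Y: "Y \<in> carrier (Ext R 2 M N)"
    obtain f where f: "f \<in> Ext_cocycles R 2 M N" "X = Ext_class R 2 M N f" using X by (auto simp: E.Ext_carrier)
    obtain g where g: "g \<in> Ext_cocycles R 2 M N" "Y = Ext_class R 2 M N g" using Y by (auto simp: E.Ext_carrier)
    show "\<Phi> (X \<oplus>\<^bsub>Ext R 2 M N\<^esub> Y) = \<Phi> X \<oplus>\<^bsub>L\<^esub> \<Phi> Y"
      unfolding f(2) g(2) E.Ext_class_add[OF f(1) g(1)] \<Phi>[OF E.cocycle_add[OF f(1) g(1)]] \<Phi>[OF f(1)] \<Phi>[OF g(1)]
        cocycle_value_add
      by (rule \<kappa>_add[OF vc[OF f(1)] vc[OF g(1)]])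
  next
    fix g X r assume g: "g \<in> module_hom R N N" and X: "X \<in> carrier (Ext R 2 M N)"
      and r: "r \<in> carrier R" and eq: "\<Phi> X = \<kappa> r"
    obtain f where f: "f \<in> Ext_cocycles R 2 M N" "X = Ext_class R 2 M N f" using X by (auto simp: E.Ext_carrier)
    let ?v = "cocycle_value f"
    have gc: "g a \<in> carrier R" if "a \<in> carrier R" for a using module_hom_closed[OF g] that by simp
    \<comment> \<open>The value v of f and the given r differ by an element of the right ideal. A
      left linear g sends \<beta>1 x + \<beta>2 y to \<beta>1 g(x) + \<beta>2 g(y), so g v and g r
      have the same image under \<kappa>.\<close>
    obtain x y where xy: "x \<in> carrier R" "y \<in> carrier R" "?v \<ominus> r = \<beta>1 \<otimes> x \<oplus> \<beta>2 \<otimes> y"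
      using diff[OF vc[OF f(1)] r] eq \<Phi>[OF f(1)] f(2) by auto
    have v: "?v = (\<beta>1 \<otimes> x \<oplus> \<beta>2 \<otimes> y) \<oplus> r"
      using vc[OF f(1)] r unfolding xy(3)[symmetric] by (simp add: a_minus_def M.R.a_assoc M.R.l_neg)
    have "g ?v = (\<beta>1 \<otimes> g x \<oplus> \<beta>2 \<otimes> g y) \<oplus> g r"
      unfolding v using xy r module_hom_add[OF g] module_hom_act[OF g] by simp
    moreover have "\<kappa> (\<beta>1 \<otimes> g x \<oplus> \<beta>2 \<otimes> g y) = \<zero>\<^bsub>L\<^esub>"
    proof -
      have "\<beta>1 \<otimes> g x \<oplus> \<beta>2 \<otimes> g y \<in> carrier R" using gc xy by simp
      then show ?thesis using \<kappa>_kernel gc xy(1,2) by blast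
    qed
    ultimately have "\<kappa> (g ?v) = \<kappa> (g r)" using \<kappa>_add gc xy r \<kappa>_closed by simp
    then show "Ext_map_right R 2 M N g X \<in> carrier (Ext R 2 M N) \<and> \<Phi> (Ext_map_right R 2 M N g X) = \<kappa> (g r)"
      using E.Ext_map_right_class[OF g f(1)] \<Phi> f(2) generator_closed
      by (auto simp: E.Ext_carrier cocycle_value_def compose_eq)
  qed
qed

end

subsection \<open>Vector spaces and linear extension\<close>

locale k_space = abelian_group V for V :: "('k::field, 'a, 'z) module_scheme" (structure) +
  assumes vs_closed: "x \<in> carrier V \<Longrightarrow> r \<odot> x \<in> carrier V"
    and vs_add_left: "x \<in> carrier V \<Longrightarrow> (r + s) \<odot> x = r \<odot> x \<oplus> s \<odot> x"
    and vs_add_right: "\<lbrakk>x \<in> carrier V; y \<in> carrier V\<rbrakk> \<Longrightarrow> r \<odot> (x \<oplus> y) = r \<odot> x \<oplus> r \<odot> y"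
    and vs_scal: "x \<in> carrier V \<Longrightarrow> r \<odot> (s \<odot> x) = (r * s) \<odot> x"
    and vs_one: "x \<in> carrier V \<Longrightarrow> 1 \<odot> x = x"
begin

lemma vs_zero_left [simp]: "x \<in> carrier V \<Longrightarrow> 0 \<odot> x = \<zero>"
  using vs_add_left[of x 0 0] vs_closed[of x 0] by (simp add: add.r_cancel_one')

lemma vs_zero_right [simp]: "r \<odot> \<zero> = \<zero>"
  using vs_add_right[of \<zero> \<zero> r] vs_closed[of \<zero> r] by (simp add: add.r_cancel_one')

lemma vs_finsum: "\<lbrakk>finite A; \<And>i. i \<in> A \<Longrightarrow> g i \<in> carrier V\<rbrakk> \<Longrightarrow> r \<odot> finsum V g A = finsum V (\<lambda>i. r \<odot> g i) A"
  by (rule additive_finsum[OF abelian_group_axioms abelian_group_axioms]) (auto simp: vs_closed vs_add_right)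

lemma vs_minus: "x \<in> carrier V \<Longrightarrow> (- r) \<odot> x = \<ominus> (r \<odot> x)"
  by (rule minus_equality[symmetric]) (auto simp: vs_closed vs_add_left[symmetric])

end

sublocale k_algebra \<subseteq> k_space A
  by unfold_locales (auto simp: scal_closed scal_add_left scal_add_right scal_scal scal_one)

lemma poly_mapping_sum_singles: "f = (\<Sum>u \<in> Poly_Mapping.keys f. Poly_Mapping.single u (Poly_Mapping.lookup f u))"
proof (rule poly_mapping_eqI)
  fix k
  show "Poly_Mapping.lookup f k =
      Poly_Mapping.lookup (\<Sum>u \<in> Poly_Mapping.keys f. Poly_Mapping.single u (Poly_Mapping.lookup f u)) k"
    by (simp add: lookup_sum lookup_single when_def sum.delta in_keys_iff)
qed

text \<open>The expression evaluated inside \<open>tensor_lift\<close> once a representative has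
  been fixed; well-definedness of the latter is proved through it.\<close>

definition lin_ext :: "('k::field, 'c, 'z) module_scheme \<Rightarrow> ('x \<Rightarrow> 'c) \<Rightarrow> ('x \<Rightarrow>\<^sub>0 'k) \<Rightarrow> 'c"
  where "lin_ext C \<psi> f = (\<Oplus>\<^bsub>C\<^esub>v \<in> Poly_Mapping.keys f. Poly_Mapping.lookup f v \<odot>\<^bsub>C\<^esub> \<psi> v)"

context k_space
begin

lemma lin_ext_superset:
  assumes "finite T" "Poly_Mapping.keys f \<subseteq> T" "\<And>v. v \<in> T \<Longrightarrow> \<psi> v \<in> carrier V"
  shows "lin_ext V \<psi> f = (\<Oplus>v \<in> T. Poly_Mapping.lookup f v \<odot> \<psi> v)"
  unfolding lin_ext_def
  by (rule add.finprod_mono_neutral_cong_left) (use assms vs_closed in \<open>auto simp: in_keys_iff\<close>)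

lemma lin_ext_closed:
  "(\<And>v. v \<in> Poly_Mapping.keys f \<Longrightarrow> \<psi> v \<in> carrier V) \<Longrightarrow> lin_ext V \<psi> f \<in> carrier V"
  unfolding lin_ext_def by (rule finsum_closed) (auto simp: vs_closed)

lemma lin_ext_add:
  assumes "\<And>v. v \<in> Poly_Mapping.keys f \<union> Poly_Mapping.keys g \<Longrightarrow> \<psi> v \<in> carrier V"
  shows "lin_ext V \<psi> (f + g) = lin_ext V \<psi> f \<oplus> lin_ext V \<psi> g"
proof -
  let ?T = "Poly_Mapping.keys f \<union> Poly_Mapping.keys g"
  have "lin_ext V \<psi> (f + g) = (\<Oplus>v \<in> ?T. Poly_Mapping.lookup (f + g) v \<odot> \<psi> v)"
    by (rule lin_ext_superset) (use assms keys_add[of f g] in auto)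
  also have "\<dots> = (\<Oplus>v \<in> ?T. Poly_Mapping.lookup f v \<odot> \<psi> v \<oplus> Poly_Mapping.lookup g v \<odot> \<psi> v)"
    by (rule finsum_cong') (use assms vs_closed in \<open>auto simp: lookup_add vs_add_left\<close>)
  also have "\<dots> = (\<Oplus>v \<in> ?T. Poly_Mapping.lookup f v \<odot> \<psi> v) \<oplus> (\<Oplus>v \<in> ?T. Poly_Mapping.lookup g v \<odot> \<psi> v)"
    by (rule finsum_addf) (use assms vs_closed in auto)
  finally show ?thesis
    using lin_ext_superset[of ?T f \<psi>] lin_ext_superset[of ?T g \<psi>] assms by auto
qed

lemma lin_ext_zero [simp]: "lin_ext V \<psi> 0 = \<zero>"
  by (simp add: lin_ext_def)

lemma lin_ext_single: "\<psi> u \<in> carrier V \<Longrightarrow> lin_ext V \<psi> (Poly_Mapping.single u r) = r \<odot> \<psi> u"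
  by (cases "r = 0") (simp_all add: lin_ext_def vs_closed)

lemma lin_ext_uminus:
  assumes "\<And>v. v \<in> Poly_Mapping.keys f \<Longrightarrow> \<psi> v \<in> carrier V"
  shows "lin_ext V \<psi> (- f) = \<ominus> lin_ext V \<psi> f"
proof (rule minus_equality[symmetric])
  show "lin_ext V \<psi> (- f) \<oplus> lin_ext V \<psi> f = \<zero>"
    using lin_ext_add[of "- f" f \<psi>] assms by (simp add: keys_minus)
qed (use assms in \<open>auto intro!: lin_ext_closed simp: keys_minus\<close>)

lemma lin_ext_sum:
  assumes "finite S" "\<And>i v. \<lbrakk>i \<in> S; v \<in> Poly_Mapping.keys (h i)\<rbrakk> \<Longrightarrow> \<psi> v \<in> carrier V"
  shows "lin_ext V \<psi> (sum h S) = (\<Oplus>i \<in> S. lin_ext V \<psi> (h i))"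
  using assms
proof (induction S rule: finite_induct)
  case (insert x S)
  have "Poly_Mapping.keys (sum h S) \<subseteq> (\<Union>i \<in> S. Poly_Mapping.keys (h i))" by (rule keys_sum)
  then have "lin_ext V \<psi> (h x + sum h S) = lin_ext V \<psi> (h x) \<oplus> lin_ext V \<psi> (sum h S)"
    by (intro lin_ext_add) (use insert in auto)
  moreover have "lin_ext V \<psi> (h i) \<in> carrier V" if "i \<in> insert x S" for i
    using insert.prems that by (intro lin_ext_closed) auto
  moreover have "lin_ext V \<psi> (sum h S) = (\<Oplus>i \<in> S. lin_ext V \<psi> (h i))"
    by (rule insert.IH) (use insert.prems in auto)
  ultimately show ?case using insert.hyps by simp
qed simp

end

text \<open>Convolution with respect to an arbitrary operation on the index type; the library product of
  \<open>poly_mapping\<close> needs an additive monoid there.\<close>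

definition conv :: "('x \<Rightarrow> 'x \<Rightarrow> 'x) \<Rightarrow> ('x \<Rightarrow>\<^sub>0 'k::comm_ring_1) \<Rightarrow> ('x \<Rightarrow>\<^sub>0 'k) \<Rightarrow> ('x \<Rightarrow>\<^sub>0 'k)"
  where "conv m f g = (\<Sum>u \<in> Poly_Mapping.keys f. \<Sum>v \<in> Poly_Mapping.keys g.
    Poly_Mapping.single (m u v) (Poly_Mapping.lookup f u * Poly_Mapping.lookup g v))"

lemma conv_add_left: "conv m (f + f') g = conv m f g + conv m f' g"
  unfolding conv_def
  by (rule setsum_keys_plus_distrib) (simp_all add: sum.distrib single_add distrib_right)

lemma conv_add_right: "conv m f (g + g') = conv m f g + conv m f g'"
proof -
  have "(\<Sum>v \<in> Poly_Mapping.keys (g + g'). Poly_Mapping.single (m u v) (c * Poly_Mapping.lookup (g + g') v)) =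
     (\<Sum>v \<in> Poly_Mapping.keys g. Poly_Mapping.single (m u v) (c * Poly_Mapping.lookup g v)) +
     (\<Sum>v \<in> Poly_Mapping.keys g'. Poly_Mapping.single (m u v) (c * Poly_Mapping.lookup g' v))" for u c
    by (rule setsum_keys_plus_distrib) (simp_all add: single_add distrib_left)
  then show ?thesis unfolding conv_def by (simp add: sum.distrib)
qed

lemma conv_zero [simp]: "conv m 0 g = 0" "conv m f 0 = 0"
  by (simp_all add: conv_def)

lemma conv_sum_left: "conv m (sum h S) g = (\<Sum>i \<in> S. conv m (h i) g)"
  by (induction S rule: infinite_finite_induct) (simp_all add: conv_add_left)

lemma conv_sum_right: "conv m f (sum h S) = (\<Sum>i \<in> S. conv m f (h i))"
  by (induction S rule: infinite_finite_induct) (simp_all add: conv_add_right)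

lemma conv_single_left: "conv m (Poly_Mapping.single u a) g =
    (\<Sum>v \<in> Poly_Mapping.keys g. Poly_Mapping.single (m u v) (a * Poly_Mapping.lookup g v))"
  by (cases "a = 0") (simp_all add: conv_def)

lemma conv_single_right: "conv m f (Poly_Mapping.single v b) =
    (\<Sum>u \<in> Poly_Mapping.keys f. Poly_Mapping.single (m u v) (Poly_Mapping.lookup f u * b))"
  by (cases "b = 0") (simp_all add: conv_def)

lemma conv_single [simp]:
  "conv m (Poly_Mapping.single u a) (Poly_Mapping.single v b) = Poly_Mapping.single (m u v) (a * b)"
  by (cases "b = 0") (simp_all add: conv_single_left)

lemma keys_conv: "Poly_Mapping.keys (conv m f g) \<subseteq>
    (\<lambda>(u, v). m u v) ` (Poly_Mapping.keys f \<times> Poly_Mapping.keys g)"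
proof -
  have "Poly_Mapping.keys (conv m f g) \<subseteq> (\<Union>u \<in> Poly_Mapping.keys f. \<Union>v \<in> Poly_Mapping.keys g.
      Poly_Mapping.keys (Poly_Mapping.single (m u v) (Poly_Mapping.lookup f u * Poly_Mapping.lookup g v)))"
    unfolding conv_def by (intro order.trans[OF keys_sum] UN_mono order.refl)
  also have "\<dots> \<subseteq> (\<lambda>(u, v). m u v) ` (Poly_Mapping.keys f \<times> Poly_Mapping.keys g)"
    by (auto split: if_splits)
  finally show ?thesis .
qed

text \<open>Associativity is asked only on the supports, because the product of pairs is associative
  on the carriers and not on the whole type.\<close>

lemma conv_assoc:
  assumes "\<And>u v w. \<lbrakk>u \<in> Poly_Mapping.keys f; v \<in> Poly_Mapping.keys g; w \<in> Poly_Mapping.keys h\<rbrakk> \<Longrightarrow>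
    m (m u v) w = m u (m v w)"
  shows "conv m (conv m f g) h = conv m f (conv m g h)"
proof -
  have "conv m (conv m f g) h = (\<Sum>u \<in> Poly_Mapping.keys f. \<Sum>v \<in> Poly_Mapping.keys g. \<Sum>w \<in> Poly_Mapping.keys h.
      Poly_Mapping.single (m (m u v) w) (Poly_Mapping.lookup f u * Poly_Mapping.lookup g v * Poly_Mapping.lookup h w))"
    by (subst conv_def[of m f g]) (simp add: conv_sum_left conv_single_left)
  also have "\<dots> = (\<Sum>u \<in> Poly_Mapping.keys f. \<Sum>v \<in> Poly_Mapping.keys g. \<Sum>w \<in> Poly_Mapping.keys h.
      Poly_Mapping.single (m u (m v w)) (Poly_Mapping.lookup f u * (Poly_Mapping.lookup g v * Poly_Mapping.lookup h w)))"
    using assms by (intro sum.cong refl) (simp add: mult.assoc)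
  also have "\<dots> = (\<Sum>v \<in> Poly_Mapping.keys g. \<Sum>w \<in> Poly_Mapping.keys h. \<Sum>u \<in> Poly_Mapping.keys f.
      Poly_Mapping.single (m u (m v w)) (Poly_Mapping.lookup f u * (Poly_Mapping.lookup g v * Poly_Mapping.lookup h w)))"
    by (subst sum.swap) (intro sum.cong refl sum.swap)
  also have "\<dots> = conv m f (conv m g h)"
    by (subst conv_def[of m g h]) (simp add: conv_sum_right conv_single_right)
  finally show ?thesis .
qed

subsection \<open>Tensor products of algebras\<close>

definition bilinear ::
    "('k::field, 'a, 'x) module_scheme \<Rightarrow> ('k, 'b, 'y) module_scheme \<Rightarrow> ('k, 'c, 'z) module_scheme \<Rightarrow>
     ('a \<Rightarrow> 'b \<Rightarrow> 'c) \<Rightarrow> bool"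
  where "bilinear A B C \<phi> \<longleftrightarrow>
    (\<forall>a \<in> carrier A. \<forall>b \<in> carrier B. \<phi> a b \<in> carrier C) \<and>
    (\<forall>a \<in> carrier A. \<forall>a' \<in> carrier A. \<forall>b \<in> carrier B. \<phi> (a \<oplus>\<^bsub>A\<^esub> a') b = \<phi> a b \<oplus>\<^bsub>C\<^esub> \<phi> a' b) \<and>
    (\<forall>a \<in> carrier A. \<forall>b \<in> carrier B. \<forall>b' \<in> carrier B. \<phi> a (b \<oplus>\<^bsub>B\<^esub> b') = \<phi> a b \<oplus>\<^bsub>C\<^esub> \<phi> a b') \<and>
    (\<forall>r. \<forall>a \<in> carrier A. \<forall>b \<in> carrier B. \<phi> (r \<odot>\<^bsub>A\<^esub> a) b = r \<odot>\<^bsub>C\<^esub> \<phi> a b) \<and>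
    (\<forall>r. \<forall>a \<in> carrier A. \<forall>b \<in> carrier B. \<phi> a (r \<odot>\<^bsub>B\<^esub> b) = r \<odot>\<^bsub>C\<^esub> \<phi> a b)"

lemma ring_extend:
  assumes "ring (Q :: 'x ring)"
  shows "ring (ring.extend Q F)"
proof -
  interpret ring Q by fact
  let ?S = "ring.extend Q F"
  have eqs [simp]: "carrier ?S = carrier Q" "mult ?S = mult Q" "one ?S = one Q" "zero ?S = zero Q" "add ?S = add Q"
    by (simp_all add: ring.defs)
  show ?thesis
  proof (rule ringI)
    show "abelian_group ?S"
    proof (rule abelian_groupI)
      fix x assume "x \<in> carrier ?S"
      then show "\<exists>y \<in> carrier ?S. y \<oplus>\<^bsub>?S\<^esub> x = \<zero>\<^bsub>?S\<^esub>" by (intro bexI[of _ "\<ominus>\<^bsub>Q\<^esub> x"]) (auto simp: l_neg)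
    qed (auto simp: a_assoc, auto simp: a_comm)
    show "monoid ?S" by (rule monoidI) (auto simp: m_assoc)
  qed (auto simp: l_distr r_distr)
qed

locale two_algebras = A: k_algebra A + B: k_algebra B
  for A :: "('k::field, 'a, 'x) module_scheme" and B :: "('k, 'b, 'y) module_scheme"
begin

abbreviation "P \<equiv> pair_algebra A B"
abbreviation "I \<equiv> tensor_ideal A B"
abbreviation "T \<equiv> tensor A B"
abbreviation "pr \<equiv> pure A B"

definition pm :: "'a \<times> 'b \<Rightarrow> 'a \<times> 'b \<Rightarrow> 'a \<times> 'b"
  where "pm u v = (fst u \<otimes>\<^bsub>A\<^esub> fst v, snd u \<otimes>\<^bsub>B\<^esub> snd v)"

lemma P_simps: "carrier P = {f. Poly_Mapping.keys f \<subseteq> carrier A \<times> carrier B}"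
  "f \<otimes>\<^bsub>P\<^esub> g = conv pm f g" "\<one>\<^bsub>P\<^esub> = Poly_Mapping.single (\<one>\<^bsub>A\<^esub>, \<one>\<^bsub>B\<^esub>) 1" "\<zero>\<^bsub>P\<^esub> = 0"
  "f \<oplus>\<^bsub>P\<^esub> g = f + g"
  by (simp_all add: pair_algebra_def conv_def pm_def)

lemma P_keys:
  "\<lbrakk>f \<in> carrier P; v \<in> Poly_Mapping.keys f\<rbrakk> \<Longrightarrow> fst v \<in> carrier A"
  "\<lbrakk>f \<in> carrier P; v \<in> Poly_Mapping.keys f\<rbrakk> \<Longrightarrow> snd v \<in> carrier B"
  by (auto simp: P_simps)

lemma P_single: "\<lbrakk>a \<in> carrier A; b \<in> carrier B\<rbrakk> \<Longrightarrow> Poly_Mapping.single (a, b) r \<in> carrier P"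
  by (simp add: P_simps)

lemma P_ring: "ring P"
proof (rule ringI)
  show "abelian_group P"
  proof (rule abelian_groupI)
    fix f assume "f \<in> carrier P"
    then show "\<exists>g \<in> carrier P. g \<oplus>\<^bsub>P\<^esub> f = \<zero>\<^bsub>P\<^esub>"
      by (intro bexI[of _ "- f"]) (auto simp: P_simps keys_minus)
  next
    fix f g assume "f \<in> carrier P" "g \<in> carrier P"
    then show "f \<oplus>\<^bsub>P\<^esub> g \<in> carrier P" using keys_add[of f g] by (auto simp: P_simps)
  qed (auto simp: P_simps algebra_simps)
  show "monoid P"
  proof
    fix f g assume "f \<in> carrier P" "g \<in> carrier P"
    then show "f \<otimes>\<^bsub>P\<^esub> g \<in> carrier P"
      using keys_conv[of pm f g] by (fastforce simp: P_simps pm_def)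
  next
    fix f g h assume "f \<in> carrier P" "g \<in> carrier P" "h \<in> carrier P"
    then show "f \<otimes>\<^bsub>P\<^esub> g \<otimes>\<^bsub>P\<^esub> h = f \<otimes>\<^bsub>P\<^esub> (g \<otimes>\<^bsub>P\<^esub> h)"
      unfolding P_simps(2) by (intro conv_assoc) (simp add: pm_def A.m_assoc B.m_assoc P_keys)
  next
    fix f assume f: "f \<in> carrier P"
    have "pm (\<one>\<^bsub>A\<^esub>, \<one>\<^bsub>B\<^esub>) v = v" "pm v (\<one>\<^bsub>A\<^esub>, \<one>\<^bsub>B\<^esub>) = v" if "v \<in> Poly_Mapping.keys f" for v
      using P_keys[OF f that] by (simp_all add: pm_def)
    then show "\<one>\<^bsub>P\<^esub> \<otimes>\<^bsub>P\<^esub> f = f" "f \<otimes>\<^bsub>P\<^esub> \<one>\<^bsub>P\<^esub> = f"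
      by (simp_all add: P_simps conv_single_left conv_single_right poly_mapping_sum_singles[of f, symmetric])
  qed (simp add: P_simps)
qed (simp_all add: P_simps conv_add_left conv_add_right)

lemma relators_subset: "bilinear_relators A B \<subseteq> carrier P"
proof -
  interpret P: ring P by (rule P_ring)
  have m: "f - g \<in> carrier P" if "f \<in> carrier P" "g \<in> carrier P" for f g
    using that keys_diff[of f g] by (auto simp: P_simps)
  show ?thesis
    unfolding bilinear_relators_def
    by (auto intro!: m P_single A.scal_closed B.scal_closed)
qed

lemma I_ideal: "ideal I P"
  unfolding tensor_ideal_def by (rule ring.genideal_ideal[OF P_ring relators_subset])

lemma T_simps: "carrier T = carrier (P Quot I)" "mult T = mult (P Quot I)" "one T = one (P Quot I)"
  "zero T = zero (P Quot I)" "add T = add (P Quot I)"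
  by (simp_all add: tensor_def Let_def ring.defs)

lemma T_ring: "ring T"
  unfolding tensor_def Let_def by (rule ring_extend[OF ideal.quotient_is_ring[OF I_ideal]])

definition cls :: "('a \<times> 'b \<Rightarrow>\<^sub>0 'k) \<Rightarrow> ('a \<times> 'b \<Rightarrow>\<^sub>0 'k) set"
  where "cls f = I +>\<^bsub>P\<^esub> f"

lemma pure_cls: "pr a b = cls (Poly_Mapping.single (a, b) 1)"
  by (simp add: pure_def cls_def)

lemma cls_hom:
  "f \<in> carrier P \<Longrightarrow> cls f \<in> carrier T"
  "\<lbrakk>f \<in> carrier P; g \<in> carrier P\<rbrakk> \<Longrightarrow> cls (f + g) = cls f \<oplus>\<^bsub>T\<^esub> cls g"
  "\<lbrakk>f \<in> carrier P; g \<in> carrier P\<rbrakk> \<Longrightarrow> cls (conv pm f g) = cls f \<otimes>\<^bsub>T\<^esub> cls g"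
  "cls (Poly_Mapping.single (\<one>\<^bsub>A\<^esub>, \<one>\<^bsub>B\<^esub>) 1) = \<one>\<^bsub>T\<^esub>"
  using ideal.rcos_ring_hom[OF I_ideal] unfolding cls_def ring_hom_def
  by (auto simp: T_simps P_simps)

lemma cls_surj: "X \<in> carrier T \<Longrightarrow> \<exists>f \<in> carrier P. X = cls f"
  by (auto simp: T_simps FactRing_def A_RCOSETS_def' cls_def)

lemma cls_eqI:
  assumes "f \<in> carrier P" "g \<in> carrier P" "f - g \<in> I"
  shows "cls f = cls g"
proof -
  interpret I: ideal I P by (rule I_ideal)
  have "f \<in> I +>\<^bsub>P\<^esub> g"
    unfolding a_r_coset_def r_coset_def using assms by (auto simp: P_simps intro!: bexI[of _ "f - g"])
  then show ?thesis
    unfolding cls_def using I.a_repr_independence'[of f g] assms by simp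
qed

lemma cls_mem: "\<lbrakk>f \<in> carrier P; u \<in> cls f\<rbrakk> \<Longrightarrow> u \<in> carrier P \<and> (\<exists>i \<in> I. u = i + f)"
proof -
  interpret P: ring P by (rule P_ring)
  interpret I: ideal I P by (rule I_ideal)
  assume f: "f \<in> carrier P" and "u \<in> cls f"
  then obtain i where i: "i \<in> I" "u = i + f"
    unfolding cls_def a_r_coset_def r_coset_def by (auto simp: P_simps)
  then have "i \<in> carrier P" using I.a_subset by auto
  then have "i + f \<in> carrier P" using ring.ring_simprules(1)[OF P_ring, of i f] f by (simp add: P_simps(5))
  then show "u \<in> carrier P \<and> (\<exists>i \<in> I. u = i + f)" using i by auto
qed

lemma cls_self: "f \<in> carrier P \<Longrightarrow> f \<in> cls f"
proof -
  interpret I: ideal I P by (rule I_ideal)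
  assume "f \<in> carrier P"
  then show "f \<in> cls f" unfolding cls_def by (rule I.a_rcos_self)
qed

lemma relators_in_I: "bilinear_relators A B \<subseteq> I"
  unfolding tensor_ideal_def by (rule ring.genideal_self[OF P_ring relators_subset])

lemma relator_mem:
  "\<lbrakk>a \<in> carrier A; a' \<in> carrier A; b \<in> carrier B\<rbrakk> \<Longrightarrow>
    Poly_Mapping.single (a \<oplus>\<^bsub>A\<^esub> a', b) 1 - Poly_Mapping.single (a, b) 1 - Poly_Mapping.single (a', b) 1 \<in> I"
  "\<lbrakk>a \<in> carrier A; b \<in> carrier B; b' \<in> carrier B\<rbrakk> \<Longrightarrow>
    Poly_Mapping.single (a, b \<oplus>\<^bsub>B\<^esub> b') 1 - Poly_Mapping.single (a, b) 1 - Poly_Mapping.single (a, b') 1 \<in> I"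
  "\<lbrakk>a \<in> carrier A; b \<in> carrier B\<rbrakk> \<Longrightarrow>
    Poly_Mapping.single (r \<odot>\<^bsub>A\<^esub> a, b) 1 - Poly_Mapping.single (a, b) r \<in> I"
  "\<lbrakk>a \<in> carrier A; b \<in> carrier B\<rbrakk> \<Longrightarrow>
    Poly_Mapping.single (a, r \<odot>\<^bsub>B\<^esub> b) 1 - Poly_Mapping.single (a, b) r \<in> I"
  by (rule subsetD[OF relators_in_I], unfold bilinear_relators_def, blast)+

lemma cls_diffD:
  assumes "f - g - h \<in> I" "f \<in> carrier P" "g \<in> carrier P" "h \<in> carrier P"
  shows "cls f = cls g \<oplus>\<^bsub>T\<^esub> cls h"
proof -
  interpret P: ring P by (rule P_ring)
  have "g + h \<in> carrier P" using assms P.a_closed[of g h] by (simp add: P_simps)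
  then have "cls f = cls (g + h)" using assms by (intro cls_eqI) (auto simp: algebra_simps)
  then show ?thesis using cls_hom assms by simp
qed

lemma pure_closed: "\<lbrakk>a \<in> carrier A; b \<in> carrier B\<rbrakk> \<Longrightarrow> pr a b \<in> carrier T"
  by (simp add: pure_cls cls_hom P_single)

lemma pure_add_left: "\<lbrakk>a \<in> carrier A; a' \<in> carrier A; b \<in> carrier B\<rbrakk> \<Longrightarrow> pr (a \<oplus>\<^bsub>A\<^esub> a') b = pr a b \<oplus>\<^bsub>T\<^esub> pr a' b"
  unfolding pure_cls
  by (rule cls_diffD) (simp_all add: relator_mem P_single)

lemma pure_add_right: "\<lbrakk>a \<in> carrier A; b \<in> carrier B; b' \<in> carrier B\<rbrakk> \<Longrightarrow> pr a (b \<oplus>\<^bsub>B\<^esub> b') = pr a b \<oplus>\<^bsub>T\<^esub> pr a b'"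
  unfolding pure_cls
  by (rule cls_diffD) (simp_all add: relator_mem P_single)

lemma cls_single_left: "\<lbrakk>a \<in> carrier A; b \<in> carrier B\<rbrakk> \<Longrightarrow> cls (Poly_Mapping.single (a, b) r) = pr (r \<odot>\<^bsub>A\<^esub> a) b"
  unfolding pure_cls
  by (rule cls_eqI[symmetric]) (simp_all add: relator_mem P_single A.scal_closed)

lemma cls_single_right: "\<lbrakk>a \<in> carrier A; b \<in> carrier B\<rbrakk> \<Longrightarrow> cls (Poly_Mapping.single (a, b) r) = pr a (r \<odot>\<^bsub>B\<^esub> b)"
  unfolding pure_cls
  by (rule cls_eqI[symmetric]) (simp_all add: relator_mem P_single B.scal_closed)

lemma pure_mult: "\<lbrakk>a \<in> carrier A; b \<in> carrier B; a' \<in> carrier A; b' \<in> carrier B\<rbrakk> \<Longrightarrow>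
    pr a b \<otimes>\<^bsub>T\<^esub> pr a' b' = pr (a \<otimes>\<^bsub>A\<^esub> a') (b \<otimes>\<^bsub>B\<^esub> b')"
  unfolding pure_cls by (simp add: cls_hom(3)[symmetric] P_single pm_def)

lemma pure_one: "pr \<one>\<^bsub>A\<^esub> \<one>\<^bsub>B\<^esub> = \<one>\<^bsub>T\<^esub>"
  by (simp add: pure_cls cls_hom)

lemma T_scal: "r \<odot>\<^bsub>T\<^esub> X = pr (r \<odot>\<^bsub>A\<^esub> \<one>\<^bsub>A\<^esub>) \<one>\<^bsub>B\<^esub> \<otimes>\<^bsub>T\<^esub> X"
  by (simp add: T_simps) (simp add: tensor_def Let_def ring.defs module.defs)

text \<open>Pure tensors generate additively, since a coefficient can be absorbed into the left
  factor; hence there is no case for scalars.\<close>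

lemma tensor_induct [consumes 1, case_names zero pure add]:
  assumes X: "X \<in> carrier T" and zero: "Q \<zero>\<^bsub>T\<^esub>"
    and pure: "\<And>a b. \<lbrakk>a \<in> carrier A; b \<in> carrier B\<rbrakk> \<Longrightarrow> Q (pr a b)"
    and add: "\<And>X Y. \<lbrakk>X \<in> carrier T; Y \<in> carrier T; Q X; Q Y\<rbrakk> \<Longrightarrow> Q (X \<oplus>\<^bsub>T\<^esub> Y)"
  shows "Q X"
proof -
  interpret P: ring P by (rule P_ring)
  obtain f where f: "f \<in> carrier P" "X = cls f" using cls_surj[OF X] by blast
  have cls0: "cls 0 = \<zero>\<^bsub>T\<^esub>"
  proof -
    interpret T: ring T by (rule T_ring)
    have "cls 0 \<oplus>\<^bsub>T\<^esub> cls 0 = cls 0" "cls 0 \<in> carrier T"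
      using cls_hom(2)[of 0 0] cls_hom(1)[of 0] P.zero_closed by (simp_all add: P_simps)
    then show ?thesis by (metis T.add.l_cancel_one)
  qed
  have "Q (cls (\<Sum>u \<in> S. Poly_Mapping.single u (Poly_Mapping.lookup f u))) \<and>
      (\<Sum>u \<in> S. Poly_Mapping.single u (Poly_Mapping.lookup f u)) \<in> carrier P"
    if "finite S" "S \<subseteq> Poly_Mapping.keys f" for S
    using that
  proof (induction S rule: finite_induct)
    case empty
    then show ?case using zero P.zero_closed by (simp add: cls0) (simp add: P_simps)
  next
    case (insert u S)
    let ?s = "\<Sum>u \<in> S. Poly_Mapping.single u (Poly_Mapping.lookup f u)"
    let ?t = "Poly_Mapping.single u (Poly_Mapping.lookup f u)"
    obtain a b where u: "u = (a, b)" "a \<in> carrier A" "b \<in> carrier B"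
      using insert.prems f by (cases u) (auto simp: P_simps)
    have t: "?t \<in> carrier P" using P_single u by simp
    have s: "?s \<in> carrier P" "Q (cls ?s)" using insert by auto
    have "Q (cls ?t)" unfolding u(1) by (subst cls_single_left) (use u pure A.scal_closed in auto)
    then have "Q (cls ?t \<oplus>\<^bsub>T\<^esub> cls ?s)" using add cls_hom(1) s t by blast
    then show ?case using insert cls_hom(2)[OF t s(1)] P.a_closed[OF t s(1)] by (simp add: P_simps)
  qed
  from this[of "Poly_Mapping.keys f"] show ?thesis
    using f(2) poly_mapping_sum_singles[of f] by simp
qed

lemma T_algebra: "k_algebra T"
proof -
  interpret T: ring T by (rule T_ring)
  let ?\<rho> = "\<lambda>r. pr (r \<odot>\<^bsub>A\<^esub> \<one>\<^bsub>A\<^esub>) \<one>\<^bsub>B\<^esub>"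
  have c: "?\<rho> r \<in> carrier T" for r by (simp add: pure_closed A.scal_closed)
  have add: "?\<rho> (r + s) = ?\<rho> r \<oplus>\<^bsub>T\<^esub> ?\<rho> s" for r s
    by (simp add: A.scal_add_left pure_add_left A.scal_closed)
  have mult: "?\<rho> (r * s) = ?\<rho> r \<otimes>\<^bsub>T\<^esub> ?\<rho> s" for r s
    by (simp add: pure_mult A.scal_closed A.scal_mult_left A.scal_scal)
  \<comment> \<open>Scalars act on the tensor product as left multiplication by ring elements, so
    the algebra axioms require these elements to be central.\<close>
  have central: "X \<otimes>\<^bsub>T\<^esub> ?\<rho> r = ?\<rho> r \<otimes>\<^bsub>T\<^esub> X" if "X \<in> carrier T" for X r
    using that
    by (induction X rule: tensor_induct)
      (simp_all add: c pure_mult A.scal_closed A.scal_mult_left A.scal_mult_right T.l_distr T.r_distr)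
  show ?thesis
  proof
    fix x y r s assume x: "x \<in> carrier T" and y: "y \<in> carrier T"
    show "(r \<odot>\<^bsub>T\<^esub> x) \<otimes>\<^bsub>T\<^esub> y = r \<odot>\<^bsub>T\<^esub> (x \<otimes>\<^bsub>T\<^esub> y)"
      using x y by (simp add: T_scal c T.m_assoc)
    have "x \<otimes>\<^bsub>T\<^esub> (?\<rho> r \<otimes>\<^bsub>T\<^esub> y) = x \<otimes>\<^bsub>T\<^esub> ?\<rho> r \<otimes>\<^bsub>T\<^esub> y" using x y c by (simp add: T.m_assoc)
    then show "x \<otimes>\<^bsub>T\<^esub> (r \<odot>\<^bsub>T\<^esub> y) = r \<odot>\<^bsub>T\<^esub> (x \<otimes>\<^bsub>T\<^esub> y)"
      using x y by (simp add: T_scal c T.m_assoc central)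
  qed (simp_all add: T_scal c add mult T.l_distr T.r_distr T.m_assoc A.scal_one pure_one)
qed

lemma pure_scal_left: "\<lbrakk>a \<in> carrier A; b \<in> carrier B\<rbrakk> \<Longrightarrow> pr (r \<odot>\<^bsub>A\<^esub> a) b = r \<odot>\<^bsub>T\<^esub> pr a b"
  by (simp add: T_scal pure_mult A.scal_closed A.scal_mult_left)

lemma pure_scal_right: "\<lbrakk>a \<in> carrier A; b \<in> carrier B\<rbrakk> \<Longrightarrow> pr a (r \<odot>\<^bsub>B\<^esub> b) = r \<odot>\<^bsub>T\<^esub> pr a b"
  using cls_single_left[of a b r] cls_single_right[of a b r] by (simp add: pure_scal_left)

lemma bilinear_pure: "bilinear A B T pr"
  by (simp add: bilinear_def pure_closed pure_add_left pure_add_right pure_scal_left pure_scal_right)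

section \<open>The universal property of the tensor product\<close>

lemma lin_ext_ideal:
  assumes C: "k_space C" and \<phi>: "bilinear A B C \<phi>" and f: "f \<in> I"
  shows "lin_ext C (\<lambda>v. \<phi> (fst v) (snd v)) f = \<zero>\<^bsub>C\<^esub>"
proof -
  interpret C: k_space C by fact
  interpret P: ring P by (rule P_ring)
  \<comment> \<open>The relations generate \<open>I\<close> as a two-sided ideal, so the common
    zeros must be shown to form an ideal. Quantifying over all bilinear maps makes this work:
    translating the arguments of a bilinear map by fixed elements gives another bilinear
    map.\<close>
  define N where "N = {f \<in> carrier P. \<forall>\<phi>. bilinear A B C \<phi> \<longrightarrow> lin_ext C (\<lambda>v. \<phi> (fst v) (snd v)) f = \<zero>\<^bsub>C\<^esub>}"
  have bc: "\<phi> (fst v) (snd v) \<in> carrier C" if "bilinear A B C \<phi>" "f \<in> carrier P" "v \<in> Poly_Mapping.keys f" for \<phi> f v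
    using that P_keys by (simp add: bilinear_def)
  have conv_ext: "lin_ext C (\<lambda>v. \<phi> (fst v) (snd v)) (conv pm g f) =
      (\<Oplus>\<^bsub>C\<^esub>u \<in> Poly_Mapping.keys g. \<Oplus>\<^bsub>C\<^esub>v \<in> Poly_Mapping.keys f.
        (Poly_Mapping.lookup g u * Poly_Mapping.lookup f v) \<odot>\<^bsub>C\<^esub> \<phi> (fst (pm u v)) (snd (pm u v)))"
    if \<phi>: "bilinear A B C \<phi>" and f: "f \<in> carrier P" and g: "g \<in> carrier P" for \<phi> f g
  proof -
    have pmc: "\<phi> (fst (pm u v)) (snd (pm u v)) \<in> carrier C"
      if "u \<in> Poly_Mapping.keys g" "v \<in> Poly_Mapping.keys f" for u v
      using \<phi> P_keys[OF g that(1)] P_keys[OF f that(2)] by (simp add: bilinear_def pm_def)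
    let ?h = "\<lambda>u v. Poly_Mapping.single (pm u v) (Poly_Mapping.lookup g u * Poly_Mapping.lookup f v)"
    have k: "Poly_Mapping.keys (\<Sum>v \<in> Poly_Mapping.keys f. ?h u v) \<subseteq> pm u ` Poly_Mapping.keys f" for u
      by (rule order.trans[OF keys_sum]) (auto split: if_splits)
    have "lin_ext C (\<lambda>v. \<phi> (fst v) (snd v)) (conv pm g f) =
        (\<Oplus>\<^bsub>C\<^esub>u \<in> Poly_Mapping.keys g. lin_ext C (\<lambda>v. \<phi> (fst v) (snd v)) (\<Sum>v \<in> Poly_Mapping.keys f. ?h u v))"
      unfolding conv_def
    proof (rule C.lin_ext_sum)
      fix u w assume u: "u \<in> Poly_Mapping.keys g" and "w \<in> Poly_Mapping.keys (\<Sum>v \<in> Poly_Mapping.keys f. ?h u v)"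
      then obtain v where "v \<in> Poly_Mapping.keys f" "w = pm u v" using k by blast
      then show "\<phi> (fst w) (snd w) \<in> carrier C" using pmc u by simp
    qed simp
    also have "\<dots> = (\<Oplus>\<^bsub>C\<^esub>u \<in> Poly_Mapping.keys g. \<Oplus>\<^bsub>C\<^esub>v \<in> Poly_Mapping.keys f.
        lin_ext C (\<lambda>v. \<phi> (fst v) (snd v)) (?h u v))"
    proof -
      have hk: "\<phi> (fst w) (snd w) \<in> carrier C"
        if "u \<in> Poly_Mapping.keys g" "v \<in> Poly_Mapping.keys f" "w \<in> Poly_Mapping.keys (?h u v)" for u v w
        using that(3) pmc[OF that(1,2)] by (simp split: if_splits)
      show ?thesis
      proof (rule C.finsum_cong')
        show "(\<lambda>u. \<Oplus>\<^bsub>C\<^esub>v \<in> Poly_Mapping.keys f. lin_ext C (\<lambda>v. \<phi> (fst v) (snd v)) (?h u v))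
            \<in> Poly_Mapping.keys g \<rightarrow> carrier C"
          by (intro Pi_I C.finsum_closed C.lin_ext_closed) (rule hk)
        show "lin_ext C (\<lambda>v. \<phi> (fst v) (snd v)) (\<Sum>v \<in> Poly_Mapping.keys f. ?h u v) =
            (\<Oplus>\<^bsub>C\<^esub>v \<in> Poly_Mapping.keys f. lin_ext C (\<lambda>v. \<phi> (fst v) (snd v)) (?h u v))"
          if "u \<in> Poly_Mapping.keys g" for u
          by (rule C.lin_ext_sum) (simp, rule hk[OF that])
      qed simp
    qed
    also have "\<dots> = (\<Oplus>\<^bsub>C\<^esub>u \<in> Poly_Mapping.keys g. \<Oplus>\<^bsub>C\<^esub>v \<in> Poly_Mapping.keys f.
        (Poly_Mapping.lookup g u * Poly_Mapping.lookup f v) \<odot>\<^bsub>C\<^esub> \<phi> (fst (pm u v)) (snd (pm u v)))"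
      using pmc by (intro C.finsum_cong') (auto intro!: C.finsum_closed C.finsum_cong' C.vs_closed simp: C.lin_ext_single)
    finally show ?thesis .
  qed
  have left: "conv pm g f \<in> N" if f: "f \<in> N" and g: "g \<in> carrier P" for f g
  proof -
    have fP: "f \<in> carrier P" using f by (simp add: N_def)
    have "lin_ext C (\<lambda>v. \<phi> (fst v) (snd v)) (conv pm g f) = \<zero>\<^bsub>C\<^esub>" if \<phi>: "bilinear A B C \<phi>" for \<phi>
    proof -
      have "(\<Oplus>\<^bsub>C\<^esub>v \<in> Poly_Mapping.keys f. (Poly_Mapping.lookup g u * Poly_Mapping.lookup f v) \<odot>\<^bsub>C\<^esub> \<phi> (fst (pm u v)) (snd (pm u v))) = \<zero>\<^bsub>C\<^esub>"
        if u: "u \<in> Poly_Mapping.keys g" for u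
      proof -
        let ?\<phi> = "\<lambda>a b. \<phi> (fst u \<otimes>\<^bsub>A\<^esub> a) (snd u \<otimes>\<^bsub>B\<^esub> b)"
        have uc: "fst u \<in> carrier A" "snd u \<in> carrier B" using P_keys[OF g u] by auto
        then have \<phi>': "bilinear A B C ?\<phi>"
          using \<phi> unfolding bilinear_def
          by (simp add: A.r_distr B.r_distr A.scal_mult_right B.scal_mult_right)
        have "(\<Oplus>\<^bsub>C\<^esub>v \<in> Poly_Mapping.keys f. (Poly_Mapping.lookup g u * Poly_Mapping.lookup f v) \<odot>\<^bsub>C\<^esub> \<phi> (fst (pm u v)) (snd (pm u v))) =
            (\<Oplus>\<^bsub>C\<^esub>v \<in> Poly_Mapping.keys f. Poly_Mapping.lookup g u \<odot>\<^bsub>C\<^esub> (Poly_Mapping.lookup f v \<odot>\<^bsub>C\<^esub> ?\<phi> (fst v) (snd v)))"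
          by (rule C.finsum_cong') (use bc[OF \<phi>' fP] in \<open>auto simp: pm_def C.vs_scal C.vs_closed\<close>)
        also have "\<dots> = Poly_Mapping.lookup g u \<odot>\<^bsub>C\<^esub> lin_ext C (\<lambda>v. ?\<phi> (fst v) (snd v)) f"
          unfolding lin_ext_def by (rule C.vs_finsum[symmetric]) (use bc[OF \<phi>' fP] in \<open>auto simp: C.vs_closed\<close>)
        also have "lin_ext C (\<lambda>v. ?\<phi> (fst v) (snd v)) f = \<zero>\<^bsub>C\<^esub>"
          using f \<phi>' unfolding N_def by blast
        finally show ?thesis by simp
      qed
      then show ?thesis unfolding conv_ext[OF \<phi> fP g] by (rule C.add.finprod_one_eqI) simp
    qed
    then show ?thesis using P.m_closed[OF g fP] by (simp add: N_def P_simps)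
  qed
  have right: "conv pm f g \<in> N" if f: "f \<in> N" and g: "g \<in> carrier P" for f g
  proof -
    have fP: "f \<in> carrier P" using f by (simp add: N_def)
    have "lin_ext C (\<lambda>v. \<phi> (fst v) (snd v)) (conv pm f g) = \<zero>\<^bsub>C\<^esub>" if \<phi>: "bilinear A B C \<phi>" for \<phi>
    proof -
      have "(\<Oplus>\<^bsub>C\<^esub>u \<in> Poly_Mapping.keys f. (Poly_Mapping.lookup f u * Poly_Mapping.lookup g v) \<odot>\<^bsub>C\<^esub> \<phi> (fst (pm u v)) (snd (pm u v))) = \<zero>\<^bsub>C\<^esub>"
        if v: "v \<in> Poly_Mapping.keys g" for v
      proof -
        let ?\<phi> = "\<lambda>a b. \<phi> (a \<otimes>\<^bsub>A\<^esub> fst v) (b \<otimes>\<^bsub>B\<^esub> snd v)"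
        have vc: "fst v \<in> carrier A" "snd v \<in> carrier B" using P_keys[OF g v] by auto
        then have \<phi>': "bilinear A B C ?\<phi>"
          using \<phi> unfolding bilinear_def
          by (simp add: A.l_distr B.l_distr A.scal_mult_left B.scal_mult_left)
        have "(\<Oplus>\<^bsub>C\<^esub>u \<in> Poly_Mapping.keys f. (Poly_Mapping.lookup f u * Poly_Mapping.lookup g v) \<odot>\<^bsub>C\<^esub> \<phi> (fst (pm u v)) (snd (pm u v))) =
            (\<Oplus>\<^bsub>C\<^esub>u \<in> Poly_Mapping.keys f. Poly_Mapping.lookup g v \<odot>\<^bsub>C\<^esub> (Poly_Mapping.lookup f u \<odot>\<^bsub>C\<^esub> ?\<phi> (fst u) (snd u)))"
          by (rule C.finsum_cong') (use bc[OF \<phi>' fP] in \<open>auto simp: pm_def C.vs_scal C.vs_closed mult.commute\<close>)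
        also have "\<dots> = Poly_Mapping.lookup g v \<odot>\<^bsub>C\<^esub> lin_ext C (\<lambda>u. ?\<phi> (fst u) (snd u)) f"
          unfolding lin_ext_def by (rule C.vs_finsum[symmetric]) (use bc[OF \<phi>' fP] in \<open>auto simp: C.vs_closed\<close>)
        also have "lin_ext C (\<lambda>v. ?\<phi> (fst v) (snd v)) f = \<zero>\<^bsub>C\<^esub>"
          using f \<phi>' unfolding N_def by blast
        finally show ?thesis by simp
      qed
      note z = this
      have pmc: "\<phi> (fst (pm u v)) (snd (pm u v)) \<in> carrier C"
        if "u \<in> Poly_Mapping.keys f" "v \<in> Poly_Mapping.keys g" for u v
        using \<phi> P_keys[OF fP that(1)] P_keys[OF g that(2)] by (simp add: bilinear_def pm_def)
      \<comment> \<open>Here the terms are grouped by the right factor, so that each inner sum runs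
        over f and is the extension of one translated bilinear map evaluated at f.\<close>
      have "lin_ext C (\<lambda>v. \<phi> (fst v) (snd v)) (conv pm f g) = lin_ext C (\<lambda>v. \<phi> (fst v) (snd v))
          (\<Sum>v \<in> Poly_Mapping.keys g. conv pm f (Poly_Mapping.single v (Poly_Mapping.lookup g v)))"
        by (subst (1) poly_mapping_sum_singles[of g]) (simp add: conv_sum_right)
      also have "\<dots> = (\<Oplus>\<^bsub>C\<^esub>v \<in> Poly_Mapping.keys g.
          lin_ext C (\<lambda>v. \<phi> (fst v) (snd v)) (conv pm f (Poly_Mapping.single v (Poly_Mapping.lookup g v))))"
      proof (rule C.lin_ext_sum)
        fix v w assume "v \<in> Poly_Mapping.keys g" "w \<in> Poly_Mapping.keys (conv pm f (Poly_Mapping.single v (Poly_Mapping.lookup g v)))"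
        then show "\<phi> (fst w) (snd w) \<in> carrier C"
          using keys_conv[of pm f "Poly_Mapping.single v (Poly_Mapping.lookup g v)"] pmc by (auto split: if_splits)
      qed simp
      also have "\<dots> = \<zero>\<^bsub>C\<^esub>"
      proof (rule C.add.finprod_one_eqI)
        fix v assume v: "v \<in> Poly_Mapping.keys g"
        have "lin_ext C (\<lambda>v. \<phi> (fst v) (snd v)) (conv pm f (Poly_Mapping.single v (Poly_Mapping.lookup g v))) =
            (\<Oplus>\<^bsub>C\<^esub>u \<in> Poly_Mapping.keys f. lin_ext C (\<lambda>v. \<phi> (fst v) (snd v)) (Poly_Mapping.single (pm u v) (Poly_Mapping.lookup f u * Poly_Mapping.lookup g v)))"
          unfolding conv_single_right by (rule C.lin_ext_sum) (use pmc v in \<open>auto split: if_splits\<close>)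
        also have "\<dots> = (\<Oplus>\<^bsub>C\<^esub>u \<in> Poly_Mapping.keys f. (Poly_Mapping.lookup f u * Poly_Mapping.lookup g v) \<odot>\<^bsub>C\<^esub> \<phi> (fst (pm u v)) (snd (pm u v)))"
          by (rule C.finsum_cong') (use pmc v in \<open>auto simp: C.lin_ext_single C.vs_closed\<close>)
        finally show "lin_ext C (\<lambda>v. \<phi> (fst v) (snd v)) (conv pm f (Poly_Mapping.single v (Poly_Mapping.lookup g v))) = \<zero>\<^bsub>C\<^esub>"
          using z[OF v] by simp
      qed
      finally show ?thesis .
    qed
    then show ?thesis using P.m_closed[OF fP g] by (simp add: N_def P_simps)
  qed
  have uminus: "\<ominus>\<^bsub>P\<^esub> f = - f" if "f \<in> carrier P" for f
    by (rule P.minus_equality) (use that in \<open>auto simp: P_simps\<close>)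
  have "ideal N P"
  proof (rule idealI[OF P_ring])
    show "subgroup N (add_monoid P)"
    proof (rule P.add.subgroupI)
      show "N \<noteq> {}" by (auto simp: N_def P_simps intro!: exI[of _ 0])
    next
      fix f assume "f \<in> N"
      then show "\<ominus>\<^bsub>P\<^esub> f \<in> N" using bc by (auto simp: N_def uminus C.lin_ext_uminus) (auto simp: P_simps)
    next
      fix f g assume fg: "f \<in> N" "g \<in> N"
      then have c: "f \<in> carrier P" "g \<in> carrier P" by (auto simp: N_def)
      have "lin_ext C (\<lambda>v. \<phi> (fst v) (snd v)) (f + g) = \<zero>\<^bsub>C\<^esub>" if \<phi>: "bilinear A B C \<phi>" for \<phi>
        by (subst C.lin_ext_add) (use fg c \<phi> bc[OF \<phi>] in \<open>auto simp: N_def\<close>)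
      then show "f \<oplus>\<^bsub>P\<^esub> g \<in> N" using P.a_closed[OF c] by (simp add: N_def P_simps)
    qed (auto simp: N_def)
  qed (use left right in \<open>auto simp: P_simps(2)\<close>)
  moreover have "bilinear_relators A B \<subseteq> N"
  proof
    fix f assume f: "f \<in> bilinear_relators A B"
    have ext: "lin_ext C \<psi> (u - v) = lin_ext C \<psi> u \<oplus>\<^bsub>C\<^esub> \<ominus>\<^bsub>C\<^esub> lin_ext C \<psi> v"
      if "\<And>w. w \<in> Poly_Mapping.keys u \<union> Poly_Mapping.keys v \<Longrightarrow> \<psi> w \<in> carrier C" for \<psi> and u v :: "'a \<times> 'b \<Rightarrow>\<^sub>0 'k"
      using C.lin_ext_add[of u "- v" \<psi>] C.lin_ext_uminus[of v \<psi>] that by simp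
    have single: "lin_ext C (\<lambda>v. \<phi> (fst v) (snd v)) (Poly_Mapping.single (a, b) r) = r \<odot>\<^bsub>C\<^esub> \<phi> a b"
      if "bilinear A B C \<phi>" "a \<in> carrier A" "b \<in> carrier B" for \<phi> a b r
      using that C.lin_ext_single[of "\<lambda>v. \<phi> (fst v) (snd v)" "(a, b)" r] by (simp add: bilinear_def)
    have kd: "w \<in> Poly_Mapping.keys (u - v) \<Longrightarrow> w \<in> Poly_Mapping.keys u \<or> w \<in> Poly_Mapping.keys v" for w and u v :: "'a \<times> 'b \<Rightarrow>\<^sub>0 'k"
      using keys_diff[of u v] by auto
    have "lin_ext C (\<lambda>v. \<phi> (fst v) (snd v)) f = \<zero>\<^bsub>C\<^esub>" if \<phi>: "bilinear A B C \<phi>" for \<phi>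
    proof -
      have c: "\<And>a b. \<lbrakk>a \<in> carrier A; b \<in> carrier B\<rbrakk> \<Longrightarrow> \<phi> a b \<in> carrier C" using \<phi> by (simp add: bilinear_def)
      have lin: "\<phi> (r \<odot>\<^bsub>A\<^esub> a) b = r \<odot>\<^bsub>C\<^esub> \<phi> a b" "\<phi> a (r \<odot>\<^bsub>B\<^esub> b) = r \<odot>\<^bsub>C\<^esub> \<phi> a b"
        if "a \<in> carrier A" "b \<in> carrier B" for r a b
        using \<phi> that by (auto simp: bilinear_def)
      have add: "\<phi> (a \<oplus>\<^bsub>A\<^esub> a') b = \<phi> a b \<oplus>\<^bsub>C\<^esub> \<phi> a' b" if "a \<in> carrier A" "a' \<in> carrier A" "b \<in> carrier B" for a a' b
        using \<phi> that by (auto simp: bilinear_def)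
      have add': "\<phi> a (b \<oplus>\<^bsub>B\<^esub> b') = \<phi> a b \<oplus>\<^bsub>C\<^esub> \<phi> a b'" if "a \<in> carrier A" "b \<in> carrier B" "b' \<in> carrier B" for a b b'
        using \<phi> that by (auto simp: bilinear_def)
      have z: "x \<oplus>\<^bsub>C\<^esub> y \<oplus>\<^bsub>C\<^esub> \<ominus>\<^bsub>C\<^esub> x \<oplus>\<^bsub>C\<^esub> \<ominus>\<^bsub>C\<^esub> y = \<zero>\<^bsub>C\<^esub>" if "x \<in> carrier C" "y \<in> carrier C" for x y
        using that by (metis C.a_assoc C.a_comm C.a_inv_closed C.l_zero C.r_neg)
      consider (1) a a' b where "f = Poly_Mapping.single (a \<oplus>\<^bsub>A\<^esub> a', b) 1 - Poly_Mapping.single (a, b) 1 - Poly_Mapping.single (a', b) 1"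
          "a \<in> carrier A" "a' \<in> carrier A" "b \<in> carrier B"
        | (2) a b b' where "f = Poly_Mapping.single (a, b \<oplus>\<^bsub>B\<^esub> b') 1 - Poly_Mapping.single (a, b) 1 - Poly_Mapping.single (a, b') 1"
          "a \<in> carrier A" "b \<in> carrier B" "b' \<in> carrier B"
        | (3) r a b where "f = Poly_Mapping.single (r \<odot>\<^bsub>A\<^esub> a, b) 1 - Poly_Mapping.single (a, b) r" "a \<in> carrier A" "b \<in> carrier B"
        | (4) r a b where "f = Poly_Mapping.single (a, r \<odot>\<^bsub>B\<^esub> b) 1 - Poly_Mapping.single (a, b) r" "a \<in> carrier A" "b \<in> carrier B"
        using f unfolding bilinear_relators_def by blast
      then show ?thesis
      proof cases
        case 1
        show ?thesis unfolding 1(1)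
          by (subst ext; (subst ext)?)
            (use 1 c in \<open>auto simp: single[OF \<phi>] C.vs_one add z dest!: kd split: if_splits\<close>)
      next
        case 2
        show ?thesis unfolding 2(1)
          by (subst ext; (subst ext)?)
            (use 2 c in \<open>auto simp: single[OF \<phi>] C.vs_one add' z dest!: kd split: if_splits\<close>)
      next
        case 3
        show ?thesis unfolding 3(1)
          by (subst ext)
            (use 3 c A.scal_closed in \<open>auto simp: single[OF \<phi>] C.vs_one C.vs_closed lin C.r_neg split: if_splits\<close>)
      next
        case 4
        show ?thesis unfolding 4(1)
          by (subst ext)
            (use 4 c B.scal_closed in \<open>auto simp: single[OF \<phi>] C.vs_one C.vs_closed lin C.r_neg split: if_splits\<close>)
      qed
    qed
    then show "f \<in> N" using relators_subset f by (auto simp: N_def)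
  qed
  ultimately have "I \<subseteq> N"
    unfolding tensor_ideal_def by (rule P.genideal_minimal)
  then show ?thesis using f \<phi> by (auto simp: N_def)
qed

text \<open>The representative chosen by \<open>SOME\<close> differs from f by an element of
  \<open>I\<close>, on which the extension of a bilinear map vanishes.\<close>

lemma tensor_lift_cls:
  assumes C: "k_space C" and \<phi>: "bilinear A B C \<phi>" and f: "f \<in> carrier P"
  shows "tensor_lift C \<phi> (cls f) = lin_ext C (\<lambda>v. \<phi> (fst v) (snd v)) f"
proof -
  interpret C: k_space C by fact
  interpret I: ideal I P by (rule I_ideal)
  have bc: "\<phi> (fst v) (snd v) \<in> carrier C" if "f \<in> carrier P" "v \<in> Poly_Mapping.keys f" for f v
    using that \<phi> P_keys by (simp add: bilinear_def)
  let ?u = "SOME u. u \<in> cls f"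
  have "?u \<in> cls f" by (rule someI[of "\<lambda>u. u \<in> cls f"]) (rule cls_self[OF f])
  then obtain i where i: "i \<in> I" "?u = i + f" using cls_mem[OF f] by blast
  have iP: "i \<in> carrier P" using i(1) I.a_subset by auto
  have "tensor_lift C \<phi> (cls f) = lin_ext C (\<lambda>v. \<phi> (fst v) (snd v)) ?u"
    by (simp add: tensor_lift_def lin_ext_def Let_def)
  also have "\<dots> = lin_ext C (\<lambda>v. \<phi> (fst v) (snd v)) i \<oplus>\<^bsub>C\<^esub> lin_ext C (\<lambda>v. \<phi> (fst v) (snd v)) f"
    unfolding i(2) by (rule C.lin_ext_add) (use bc f iP in auto)
  finally show ?thesis
    using lin_ext_ideal[OF C \<phi> i(1)] C.lin_ext_closed[of f] bc[OF f] by simp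
qed

lemma tensor_lift_pure:
  assumes C: "k_space C" and \<phi>: "bilinear A B C \<phi>" and "a \<in> carrier A" "b \<in> carrier B"
  shows "tensor_lift C \<phi> (pr a b) = \<phi> a b"
proof -
  interpret C: k_space C by fact
  have "\<phi> a b \<in> carrier C" using assms by (simp add: bilinear_def)
  then show ?thesis
    using assms C.lin_ext_single[of "\<lambda>v. \<phi> (fst v) (snd v)" "(a, b)" 1]
    by (simp add: pure_cls tensor_lift_cls P_single C.vs_one)
qed

lemma tensor_lift_closed:
  assumes C: "k_space C" and \<phi>: "bilinear A B C \<phi>" and X: "X \<in> carrier T"
  shows "tensor_lift C \<phi> X \<in> carrier C"
proof -
  interpret C: k_space C by fact
  obtain f where f: "f \<in> carrier P" "X = cls f" using cls_surj[OF X] by blast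
  then show ?thesis
    using \<phi> P_keys[OF f(1)] by (auto simp: tensor_lift_cls[OF C \<phi>] bilinear_def intro!: C.lin_ext_closed)
qed

lemma tensor_lift_add:
  assumes C: "k_space C" and \<phi>: "bilinear A B C \<phi>" and X: "X \<in> carrier T" and Y: "Y \<in> carrier T"
  shows "tensor_lift C \<phi> (X \<oplus>\<^bsub>T\<^esub> Y) = tensor_lift C \<phi> X \<oplus>\<^bsub>C\<^esub> tensor_lift C \<phi> Y"
proof -
  interpret C: k_space C by fact
  interpret P: ring P by (rule P_ring)
  obtain f g where f: "f \<in> carrier P" "X = cls f" and g: "g \<in> carrier P" "Y = cls g"
    using cls_surj X Y by metis
  have "f + g \<in> carrier P" using P.a_closed[OF f(1) g(1)] by (simp add: P_simps)
  then show ?thesis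
    unfolding f(2) g(2) cls_hom(2)[OF f(1) g(1), symmetric]
    using f(1) g(1) \<phi> P_keys[OF f(1)] P_keys[OF g(1)]
    by (auto simp: tensor_lift_cls[OF C \<phi>] bilinear_def intro!: C.lin_ext_add)
qed

lemma tensor_lift_zero:
  assumes C: "k_space C" and \<phi>: "bilinear A B C \<phi>"
  shows "tensor_lift C \<phi> \<zero>\<^bsub>T\<^esub> = \<zero>\<^bsub>C\<^esub>"
proof -
  interpret C: k_space C by fact
  interpret T: ring T by (rule T_ring)
  show ?thesis
    using tensor_lift_add[OF C \<phi>, of "\<zero>\<^bsub>T\<^esub>" "\<zero>\<^bsub>T\<^esub>"] tensor_lift_closed[OF C \<phi>, of "\<zero>\<^bsub>T\<^esub>"]
    by (metis C.add.l_cancel_one T.l_zero T.zero_closed)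
qed

lemma tensor_lift_scal:
  assumes C: "k_space C" and \<phi>: "bilinear A B C \<phi>" and X: "X \<in> carrier T"
  shows "tensor_lift C \<phi> (r \<odot>\<^bsub>T\<^esub> X) = r \<odot>\<^bsub>C\<^esub> tensor_lift C \<phi> X"
proof -
  interpret C: k_space C by fact
  interpret T: k_algebra T by (rule T_algebra)
  show ?thesis
    using X
  proof (induction X rule: tensor_induct)
    case zero
    then show ?case by (simp add: tensor_lift_zero[OF C \<phi>])
  next
    case (pure a b)
    have "\<phi> (r \<odot>\<^bsub>A\<^esub> a) b = r \<odot>\<^bsub>C\<^esub> \<phi> a b" using \<phi> pure by (simp add: bilinear_def)
    then show ?case
      using pure tensor_lift_pure[OF C \<phi>] A.scal_closed by (simp add: pure_scal_left[symmetric])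
  next
    case (add X Y)
    then show ?case
      by (simp add: T.scal_add_right tensor_lift_add[OF C \<phi>] T.scal_closed C.vs_add_right tensor_lift_closed[OF C \<phi>])
  qed
qed

text \<open>Uniqueness in the universal property, for merely additive maps. Membership of the values
  at zero in the carrier is enough to cancel f(0) = f(0) + f(0).\<close>

lemma tensor_additive_eqI:
  assumes C: "abelian_group C" and X: "X \<in> carrier T"
    and f: "\<And>X Y. \<lbrakk>X \<in> carrier T; Y \<in> carrier T\<rbrakk> \<Longrightarrow> f (X \<oplus>\<^bsub>T\<^esub> Y) = f X \<oplus>\<^bsub>C\<^esub> f Y"
    and fc: "f \<zero>\<^bsub>T\<^esub> \<in> carrier C"
    and g: "\<And>X Y. \<lbrakk>X \<in> carrier T; Y \<in> carrier T\<rbrakk> \<Longrightarrow> g (X \<oplus>\<^bsub>T\<^esub> Y) = g X \<oplus>\<^bsub>C\<^esub> g Y"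
    and gc: "g \<zero>\<^bsub>T\<^esub> \<in> carrier C"
    and pure: "\<And>a b. \<lbrakk>a \<in> carrier A; b \<in> carrier B\<rbrakk> \<Longrightarrow> f (pr a b) = g (pr a b)"
  shows "f X = g X"
  using X
proof (induction X rule: tensor_induct)
  case zero
  interpret C: abelian_group C by fact
  interpret T: ring T by (rule T_ring)
  show ?case
    using f[of "\<zero>\<^bsub>T\<^esub>" "\<zero>\<^bsub>T\<^esub>"] g[of "\<zero>\<^bsub>T\<^esub>" "\<zero>\<^bsub>T\<^esub>"] fc gc
    by (metis C.add.l_cancel_one T.l_zero T.zero_closed)
qed (simp_all add: pure f g)

end

context two_algebras
begin

lemma tensor_lift_cong:
  assumes C: "k_space C" and \<phi>: "bilinear A B C \<phi>" and eq: "\<And>a b. \<lbrakk>a \<in> carrier A; b \<in> carrier B\<rbrakk> \<Longrightarrow> \<phi> a b = \<psi> a b"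
    and X: "X \<in> carrier T"
  shows "tensor_lift C \<phi> X = tensor_lift C \<psi> X"
proof -
  interpret C: k_space C by fact
  have \<psi>: "bilinear A B C \<psi>"
    using \<phi> unfolding bilinear_def
    by (simp add: eq[symmetric] A.scal_closed B.scal_closed)
  show ?thesis
    by (rule tensor_additive_eqI[OF C.abelian_group_axioms X])
      (simp_all add: tensor_lift_add[OF C] tensor_lift_zero[OF C] tensor_lift_pure[OF C] \<phi> \<psi> eq)
qed

lemma bilinear_compose:
  assumes \<phi>: "bilinear A B C \<phi>"
    and g: "\<And>x. x \<in> carrier C \<Longrightarrow> g x \<in> carrier C'"
    and add: "\<And>x y. \<lbrakk>x \<in> carrier C; y \<in> carrier C\<rbrakk> \<Longrightarrow> g (x \<oplus>\<^bsub>C\<^esub> y) = g x \<oplus>\<^bsub>C'\<^esub> g y"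
    and scal: "\<And>r x. x \<in> carrier C \<Longrightarrow> g (r \<odot>\<^bsub>C\<^esub> x) = r \<odot>\<^bsub>C'\<^esub> g x"
  shows "bilinear A B C' (\<lambda>a b. g (\<phi> a b))"
  using \<phi> g add scal unfolding bilinear_def by simp

lemma tensor_lift_linear:
  assumes C: "k_space C" and C': "k_space C'" and \<phi>: "bilinear A B C \<phi>"
    and g: "\<And>x. x \<in> carrier C \<Longrightarrow> g x \<in> carrier C'"
    and add: "\<And>x y. \<lbrakk>x \<in> carrier C; y \<in> carrier C\<rbrakk> \<Longrightarrow> g (x \<oplus>\<^bsub>C\<^esub> y) = g x \<oplus>\<^bsub>C'\<^esub> g y"
    and scal: "\<And>r x. x \<in> carrier C \<Longrightarrow> g (r \<odot>\<^bsub>C\<^esub> x) = r \<odot>\<^bsub>C'\<^esub> g x"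
    and X: "X \<in> carrier T"
  shows "g (tensor_lift C \<phi> X) = tensor_lift C' (\<lambda>a b. g (\<phi> a b)) X"
proof -
  interpret C: k_space C by fact
  interpret C': k_space C' by fact
  have b: "bilinear A B C' (\<lambda>a b. g (\<phi> a b))" by (rule bilinear_compose[OF \<phi> g add scal])
  show ?thesis
  proof (rule tensor_additive_eqI[OF C'.abelian_group_axioms X])
    fix X Y assume XY: "X \<in> carrier T" "Y \<in> carrier T"
    show "g (tensor_lift C \<phi> (X \<oplus>\<^bsub>T\<^esub> Y)) = g (tensor_lift C \<phi> X) \<oplus>\<^bsub>C'\<^esub> g (tensor_lift C \<phi> Y)"
      unfolding tensor_lift_add[OF C \<phi> XY] by (rule add) (use XY tensor_lift_closed[OF C \<phi>] in auto)
    show "tensor_lift C' (\<lambda>a b. g (\<phi> a b)) (X \<oplus>\<^bsub>T\<^esub> Y) =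
        tensor_lift C' (\<lambda>a b. g (\<phi> a b)) X \<oplus>\<^bsub>C'\<^esub> tensor_lift C' (\<lambda>a b. g (\<phi> a b)) Y"
      by (rule tensor_lift_add[OF C' b XY])
  next
    show "g (tensor_lift C \<phi> \<zero>\<^bsub>T\<^esub>) \<in> carrier C'"
      unfolding tensor_lift_zero[OF C \<phi>] by (rule g) simp
    show "tensor_lift C' (\<lambda>a b. g (\<phi> a b)) \<zero>\<^bsub>T\<^esub> \<in> carrier C'"
      unfolding tensor_lift_zero[OF C' b] by simp
  next
    fix a b' assume ab: "a \<in> carrier A" "b' \<in> carrier B"
    show "g (tensor_lift C \<phi> (pr a b')) = tensor_lift C' (\<lambda>a b. g (\<phi> a b)) (pr a b')"
      unfolding tensor_lift_pure[OF C \<phi> ab] tensor_lift_pure[OF C' b ab] ..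
  qed
qed

end

lemma bilinearI:
  assumes "\<And>a b. \<lbrakk>a \<in> carrier A; b \<in> carrier B\<rbrakk> \<Longrightarrow> \<phi> a b \<in> carrier C"
    "\<And>a a' b. \<lbrakk>a \<in> carrier A; a' \<in> carrier A; b \<in> carrier B\<rbrakk> \<Longrightarrow> \<phi> (a \<oplus>\<^bsub>A\<^esub> a') b = \<phi> a b \<oplus>\<^bsub>C\<^esub> \<phi> a' b"
    "\<And>a b b'. \<lbrakk>a \<in> carrier A; b \<in> carrier B; b' \<in> carrier B\<rbrakk> \<Longrightarrow> \<phi> a (b \<oplus>\<^bsub>B\<^esub> b') = \<phi> a b \<oplus>\<^bsub>C\<^esub> \<phi> a b'"
    "\<And>r a b. \<lbrakk>a \<in> carrier A; b \<in> carrier B\<rbrakk> \<Longrightarrow> \<phi> (r \<odot>\<^bsub>A\<^esub> a) b = r \<odot>\<^bsub>C\<^esub> \<phi> a b"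
    "\<And>r a b. \<lbrakk>a \<in> carrier A; b \<in> carrier B\<rbrakk> \<Longrightarrow> \<phi> a (r \<odot>\<^bsub>B\<^esub> b) = r \<odot>\<^bsub>C\<^esub> \<phi> a b"
  shows "bilinear A B C \<phi>"
  unfolding bilinear_def using assms by simp

lemma bilinearD:
  assumes "bilinear A B C \<phi>"
  shows "\<lbrakk>a \<in> carrier A; b \<in> carrier B\<rbrakk> \<Longrightarrow> \<phi> a b \<in> carrier C"
    "\<lbrakk>a \<in> carrier A; a' \<in> carrier A; b \<in> carrier B\<rbrakk> \<Longrightarrow> \<phi> (a \<oplus>\<^bsub>A\<^esub> a') b = \<phi> a b \<oplus>\<^bsub>C\<^esub> \<phi> a' b"
    "\<lbrakk>a \<in> carrier A; b \<in> carrier B; b' \<in> carrier B\<rbrakk> \<Longrightarrow> \<phi> a (b \<oplus>\<^bsub>B\<^esub> b') = \<phi> a b \<oplus>\<^bsub>C\<^esub> \<phi> a b'"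
    "\<lbrakk>a \<in> carrier A; b \<in> carrier B\<rbrakk> \<Longrightarrow> \<phi> (r \<odot>\<^bsub>A\<^esub> a) b = r \<odot>\<^bsub>C\<^esub> \<phi> a b"
    "\<lbrakk>a \<in> carrier A; b \<in> carrier B\<rbrakk> \<Longrightarrow> \<phi> a (r \<odot>\<^bsub>B\<^esub> b) = r \<odot>\<^bsub>C\<^esub> \<phi> a b"
  using assms unfolding bilinear_def by simp_all

locale linear_op = V: k_space V + W: k_space W
  for V :: "('k::field, 'a, 'x) module_scheme" and W :: "('k, 'b, 'y) module_scheme" +
  fixes f :: "'a \<Rightarrow> 'b"
  assumes lin_closed: "x \<in> carrier V \<Longrightarrow> f x \<in> carrier W"
    and lin_add: "\<lbrakk>x \<in> carrier V; y \<in> carrier V\<rbrakk> \<Longrightarrow> f (x \<oplus>\<^bsub>V\<^esub> y) = f x \<oplus>\<^bsub>W\<^esub> f y"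
    and lin_scal: "x \<in> carrier V \<Longrightarrow> f (r \<odot>\<^bsub>V\<^esub> x) = r \<odot>\<^bsub>W\<^esub> f x"

subsection \<open>The antipode is an anti-homomorphism\<close>

context hopf_algebra
begin

sublocale TT: two_algebras A A by (unfold_locales)

sublocale TA: k_algebra "tensor A A" by (rule TT.T_algebra)

sublocale TTT: two_algebras A "tensor A A" by (unfold_locales)

sublocale TTA: k_algebra "tensor A (tensor A A)" by (rule TTT.T_algebra)

lemma A_space: "k_space A" ..

lemma comult:
  "x \<in> carrier A \<Longrightarrow> \<Delta> x \<in> carrier (tensor A A)"
  "\<lbrakk>x \<in> carrier A; y \<in> carrier A\<rbrakk> \<Longrightarrow> \<Delta> (x \<oplus> y) = \<Delta> x \<oplus>\<^bsub>tensor A A\<^esub> \<Delta> y"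
  "\<lbrakk>x \<in> carrier A; y \<in> carrier A\<rbrakk> \<Longrightarrow> \<Delta> (x \<otimes> y) = \<Delta> x \<otimes>\<^bsub>tensor A A\<^esub> \<Delta> y"
  "\<Delta> \<one> = \<one>\<^bsub>tensor A A\<^esub>"
  "x \<in> carrier A \<Longrightarrow> \<Delta> (r \<odot> x) = r \<odot>\<^bsub>tensor A A\<^esub> \<Delta> x"
  using comult_hom by (auto simp: alg_hom_def ring_hom_def)

text \<open>Coassociativity is an equation in A \<otimes> (A \<otimes> A). Applying the linear map
  induced by a trilinear F gives the usable form: \<Sum> F(x_1, x_2, x_3) may be computed by
  splitting either factor of the coproduct.\<close>

lemma coassoc_lift:
  assumes C: "k_space C"
    and F: "\<And>a. a \<in> carrier A \<Longrightarrow> bilinear A A C (F a)"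
    and F_add: "\<And>a a' b c. \<lbrakk>a \<in> carrier A; a' \<in> carrier A; b \<in> carrier A; c \<in> carrier A\<rbrakk> \<Longrightarrow>
      F (a \<oplus> a') b c = F a b c \<oplus>\<^bsub>C\<^esub> F a' b c"
    and F_scal: "\<And>r a b c. \<lbrakk>a \<in> carrier A; b \<in> carrier A; c \<in> carrier A\<rbrakk> \<Longrightarrow>
      F (r \<odot> a) b c = r \<odot>\<^bsub>C\<^esub> F a b c"
    and x: "x \<in> carrier A"
  shows "tensor_lift C (\<lambda>a b. tensor_lift C (F a) (\<Delta> b)) (\<Delta> x) =
    tensor_lift C (\<lambda>a b. tensor_lift C (\<lambda>a' a''. F a' a'' b) (\<Delta> a)) (\<Delta> x)"
proof -
  interpret C: k_space C by fact
  have abg: "abelian_group C" ..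
  have pure_TT: "bilinear A A (tensor A A) (pure A A)" by (rule TT.bilinear_pure)
  have pure_TTT: "bilinear A (tensor A A) (tensor A (tensor A A)) (pure A (tensor A A))"
    by (rule TTT.bilinear_pure)
  have F1: "tensor_lift C (F (a \<oplus> a')) Y = tensor_lift C (F a) Y \<oplus>\<^bsub>C\<^esub> tensor_lift C (F a') Y"
    if "a \<in> carrier A" "a' \<in> carrier A" "Y \<in> carrier (tensor A A)" for a a' Y
    by (rule TT.tensor_additive_eqI[OF abg that(3)])
      (use that in \<open>simp_all add: TT.tensor_lift_add[OF C F] TT.tensor_lift_zero[OF C F] TT.tensor_lift_pure[OF C F]
        F_add C.a_ac TT.tensor_lift_closed[OF C F]\<close>)
  have F2: "tensor_lift C (F (r \<odot> a)) Y = r \<odot>\<^bsub>C\<^esub> tensor_lift C (F a) Y"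
    if "a \<in> carrier A" "Y \<in> carrier (tensor A A)" for r a Y
    by (rule TT.tensor_additive_eqI[OF abg that(2)])
      (use that in \<open>simp_all add: TT.tensor_lift_add[OF C F] TT.tensor_lift_zero[OF C F] TT.tensor_lift_pure[OF C F]
        F_scal C.vs_add_right scal_closed TT.tensor_lift_closed[OF C F]\<close>)
  have \<Phi>: "bilinear A (tensor A A) C (\<lambda>a Y. tensor_lift C (F a) Y)"
    by (rule bilinearI)
      (simp_all add: TT.tensor_lift_closed[OF C F] F1 F2 TT.tensor_lift_add[OF C F] TT.tensor_lift_scal[OF C F])
  let ?\<Psi> = "tensor_lift C (\<lambda>a Y. tensor_lift C (F a) Y)"
  have 1: "bilinear A A (tensor A (tensor A A)) (\<lambda>a b. pure A (tensor A A) a (\<Delta> b))"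
    by (rule bilinearI) (simp_all add: bilinearD[OF pure_TTT] comult)
  have 2: "bilinear A A (tensor A (tensor A A)) (\<lambda>a' a''. pure A (tensor A A) a' (pure A A a'' b))"
    if "b \<in> carrier A" for b
    by (rule bilinearI) (use that in \<open>simp_all add: bilinearD[OF pure_TTT] bilinearD[OF pure_TT]\<close>)
  have 3: "bilinear A A (tensor A (tensor A A)) (\<lambda>a b. tensor_lift (tensor A (tensor A A))
        (\<lambda>a' a''. pure A (tensor A A) a' (pure A A a'' b)) (\<Delta> a))"
  proof (rule bilinearI)
    have add: "bilinear A A (tensor A (tensor A A)) (\<lambda>a' a''. pure A (tensor A A) a' (pure A A a'' (b \<oplus> b')))"
      if "b \<in> carrier A" "b' \<in> carrier A" for b b'
      by (rule 2) (simp add: that)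
    show "tensor_lift (tensor A (tensor A A)) (\<lambda>a' a''. pure A (tensor A A) a' (pure A A a'' (b \<oplus> b'))) (\<Delta> a) =
        tensor_lift (tensor A (tensor A A)) (\<lambda>a' a''. pure A (tensor A A) a' (pure A A a'' b)) (\<Delta> a)
        \<oplus>\<^bsub>tensor A (tensor A A)\<^esub>
        tensor_lift (tensor A (tensor A A)) (\<lambda>a' a''. pure A (tensor A A) a' (pure A A a'' b')) (\<Delta> a)"
      if "a \<in> carrier A" "b \<in> carrier A" "b' \<in> carrier A" for a b b'
      by (rule TT.tensor_additive_eqI[OF TTA.abelian_group_axioms comult(1)[OF that(1)]])
        (use that in \<open>simp_all add: TT.tensor_lift_add[OF TTA.k_space_axioms 2] TT.tensor_lift_add[OF TTA.k_space_axioms add]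
          TT.tensor_lift_zero[OF TTA.k_space_axioms 2] TT.tensor_lift_zero[OF TTA.k_space_axioms add]
          TT.tensor_lift_pure[OF TTA.k_space_axioms 2] TT.tensor_lift_pure[OF TTA.k_space_axioms add]
          bilinearD[OF pure_TTT] bilinearD[OF pure_TT] TT.tensor_lift_closed[OF TTA.k_space_axioms 2] TTA.a_ac\<close>)
    show "tensor_lift (tensor A (tensor A A)) (\<lambda>a' a''. pure A (tensor A A) a' (pure A A a'' (r \<odot> b))) (\<Delta> a) =
        r \<odot>\<^bsub>tensor A (tensor A A)\<^esub>
        tensor_lift (tensor A (tensor A A)) (\<lambda>a' a''. pure A (tensor A A) a' (pure A A a'' b)) (\<Delta> a)"
      if "a \<in> carrier A" "b \<in> carrier A" for r a b
      by (rule TT.tensor_additive_eqI[OF TTA.abelian_group_axioms comult(1)[OF that(1)]])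
        (use that in \<open>simp_all add: TT.tensor_lift_add[OF TTA.k_space_axioms 2] scal_closed
          TT.tensor_lift_zero[OF TTA.k_space_axioms 2] TT.tensor_lift_pure[OF TTA.k_space_axioms 2]
          bilinearD[OF pure_TTT] bilinearD[OF pure_TT] TT.tensor_lift_closed[OF TTA.k_space_axioms 2] TTA.vs_add_right\<close>)
  qed (simp_all add: comult TT.tensor_lift_add[OF TTA.k_space_axioms 2] TT.tensor_lift_scal[OF TTA.k_space_axioms 2]
      TT.tensor_lift_closed[OF TTA.k_space_axioms 2])
  have lin: "Y \<in> carrier (tensor A (tensor A A)) \<Longrightarrow> ?\<Psi> Y \<in> carrier C"
    "\<lbrakk>Y \<in> carrier (tensor A (tensor A A)); Z \<in> carrier (tensor A (tensor A A))\<rbrakk> \<Longrightarrow>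
      ?\<Psi> (Y \<oplus>\<^bsub>tensor A (tensor A A)\<^esub> Z) = ?\<Psi> Y \<oplus>\<^bsub>C\<^esub> ?\<Psi> Z"
    "Y \<in> carrier (tensor A (tensor A A)) \<Longrightarrow> ?\<Psi> (r \<odot>\<^bsub>tensor A (tensor A A)\<^esub> Y) = r \<odot>\<^bsub>C\<^esub> ?\<Psi> Y" for Y Z r
    by (simp_all add: TTT.tensor_lift_closed[OF C \<Phi>] TTT.tensor_lift_add[OF C \<Phi>] TTT.tensor_lift_scal[OF C \<Phi>])
  have L: "?\<Psi> (tensor_lift (tensor A (tensor A A)) (\<lambda>a b. pure A (tensor A A) a (\<Delta> b)) (\<Delta> x)) =
      tensor_lift C (\<lambda>a b. tensor_lift C (F a) (\<Delta> b)) (\<Delta> x)" (is "?l = ?r")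
  proof -
    have "?l = tensor_lift C (\<lambda>a b. ?\<Psi> (pure A (tensor A A) a (\<Delta> b))) (\<Delta> x)"
      by (rule TT.tensor_lift_linear[OF TTA.k_space_axioms C 1]) (simp_all add: lin comult x)
    also have "\<dots> = ?r"
      by (rule TT.tensor_lift_cong[OF C TT.bilinear_compose[OF 1] _ comult(1)[OF x]])
        (simp_all add: lin TTT.tensor_lift_pure[OF C \<Phi>] comult)
    finally show ?thesis .
  qed
  have R: "?\<Psi> (tensor_lift (tensor A (tensor A A)) (\<lambda>a b. tensor_lift (tensor A (tensor A A))
        (\<lambda>a' a''. pure A (tensor A A) a' (pure A A a'' b)) (\<Delta> a)) (\<Delta> x)) =
      tensor_lift C (\<lambda>a b. tensor_lift C (\<lambda>a' a''. F a' a'' b) (\<Delta> a)) (\<Delta> x)" (is "?l = ?r")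
  proof -
    have "?l = tensor_lift C (\<lambda>a b. ?\<Psi> (tensor_lift (tensor A (tensor A A))
        (\<lambda>a' a''. pure A (tensor A A) a' (pure A A a'' b)) (\<Delta> a))) (\<Delta> x)"
      by (rule TT.tensor_lift_linear[OF TTA.k_space_axioms C 3]) (simp_all add: lin comult x)
    also have "\<dots> = ?r"
    proof (rule TT.tensor_lift_cong[OF C TT.bilinear_compose[OF 3] _ comult(1)[OF x]])
      fix a b assume a: "a \<in> carrier A" and b: "b \<in> carrier A"
      have "?\<Psi> (tensor_lift (tensor A (tensor A A)) (\<lambda>a' a''. pure A (tensor A A) a' (pure A A a'' b)) (\<Delta> a)) =
          tensor_lift C (\<lambda>a' a''. ?\<Psi> (pure A (tensor A A) a' (pure A A a'' b))) (\<Delta> a)"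
        by (rule TT.tensor_lift_linear[OF TTA.k_space_axioms C 2[OF b]]) (simp_all add: lin comult a)
      also have "\<dots> = tensor_lift C (\<lambda>a' a''. F a' a'' b) (\<Delta> a)"
        by (rule TT.tensor_lift_cong[OF C TT.bilinear_compose[OF 2[OF b]] _ comult(1)[OF a]])
          (simp_all add: lin TTT.tensor_lift_pure[OF C \<Phi>] TT.tensor_lift_pure[OF C F] b TT.pure_closed)
      finally show "?\<Psi> (tensor_lift (tensor A (tensor A A)) (\<lambda>a' a''. pure A (tensor A A) a' (pure A A a'' b)) (\<Delta> a)) =
          tensor_lift C (\<lambda>a' a''. F a' a'' b) (\<Delta> a)" .
    qed (simp_all add: lin)
    finally show ?thesis .
  qed
  show ?thesis using L R coassociative[OF x] by simp
qed

text \<open>The uniqueness of inverses for convolution: F = F * id * S, and the hypothesis replaces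
  F * id by c times the counit. The constant c is general because \<open>antipode_mult\<close> uses
  it with values other than one.\<close>

lemma convolution_inverse:
  assumes F: "linear_op A A F" and c: "c \<in> carrier A"
    and conv: "\<And>x. x \<in> carrier A \<Longrightarrow> tensor_lift A (\<lambda>a b. F a \<otimes> b) (\<Delta> x) = \<epsilon> x \<odot> c"
    and x: "x \<in> carrier A"
  shows "F x = c \<otimes> S x"
proof -
  interpret F: linear_op A A F by fact
  note C = A_space
  note cx = comult(1)[OF x]
  note simps = F.lin_closed F.lin_add F.lin_scal scal_closed l_distr r_distr scal_mult_left scal_mult_right
    antipode_closed antipode_add antipode_scal counit_add counit_scal counit_mult scal_add_left scal_add_right scal_scal
  have b1: "bilinear A A A (\<lambda>a b. \<epsilon> b \<odot> a)" by (rule bilinearI) (simp_all add: simps mult.commute)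
  have b2: "bilinear A A A (\<lambda>a b. \<epsilon> a \<odot> b)" by (rule bilinearI) (simp_all add: simps mult.commute)
  have b3: "bilinear A A A (\<lambda>a b. a \<otimes> S b)" by (rule bilinearI) (simp_all add: simps)
  have b4: "bilinear A A A (\<lambda>a b. F a \<otimes> b)" by (rule bilinearI) (simp_all add: simps)
  have "F x = F (tensor_lift A (\<lambda>a b. \<epsilon> b \<odot> a) (\<Delta> x))" by (simp add: counit_right x)
  also have "\<dots> = tensor_lift A (\<lambda>a b. F (\<epsilon> b \<odot> a)) (\<Delta> x)"
    by (rule TT.tensor_lift_linear[OF C C b1]) (simp_all add: simps cx)
  also have "\<dots> = tensor_lift A (\<lambda>a b. tensor_lift A (\<lambda>b' b''. F a \<otimes> b' \<otimes> S b'') (\<Delta> b)) (\<Delta> x)"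
  proof (rule TT.tensor_lift_cong[OF C _ _ cx])
    show "bilinear A A A (\<lambda>a b. F (\<epsilon> b \<odot> a))" by (rule bilinearI) (simp_all add: simps mult.commute)
    fix a b assume a: "a \<in> carrier A" and b: "b \<in> carrier A"
    have "F (\<epsilon> b \<odot> a) = F a \<otimes> tensor_lift A (\<lambda>b' b''. b' \<otimes> S b'') (\<Delta> b)"
      using a b by (simp add: antipode_right simps)
    also have "\<dots> = tensor_lift A (\<lambda>b' b''. F a \<otimes> (b' \<otimes> S b'')) (\<Delta> b)"
      by (rule TT.tensor_lift_linear[OF C C b3, where g = "\<lambda>y. F a \<otimes> y"]) (use a b in \<open>simp_all add: simps comult\<close>)
    also have "\<dots> = tensor_lift A (\<lambda>b' b''. F a \<otimes> b' \<otimes> S b'') (\<Delta> b)"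
      by (rule TT.tensor_lift_cong[OF C TT.bilinear_compose[OF b3, where g = "\<lambda>y. F a \<otimes> y"]])
        (use a b in \<open>simp_all add: simps comult m_assoc\<close>)
    finally show "F (\<epsilon> b \<odot> a) = tensor_lift A (\<lambda>b' b''. F a \<otimes> b' \<otimes> S b'') (\<Delta> b)" .
  qed
  also have "\<dots> = tensor_lift A (\<lambda>a b. tensor_lift A (\<lambda>a' a''. F a' \<otimes> a'' \<otimes> S b) (\<Delta> a)) (\<Delta> x)"
    by (rule coassoc_lift[OF C _ _ _ x]) (simp_all add: simps bilinearI)
  also have "\<dots> = tensor_lift A (\<lambda>a b. c \<otimes> S (\<epsilon> a \<odot> b)) (\<Delta> x)"
  proof (rule TT.tensor_lift_cong[OF C _ _ cx, symmetric])
    show "bilinear A A A (\<lambda>a b. c \<otimes> S (\<epsilon> a \<odot> b))" by (rule bilinearI) (use c in \<open>simp_all add: simps mult.commute\<close>)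
    fix a b assume a: "a \<in> carrier A" and b: "b \<in> carrier A"
    have "tensor_lift A (\<lambda>a' a''. F a' \<otimes> a'' \<otimes> S b) (\<Delta> a) = tensor_lift A (\<lambda>a b. F a \<otimes> b) (\<Delta> a) \<otimes> S b"
      by (rule TT.tensor_lift_linear[OF C C b4, where g = "\<lambda>y. y \<otimes> S b", symmetric]) (use a b in \<open>simp_all add: simps comult\<close>)
    then show "c \<otimes> S (\<epsilon> a \<odot> b) = tensor_lift A (\<lambda>a' a''. F a' \<otimes> a'' \<otimes> S b) (\<Delta> a)"
      using a b c by (simp add: conv simps)
  qed
  also have "\<dots> = c \<otimes> S (tensor_lift A (\<lambda>a b. \<epsilon> a \<odot> b) (\<Delta> x))"
    by (rule TT.tensor_lift_linear[OF C C b2, where g = "\<lambda>y. c \<otimes> S y", symmetric]) (use c in \<open>simp_all add: simps cx\<close>)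
  finally show ?thesis by (simp add: counit_left x)
qed

text \<open>Two applications of \<open>convolution_inverse\<close> replace the convolution algebra
  of maps on A \<otimes> A. For fixed x, the map y \<mapsto> \<Sum> S(x_1 y) x_2 convolved with the
  identity is \<epsilon>(x) \<epsilon>, so it is \<epsilon>(x) S(y). Read as a statement on x, this
  says that x \<mapsto> S(x y) convolved with the identity is \<epsilon>(x) S(y), whence S(x y) =
  S(y) S(x).\<close>

lemma antipode_mult:
  assumes x: "x \<in> carrier A" and y: "y \<in> carrier A"
  shows "S (x \<otimes> y) = S y \<otimes> S x"
proof -
  note C = A_space
  note simps = scal_closed l_distr r_distr scal_mult_left scal_mult_right
    antipode_closed antipode_add antipode_scal scal_add_left scal_add_right scal_scal
  have b0: "bilinear A A A (\<lambda>a b. S a \<otimes> b)" by (rule bilinearI) (simp_all add: simps)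
  have b1: "bilinear A A A (\<lambda>a b. S (a \<otimes> y) \<otimes> b)" if "y \<in> carrier A" for y
    by (rule bilinearI) (use that in \<open>simp_all add: simps\<close>)
  define G where "G X y = tensor_lift A (\<lambda>a b. S (a \<otimes> y) \<otimes> b) X" for X y
  have G_closed: "G X y \<in> carrier A" if "X \<in> carrier (tensor A A)" "y \<in> carrier A" for X y
    unfolding G_def by (rule TT.tensor_lift_closed[OF C b1]) (use that in simp_all)
  have G_add: "G X (y \<oplus> y') = G X y \<oplus> G X y'"
    if "X \<in> carrier (tensor A A)" "y \<in> carrier A" "y' \<in> carrier A" for X y y'
    by (rule TT.tensor_additive_eqI[OF abelian_group_axioms that(1)])
      (use that in \<open>simp_all add: G_def TT.tensor_lift_add[OF C b1] TT.tensor_lift_zero[OF C b1]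
        TT.tensor_lift_pure[OF C b1] TT.tensor_lift_closed[OF C b1] simps a_ac\<close>)
  have G_scal: "G X (r \<odot> y) = r \<odot> G X y" if "X \<in> carrier (tensor A A)" "y \<in> carrier A" for X r y
    by (rule TT.tensor_additive_eqI[OF abelian_group_axioms that(1)])
      (use that in \<open>simp_all add: G_def TT.tensor_lift_add[OF C b1] TT.tensor_lift_zero[OF C b1]
        TT.tensor_lift_pure[OF C b1] TT.tensor_lift_closed[OF C b1] simps\<close>)
  have G_add': "G (X \<oplus>\<^bsub>tensor A A\<^esub> Y) y = G X y \<oplus> G Y y"
    if "X \<in> carrier (tensor A A)" "Y \<in> carrier (tensor A A)" "y \<in> carrier A" for X Y y
    using that by (simp add: G_def TT.tensor_lift_add[OF C b1])
  have G_zero: "G \<zero>\<^bsub>tensor A A\<^esub> y = \<zero>" if "y \<in> carrier A" for y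
    unfolding G_def by (rule TT.tensor_lift_zero[OF C b1[OF that]])
  have G_pure: "G (pure A A a b) y = S (a \<otimes> y) \<otimes> b" if "a \<in> carrier A" "b \<in> carrier A" "y \<in> carrier A" for a b y
    unfolding G_def by (rule TT.tensor_lift_pure[OF C b1[OF that(3)] that(1,2)])
  have b2: "bilinear A A A (\<lambda>c d. G X c \<otimes> d)" if "X \<in> carrier (tensor A A)" for X
    by (rule bilinearI) (use that in \<open>simp_all add: G_closed G_add G_scal simps\<close>)
  \<comment> \<open>Summing over X inside and Y outside is the same as summing over the product X Y;
    with coproducts for X and Y this brings in the antipode axiom for a product.\<close>
  have fubini: "tensor_lift A (\<lambda>c d. G X c \<otimes> d) Y = tensor_lift A (\<lambda>a b. S a \<otimes> b) (X \<otimes>\<^bsub>tensor A A\<^esub> Y)"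
    if X: "X \<in> carrier (tensor A A)" and Y: "Y \<in> carrier (tensor A A)" for X Y
  proof (rule TT.tensor_additive_eqI[OF abelian_group_axioms Y])
    fix c d assume c: "c \<in> carrier A" and d: "d \<in> carrier A"
    have "G X c \<otimes> d = tensor_lift A (\<lambda>a b. S a \<otimes> b) (X \<otimes>\<^bsub>tensor A A\<^esub> pure A A c d)"
      by (rule TT.tensor_additive_eqI[OF abelian_group_axioms X])
        (use c d in \<open>simp_all add: G_add' G_zero G_pure G_closed simps TT.pure_closed TA.l_distr TT.tensor_lift_add[OF C b0]
          TT.tensor_lift_zero[OF C b0] TT.pure_mult TT.tensor_lift_pure[OF C b0] m_assoc\<close>)
    then show "tensor_lift A (\<lambda>c d. G X c \<otimes> d) (pure A A c d) =
        tensor_lift A (\<lambda>a b. S a \<otimes> b) (X \<otimes>\<^bsub>tensor A A\<^esub> pure A A c d)"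
      using c d by (simp add: TT.tensor_lift_pure[OF C b2[OF X]])
  qed (use X in \<open>simp_all add: TT.tensor_lift_add[OF C b2] TT.tensor_lift_zero[OF C b2] TT.tensor_lift_add[OF C b0]
      TT.tensor_lift_zero[OF C b0] TA.r_distr\<close>)
  have inner: "G (\<Delta> x) y = \<epsilon> x \<odot> S y" if x: "x \<in> carrier A" and y: "y \<in> carrier A" for x y
  proof -
    have "G (\<Delta> x) y = (\<epsilon> x \<odot> \<one>) \<otimes> S y"
    proof (rule convolution_inverse[OF _ _ _ y])
      show "linear_op A A (G (\<Delta> x))"
        by unfold_locales (use x in \<open>simp_all add: comult G_closed G_add G_scal\<close>)
      fix z assume z: "z \<in> carrier A"
      have "tensor_lift A (\<lambda>c d. G (\<Delta> x) c \<otimes> d) (\<Delta> z) = tensor_lift A (\<lambda>a b. S a \<otimes> b) (\<Delta> (x \<otimes> z))"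
        using fubini[of "\<Delta> x" "\<Delta> z"] x z by (simp add: comult)
      also have "\<dots> = \<epsilon> z \<odot> (\<epsilon> x \<odot> \<one>)"
        using x z by (simp add: antipode_left counit_mult scal_scal mult.commute)
      finally show "tensor_lift A (\<lambda>c d. G (\<Delta> x) c \<otimes> d) (\<Delta> z) = \<epsilon> z \<odot> (\<epsilon> x \<odot> \<one>)" .
    qed (simp add: scal_closed)
    then show ?thesis using y by (simp add: scal_mult_left antipode_closed)
  qed
  show ?thesis
  proof (rule convolution_inverse[OF _ _ _ x, where F = "\<lambda>a. S (a \<otimes> y)"])
    show "linear_op A A (\<lambda>a. S (a \<otimes> y))"
      by unfold_locales (use y in \<open>simp_all add: simps\<close>)
  qed (use y inner in \<open>simp_all add: antipode_closed G_def\<close>)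
qed

lemma antipode_one: "S \<one> = \<one>"
proof -
  have "bilinear A A A (\<lambda>a b. S a \<otimes> b)"
    by (rule bilinearI) (simp_all add: scal_closed l_distr r_distr scal_mult_left scal_mult_right antipode_closed
      antipode_add antipode_scal)
  from TT.tensor_lift_pure[OF A_space this one_closed one_closed] antipode_left[OF one_closed]
  show ?thesis by (simp add: comult TT.pure_one counit_one scal_one antipode_closed)
qed

end

subsection \<open>The Ore extension \<open>H\<close>\<close>

text \<open>The algebra axioms of the Ore extension, in particular associativity, are assumptions
  here; in the theorem the Hopf algebra hypothesis supplies them.\<close>

locale hoe = H: k_algebra "hoe_algebra d" for d :: "nat \<Rightarrow> 'k::field" +
  fixes p :: nat
  assumes char_p: "CHAR('k) = p" and char_pos: "p > 0" and finite_support: "finite {s. d s \<noteq> 0}"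
begin

abbreviation "H \<equiv> hoe_algebra d"
abbreviation hmul (infixl \<open>\<star>\<close> 70) where "f \<star> g \<equiv> f \<otimes>\<^bsub>H\<^esub> g"
abbreviation "\<delta> \<equiv> hoe_derivation d"

definition Y :: "'k poly poly \<Rightarrow> 'k poly poly" where "Y = ore_shift id \<delta>"

definition D1 :: "'k poly" where "D1 = (\<Sum>s \<in> {s. d s \<noteq> 0}. Polynomial.monom (d s) (p ^ s))"

lemma prime_p: "prime p"
  using prime_CHAR_semidom[where 'a = 'k] char_pos by (simp add: char_p)

lemma p_gt_1: "1 < p" using prime_gt_1_nat[OF prime_p] .

lemma \<delta>_eq: "\<delta> f = pderiv f * D1"
  by (simp add: hoe_derivation_def D1_def char_p)

lemma \<delta>_simps [simp]: "\<delta> 0 = 0" "\<delta> 1 = 0" "\<delta> [:a:] = 0" "\<delta> [:0, 1:] = D1"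
  by (simp_all add: \<delta>_eq pderiv_pCons)

lemma \<delta>_add: "\<delta> (f + g) = \<delta> f + \<delta> g"
  and \<delta>_diff: "\<delta> (f - g) = \<delta> f - \<delta> g"
  and \<delta>_mult: "\<delta> (f * g) = \<delta> f * g + f * \<delta> g"
  and \<delta>_smult: "\<delta> (Polynomial.smult a f) = Polynomial.smult a (\<delta> f)"
  by (simp_all add: \<delta>_eq pderiv_add pderiv_diff pderiv_mult pderiv_smult algebra_simps)

lemma Y_coeff: "poly.coeff (Y g) n = (if n = 0 then 0 else poly.coeff g (n - 1)) + \<delta> (poly.coeff g n)"
  by (cases n) (simp_all add: Y_def ore_shift_def coeff_pCons coeff_map_poly map_poly_id)

lemma Y_zero [simp]: "Y 0 = 0"
  by (rule poly_eqI) (simp add: Y_coeff)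

lemma H_simps [simp]: "carrier H = UNIV" "f \<oplus>\<^bsub>H\<^esub> g = f + g" "\<zero>\<^bsub>H\<^esub> = 0" "\<one>\<^bsub>H\<^esub> = 1"
  "a \<odot>\<^bsub>H\<^esub> f = Polynomial.smult [:a:] f"
  by (simp_all add: hoe_algebra_def ore_extension_def ring.defs module.defs)

lemma hmul_def: "f \<star> g = (\<Sum>i\<le>degree f. Polynomial.smult (poly.coeff f i) ((Y ^^ i) g))"
  unfolding Y_def by (simp add: hoe_algebra_def ore_extension_def ring.defs module.defs del: funpow.simps)

lemma hmul_superset: "degree f \<le> n \<Longrightarrow> f \<star> g = (\<Sum>i\<le>n. Polynomial.smult (poly.coeff f i) ((Y ^^ i) g))"
  unfolding hmul_def by (rule sum.mono_neutral_left) (auto simp: coeff_eq_0)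

lemma hmul_assoc: "f \<star> g \<star> h = f \<star> (g \<star> h)"
  using H.m_assoc[of f g h] by simp

lemma hmul_add_left: "(f + g) \<star> h = f \<star> h + g \<star> h"
  using H.l_distr[of f g h] by simp

lemma hmul_add_right: "f \<star> (g + h) = f \<star> g + f \<star> h"
  using H.r_distr[of g h f] by simp

lemma hmul_one [simp]: "1 \<star> f = f" "f \<star> 1 = f"
  using H.l_one[of f] H.r_one[of f] by simp_all

lemma hmul_zero [simp]: "0 \<star> f = 0" "f \<star> 0 = 0"
  using H.l_null[of f] H.r_null[of f] by simp_all

lemma H_uminus [simp]: "\<ominus>\<^bsub>H\<^esub> f = - f"
  using H.minus_equality[of "- f" f] by simp

lemma H_minus [simp]: "f \<ominus>\<^bsub>H\<^esub> g = f - g"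
  by (simp add: a_minus_def)

lemma hmul_diff_left: "(f - g) \<star> h = f \<star> h - g \<star> h"
  using hmul_add_left[of "f - g" g h] by (simp add: algebra_simps)

lemma hmul_diff_right: "f \<star> (g - h) = f \<star> g - f \<star> h"
  using hmul_add_right[of f "g - h" h] by (simp add: algebra_simps)

lemma hmul_uminus: "(- f) \<star> g = - (f \<star> g)" "f \<star> (- g) = - (f \<star> g)"
  using hmul_diff_left[of 0 f g] hmul_diff_right[of f 0 g] by simp_all

lemma hmul_scal: "Polynomial.smult [:a:] f \<star> g = Polynomial.smult [:a:] (f \<star> g)"
  "f \<star> Polynomial.smult [:a:] g = Polynomial.smult [:a:] (f \<star> g)"
  using H.scal_mult_left[of f g a] H.scal_mult_right[of f g a] by simp_all

lemma hmul_const_left: "[:r:] \<star> g = Polynomial.smult r g"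
  by (simp add: hmul_def)

lemma hmul_sum_left: "sum f S \<star> g = (\<Sum>i\<in>S. f i \<star> g)"
  by (induction S rule: infinite_finite_induct) (simp_all add: hmul_add_left)

lemma X1_left: "X1 \<star> g = Polynomial.smult [:0, 1:] g"
  by (simp add: X1_def hmul_const_left)

lemma X2_left: "X2 \<star> g = Y g"
  by (simp add: X2_def hmul_superset[of _ 1])

lemma Y_monom: "(Y ^^ i) (Polynomial.monom 1 j) = Polynomial.monom 1 (i + j)"
proof (induction i)
  case (Suc i)
  have "Y (Polynomial.monom 1 m) = Polynomial.monom 1 (Suc m)" for m
    by (rule poly_eqI) (auto simp: Y_coeff)
  then show ?case using Suc by simp
qed simp

lemma hmul_monom_right: "f \<star> Polynomial.monom 1 j = Polynomial.monom 1 j * f"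
proof -
  have "f \<star> Polynomial.monom 1 j = (\<Sum>i\<le>degree f. Polynomial.monom (poly.coeff f i) i) * Polynomial.monom 1 j"
    by (simp add: hmul_def Y_monom smult_monom sum_distrib_right mult_monom)
  then show ?thesis by (simp add: poly_as_sum_of_monoms mult.commute)
qed

lemma X2_right: "f \<star> X2 = pCons 0 f"
  using hmul_monom_right[of f 1] by (simp add: X2_def monom_Suc monom_0)

text \<open>X2 commutes with its own powers, so only the action of \<delta> on the left coefficients
  survives. Commuting with X2 thus means that \<delta> kills every coefficient.\<close>

lemma X2_commutator: "X2 \<star> f - f \<star> X2 = map_poly \<delta> f"
  by (simp add: X2_left X2_right Y_def ore_shift_def map_poly_id)

lemma X2_X1: "X2 \<star> X1 = X1 \<star> X2 + [:D1:]"
  using X2_commutator[of X1] by (simp add: X1_def map_poly_pCons algebra_simps)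

lemma X1_pow: "X1 [^]\<^bsub>H\<^esub> n = [:Polynomial.monom 1 n:]"
proof (induction n)
  case (Suc n)
  then show ?case
    by (simp add: X1_def hmul_const_left monom_Suc mult.commute)
qed (simp add: one_pCons)

lemma X2_pow: "X2 [^]\<^bsub>H\<^esub> n = Polynomial.monom 1 n"
  by (induction n) (simp_all add: X2_right monom_Suc)

lemma H_induct [case_names one X1 X2 add scal mult]:
  assumes one: "Q 1" and X1: "Q X1" and X2: "Q X2" and add: "\<And>f g. Q f \<Longrightarrow> Q g \<Longrightarrow> Q (f + g)"
    and scal: "\<And>a f. Q f \<Longrightarrow> Q (Polynomial.smult [:a:] f)" and mult: "\<And>f g. Q f \<Longrightarrow> Q g \<Longrightarrow> Q (f \<star> g)"
  shows "Q f"
proof -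
  have zero: "Q 0" using scal[OF one, of 0] by simp
  have const: "Q [:r:]" for r
  proof (induction r rule: pCons_induct)
    case 0
    then show ?case using zero by simp
  next
    case (pCons a r)
    have "[:pCons a r:] = Polynomial.smult [:a:] 1 + X1 \<star> [:r:]"
      by (simp add: X1_left)
    then show ?case using add[OF scal[OF one] mult[OF X1 pCons(2)]] by simp
  qed
  show ?thesis
  proof (induction f rule: pCons_induct)
    case 0
    then show ?case by (rule zero)
  next
    case (pCons r f)
    have "pCons r f = [:r:] + f \<star> X2" by (simp add: X2_right)
    then show ?case using add[OF const mult[OF pCons(2) X2]] by simp
  qed
qed

text \<open>The Leibniz rule X2^n f = \<Sum> binom(n, j) \<delta>^(n-j)(f) X2^j for f \<in> k[X1],
  proved by Pascal's recursion.\<close>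

lemma Y_pow_coeff: "poly.coeff ((Y ^^ n) [:f:]) j = (if j \<le> n then of_nat (n choose j) * (\<delta> ^^ (n - j)) f else 0)"
proof (induction n arbitrary: j)
  case 0
  then show ?case by (cases j) auto
next
  case (Suc n)
  have of_nat_\<delta>: "\<delta> (of_nat m * g) = of_nat m * \<delta> g" for m g
    by (induction m) (simp_all add: \<delta>_add algebra_simps)
  show ?case
  proof (cases j)
    case 0
    then show ?thesis using Suc[of 0] by (simp add: Y_coeff)
  next
    case (Suc i)
    consider "i > n" | "i = n" | "i < n" by linarith
    then show ?thesis
    proof cases
      case 3
      then have "Suc (n - Suc i) = n - i" by simp
      then have "\<delta> ((\<delta> ^^ (n - Suc i)) f) = (\<delta> ^^ (n - i)) f" by (metis comp_apply funpow.simps(2))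
      then show ?thesis using 3 Suc Suc.IH[of i] Suc.IH[of j] by (simp add: Y_coeff of_nat_\<delta> distrib_right)
    qed (use Suc Suc.IH[of i] Suc.IH[of j] in \<open>simp_all add: Y_coeff\<close>)
  qed
qed

subsection \<open>Degrees\<close>

lemma degree_Y_pow: "degree g \<le> n \<Longrightarrow> degree ((Y ^^ i) g) \<le> i + n \<and> poly.coeff ((Y ^^ i) g) (i + n) = poly.coeff g n"
proof (induction i)
  case (Suc i)
  let ?h = "(Y ^^ i) g"
  have h: "degree ?h \<le> i + n" "poly.coeff ?h (i + n) = poly.coeff g n" using Suc by auto
  have "degree (Y ?h) \<le> Suc (i + n)"
    by (rule degree_le) (use h in \<open>auto simp: Y_coeff coeff_eq_0\<close>)
  moreover have "poly.coeff (Y ?h) (Suc (i + n)) = poly.coeff g n"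
    using h by (simp add: Y_coeff coeff_eq_0)
  ultimately show ?case by simp
qed simp

lemma degree_hmul_le: "degree f \<le> m \<Longrightarrow> degree g \<le> n \<Longrightarrow> degree (f \<star> g) \<le> m + n"
proof -
  assume fg: "degree f \<le> m" "degree g \<le> n"
  have "degree (Polynomial.smult (poly.coeff f i) ((Y ^^ i) g)) \<le> m + n" if "i \<le> m" for i
    using degree_smult_le[of "poly.coeff f i" "(Y ^^ i) g"] degree_Y_pow[OF fg(2), of i] that by linarith
  then show ?thesis unfolding hmul_superset[OF fg(1)] by (intro degree_sum_le) auto
qed

text \<open>Commuting powers of X2 past coefficients only creates lower terms, so top coefficients
  multiply as for ordinary polynomials. In particular H is a domain.\<close>

lemma coeff_hmul_top:
  assumes "degree f \<le> m" "degree g \<le> n"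
  shows "poly.coeff (f \<star> g) (m + n) = poly.coeff f m * poly.coeff g n"
proof -
  have "poly.coeff (f \<star> g) (m + n) = (\<Sum>i\<le>m. poly.coeff f i * poly.coeff ((Y ^^ i) g) (m + n))"
    unfolding hmul_superset[OF assms(1)] by (simp add: coeff_sum)
  also have "\<dots> = (\<Sum>i\<in>{m}. poly.coeff f i * poly.coeff ((Y ^^ i) g) (m + n))"
  proof (rule sum.mono_neutral_right)
    show "\<forall>i\<in>{..m} - {m}. poly.coeff f i * poly.coeff ((Y ^^ i) g) (m + n) = 0"
    proof
      fix i assume "i \<in> {..m} - {m}"
      then have "degree ((Y ^^ i) g) < m + n"
        using degree_Y_pow[OF assms(2), of i] by auto
      then show "poly.coeff f i * poly.coeff ((Y ^^ i) g) (m + n) = 0" by (simp add: coeff_eq_0)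
    qed
  qed auto
  finally show ?thesis using degree_Y_pow[OF assms(2), of m] by simp
qed

lemma hmul_nonzero:
  assumes "f \<noteq> 0" "g \<noteq> 0"
  shows "f \<star> g \<noteq> 0" "degree (f \<star> g) = degree f + degree g" "lead_coeff (f \<star> g) = lead_coeff f * lead_coeff g"
proof -
  have c: "poly.coeff (f \<star> g) (degree f + degree g) = lead_coeff f * lead_coeff g"
    by (rule coeff_hmul_top) auto
  moreover have "lead_coeff f * lead_coeff g \<noteq> 0" using assms by simp
  ultimately show "f \<star> g \<noteq> 0" by auto
  show deg: "degree (f \<star> g) = degree f + degree g"
    using degree_hmul_le[of f "degree f" g "degree g"] c assms
    by (intro antisym le_degree) auto
  show "lead_coeff (f \<star> g) = lead_coeff f * lead_coeff g" using c deg by simp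
qed

lemma hmul_eq_0_iff: "f \<star> g = 0 \<longleftrightarrow> f = 0 \<or> g = 0"
  using hmul_nonzero(1) by auto

text \<open>Degrees add in both variables. A one-sided inverse suffices, which is the form in which
  uniqueness of the Nakayama automorphism meets units.\<close>

lemma unit_is_scalar:
  assumes "f \<star> g = 1"
  shows "\<exists>a. a \<noteq> 0 \<and> f = [:[:a:]:]"
proof -
  have nz: "f \<noteq> 0" "g \<noteq> 0" using assms by auto
  have "degree f = 0" "degree g = 0" using hmul_nonzero(2)[OF nz] assms by auto
  then obtain r s where r: "f = [:r:]" "g = [:s:]" by (metis degree_eq_zeroE)
  then have rs: "r * s = 1" using assms by (simp add: hmul_const_left one_pCons)
  then have "degree r = 0" by (metis degree_1 degree_mult_eq one_neq_zero add_is_0 mult_zero_left mult_zero_right)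
  then obtain a where "r = [:a:]" by (metis degree_eq_zeroE)
  then show ?thesis using r nz by auto
qed

subsection \<open>Commutativity and the center\<close>

lemma coeff_D1: "poly.coeff D1 (p ^ s) = d s"
proof -
  have "poly.coeff D1 (p ^ s) = (\<Sum>t \<in> {s. d s \<noteq> 0}. if s = t then d t else 0)"
    unfolding D1_def using p_gt_1 by (auto simp: coeff_sum intro!: sum.cong)
  then show ?thesis using finite_support by (simp add: sum.delta')
qed

lemma D1_eq_0_iff: "D1 = 0 \<longleftrightarrow> (\<forall>s. d s = 0)"
proof
  assume "D1 = 0"
  then show "\<forall>s. d s = 0" using coeff_D1 by (metis coeff_0)
qed (simp add: D1_def)

lemma of_nat_p [simp]: "(of_nat p :: 'k) = 0" "(of_nat p :: 'k poly) = 0"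
  using of_nat_CHAR[where 'a = 'k] by (simp_all add: of_nat_poly char_p)

lemma of_nat_eq_0: "(of_nat n :: 'k) = 0 \<longleftrightarrow> p dvd n"
  using of_nat_eq_0_iff_char_dvd[where 'a = 'k] by (simp add: char_p)

text \<open>The monomials X^(p^s) with s > 0 have derivative zero. Consequently D1 is an eigenvector
  of \<delta> with eigenvalue d_0, which produces the powers of d_0 in the center.\<close>

lemma pderiv_D1: "pderiv D1 = [:d 0:]"
proof -
  have *: "pderiv (Polynomial.monom (d s) (p ^ s)) = (if s = 0 then [:d 0:] else 0)" for s
    by (cases s) (simp_all add: pderiv_monom monom_0)
  have "pderiv (sum f S) = (\<Sum>s\<in>S. pderiv (f s))" for f :: "nat \<Rightarrow> 'k poly" and S
    by (induction S rule: infinite_finite_induct) (simp_all add: pderiv_add)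
  then have "pderiv D1 = (\<Sum>s \<in> {s. d s \<noteq> 0}. pderiv (Polynomial.monom (d s) (p ^ s)))"
    by (simp add: D1_def)
  also have "\<dots> = (\<Sum>s \<in> {s. d s \<noteq> 0}. if s = 0 then [:d 0:] else 0)"
    unfolding * ..
  also have "\<dots> = [:d 0:]" using finite_support by (simp add: sum.delta)
  finally show ?thesis .
qed

lemma \<delta>_D1: "\<delta> D1 = Polynomial.smult (d 0) D1"
  by (simp add: \<delta>_eq pderiv_D1)

lemma \<delta>_pow_X: "(\<delta> ^^ Suc n) [:0, 1:] = Polynomial.smult (d 0 ^ n) D1"
  by (induction n) (simp_all add: \<delta>_smult \<delta>_D1 mult.commute)

lemma hmul_commutative: 
  assumes "\<forall>s. d s = 0"
  shows "f \<star> g = f * g"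
proof -
  have D: "D1 = 0" using assms D1_eq_0_iff by simp
  have "Y g = pCons 0 g" for g
    by (rule poly_eqI) (auto simp: Y_coeff \<delta>_eq D coeff_pCons split: nat.splits)
  then have Yg: "(Y ^^ i) g = Polynomial.monom 1 i * g" for i
    by (induction i) (simp_all add: monom_Suc)
  have "f \<star> g = (\<Sum>i\<le>degree f. Polynomial.monom (poly.coeff f i) i) * g"
    by (simp add: hmul_def Yg sum_distrib_right smult_monom_mult[symmetric] flip: mult_smult_left) (simp add: smult_monom)
  then show ?thesis by (simp add: poly_as_sum_of_monoms)
qed

lemma cring_iff: "cring H \<longleftrightarrow> (\<forall>s. d s = 0)"
proof
  assume "cring H"
  then have "X2 \<star> X1 = X1 \<star> X2"
    by (simp add: cring_def comm_monoid_def comm_monoid_axioms_def)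
  then show "\<forall>s. d s = 0" using X2_X1 D1_eq_0_iff by simp
next
  assume d0: "\<forall>s. d s = 0"
  show "cring H"
    by (rule cring.intro[OF H.ring_axioms]) (unfold_locales, simp add: hmul_commutative[OF d0] mult.commute)
qed

section \<open>Central elements and the generators of the center\<close>

abbreviation "Z \<equiv> ring_center H"

definition zp :: "'k poly poly" where "zp = Polynomial.monom 1 p - Polynomial.smult [:d 0 ^ (p - 1):] X2"

lemma Z_iff: "z \<in> Z \<longleftrightarrow> (\<forall>f. z \<star> f = f \<star> z)"
  by (simp add: ring_center_def)

lemma Z_add: "y \<in> Z \<Longrightarrow> z \<in> Z \<Longrightarrow> y + z \<in> Z"
  by (simp add: Z_iff hmul_add_left hmul_add_right)

lemma Z_diff: "y \<in> Z \<Longrightarrow> z \<in> Z \<Longrightarrow> y - z \<in> Z"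
  by (simp add: Z_iff hmul_diff_left hmul_diff_right)

lemma Z_mult: "y \<in> Z \<Longrightarrow> z \<in> Z \<Longrightarrow> y \<star> z \<in> Z"
  by (metis Z_iff hmul_assoc)

lemma Z_scal: "z \<in> Z \<Longrightarrow> Polynomial.smult [:a:] z \<in> Z"
  by (simp add: Z_iff hmul_scal)

lemma Z_one: "1 \<in> Z" by (simp add: Z_iff)

lemma Z_zero: "0 \<in> Z" by (simp add: Z_iff)

lemma central_if_commutes:
  assumes "z \<star> X1 = X1 \<star> z" "z \<star> X2 = X2 \<star> z"
  shows "z \<in> Z"
proof -
  have "z \<star> f = f \<star> z" for f
  proof (induction f rule: H_induct)
    case (mult f g)
    then show ?case by (metis hmul_assoc)
  qed (simp_all add: assms hmul_add_left hmul_add_right hmul_scal)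
  then show ?thesis by (simp add: Z_iff)
qed

lemma map_\<delta>_eq_0_iff: "map_poly \<delta> f = 0 \<longleftrightarrow> (\<forall>i. \<delta> (poly.coeff f i) = 0)"
  by (simp add: poly_eq_iff coeff_map_poly)

lemma const_central: "pderiv r = 0 \<Longrightarrow> [:r:] \<in> Z"
proof (rule central_if_commutes)
  assume "pderiv r = 0"
  then have "map_poly \<delta> [:r:] = 0" by (simp add: map_poly_pCons \<delta>_eq)
  then show "[:r:] \<star> X2 = X2 \<star> [:r:]" using X2_commutator[of "[:r:]"] by simp
qed (simp add: X1_def hmul_const_left mult.commute)

lemma X1p_central: "[:Polynomial.monom 1 p:] \<in> Z"
  by (rule const_central) (simp add: pderiv_monom)

text \<open>In the Leibniz rule for X2^p the inner binomial coefficients are divisible by p, so only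
  X1 X2^p and \<delta>^p(X1) remain. The latter is d_0^(p-1) D1, the same commutator that d_0^(p-1)
  X2 has with X1; \<open>zp\<close> is the difference.\<close>

lemma X2_pow_X1: "Polynomial.monom 1 p \<star> X1 = Polynomial.monom [:0, 1:] p + [:Polynomial.smult (d 0 ^ (p - 1)) D1:]"
proof (rule poly_eqI)
  fix j
  have "Polynomial.monom 1 p \<star> X1 = (Y ^^ p) X1"
    by (simp add: hmul_superset[OF degree_monom_le] if_distrib[of "\<lambda>c. Polynomial.smult c _"] cong: if_cong)
  then have "poly.coeff (Polynomial.monom 1 p \<star> X1) j = (if j \<le> p then of_nat (p choose j) * (\<delta> ^^ (p - j)) [:0, 1:] else 0)"
    by (simp add: X1_def Y_pow_coeff)
  moreover have "(of_nat (p choose j) :: 'k poly) = 0" if "0 < j" "j < p"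
    using dvd_choose_prime[of j p] that prime_p by (simp add: of_nat_poly of_nat_eq_0)
  moreover have "(\<delta> ^^ p) [:0, 1:] = Polynomial.smult (d 0 ^ (p - 1)) D1"
    using \<delta>_pow_X[of "p - 1"] p_gt_1 by simp
  ultimately show "poly.coeff (Polynomial.monom 1 p \<star> X1) j =
      poly.coeff (Polynomial.monom [:0, 1:] p + [:Polynomial.smult (d 0 ^ (p - 1)) D1:]) j"
    using p_gt_1 by (cases "j = 0"; cases "j = p"; cases "j < p") (auto simp: coeff_pCons split: nat.splits)
qed

lemma zp_central: "zp \<in> Z"
proof (rule central_if_commutes)
  have "X1 \<star> Polynomial.monom 1 p = Polynomial.monom [:0, 1:] p"
    by (simp add: X1_left smult_monom)
  then show "zp \<star> X1 = X1 \<star> zp"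
    by (simp add: zp_def hmul_diff_left hmul_diff_right hmul_scal X2_pow_X1 X2_X1 smult_add_right)
  have "map_poly \<delta> zp = 0"
    by (auto simp: map_\<delta>_eq_0_iff zp_def X2_def coeff_pCons \<delta>_diff split: nat.splits)
  then show "zp \<star> X2 = X2 \<star> zp" using X2_commutator[of zp] by simp
qed

lemma zp_degree: "degree zp = p" "poly.coeff zp p = 1"
proof -
  have "poly.coeff (X2 :: 'k poly poly) p = 0" using p_gt_1 by (intro coeff_eq_0) (simp add: X2_def)
  then show c: "poly.coeff zp p = 1" unfolding zp_def coeff_diff coeff_smult by simp
  have "degree zp \<le> p"
    unfolding zp_def using p_gt_1
    by (intro degree_diff_le degree_monom_le) (auto simp: X2_def intro: order.trans[OF degree_smult_le])
  then show "degree zp = p" using c by (intro antisym le_degree) auto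
qed

lemma zp_pow: "zp [^]\<^bsub>H\<^esub> n \<noteq> 0 \<and> degree (zp [^]\<^bsub>H\<^esub> n) = p * n \<and> lead_coeff (zp [^]\<^bsub>H\<^esub> n) = 1"
proof (induction n)
  case (Suc n)
  have "zp \<noteq> 0" using zp_degree by auto
  moreover have "poly.coeff (zp [^]\<^bsub>H\<^esub> n) (p * n) = 1" using Suc by auto
  ultimately show ?case using Suc hmul_nonzero[of "zp [^]\<^bsub>H\<^esub> n" zp] zp_degree by simp
qed simp

lemma zp_pow_coeff: "poly.coeff (zp [^]\<^bsub>H\<^esub> n) (p * n) = 1"
  using zp_pow[of n] by metis

text \<open>Only the summand of X2^(n+1) that loses exactly one power of X2 contributes; the
  contributions of the coefficient at n to the two products cancel.\<close>

lemma commutator_X1_coeff: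
  assumes "degree f \<le> Suc n"
  shows "poly.coeff (f \<star> X1 - X1 \<star> f) n = of_nat (Suc n) * poly.coeff f (Suc n) * D1"
proof -
  have "poly.coeff (f \<star> X1) n = (\<Sum>i\<le>Suc n. poly.coeff f i * poly.coeff ((Y ^^ i) X1) n)"
    by (simp add: hmul_superset[OF assms] coeff_sum)
  also have "\<dots> = (\<Sum>i<n. poly.coeff f i * poly.coeff ((Y ^^ i) X1) n) +
      poly.coeff f n * poly.coeff ((Y ^^ n) X1) n + poly.coeff f (Suc n) * poly.coeff ((Y ^^ Suc n) X1) n"
    by (simp add: lessThan_Suc_atMost[symmetric])
  also have "(\<Sum>i<n. poly.coeff f i * poly.coeff ((Y ^^ i) X1) n) = 0"
    by (rule sum.neutral) (simp add: X1_def Y_pow_coeff)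
  finally have "poly.coeff (f \<star> X1) n = [:0, 1:] * poly.coeff f n + of_nat (Suc n) * poly.coeff f (Suc n) * D1"
    by (simp add: X1_def Y_pow_coeff del: funpow.simps) (simp add: algebra_simps)
  then show ?thesis by (simp add: X1_left)
qed

lemma pderiv_eq_0D:
  assumes "pderiv r = (0 :: 'k poly)" "\<not> p dvd j"
  shows "poly.coeff r j = 0"
proof (cases j)
  case (Suc i)
  have "of_nat (Suc i) * poly.coeff r (Suc i) = 0"
    using arg_cong[OF assms(1), of "\<lambda>q. poly.coeff q i"] by (simp add: coeff_pderiv)
  then show ?thesis using assms(2) Suc of_nat_eq_0[of "Suc i"] by (simp del: of_nat_Suc)
qed (use assms(2) in simp)

text \<open>Commuting with X1 annihilates degree times leading coefficient times D1, and commuting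
  with X2 annihilates \<delta> of the leading coefficient. Since D1 is nonzero, both the degree and
  the exponents in the leading coefficient are multiples of p.\<close>

lemma central_lead:
  assumes D: "D1 \<noteq> 0" and f: "f \<in> Z"
  shows "f = 0 \<or> p dvd degree f" "pderiv (lead_coeff f) = 0"
proof -
  have "map_poly \<delta> f = 0" using X2_commutator[of f] f by (simp add: Z_iff)
  then have "\<delta> (lead_coeff f) = 0" by (simp add: map_\<delta>_eq_0_iff)
  then show "pderiv (lead_coeff f) = 0" using D by (simp add: \<delta>_eq)
  show "f = 0 \<or> p dvd degree f"
  proof (cases "degree f")
    case (Suc n)
    then have "of_nat (Suc n) * poly.coeff f (Suc n) * D1 = 0"
      using commutator_X1_coeff[of f n] f by (simp add: Z_iff)
    moreover have "f \<noteq> 0" using Suc by auto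
    ultimately have "(of_nat (Suc n) :: 'k poly) = 0" using D Suc by (metis leading_coeff_0_iff mult_eq_0_iff)
    then show ?thesis using Suc of_nat_eq_0[of "Suc n"] by (simp add: of_nat_poly del: of_nat_Suc)
  qed simp
qed

text \<open>Generation of the center in the shape of an induction rule: the leading term of a
  central element is removed by a central constant times a power of the monic element
  \<open>zp\<close>, and the degree drops.\<close>

lemma central_induct [consumes 2, case_names one X1p zp add scal mult]:
  assumes D: "D1 \<noteq> 0" and f: "f \<in> Z"
    and one: "Q 1" and X1p: "Q [:Polynomial.monom 1 p:]" and zp: "Q zp" and add: "\<And>f g. Q f \<Longrightarrow> Q g \<Longrightarrow> Q (f + g)"
    and scal: "\<And>a f. Q f \<Longrightarrow> Q (Polynomial.smult [:a:] f)" and mult: "\<And>f g. Q f \<Longrightarrow> Q g \<Longrightarrow> Q (f \<star> g)"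
  shows "Q f"
proof -
  have zero: "Q 0" using scal[OF one, of 0] by simp
  have pow: "Q (g [^]\<^bsub>H\<^esub> n)" if "Q g" for g and n :: nat
    by (induction n) (use one mult that in auto)
  have const: "Q [:r:]" if "pderiv r = 0" for r
  proof -
    have m: "Q [:Polynomial.monom (poly.coeff r i) i:]" for i
    proof (cases "p dvd i")
      case True
      then obtain k where k: "i = p * k" by blast
      have "[:Polynomial.monom 1 p:] [^]\<^bsub>H\<^esub> n = [:Polynomial.monom 1 (p * n):]" for n
        by (induction n) (simp_all add: one_pCons hmul_const_left mult_monom add.commute)
      then have "[:Polynomial.monom (poly.coeff r i) i:] = Polynomial.smult [:poly.coeff r i:] ([:Polynomial.monom 1 p:] [^]\<^bsub>H\<^esub> k)"
        by (simp add: k smult_monom)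
      then show ?thesis using scal[OF pow[OF X1p]] by simp
    next
      case False
      then show ?thesis using pderiv_eq_0D[OF that] zero by simp
    qed
    have "Q [:\<Sum>i\<in>S. Polynomial.monom (poly.coeff r i) i:]" if "finite S" for S
      using that
    proof (induction S rule: finite_induct)
      case (insert x S)
      then show ?case using add[OF m[of x] insert.IH] by simp
    qed (simp add: zero)
    from this[of "{..degree r}"] show ?thesis by (simp add: poly_as_sum_of_monoms)
  qed
  show ?thesis
    using f
  proof (induction "degree f" arbitrary: f rule: less_induct)
    case less
    show ?case
    proof (cases "f = 0")
      case True
      then show ?thesis using zero by simp
    next
      case False
      then obtain m where m: "degree f = p * m" using central_lead(1)[OF D less.prems] by blast
      \<comment> \<open>This has the same degree and leading coefficient as f and is central, so the
        difference is central of smaller degree.\<close>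
      let ?t = "[:lead_coeff f:] \<star> (zp [^]\<^bsub>H\<^esub> m)"
      have c: "[:lead_coeff f:] \<noteq> 0" using False by simp
      note t = hmul_nonzero[OF c, of "zp [^]\<^bsub>H\<^esub> m"]
      have tZ: "?t \<in> Z"
      proof -
        have "zp [^]\<^bsub>H\<^esub> m \<in> Z" by (induction m) (simp_all add: Z_one Z_mult zp_central)
        then show ?thesis using Z_mult const_central[OF central_lead(2)[OF D less.prems]] by blast
      qed
      have Qt: "Q ?t" by (intro mult const pow zp central_lead(2)[OF D less.prems])
      have Qd: "Q (f - ?t)"
      proof (cases "f - ?t = 0")
        case False
        have "degree (f - ?t) \<le> degree f" using t zp_pow[of m] m by (intro degree_diff_le) auto
        moreover have "poly.coeff (f - ?t) (degree f) = 0" using t(2,3) zp_pow[of m] zp_pow_coeff[of m] m by simp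
        ultimately have "degree (f - ?t) < degree f"
          using False by (metis le_neq_implies_less leading_coeff_0_iff)
        then show ?thesis by (rule less.hyps) (rule Z_diff[OF less.prems tZ])
      qed (simp add: zero)
      show ?thesis using add[OF Qd Qt] by simp
    qed
  qed
qed

lemma center_eq:
  assumes D: "D1 \<noteq> 0"
  shows "Z = generated_subalgebra H {X1 [^]\<^bsub>H\<^esub> p, X2 [^]\<^bsub>H\<^esub> p \<ominus>\<^bsub>H\<^esub> (d 0 ^ (p - 1)) \<odot>\<^bsub>H\<^esub> X2}" (is "_ = generated_subalgebra H ?G")
proof
  have G: "?G = {[:Polynomial.monom 1 p:], zp}"
    by (simp add: X1_pow X2_pow zp_def)
  let ?S = "range (\<lambda>r. r \<odot>\<^bsub>H\<^esub> \<one>\<^bsub>H\<^esub>) \<union> ?G"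
  show "Z \<subseteq> generated_subalgebra H ?G"
  proof
    fix f assume "f \<in> Z"
    with D show "f \<in> generated_subalgebra H ?G"
      unfolding generated_subalgebra_def
    proof (induction f rule: central_induct)
      case one
      show ?case using generate_ring.one[of H ?S] by simp
    next
      case X1p
      show ?case by (rule generate_ring.incl, unfold G, blast)
    next
      case zp
      show ?case by (rule generate_ring.incl, unfold G, blast)
    next
      case (add f g)
      then show ?case using generate_ring.eng_add[of f H ?S g] by simp
    next
      case (scal a f)
      have "a \<odot>\<^bsub>H\<^esub> \<one>\<^bsub>H\<^esub> \<in> generate_ring H ?S" by (rule generate_ring.incl) blast
      from generate_ring.eng_mult[OF this scal] show ?case by (simp add: hmul_const_left)
    next
      case (mult f g)
      then show ?case by (rule generate_ring.eng_mult)
    qed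
  qed
  show "generated_subalgebra H ?G \<subseteq> Z"
  proof
    fix f assume "f \<in> generated_subalgebra H ?G"
    then show "f \<in> Z"
      unfolding generated_subalgebra_def
    proof (induction rule: generate_ring.induct)
      case (incl h)
      then show ?case unfolding G using Z_scal[OF Z_one] X1p_central zp_central by auto
    next
      case (a_inv h)
      then show ?case using Z_diff[OF Z_zero, of h] by simp
    qed (use Z_one Z_add Z_mult in auto)
  qed
qed

end

context hoe
begin

subsection \<open>\<open>H\<close> is free of rank \<open>p\<^sup>2\<close> over its center\<close>

text \<open>The two base p digits of n < p^2 are the exponents of X1 and X2, which turns the p
  \<times> p monomials into one list.\<close>

definition basis :: "nat \<Rightarrow> 'k poly poly"
  where "basis n = Polynomial.monom (Polynomial.monom 1 (n mod p)) (n div p)"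

text \<open>The exponents of the lexicographically leading monomials of the summands determine these
  summands, hence there is no cancellation between them.\<close>

lemma sum_distinct_leading:
  fixes g :: "'i \<Rightarrow> 'k poly poly"
  assumes N: "finite N" "N \<noteq> {}" and nz: "\<And>n. n \<in> N \<Longrightarrow> g n \<noteq> 0"
    and inj: "inj_on (\<lambda>n. (degree (g n), degree (lead_coeff (g n)))) N"
  shows "sum g N \<noteq> 0"
proof -
  define D where "D = Max ((\<lambda>n. degree (g n)) ` N)"
  let ?M = "{n \<in> N. degree (g n) = D}"
  have "D \<in> (\<lambda>n. degree (g n)) ` N" unfolding D_def using N by (intro Max_in) auto
  then have M: "finite ?M" "?M \<noteq> {}" using N by auto
  define E where "E = Max ((\<lambda>n. degree (lead_coeff (g n))) ` ?M)"
  have "E \<in> (\<lambda>n. degree (lead_coeff (g n))) ` ?M" unfolding E_def using M by (intro Max_in) auto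
  then obtain m where m: "m \<in> N" "degree (g m) = D" "degree (lead_coeff (g m)) = E" by auto
  have le_D: "degree (g n) \<le> D" if "n \<in> N" for n using N that by (simp add: D_def)
  have le_E: "degree (lead_coeff (g n)) \<le> E" if "n \<in> N" "degree (g n) = D" for n
    unfolding E_def using M that by (intro Max_ge) auto
  have "poly.coeff (poly.coeff (sum g N) D) E = (\<Sum>n\<in>N. poly.coeff (poly.coeff (g n) D) E)"
    by (simp add: coeff_sum)
  also have "\<dots> = (\<Sum>n\<in>{m}. poly.coeff (poly.coeff (g n) D) E)"
  proof (rule sum.mono_neutral_right)
    show "\<forall>n\<in>N - {m}. poly.coeff (poly.coeff (g n) D) E = 0"
    proof
      fix n assume n: "n \<in> N - {m}"
      then have "(degree (g n), degree (lead_coeff (g n))) \<noteq> (D, E)"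
        using inj m by (auto simp: inj_on_def)
      then consider "degree (g n) < D" | "degree (g n) = D" "degree (lead_coeff (g n)) < E"
        using le_D[of n] le_E[of n] n by fastforce
      then show "poly.coeff (poly.coeff (g n) D) E = 0"
        by cases (auto simp: coeff_eq_0)
    qed
  qed (use N m in auto)
  also have "\<dots> = lead_coeff (lead_coeff (g m))" using m by simp
  also have "\<dots> \<noteq> 0" using nz[OF m(1)] by simp
  finally show ?thesis by auto
qed

text \<open>A central factor has both leading exponents divisible by p, so the residues modulo p of
  the exponents of the product recover n. Distinct basis elements therefore cannot cancel each
  other.\<close>

lemma central_basis_leading:
  assumes D: "D1 \<noteq> 0" and c: "c \<in> Z" "c \<noteq> 0" and n: "n < p\<^sup>2"
  shows "degree (c \<star> basis n) mod p = n div p" "degree (lead_coeff (c \<star> basis n)) mod p = n mod p"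
    "c \<star> basis n \<noteq> 0"
proof -
  have np: "n div p < p" using n char_pos by (simp add: less_mult_imp_div_less power2_eq_square)
  have b: "basis n \<noteq> 0" "degree (basis n) = n div p" "lead_coeff (basis n) = Polynomial.monom 1 (n mod p)"
    unfolding basis_def by (simp_all add: degree_monom_eq)
  show "c \<star> basis n \<noteq> 0" using hmul_nonzero(1)[OF c(2) b(1)] .
  have "p dvd degree c" using central_lead(1)[OF D c(1)] c(2) by simp
  then show "degree (c \<star> basis n) mod p = n div p"
    using hmul_nonzero(2)[OF c(2) b(1)] b(2) np by (auto simp: dvd_def)
  have l: "lead_coeff c \<noteq> 0" using c by simp
  have "poly.coeff (lead_coeff c) (degree (lead_coeff c)) \<noteq> 0" using c by simp
  then have "p dvd degree (lead_coeff c)" using pderiv_eq_0D[OF central_lead(2)[OF D c(1)]] by blast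
  moreover have "degree (lead_coeff (c \<star> basis n)) = degree (lead_coeff c) + n mod p"
    unfolding hmul_nonzero(3)[OF c(2) b(1)] b(3) using l by (simp add: degree_mult_eq degree_monom_eq)
  ultimately show "degree (lead_coeff (c \<star> basis n)) mod p = n mod p"
    by (auto simp: dvd_def)
qed

lemma basis_independent:
  assumes D: "D1 \<noteq> 0" and c: "\<And>n. n < p\<^sup>2 \<Longrightarrow> c n \<in> Z" and sum: "(\<Sum>n<p\<^sup>2. c n \<star> basis n) = 0" and n: "n < p\<^sup>2"
  shows "c n = 0"
proof (rule ccontr)
  assume "c n \<noteq> 0"
  let ?N = "{n. n < p\<^sup>2 \<and> c n \<noteq> 0}"
  have "(\<Sum>n\<in>?N. c n \<star> basis n) = (\<Sum>n<p\<^sup>2. c n \<star> basis n)"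
    by (rule sum.mono_neutral_left) auto
  moreover have "(\<Sum>n\<in>?N. c n \<star> basis n) \<noteq> 0"
  proof (rule sum_distinct_leading)
    show "?N \<noteq> {}" using n \<open>c n \<noteq> 0\<close> by auto
    show "inj_on (\<lambda>n. (degree (c n \<star> basis n), degree (lead_coeff (c n \<star> basis n)))) ?N"
    proof (rule inj_onI)
      fix m n assume mn: "m \<in> ?N" "n \<in> ?N"
        and eq: "(degree (c m \<star> basis m), degree (lead_coeff (c m \<star> basis m))) =
          (degree (c n \<star> basis n), degree (lead_coeff (c n \<star> basis n)))"
      have "m div p = n div p" "m mod p = n mod p"
        using central_basis_leading(1,2)[OF D c, of m m] central_basis_leading(1,2)[OF D c, of n n] mn eq by auto
      then show "m = n" by (metis div_mult_mod_eq)
    qed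
    show "c n \<star> basis n \<noteq> 0" if "n \<in> ?N" for n
      using central_basis_leading(3)[OF D c] that by auto
  qed simp
  ultimately show False using sum by simp
qed

definition basis_span :: "'k poly poly set"
  where "basis_span = {f. \<exists>c. (\<forall>n. c n \<in> Z) \<and> f = (\<Sum>n<p\<^sup>2. c n \<star> basis n)}"

lemma span_add: "f \<in> basis_span \<Longrightarrow> g \<in> basis_span \<Longrightarrow> f + g \<in> basis_span"
proof -
  assume "f \<in> basis_span" "g \<in> basis_span"
  then obtain c e where "\<forall>n. c n \<in> Z" "f = (\<Sum>n<p\<^sup>2. c n \<star> basis n)"
    "\<forall>n. e n \<in> Z" "g = (\<Sum>n<p\<^sup>2. e n \<star> basis n)" unfolding basis_span_def by blast
  then show ?thesis
    unfolding basis_span_def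
    by (auto intro!: exI[of _ "\<lambda>n. c n + e n"] simp: Z_add hmul_add_left sum.distrib)
qed

lemma span_mult: "z \<in> Z \<Longrightarrow> f \<in> basis_span \<Longrightarrow> z \<star> f \<in> basis_span"
proof -
  assume z: "z \<in> Z" and "f \<in> basis_span"
  then obtain c where c: "\<forall>n. c n \<in> Z" "f = (\<Sum>n<p\<^sup>2. c n \<star> basis n)" unfolding basis_span_def by blast
  have "z \<star> (\<Sum>n\<in>S. g n) = (\<Sum>n\<in>S. z \<star> g n)" for g :: "nat \<Rightarrow> _" and S
    by (induction S rule: infinite_finite_induct) (simp_all add: hmul_add_right)
  with c z show ?thesis
    unfolding basis_span_def
    by (auto intro!: exI[of _ "\<lambda>n. z \<star> c n"] simp: Z_mult hmul_assoc)
qed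

lemma span_zero: "0 \<in> basis_span"
  unfolding basis_span_def using Z_zero by (auto intro!: exI[of _ "\<lambda>_. 0"])

lemma span_scal: "f \<in> basis_span \<Longrightarrow> Polynomial.smult [:a:] f \<in> basis_span"
  using span_mult[OF Z_scal[OF Z_one], of f a] by (simp add: hmul_const_left)

lemma span_basis: 
  assumes "n < p\<^sup>2"
  shows "basis n \<in> basis_span"
proof -
  have "(\<Sum>m<p\<^sup>2. (if m = n then 1 else 0) \<star> basis m) = (\<Sum>m<p\<^sup>2. if m = n then basis m else 0)"
    by (intro sum.cong) auto
  also have "\<dots> = basis n" using assms by simp
  finally show ?thesis
    unfolding basis_span_def using Z_one Z_zero by (auto intro!: exI[of _ "\<lambda>m. if m = n then 1 else 0"])
qed

lemma span_monom_small:
  assumes "i < p"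
  shows "Polynomial.monom (Polynomial.monom 1 i) b \<in> basis_span"
proof (induction b rule: less_induct)
  case (less b)
  show ?case
  proof (cases "b < p")
    case True
    have "b * p + i < p * p"
      using mult_le_mono1[of "Suc b" p p] True assms by (simp add: algebra_simps)
    then show ?thesis
      using span_basis[of "b * p + i"] assms by (simp add: basis_def power2_eq_square)
  next
    case False
    let ?m = "\<lambda>b. Polynomial.monom (Polynomial.monom 1 i) b :: 'k poly poly"
    have m: "Polynomial.monom 1 j * ?m e = ?m (j + e)" for j e by (simp add: mult_monom)
    \<comment> \<open>Multiplying by \<open>zp\<close> raises the exponent by p and leaves only the
      exponent b - p + 1 besides b; both b - p and b - p + 1 are below b because p > 1.\<close>
    have "?m (b - p) \<star> zp = ?m b - Polynomial.smult [:d 0 ^ (p - 1):] (?m (b - p + 1))"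
      unfolding zp_def hmul_diff_right hmul_scal hmul_monom_right m X2_right
      using False by (simp add: monom_Suc)
    then have "?m b = zp \<star> ?m (b - p) + Polynomial.smult [:d 0 ^ (p - 1):] (?m (b - p + 1))"
      using zp_central by (simp add: Z_iff)
    moreover have "b - p < b" "b - p + 1 < b" using False p_gt_1 by auto
    ultimately show ?thesis
      using span_add[OF span_mult[OF zp_central less] span_scal[OF less]] by metis
  qed
qed

lemma span_monom: "Polynomial.monom (Polynomial.monom 1 a) b \<in> basis_span"
proof -
  have "Polynomial.monom (Polynomial.monom 1 a) b =
      [:Polynomial.monom 1 (a div p * p):] \<star> Polynomial.monom (Polynomial.monom 1 (a mod p)) b"
    by (simp add: hmul_const_left smult_monom mult_monom)
  moreover have "[:Polynomial.monom 1 (a div p * p):] \<in> Z"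
    by (rule const_central) (simp add: pderiv_monom)
  ultimately show ?thesis using span_mult span_monom_small char_pos by simp
qed

lemma span_all: "f \<in> basis_span"
proof -
  have 1: "Polynomial.monom r b \<in> basis_span" for r b
  proof -
    have "Polynomial.monom (\<Sum>i\<in>S. Polynomial.monom (poly.coeff r i) i) b \<in> basis_span" for S
    proof (induction S rule: infinite_finite_induct)
      case (insert i S)
      have "Polynomial.monom (Polynomial.monom (poly.coeff r i) i) b =
          Polynomial.smult [:poly.coeff r i:] (Polynomial.monom (Polynomial.monom 1 i) b)"
        by (simp add: smult_monom)
      then show ?case using insert span_add[OF span_scal[OF span_monom]] by (simp add: add_monom[symmetric])
    qed (simp_all add: span_zero)
    from this[of "{..degree r}"] show ?thesis by (simp add: poly_as_sum_of_monoms)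
  qed
  have "(\<Sum>i\<in>S. Polynomial.monom (poly.coeff f i) i) \<in> basis_span" for S
    by (induction S rule: infinite_finite_induct) (simp_all add: span_zero span_add 1)
  from this[of "{..degree f}"] show ?thesis by (simp add: poly_as_sum_of_monoms)
qed

subsection \<open>The ring of fractions with central denominators\<close>

text \<open>The fraction a/s as the set of all pairs (b, t) with b/t = a/s. Denominators are nonzero
  and central, so no Ore condition is needed to calculate; sets of pairs are the type demanded by
  \<open>has_PI_degree\<close>.\<close>

definition fr :: "'k poly poly \<Rightarrow> 'k poly poly \<Rightarrow> ('k poly poly \<times> 'k poly poly) set"
  where "fr a s = {(b, t). t \<in> Z - {0} \<and> b \<star> s = a \<star> t}"

definition Q :: "('k poly poly \<times> 'k poly poly) set ring"
  where "Q = \<lparr>carrier = {fr a s | a s. s \<in> Z - {0}},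
    mult = (\<lambda>X Y. \<Union>(a, s)\<in>X. \<Union>(b, t)\<in>Y. fr (a \<star> b) (s \<star> t)),
    one = fr 1 1, zero = fr 0 1,
    add = (\<lambda>X Y. \<Union>(a, s)\<in>X. \<Union>(b, t)\<in>Y. fr (a \<star> t + b \<star> s) (s \<star> t))\<rparr>"

lemma hmul_cancel: "c \<noteq> 0 \<Longrightarrow> a \<star> c = b \<star> c \<longleftrightarrow> a = b" "c \<noteq> 0 \<Longrightarrow> c \<star> a = c \<star> b \<longleftrightarrow> a = b"
  using hmul_eq_0_iff[of "a - b" c] hmul_eq_0_iff[of c "a - b"] by (auto simp: hmul_diff_left hmul_diff_right)

lemma Z_comm: "z \<in> Z \<Longrightarrow> f \<star> z = z \<star> f"
  by (simp add: Z_iff)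

lemma Z_left_comm: "z \<in> Z \<Longrightarrow> f \<star> (z \<star> g) = z \<star> (f \<star> g)"
  by (metis Z_comm hmul_assoc)

lemma S_mult: "s \<in> Z - {0} \<Longrightarrow> t \<in> Z - {0} \<Longrightarrow> s \<star> t \<in> Z - {0}"
  using Z_mult[of s t] hmul_eq_0_iff[of s t] by auto

text \<open>The operations of \<open>Q\<close> are unions over all representatives. If the result
  does not depend on the representatives, the union collapses; this is how well-definedness
  enters.\<close>

lemma UN_pairs_eq:
  assumes "\<And>a s b t. \<lbrakk>(a, s) \<in> X; (b, t) \<in> W\<rbrakk> \<Longrightarrow> g a s b t = C" "(a, s) \<in> X" "(b, t) \<in> W"
  shows "(\<Union>(a, s)\<in>X. \<Union>(b, t)\<in>W. g a s b t) = C"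
proof -
  have "(\<Union>(a, s)\<in>X. \<Union>(b, t)\<in>W. g a s b t) = (\<Union>x\<in>X. \<Union>y\<in>W. C)"
    using assms(1) by (intro SUP_cong refl) (auto split: prod.splits)
  then show ?thesis using assms(2,3) by auto
qed

lemma fr_mem: "s \<in> Z - {0} \<Longrightarrow> (b, t) \<in> fr a s \<longleftrightarrow> t \<in> Z - {0} \<and> b \<star> s = a \<star> t"
  by (simp add: fr_def)

lemma fr_eq:
  assumes s: "s \<in> Z - {0}" and t: "t \<in> Z - {0}"
  shows "fr a s = fr b t \<longleftrightarrow> a \<star> t = b \<star> s"
proof
  assume "fr a s = fr b t"
  moreover have "(a, s) \<in> fr a s" using s by (simp add: fr_def)
  ultimately show "a \<star> t = b \<star> s" by (simp add: fr_def)
next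
  assume eq: "a \<star> t = b \<star> s"
  have sub: "fr a s \<subseteq> fr b t" if s: "s \<in> Z - {0}" and t: "t \<in> Z - {0}" and eq: "a \<star> t = b \<star> s" for a b s t
  proof
    fix x assume "x \<in> fr a s"
    then obtain e u where x: "x = (e, u)" "u \<in> Z - {0}" "e \<star> s = a \<star> u" by (auto simp: fr_def)
    have "e \<star> t \<star> s = e \<star> s \<star> t" using s t by (simp add: hmul_assoc Z_comm)
    also have "\<dots> = a \<star> t \<star> u" using x s t by (simp add: hmul_assoc Z_comm)
    also have "\<dots> = b \<star> u \<star> s" using eq x s by (simp add: hmul_assoc Z_comm)
    finally have "e \<star> t = b \<star> u" using s hmul_cancel(1)[of s] by simp
    then show "x \<in> fr b t" using x by (simp add: fr_def)
  qed
  show "fr a s = fr b t" using sub[OF s t eq] sub[OF t s eq[symmetric]] by blast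
qed

lemma fr_expand: "\<lbrakk>s \<in> Z - {0}; t \<in> Z - {0}\<rbrakk> \<Longrightarrow> fr a s = fr (a \<star> t) (s \<star> t)"
  using S_mult[of s t] by (subst fr_eq) (auto simp: hmul_assoc Z_comm)

lemma Q_simps: "carrier Q = {fr a s | a s. s \<in> Z - {0}}" "\<one>\<^bsub>Q\<^esub> = fr 1 1" "\<zero>\<^bsub>Q\<^esub> = fr 0 1"
  by (simp_all add: Q_def)

lemma one_S: "1 \<in> Z - {0}" using Z_one by simp

lemma fr_mult:
  assumes s: "s \<in> Z - {0}" and t: "t \<in> Z - {0}"
  shows "fr a s \<otimes>\<^bsub>Q\<^esub> fr b t = fr (a \<star> b) (s \<star> t)"
proof -
  have "fr (a' \<star> b') (s' \<star> t') = fr (a \<star> b) (s \<star> t)" if "(a', s') \<in> fr a s" "(b', t') \<in> fr b t" for a' s' b' t'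
  proof (subst fr_eq)
    have 1: "s' \<in> Z - {0}" "t' \<in> Z - {0}" "a' \<star> s = a \<star> s'" "b' \<star> t = b \<star> t'"
      using that s t by (auto simp: fr_mem)
    then show "s' \<star> t' \<in> Z - {0}" by (intro S_mult)
    show "s \<star> t \<in> Z - {0}" by (intro S_mult s t)
    have z: "s \<in> Z" "t \<in> Z" "s' \<in> Z" "t' \<in> Z" using s t 1 by auto
    then have "a' \<star> b' \<star> (s \<star> t) = (a' \<star> s) \<star> (b' \<star> t)"
      by (simp add: hmul_assoc Z_left_comm[of s b' t])
    also have "\<dots> = a \<star> b \<star> (s' \<star> t')"
      unfolding 1 using z by (simp add: hmul_assoc Z_left_comm[of s' b t'])
    finally show "a' \<star> b' \<star> (s \<star> t) = a \<star> b \<star> (s' \<star> t')" .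
  qed
  moreover have "(a, s) \<in> fr a s" "(b, t) \<in> fr b t" using s t by (auto simp: fr_def)
  ultimately have "(\<Union>(a, s)\<in>fr a s. \<Union>(b, t)\<in>fr b t. fr (a \<star> b) (s \<star> t)) = fr (a \<star> b) (s \<star> t)"
    by (intro UN_pairs_eq)
  then show ?thesis by (simp add: Q_def)
qed

text \<open>A common denominator is enough, as \<open>common_denominator2\<close> and
  \<open>common_denominator3\<close> always provide one.\<close>

lemma fr_add:
  assumes s: "s \<in> Z - {0}"
  shows "fr a s \<oplus>\<^bsub>Q\<^esub> fr b s = fr (a + b) s"
proof -
  have "fr (a' \<star> t' + b' \<star> s') (s' \<star> t') = fr (a + b) s" if "(a', s') \<in> fr a s" "(b', t') \<in> fr b s" for a' s' b' t'
  proof (subst fr_eq)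
    have 1: "s' \<in> Z - {0}" "t' \<in> Z - {0}" "a' \<star> s = a \<star> s'" "b' \<star> s = b \<star> t'"
      using that s by (auto simp: fr_mem)
    then show "s' \<star> t' \<in> Z - {0}" by (intro S_mult)
    have "(a' \<star> t' + b' \<star> s') \<star> s = (a' \<star> s) \<star> t' + (b' \<star> s) \<star> s'"
      using s 1(1,2) by (simp add: hmul_assoc hmul_add_left Z_comm)
    also have "\<dots> = (a + b) \<star> (s' \<star> t')"
      unfolding 1 using 1(1,2) by (simp add: hmul_assoc hmul_add_left Z_comm)
    finally show "(a' \<star> t' + b' \<star> s') \<star> s = (a + b) \<star> (s' \<star> t')" .
  qed (rule s)
  note eq = this
  have mem: "(a, s) \<in> fr a s" "(b, s) \<in> fr b s" using s by (auto simp: fr_def)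
  have "(\<Union>(a', s')\<in>fr a s. \<Union>(b', t')\<in>fr b s. fr (a' \<star> t' + b' \<star> s') (s' \<star> t')) = fr (a + b) s"
    by (rule UN_pairs_eq[OF _ mem]) (rule eq)
  then show ?thesis by (simp add: Q_def)
qed

lemma fr_closed: "s \<in> Z - {0} \<Longrightarrow> fr a s \<in> carrier Q"
  by (auto simp: Q_simps)

lemma common_denominator2:
  assumes "X \<in> carrier Q" "W \<in> carrier Q"
  obtains a b s where "s \<in> Z - {0}" "X = fr a s" "W = fr b s"
proof -
  obtain a s b t where 1: "X = fr a s" "s \<in> Z - {0}" "W = fr b t" "t \<in> Z - {0}"
    using assms by (auto simp: Q_simps)
  have "W = fr (b \<star> s) (s \<star> t)"
    using 1 fr_expand[of t s b] Z_comm[of s t] by simp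
  then show thesis using that[of "s \<star> t" "a \<star> t" "b \<star> s"] 1 fr_expand[of s t a] S_mult by simp
qed

lemma common_denominator3:
  assumes "X \<in> carrier Q" "W \<in> carrier Q" "V \<in> carrier Q"
  obtains a b c s where "s \<in> Z - {0}" "X = fr a s" "W = fr b s" "V = fr c s"
proof -
  obtain a b s where 1: "s \<in> Z - {0}" "X = fr a s" "W = fr b s"
    using common_denominator2[OF assms(1,2)] .
  obtain c t where 2: "V = fr c t" "t \<in> Z - {0}" using assms by (auto simp: Q_simps)
  have "V = fr (c \<star> s) (s \<star> t)"
    using 1 2 fr_expand[of t s c] Z_comm[of s t] by simp
  then show thesis using that[of "s \<star> t" "a \<star> t" "b \<star> t" "c \<star> s"] 1 2 fr_expand[of s t] S_mult by simp
qed

lemma fr_zero: "s \<in> Z - {0} \<Longrightarrow> fr a s = \<zero>\<^bsub>Q\<^esub> \<longleftrightarrow> a = 0"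
  unfolding Q_simps by (subst fr_eq) (use one_S in auto)

lemma fr_one: "s \<in> Z - {0} \<Longrightarrow> fr s s = \<one>\<^bsub>Q\<^esub>"
  unfolding Q_simps by (subst fr_eq) (use one_S in auto)

lemma Q_ring: "ring Q"
proof (rule ringI)
  show "abelian_group Q"
  proof (rule abelian_groupI)
    fix X W assume X: "X \<in> carrier Q" and W: "W \<in> carrier Q"
    obtain a b s where 1: "s \<in> Z - {0}" "X = fr a s" "W = fr b s" using common_denominator2[OF X W] .
    then show "X \<oplus>\<^bsub>Q\<^esub> W \<in> carrier Q" by (simp add: fr_add fr_closed)
    show "X \<oplus>\<^bsub>Q\<^esub> W = W \<oplus>\<^bsub>Q\<^esub> X" using 1 by (simp add: fr_add add.commute)
    fix V assume V: "V \<in> carrier Q"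
    obtain a b c s where "s \<in> Z - {0}" "X = fr a s" "W = fr b s" "V = fr c s"
      using common_denominator3[OF X W V] .
    then show "X \<oplus>\<^bsub>Q\<^esub> W \<oplus>\<^bsub>Q\<^esub> V = X \<oplus>\<^bsub>Q\<^esub> (W \<oplus>\<^bsub>Q\<^esub> V)" by (simp add: fr_add add.assoc)
  next
    show "\<zero>\<^bsub>Q\<^esub> \<in> carrier Q" unfolding Q_simps(3) by (rule fr_closed[OF one_S])
    fix X assume "X \<in> carrier Q"
    then obtain a s where 1: "X = fr a s" "s \<in> Z - {0}" by (auto simp: Q_simps)
    have "\<zero>\<^bsub>Q\<^esub> = fr 0 s" using fr_zero[of s 0] 1 by simp
    then show "\<zero>\<^bsub>Q\<^esub> \<oplus>\<^bsub>Q\<^esub> X = X" using 1 by (simp add: fr_add)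
    have "fr (- a) s \<oplus>\<^bsub>Q\<^esub> X = \<zero>\<^bsub>Q\<^esub>" using 1 fr_zero[of s 0] by (simp add: fr_add)
    then show "\<exists>W\<in>carrier Q. W \<oplus>\<^bsub>Q\<^esub> X = \<zero>\<^bsub>Q\<^esub>" using fr_closed[OF 1(2)] by blast
  qed
  show "monoid Q"
  proof
    fix X W V assume "X \<in> carrier Q" "W \<in> carrier Q" "V \<in> carrier Q"
    then obtain a s b t c u where "X = fr a s" "s \<in> Z - {0}" "W = fr b t" "t \<in> Z - {0}" "V = fr c u" "u \<in> Z - {0}"
      by (auto simp: Q_simps)
    then show "X \<otimes>\<^bsub>Q\<^esub> W \<otimes>\<^bsub>Q\<^esub> V = X \<otimes>\<^bsub>Q\<^esub> (W \<otimes>\<^bsub>Q\<^esub> V)" by (simp add: fr_mult S_mult[simplified] hmul_assoc)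
  next
    fix X W assume "X \<in> carrier Q" "W \<in> carrier Q"
    then obtain a s b t where "X = fr a s" "s \<in> Z - {0}" "W = fr b t" "t \<in> Z - {0}" by (auto simp: Q_simps)
    then show "X \<otimes>\<^bsub>Q\<^esub> W \<in> carrier Q" by (simp add: fr_mult fr_closed S_mult[simplified])
  next
    fix X assume "X \<in> carrier Q"
    then obtain a s where "X = fr a s" "s \<in> Z - {0}" by (auto simp: Q_simps)
    then show "\<one>\<^bsub>Q\<^esub> \<otimes>\<^bsub>Q\<^esub> X = X" "X \<otimes>\<^bsub>Q\<^esub> \<one>\<^bsub>Q\<^esub> = X"
      using fr_mult[OF one_S, of s 1 a] fr_mult[OF _ one_S, of s a 1] by (simp_all add: Q_simps)
  qed (unfold Q_simps(2), rule fr_closed[OF one_S])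
next
  fix X W V assume XWV: "X \<in> carrier Q" "W \<in> carrier Q" "V \<in> carrier Q"
  obtain a b s where 1: "s \<in> Z - {0}" "X = fr a s" "W = fr b s" using common_denominator2[OF XWV(1,2)] .
  obtain c t where 2: "V = fr c t" "t \<in> Z - {0}" using XWV by (auto simp: Q_simps)
  show "(X \<oplus>\<^bsub>Q\<^esub> W) \<otimes>\<^bsub>Q\<^esub> V = X \<otimes>\<^bsub>Q\<^esub> V \<oplus>\<^bsub>Q\<^esub> W \<otimes>\<^bsub>Q\<^esub> V"
    using 1 2 S_mult[of s t] by (simp add: fr_add fr_mult hmul_add_left)
  show "V \<otimes>\<^bsub>Q\<^esub> (X \<oplus>\<^bsub>Q\<^esub> W) = V \<otimes>\<^bsub>Q\<^esub> X \<oplus>\<^bsub>Q\<^esub> V \<otimes>\<^bsub>Q\<^esub> W"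
    using 1 2 S_mult[of t s] by (simp add: fr_add fr_mult hmul_add_right)
qed

lemma Q_center: "ring_center Q = {fr z s | z s. z \<in> Z \<and> s \<in> Z - {0}}"
proof (intro Set.set_eqI iffI)
  fix X assume "X \<in> ring_center Q"
  then have X: "X \<in> carrier Q" and c: "\<And>W. W \<in> carrier Q \<Longrightarrow> X \<otimes>\<^bsub>Q\<^esub> W = W \<otimes>\<^bsub>Q\<^esub> X"
    by (auto simp: ring_center_def)
  obtain a s where 1: "X = fr a s" "s \<in> Z - {0}" using X by (auto simp: Q_simps)
  \<comment> \<open>Testing against the fractions f/1 suffices: both products have denominator s,
    which cancels and leaves a condition on the numerator.\<close>
  have "a \<star> f = f \<star> a" for f
    using c[OF fr_closed[OF one_S], of f] 1 one_S by (simp add: fr_mult fr_eq hmul_cancel)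
  then show "X \<in> {fr z s | z s. z \<in> Z \<and> s \<in> Z - {0}}" using 1 by (auto simp: Z_iff)
next
  fix X assume "X \<in> {fr z s | z s. z \<in> Z \<and> s \<in> Z - {0}}"
  then obtain z s where 1: "X = fr z s" "z \<in> Z" "s \<in> Z - {0}" by blast
  have "X \<otimes>\<^bsub>Q\<^esub> W = W \<otimes>\<^bsub>Q\<^esub> X" if W: "W \<in> carrier Q" for W
  proof -
    obtain a t where 2: "W = fr a t" "t \<in> Z - {0}" using W by (auto simp: Q_simps)
    show ?thesis using 1 2 Z_comm[of z a] Z_comm[of s t] by (simp add: fr_mult)
  qed
  then show "X \<in> ring_center Q" using 1 fr_closed by (auto simp: ring_center_def)
qed

lemma Q_center_subfield: "subfield (ring_center Q) Q"
proof -
  interpret Q: ring Q by (rule Q_ring)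
  let ?K = "ring_center Q"
  have neg: "\<ominus>\<^bsub>Q\<^esub> fr a s = fr (- a) s" if s: "s \<in> Z - {0}" for a s
    by (rule Q.minus_equality) (use s fr_closed fr_zero[of s 0] in \<open>auto simp: fr_add\<close>)
  have "subring ?K Q"
  proof (rule Q.subringI)
    show "?K \<subseteq> carrier Q" by (auto simp: ring_center_def)
    show "\<one>\<^bsub>Q\<^esub> \<in> ?K" unfolding Q_center Q_simps(2) using one_S by blast
  next
    fix X assume "X \<in> ?K"
    then obtain z s where "X = fr z s" "z \<in> Z" "s \<in> Z - {0}" unfolding Q_center by blast
    then show "\<ominus>\<^bsub>Q\<^esub> X \<in> ?K" unfolding Q_center using neg Z_diff[OF Z_zero, of z] by auto
  next
    fix X W assume X: "X \<in> ?K" and W: "W \<in> ?K"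
    obtain z s where 1: "X = fr z s" "z \<in> Z" "s \<in> Z - {0}" using X unfolding Q_center by blast
    obtain y t where 2: "W = fr y t" "y \<in> Z" "t \<in> Z - {0}" using W unfolding Q_center by blast
    have "X \<otimes>\<^bsub>Q\<^esub> W = fr (z \<star> y) (s \<star> t)" using 1 2 by (simp add: fr_mult)
    then show "X \<otimes>\<^bsub>Q\<^esub> W \<in> ?K" unfolding Q_center using 1 2 Z_mult S_mult by blast
    have "X = fr (z \<star> t) (s \<star> t)" "W = fr (y \<star> s) (s \<star> t)"
      using 1 2 fr_expand[of s t z] fr_expand[of t s y] Z_comm[of s t] by simp_all
    then have "X \<oplus>\<^bsub>Q\<^esub> W = fr (z \<star> t + y \<star> s) (s \<star> t)" using 1 2 S_mult[of s t] by (simp add: fr_add)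
    moreover have "z \<star> t + y \<star> s \<in> Z" using 1 2 by (intro Z_add Z_mult) auto
    ultimately show "X \<oplus>\<^bsub>Q\<^esub> W \<in> ?K" unfolding Q_center using 1 2 S_mult by blast
  qed
  then have sc: "subcring ?K Q"
  proof (rule Q.subcringI)
    show "X \<otimes>\<^bsub>Q\<^esub> W = W \<otimes>\<^bsub>Q\<^esub> X" if "X \<in> ?K" "W \<in> ?K" for X W
      using that unfolding ring_center_def by blast
  qed
  show ?thesis
  proof (rule Q.subfieldI[OF sc])
    show "Units (Q\<lparr>carrier := ?K\<rparr>) = ?K - {\<zero>\<^bsub>Q\<^esub>}"
    proof (intro Set.set_eqI iffI)
      fix X assume "X \<in> Units (Q\<lparr>carrier := ?K\<rparr>)"
      then have X: "X \<in> ?K" "\<exists>W\<in>?K. W \<otimes>\<^bsub>Q\<^esub> X = \<one>\<^bsub>Q\<^esub>" by (auto simp: Units_def)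
      have "\<one>\<^bsub>Q\<^esub> \<noteq> \<zero>\<^bsub>Q\<^esub>" using fr_zero[OF one_S, of 1] by (simp add: Q_simps)
      moreover have "?K \<subseteq> carrier Q" by (auto simp: ring_center_def)
      ultimately show "X \<in> ?K - {\<zero>\<^bsub>Q\<^esub>}" using X by auto
    next
      fix X assume X: "X \<in> ?K - {\<zero>\<^bsub>Q\<^esub>}"
      then obtain z s where 1: "X = fr z s" "z \<in> Z" "s \<in> Z - {0}" unfolding Q_center by blast
      then have z: "z \<in> Z - {0}" using X fr_zero by auto
      have "fr s z \<in> ?K" unfolding Q_center using 1 z by blast
      moreover have "fr s z \<otimes>\<^bsub>Q\<^esub> X = \<one>\<^bsub>Q\<^esub>" "X \<otimes>\<^bsub>Q\<^esub> fr s z = \<one>\<^bsub>Q\<^esub>"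
        using 1 z fr_one[OF S_mult[OF z 1(3)]] Z_comm[of z s] by (simp_all add: fr_mult)
      ultimately show "X \<in> Units (Q\<lparr>carrier := ?K\<rparr>)" using X by (auto simp: Units_def)
    qed
  qed
qed

text \<open>\<open>combine\<close> stops at the end of the shorter list, hence the minimum of the
  lengths.\<close>

lemma combine_fr:
  assumes "s \<in> Z - {0}" "\<And>i. i < length Ks \<Longrightarrow> Ks ! i = fr (c i) s"
  shows "ring.combine Q Ks (map (\<lambda>u. fr u 1) us) = fr (\<Sum>i<min (length Ks) (length us). c i \<star> us ! i) s"
  using assms(2)
proof (induction us arbitrary: Ks c)
  interpret Q: ring Q by (rule Q_ring)
  case Nil
  then show ?case using fr_zero[OF assms(1), of 0] by (cases Ks) simp_all
next
  interpret Q: ring Q by (rule Q_ring)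
  case (Cons u us)
  show ?case
  proof (cases Ks)
    case Nil
    then show ?thesis using fr_zero[OF assms(1), of 0] by simp
  next
    case K: (Cons k Ks')
    have "Q.combine Ks' (map (\<lambda>u. fr u 1) us) = fr (\<Sum>i<min (length Ks') (length us). c (Suc i) \<star> us ! i) s"
    proof (rule Cons.IH)
      fix i assume "i < length Ks'"
      then show "Ks' ! i = fr (c (Suc i)) s" using Cons.prems[of "Suc i"] K by simp
    qed
    moreover have "k = fr (c 0) s" using Cons.prems[of 0] K by simp
    ultimately show ?thesis
      using K fr_mult[OF assms(1) one_S] fr_add[OF assms(1)]
      by (simp add: sum.lessThan_Suc_shift del: sum.lessThan_Suc)
  qed
qed

lemma common_denominator_list:
  assumes "set Ks \<subseteq> ring_center Q"
  shows "\<exists>s c. s \<in> Z - {0} \<and> (\<forall>i. c i \<in> Z) \<and> (\<forall>i<length Ks. Ks ! i = fr (c i) s)"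
  using assms
proof (induction Ks)
  case Nil
  then show ?case using one_S by auto
next
  case (Cons k Ks)
  then obtain s c where 1: "s \<in> Z - {0}" "\<And>i. c i \<in> Z" "\<And>i. i < length Ks \<Longrightarrow> Ks ! i = fr (c i) s" by auto
  obtain z t where 2: "k = fr z t" "z \<in> Z" "t \<in> Z - {0}" using Cons.prems unfolding Q_center by auto
  let ?c = "\<lambda>i. case i of 0 \<Rightarrow> z \<star> s | Suc i \<Rightarrow> c i \<star> t"
  have "(k # Ks) ! i = fr (?c i) (s \<star> t)" if "i < length (k # Ks)" for i
    using that 1(1,3) 2 fr_expand[of t s z] fr_expand[of s t] Z_comm[of s t]
    by (cases i) simp_all
  moreover have "?c i \<in> Z" for i using 1(1,2) 2 by (cases i) (simp_all add: Z_mult)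
  ultimately show ?case using S_mult[OF 1(1) 2(3)] by blast
qed

lemma Q_dimension:
  assumes D: "D1 \<noteq> 0"
  shows "ring.dimension Q (p\<^sup>2) (ring_center Q) (carrier Q)"
proof -
  interpret Q: ring Q by (rule Q_ring)
  let ?K = "ring_center Q" and ?us = "map basis [0..<p\<^sup>2]"
  let ?Us = "map (\<lambda>u. fr u 1) ?us"
  have Us: "set ?Us \<subseteq> carrier Q" using fr_closed[OF one_S] by auto
  have "Q.independent ?K ?Us"
  proof (rule Q.trivial_combine_imp_independent[OF Q_center_subfield Us])
    fix Ks assume Ks: "set Ks \<subseteq> ?K" and z: "Q.combine Ks ?Us = \<zero>\<^bsub>Q\<^esub>"
    obtain s c where 1: "s \<in> Z - {0}" "\<And>i. c i \<in> Z" "\<And>i. i < length Ks \<Longrightarrow> Ks ! i = fr (c i) s"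
      using common_denominator_list[OF Ks] by blast
    \<comment> \<open>The list of coefficients need not have length p^2; padding with zeros brings
      it into the form of \<open>basis_independent\<close>.\<close>
    let ?c = "\<lambda>i. if i < length Ks then c i else 0"
    let ?m = "min (length Ks) (p\<^sup>2)"
    have "(\<Sum>n<p\<^sup>2. ?c n \<star> basis n) = (\<Sum>n<?m. ?c n \<star> basis n)"
      by (rule sum.mono_neutral_right) auto
    also have "\<dots> = (\<Sum>n<?m. c n \<star> ?us ! n)" by (intro sum.cong) auto
    also have "\<dots> = 0"
    proof -
      have "Q.combine Ks ?Us = fr (\<Sum>i<min (length Ks) (length ?us). c i \<star> ?us ! i) s"
        by (rule combine_fr[OF 1(1)]) (rule 1(3))
      then have "fr (\<Sum>i<min (length Ks) (length ?us). c i \<star> ?us ! i) s = \<zero>\<^bsub>Q\<^esub>" using z by argo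
      then show ?thesis unfolding fr_zero[OF 1(1)] by (simp only: length_map length_upt diff_zero)
    qed
    finally have sum: "(\<Sum>n<p\<^sup>2. ?c n \<star> basis n) = 0" .
    have "?c n = 0" if "n < p\<^sup>2" for n
      by (rule basis_independent[OF D _ sum that]) (use 1(2) Z_zero in auto)
    then have "Ks ! i = \<zero>\<^bsub>Q\<^esub>" if "i < length Ks" "i < p\<^sup>2" for i
      using 1(3)[OF that(1)] fr_zero[OF 1(1), of "c i"] that by force
    then show "set (take (length ?Us) Ks) \<subseteq> {\<zero>\<^bsub>Q\<^esub>}" by (auto simp: in_set_conv_nth)
  qed
  moreover have "Q.Span ?K ?Us = carrier Q"
  proof
    show "Q.Span ?K ?Us \<subseteq> carrier Q"
      by (rule Q.Span_in_carrier[OF _ Us]) (auto simp: ring_center_def)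
    show "carrier Q \<subseteq> Q.Span ?K ?Us"
    proof
      fix X assume "X \<in> carrier Q"
      then obtain f s where 1: "X = fr f s" "s \<in> Z - {0}" by (auto simp: Q_simps)
      obtain c where c: "\<And>n. c n \<in> Z" "f = (\<Sum>n<p\<^sup>2. c n \<star> basis n)"
        using span_all[of f] by (auto simp: basis_span_def)
      let ?Ks = "map (\<lambda>n. fr (c n) s) [0..<p\<^sup>2]"
      have "(\<Sum>i<min (length ?Ks) (length ?us). c i \<star> ?us ! i) = f"
        unfolding c(2) by (rule sum.cong) auto
      then have "X = Q.combine ?Ks ?Us"
        using combine_fr[OF 1(2), of ?Ks c ?us] 1(1) by simp
      moreover have "set ?Ks \<subseteq> ?K" unfolding Q_center using c(1) 1(2) by auto
      ultimately show "X \<in> Q.Span ?K ?Us"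
        using Q.Span_eq_combine_set[OF Q_center_subfield Us] by blast
    qed
  qed
  ultimately show ?thesis using Q.dimension_independent[of ?K ?Us] by simp
qed

text \<open>In dimension p^2 over the center of \<open>Q\<close>, any p^2 + 1 fractions are
  dependent; a common central denominator turns the relation into one with coefficients in the
  center of H.\<close>

lemma central_dependency:
  assumes D: "D1 \<noteq> 0"
  shows "\<exists>c. (\<forall>i. c i \<in> Z) \<and> (\<exists>i\<le>p\<^sup>2. c i \<noteq> 0) \<and> (\<Sum>i\<le>p\<^sup>2. c i \<star> a i) = 0"
proof -
  interpret Q: ring Q by (rule Q_ring)
  let ?K = "ring_center Q" and ?us = "map a [0..<Suc (p\<^sup>2)]"
  let ?Us = "map (\<lambda>u. fr u 1) ?us"
  have Us: "set ?Us \<subseteq> carrier Q" using fr_closed[OF one_S] by auto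
  have "\<not> Q.independent ?K ?Us"
    using Q.independent_length_le_dimension[OF Q_center_subfield Q_dimension[OF D] _ Us] by auto
  then obtain Ks where Ks: "length Ks = length ?Us" "Q.combine Ks ?Us = \<zero>\<^bsub>Q\<^esub>" "set Ks \<subseteq> ?K" "set Ks \<noteq> {\<zero>\<^bsub>Q\<^esub>}"
    using Q.dependent_imp_non_trivial_combine[OF Q_center_subfield Us] by metis
  obtain s c where 1: "s \<in> Z - {0}" "\<And>i. c i \<in> Z" "\<And>i. i < length Ks \<Longrightarrow> Ks ! i = fr (c i) s"
    using common_denominator_list[OF Ks(3)] by blast
  have "(\<Sum>i<Suc (p\<^sup>2). c i \<star> ?us ! i) = 0"
  proof -
    have "Q.combine Ks ?Us = fr (\<Sum>i<min (length Ks) (length ?us). c i \<star> ?us ! i) s"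
      by (rule combine_fr[OF 1(1)]) (rule 1(3))
    then have "fr (\<Sum>i<min (length Ks) (length ?us). c i \<star> ?us ! i) s = \<zero>\<^bsub>Q\<^esub>" using Ks(2) by argo
    moreover have "min (length Ks) (length ?us) = Suc (p\<^sup>2)" using Ks(1) by simp
    ultimately have "fr (\<Sum>i<Suc (p\<^sup>2). c i \<star> ?us ! i) s = \<zero>\<^bsub>Q\<^esub>" by argo
    then show ?thesis using fr_zero[OF 1(1)] by blast
  qed
  moreover have "(\<Sum>i<Suc (p\<^sup>2). c i \<star> ?us ! i) = (\<Sum>i\<le>p\<^sup>2. c i \<star> a i)"
    by (rule sum.cong) (auto simp del: upt_Suc)
  moreover have "\<exists>i\<le>p\<^sup>2. c i \<noteq> 0"
  proof (rule ccontr)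
    assume "\<not> ?thesis"
    then have "Ks ! i = \<zero>\<^bsub>Q\<^esub>" if "i < length Ks" for i
      using 1(3)[OF that] fr_zero[OF 1(1), of "c i"] Ks(1) that by simp
    moreover have "Ks \<noteq> []" using Ks(1) by auto
    ultimately show False using Ks(4) by (auto simp: in_set_conv_nth set_eq_iff)
  qed
  ultimately show ?thesis using 1(2) by (intro exI[of _ c]) auto
qed

text \<open>The powers of s satisfy a relation with central coefficients. Cancelling the lowest
  power that occurs leaves a nonzero central coefficient which is a multiple of s.\<close>

lemma central_multiple:
  assumes D: "D1 \<noteq> 0" and s: "s \<noteq> 0"
  shows "\<exists>t. s \<star> t \<in> Z - {0} \<and> t \<star> s = s \<star> t"
proof -
  have nz: "s [^]\<^bsub>H\<^esub> n \<noteq> 0" for n :: nat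
    by (induction n) (simp_all add: hmul_eq_0_iff s)
  obtain c where c: "\<And>i. c i \<in> Z" "\<exists>i\<le>p\<^sup>2. c i \<noteq> 0" "(\<Sum>i\<le>p\<^sup>2. c i \<star> s [^]\<^bsub>H\<^esub> i) = 0"
    using central_dependency[OF D, of "\<lambda>i. s [^]\<^bsub>H\<^esub> i"] by blast
  \<comment> \<open>The lowest index with nonzero coefficient: every remaining term contains s^m,
    which cancels in a domain.\<close>
  define m where "m = (LEAST i. i \<le> p\<^sup>2 \<and> c i \<noteq> 0)"
  have m: "m \<le> p\<^sup>2" "c m \<noteq> 0" and least: "\<And>i. i < m \<Longrightarrow> c i = 0"
    using LeastI_ex[OF c(2)] not_less_Least[of _ "\<lambda>i. i \<le> p\<^sup>2 \<and> c i \<noteq> 0"]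
    by (auto simp: m_def[symmetric])
  have pow_add: "s [^]\<^bsub>H\<^esub> (i + j) = s [^]\<^bsub>H\<^esub> i \<star> s [^]\<^bsub>H\<^esub> j" for i j :: nat
    using H.nat_pow_mult[of s i j] by simp
  define t where "t = - (\<Sum>i\<in>{Suc m..p\<^sup>2}. c i \<star> s [^]\<^bsub>H\<^esub> (i - Suc m))"
  have "0 = (\<Sum>i\<in>{m..p\<^sup>2}. c i \<star> s [^]\<^bsub>H\<^esub> i)"
    unfolding c(3)[symmetric] by (rule sum.mono_neutral_right) (use least in auto)
  also have "\<dots> = c m \<star> s [^]\<^bsub>H\<^esub> m + (\<Sum>i\<in>{Suc m..p\<^sup>2}. c i \<star> s [^]\<^bsub>H\<^esub> i)"
    using m(1) by (simp add: sum.atLeast_Suc_atMost)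
  also have "(\<Sum>i\<in>{Suc m..p\<^sup>2}. c i \<star> s [^]\<^bsub>H\<^esub> i) = - (t \<star> s \<star> s [^]\<^bsub>H\<^esub> m)"
    unfolding t_def hmul_uminus hmul_sum_left minus_minus
  proof (rule sum.cong)
    fix i assume "i \<in> {Suc m..p\<^sup>2}"
    then have "i = (i - Suc m) + Suc m" by simp
    then show "c i \<star> s [^]\<^bsub>H\<^esub> i = c i \<star> s [^]\<^bsub>H\<^esub> (i - Suc m) \<star> s \<star> s [^]\<^bsub>H\<^esub> m"
      using pow_add[of "i - Suc m" "Suc m"] pow_add[of 1 m] by (simp add: hmul_assoc)
  qed simp
  finally have "(c m - t \<star> s) \<star> s [^]\<^bsub>H\<^esub> m = 0" by (simp add: hmul_diff_left)
  then have ts: "t \<star> s = c m" using hmul_eq_0_iff nz by simp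
  \<comment> \<open>As t s is central, s (t s) = (t s) s; cancelling s on the right gives s t = t
    s.\<close>
  have "s \<star> (t \<star> s) = s \<star> t \<star> s" by (simp add: hmul_assoc)
  then have "s \<star> (t \<star> s) = (t \<star> s) \<star> s" "(s \<star> t) \<star> s = (t \<star> s) \<star> s"
    using Z_comm[OF c(1), of s m] ts by (simp_all add: hmul_assoc)
  then have "s \<star> t = t \<star> s" using hmul_cancel(1)[OF s] by simp
  then show ?thesis using ts c(1)[of m] m(2) by (intro exI[of _ t]) auto
qed

text \<open>Inverting central elements inverts every regular element s: with a central multiple s t,
  the inverse of s/1 is t/(s t).\<close>

lemma Q_total: 
  assumes D: "D1 \<noteq> 0"
  shows "total_quotient_ring H Q (\<lambda>f. fr f 1)"
proof -
  have reg: "s \<noteq> 0" if "s \<in> regular_elements H" for s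
  proof
    assume "s = 0"
    then have "\<forall>x. x = (0 :: 'k poly poly)" using that by (simp add: regular_elements_def)
    then show False by (metis one_neq_zero)
  qed
  have regS: "s \<in> regular_elements H" if "s \<in> Z - {0}" for s
    using that by (simp add: regular_elements_def hmul_eq_0_iff)
  interpret Q: ring Q by (rule Q_ring)
  have unit: "x \<in> Units Q \<and> inv\<^bsub>Q\<^esub> x = y"
    if "x \<in> carrier Q" "y \<in> carrier Q" "x \<otimes>\<^bsub>Q\<^esub> y = \<one>\<^bsub>Q\<^esub>" "y \<otimes>\<^bsub>Q\<^esub> x = \<one>\<^bsub>Q\<^esub>" for x y
    using that Q.inv_unique'[of x y] by (auto simp: Units_def)
  have inv: "fr s 1 \<in> Units Q \<and> inv\<^bsub>Q\<^esub> fr s 1 = fr 1 s" if s: "s \<in> Z - {0}" for s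
  proof -
    have "fr s 1 \<otimes>\<^bsub>Q\<^esub> fr 1 s = \<one>\<^bsub>Q\<^esub>" "fr 1 s \<otimes>\<^bsub>Q\<^esub> fr s 1 = \<one>\<^bsub>Q\<^esub>"
      using fr_one[OF s] by (simp_all add: fr_mult[OF one_S s] fr_mult[OF s one_S])
    then show ?thesis using unit[of "fr s 1" "fr 1 s"] fr_closed[OF one_S] fr_closed[OF s] by simp
  qed
  have "fr s 1 \<in> Units Q" if s: "s \<in> regular_elements H" for s
  proof -
    obtain t where t: "s \<star> t \<in> Z - {0}" "t \<star> s = s \<star> t" using central_multiple[OF D reg[OF s]] by blast
    have "fr s 1 \<otimes>\<^bsub>Q\<^esub> fr t (s \<star> t) = \<one>\<^bsub>Q\<^esub>" "fr t (s \<star> t) \<otimes>\<^bsub>Q\<^esub> fr s 1 = \<one>\<^bsub>Q\<^esub>"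
      using fr_one[OF t(1)] t(2) by (simp_all add: fr_mult[OF one_S t(1)] fr_mult[OF t(1) one_S])
    then show ?thesis
      using unit[of "fr s 1" "fr t (s \<star> t)"] fr_closed[OF one_S] fr_closed[OF t(1)] by simp
  qed
  moreover have "\<exists>a\<in>carrier H. \<exists>s\<in>regular_elements H. X = fr a 1 \<otimes>\<^bsub>Q\<^esub> inv\<^bsub>Q\<^esub> fr s 1"
    "\<exists>a\<in>carrier H. \<exists>s\<in>regular_elements H. X = inv\<^bsub>Q\<^esub> fr s 1 \<otimes>\<^bsub>Q\<^esub> fr a 1" if X: "X \<in> carrier Q" for X
  proof -
    obtain a s where 1: "X = fr a s" "s \<in> Z - {0}" using X by (auto simp: Q_simps)
    have "X = fr a 1 \<otimes>\<^bsub>Q\<^esub> inv\<^bsub>Q\<^esub> fr s 1" "X = inv\<^bsub>Q\<^esub> fr s 1 \<otimes>\<^bsub>Q\<^esub> fr a 1"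
      using 1 inv[OF 1(2)] by (simp_all add: fr_mult[OF one_S 1(2)] fr_mult[OF 1(2) one_S])
    then show "\<exists>a\<in>carrier H. \<exists>s\<in>regular_elements H. X = fr a 1 \<otimes>\<^bsub>Q\<^esub> inv\<^bsub>Q\<^esub> fr s 1"
      "\<exists>a\<in>carrier H. \<exists>s\<in>regular_elements H. X = inv\<^bsub>Q\<^esub> fr s 1 \<otimes>\<^bsub>Q\<^esub> fr a 1"
      using regS[OF 1(2)] by auto
  qed
  moreover have "(\<lambda>f. fr f 1) \<in> ring_hom H Q"
    by (rule ring_hom_memI) (simp_all add: fr_closed[OF one_S] fr_mult[OF one_S one_S] fr_add[OF one_S] Q_simps(2))
  moreover have "inj_on (\<lambda>f. fr f 1) (carrier H)"
    by (rule inj_onI) (simp add: fr_eq[OF one_S one_S])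
  ultimately show ?thesis unfolding total_quotient_ring_def using Q_ring by blast
qed

lemma H_prime: "prime_ring H"
  unfolding prime_ring_def
proof (intro conjI ballI impI)
  show "ring H" ..
  fix a b assume "\<forall>x\<in>carrier H. a \<star> x \<star> b = \<zero>\<^bsub>H\<^esub>"
  then have "a \<star> x \<star> b = 0" for x by simp
  from this[of 1] show "a = \<zero>\<^bsub>H\<^esub> \<or> b = \<zero>\<^bsub>H\<^esub>" by (simp add: hmul_eq_0_iff)
qed simp

subsection \<open>A polynomial identity\<close>

definition wprod :: "(nat \<Rightarrow> 'k poly poly) \<Rightarrow> nat list \<Rightarrow> 'k poly poly"
  where "wprod x w = foldr (\<lambda>i a. x i \<star> a) w 1"

lemma wprod_append: "wprod x (u @ v) = wprod x u \<star> wprod x v"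
  by (induction u) (simp_all add: wprod_def hmul_assoc)

end

text \<open>A coefficient and a word. Lists of these keep equal words apart, so that words can be
  traced through the recursion; \<open>sw_poly\<close> collects them afterwards.\<close>

type_synonym sword = "int \<times> nat list"

definition sw_mult :: "sword list \<Rightarrow> nat \<Rightarrow> sword list \<Rightarrow> sword list"
  where "sw_mult A y B = concat (map (\<lambda>(c, u). map (\<lambda>(e, v). (c * e, u @ y # v)) B) A)"

definition sw_neg :: "sword list \<Rightarrow> sword list"
  where "sw_neg A = map (\<lambda>(c, u). (- c, u)) A"

definition sw_coeff :: "nat list \<Rightarrow> sword list \<Rightarrow> int"
  where "sw_coeff w A = (\<Sum>(c, u)\<leftarrow>A. if u = w then c else 0)"

text \<open>If \<open>\<Sum>i\<ge>k. z i * F k i = 0\<close> with central \<open>z i\<close>, then multiplying on the left and on the right by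
  \<open>F k k\<close> (and a new variable) and subtracting eliminates the term for \<open>i = k\<close>. The variables are
  \<open>0, \<dots>, N\<close> for the dependent elements and \<open>N + 1 + k\<close> for the auxiliary ones.\<close>

fun elim_poly :: "nat \<Rightarrow> nat \<Rightarrow> nat \<Rightarrow> sword list"
  where "elim_poly N 0 i = [(1, [i])]"
  | "elim_poly N (Suc k) i = sw_mult (elim_poly N k i) (Suc (N + k)) (elim_poly N k k) @
      sw_neg (sw_mult (elim_poly N k k) (Suc (N + k)) (elim_poly N k i))"

fun lead_word :: "nat \<Rightarrow> nat \<Rightarrow> nat \<Rightarrow> nat list"
  where "lead_word N 0 i = [i]"
  | "lead_word N (Suc k) i = lead_word N k i @ Suc (N + k) # lead_word N k k"

fun elim_length :: "nat \<Rightarrow> nat"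
  where "elim_length 0 = 1" | "elim_length (Suc k) = Suc (2 * elim_length k)"

lemma sw_coeff_simps: "sw_coeff w [] = 0" "sw_coeff w ((c, u) # A) = (if u = w then c else 0) + sw_coeff w A"
  "sw_coeff w (A @ B) = sw_coeff w A + sw_coeff w B" "sw_coeff w (sw_neg A) = - sw_coeff w A"
proof -
  show "sw_coeff w (sw_neg A) = - sw_coeff w A"
    by (induction A) (auto simp: sw_coeff_def sw_neg_def)
qed (simp_all add: sw_coeff_def)

text \<open>All words of A have the length of u, so a word u y w can only arise by splitting at that
  place, and the coefficient is a single product.\<close>

lemma sw_coeff_mult:
  assumes "\<And>c v. (c, v) \<in> set A \<Longrightarrow> length v = length u" 
  shows "sw_coeff (u @ y # w) (sw_mult A y B) = sw_coeff u A * sw_coeff w B"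
  using assms
proof (induction A)
  case Nil
  then show ?case by (simp add: sw_mult_def sw_coeff_simps)
next
  case (Cons a A)
  obtain c v where a: "a = (c, v)" by force
  have l: "length v = length u" using Cons.prems[of c v] a by simp
  have "sw_coeff (u @ y # w) (map (\<lambda>(e, v'). (c * e, v @ y # v')) B) = (if v = u then c else 0) * sw_coeff w B"
  proof (induction B)
    case (Cons b B)
    obtain e v' where b: "b = (e, v')" by force
    show ?case using Cons.IH l by (auto simp: b sw_coeff_simps algebra_simps)
  qed (simp add: sw_coeff_simps)
  moreover have "sw_coeff (u @ y # w) (sw_mult A y B) = sw_coeff u A * sw_coeff w B"
    using Cons by auto
  moreover have "sw_mult (a # A) y B = map (\<lambda>(e, v'). (c * e, v @ y # v')) B @ sw_mult A y B"
    by (simp add: sw_mult_def a)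
  ultimately show ?case by (simp add: a sw_coeff_simps algebra_simps)
qed

lemma sw_mult_mem: "(c, u) \<in> set (sw_mult A y B) \<Longrightarrow> \<exists>c1 u1 c2 u2. (c1, u1) \<in> set A \<and> (c2, u2) \<in> set B \<and> u = u1 @ y # u2"
  by (force simp: sw_mult_def)

lemma sw_neg_mem: "(c, u) \<in> set (sw_neg A) \<Longrightarrow> (- c, u) \<in> set A"
  by (force simp: sw_neg_def)

lemma elim_poly_Suc_mem:
  assumes "(c, u) \<in> set (elim_poly N (Suc k) i)"
  shows "\<exists>c1 u1 c2 u2 i1 i2. (c1, u1) \<in> set (elim_poly N k i1) \<and> (c2, u2) \<in> set (elim_poly N k i2) \<and>
    u = u1 @ Suc (N + k) # u2 \<and> (i1 = i \<or> i1 = k) \<and> (i2 = i \<or> i2 = k)"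
proof -
  consider "(c, u) \<in> set (sw_mult (elim_poly N k i) (Suc (N + k)) (elim_poly N k k))"
    | "(- c, u) \<in> set (sw_mult (elim_poly N k k) (Suc (N + k)) (elim_poly N k i))"
    using assms sw_neg_mem[of c u] by auto
  then show ?thesis by cases (blast dest: sw_mult_mem)+
qed

text \<open>The polynomials are homogeneous, of degree 2^(k+1) - 1. Any word with coefficient one is
  then a word of maximal length, as \<open>PI_ring\<close> requires.\<close>

lemma elim_poly_length: "(c, u) \<in> set (elim_poly N k i) \<Longrightarrow> length u = elim_length k"
proof (induction k arbitrary: c u i)
  case (Suc k)
  obtain c1 u1 c2 u2 i1 i2 where "(c1, u1) \<in> set (elim_poly N k i1)" "(c2, u2) \<in> set (elim_poly N k i2)" "u = u1 @ Suc (N + k) # u2"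
    using elim_poly_Suc_mem[OF Suc.prems] by blast
  then show ?case using Suc.IH[of c1 u1 i1] Suc.IH[of c2 u2 i2] by simp
qed simp

lemma elim_poly_vars: "(c, u) \<in> set (elim_poly N k i) \<Longrightarrow> j \<in> set u \<Longrightarrow> j = i \<or> j < k \<or> j > N"
proof (induction k arbitrary: c u i)
  case (Suc k)
  obtain c1 u1 c2 u2 i1 i2 where 1: "(c1, u1) \<in> set (elim_poly N k i1)" "(c2, u2) \<in> set (elim_poly N k i2)" "u = u1 @ Suc (N + k) # u2"
    "i1 = i \<or> i1 = k" "i2 = i \<or> i2 = k"
    using elim_poly_Suc_mem[OF Suc.prems(1)] by blast
  then consider "j \<in> set u1" | "j = Suc (N + k)" | "j \<in> set u2" using Suc.prems(2) by auto
  then show ?case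
    by cases (use Suc.IH[OF 1(1)] Suc.IH[OF 1(2)] 1(4,5) in auto)
qed simp

lemma lead_word_facts: "length (lead_word N k i) = elim_length k" "lead_word N k i \<noteq> [] \<and> hd (lead_word N k i) = i"
  by (induction k arbitrary: i) auto

lemma sw_coeff_eq_0:
  assumes "\<And>c. (c, w) \<notin> set A"
  shows "sw_coeff w A = 0"
proof -
  have "w \<notin> snd ` set A" using assms by auto
  then show ?thesis by (induction A) (auto simp: sw_coeff_simps)
qed

text \<open>The leading word starts with the variable i. The subtracted product begins with a word
  of \<open>elim_poly N k k\<close>, which cannot contain the variable i because k < i \<le> N, so
  it does not cancel the leading word.\<close>

lemma lead_word_coeff: "k \<le> i \<Longrightarrow> i \<le> N \<Longrightarrow> sw_coeff (lead_word N k i) (elim_poly N k i) = 1"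
proof (induction k arbitrary: i)
  case (Suc k)
  have len: "length v = length (lead_word N k i)" if "(c, v) \<in> set (elim_poly N k j)" for c v j
    using elim_poly_length[OF that] by (simp add: lead_word_facts)
  have "sw_coeff (lead_word N k i) (elim_poly N k k) = 0"
  proof (rule sw_coeff_eq_0)
    fix c show "(c, lead_word N k i) \<notin> set (elim_poly N k k)"
      using elim_poly_vars[of c "lead_word N k i" N k k i] lead_word_facts(2)[of N k i] Suc.prems
      by (metis hd_in_set less_le_not_le not_less_eq_eq order_less_le order_refl)
  qed
  then show ?case
    using Suc len by (simp add: sw_coeff_simps sw_coeff_mult)
qed (simp add: sw_coeff_simps)

definition sw_poly :: "sword list \<Rightarrow> (nat list \<Rightarrow>\<^sub>0 int)"
  where "sw_poly A = (\<Sum>(c, u)\<leftarrow>A. Poly_Mapping.single u c)"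

lemma lookup_sw_poly: "Poly_Mapping.lookup (sw_poly A) w = sw_coeff w A"
  by (induction A) (auto simp: sw_poly_def sw_coeff_simps lookup_add lookup_single when_def)

lemma keys_sw_poly: "w \<in> Poly_Mapping.keys (sw_poly A) \<Longrightarrow> \<exists>c. (c, w) \<in> set A"
  using sw_coeff_eq_0[of w A] by (auto simp: in_keys_iff lookup_sw_poly)

context hoe
begin

definition sw_eval :: "(nat \<Rightarrow> 'k poly poly) \<Rightarrow> sword list \<Rightarrow> 'k poly poly"
  where "sw_eval x A = (\<Sum>(c, u)\<leftarrow>A. of_int c * wprod x u)"

lemma of_int_hmul: "(of_int c * f) \<star> g = of_int c * (f \<star> g)" "f \<star> (of_int c * g) = of_int c * (f \<star> g)"
proof -
  have e: "of_int c * f = Polynomial.smult [:of_int c:] f" for f :: "'k poly poly"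
    by (simp add: of_int_poly)
  show "(of_int c * f) \<star> g = of_int c * (f \<star> g)" "f \<star> (of_int c * g) = of_int c * (f \<star> g)"
    unfolding e by (rule hmul_scal)+
qed

lemma sw_eval_simps: "sw_eval x (A @ B) = sw_eval x A + sw_eval x B" "sw_eval x (sw_neg A) = - sw_eval x A"
  "sw_eval x [(1, [i])] = x i"
proof -
  show "sw_eval x (sw_neg A) = - sw_eval x A"
    by (induction A) (auto simp: sw_eval_def sw_neg_def)
qed (simp_all add: sw_eval_def wprod_def)

lemma sw_eval_mult: "sw_eval x (sw_mult A y B) = sw_eval x A \<star> x y \<star> sw_eval x B"
proof (induction A)
  case (Cons a A)
  obtain c v where a: "a = (c, v)" by force
  have w: "wprod x (v @ y # u) = wprod x v \<star> x y \<star> wprod x u" for u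
    using wprod_append[of x v "y # u"] by (simp add: wprod_def hmul_assoc)
  have "sw_eval x (map (\<lambda>(e, v'). (c * e, v @ y # v')) B) = of_int c * wprod x v \<star> x y \<star> sw_eval x B"
    by (induction B) (auto simp: sw_eval_def w of_int_hmul hmul_add_right algebra_simps)
  moreover have "sw_mult (a # A) y B = map (\<lambda>(e, v'). (c * e, v @ y # v')) B @ sw_mult A y B"
    by (simp add: sw_mult_def a)
  moreover have "sw_eval x (a # A) = of_int c * wprod x v + sw_eval x A"
    by (simp add: sw_eval_def a)
  ultimately show ?case using Cons by (simp add: sw_eval_simps hmul_add_left)
qed (simp add: sw_eval_def sw_mult_def)

lemma H_int_smult: "[c] \<cdot>\<^bsub>H\<^esub> f = of_int c * f"
proof -
  have n: "[n] \<cdot>\<^bsub>H\<^esub> f = of_nat n * f" for n :: nat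
  proof (induction n)
    case (Suc n)
    have "[Suc n] \<cdot>\<^bsub>H\<^esub> f = [n] \<cdot>\<^bsub>H\<^esub> f + f" using H.add.nat_pow_Suc[of n f] by simp
    then show ?case using Suc by (simp add: distrib_right)
  qed (use H.add.nat_pow_0[of f] in simp)
  have neg: "of_int c = - (of_nat (nat (- c)) :: 'k poly poly)" if "c < 0"
  proof -
    have "c = - int (nat (- c))" using that by simp
    then show ?thesis by (metis of_int_minus of_int_of_nat_eq)
  qed
  have pos: "of_int c = (of_nat (nat c) :: 'k poly poly)" if "0 \<le> c"
  proof -
    have "c = int (nat c)" using that by simp
    then show ?thesis by (metis of_int_of_nat_eq)
  qed
  show ?thesis
  proof (cases "0 \<le> c")
    case True
    show ?thesis unfolding add_pow_int_ge[OF True] n pos[OF True] by (rule refl)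
  next
    case False
    then have c: "c < 0" by simp
    then show ?thesis unfolding add_pow_int_lt[OF c] n neg[OF c] by simp
  qed
qed

lemma H_finsum: "finsum H g S = sum g S"
proof (cases "finite S")
  case True
  then show ?thesis by (induction S rule: finite_induct) simp_all
qed (simp add: H.finsum_infinite)

lemma free_ring_eval_sw_poly: "free_ring_eval H x (sw_poly A) = sw_eval x A"
proof -
  define ev where "ev f = (\<Sum>w\<in>Poly_Mapping.keys f. of_int (Poly_Mapping.lookup f w) * wprod x w)" for f
  have add: "ev (f + g) = ev f + ev g" for f g
    unfolding ev_def by (rule setsum_keys_plus_distrib) (simp_all add: algebra_simps)
  have single: "ev (Poly_Mapping.single u c) = of_int c * wprod x u" for u c
    by (cases "c = 0") (simp_all add: ev_def)
  have "ev (sw_poly A) = sw_eval x A"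
  proof (induction A)
    case Nil
    show ?case by (simp add: ev_def sw_poly_def sw_eval_def)
  next
    case (Cons a A)
    have "sw_poly (a # A) = Poly_Mapping.single (snd a) (fst a) + sw_poly A"
      by (simp add: sw_poly_def case_prod_beta)
    moreover have "sw_eval x (a # A) = of_int (fst a) * wprod x (snd a) + sw_eval x A"
      by (simp add: sw_eval_def case_prod_beta)
    ultimately show ?case using Cons by (simp add: add single)
  qed
  then show ?thesis
    by (simp add: free_ring_eval_def H_finsum H_int_smult ev_def wprod_def)
qed

text \<open>For every substitution the p^2 + 1 main variables become dependent over the center. The
  elimination then forces the last polynomial to vanish, whichever coefficients of the dependency
  happen to be nonzero.\<close>

lemma H_PI:
  assumes D: "D1 \<noteq> 0"
  shows "PI_ring H"
proof -
  let ?N = "p\<^sup>2"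
  let ?f = "sw_poly (elim_poly ?N ?N ?N)"
  have lead: "Poly_Mapping.lookup ?f (lead_word ?N ?N ?N) = 1"
    by (simp add: lookup_sw_poly lead_word_coeff)
  have len: "length v \<le> length (lead_word ?N ?N ?N)" if "v \<in> Poly_Mapping.keys ?f" for v
    using keys_sw_poly[OF that] elim_poly_length by (metis lead_word_facts(1) order_refl)
  have "free_ring_eval H x ?f = 0" for x
  proof -
    obtain c where c: "\<And>i. c i \<in> Z" "\<exists>i\<le>?N. c i \<noteq> 0" "(\<Sum>i\<le>?N. c i \<star> x i) = 0"
      using central_dependency[OF D] by blast
    define E where "E k i = sw_eval x (elim_poly ?N k i)" for k i
    have E0: "E 0 i = x i" for i by (simp add: E_def sw_eval_simps)
    have ES: "E (Suc k) i = E k i \<star> x (Suc (?N + k)) \<star> E k k - E k k \<star> x (Suc (?N + k)) \<star> E k i" for k i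
      by (simp add: E_def sw_eval_simps sw_eval_mult)
    have sum0: "k \<le> ?N \<Longrightarrow> (\<Sum>i\<in>{k..?N}. c i \<star> E k i) = 0" for k
    proof (induction k)
      case 0
      then show ?case using c(3) by (simp add: E0 atMost_atLeast0)
    next
      case (Suc k)
      let ?y = "x (Suc (?N + k))"
      have right: "u \<star> (\<Sum>i\<in>S. g i) = (\<Sum>i\<in>S. u \<star> g i)" for u and g :: "nat \<Rightarrow> _" and S
        by (induction S rule: infinite_finite_induct) (simp_all add: hmul_add_right)
      have summand: "c i \<star> E (Suc k) i = (c i \<star> E k i) \<star> (?y \<star> E k k) - (E k k \<star> ?y) \<star> (c i \<star> E k i)" for i
        using Z_left_comm[OF c(1)[of i], of "E k k \<star> ?y" "E k i"] by (simp add: ES hmul_diff_right hmul_assoc)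
      have "(\<Sum>i\<in>{k..?N}. c i \<star> E (Suc k) i) =
          (\<Sum>i\<in>{k..?N}. c i \<star> E k i) \<star> (?y \<star> E k k) - (E k k \<star> ?y) \<star> (\<Sum>i\<in>{k..?N}. c i \<star> E k i)"
        unfolding summand sum_subtractf hmul_sum_left right ..
      also have "\<dots> = 0" using Suc by simp
      finally have "(\<Sum>i\<in>{k..?N}. c i \<star> E (Suc k) i) = 0" .
      moreover have "E (Suc k) k = 0" by (simp add: ES)
      ultimately show ?case using Suc.prems by (simp add: sum.atLeast_Suc_atMost)
    qed
    \<comment> \<open>The last index with nonzero coefficient. After m eliminations only the term c
      m \<star> E m m is left, so E m m = 0 because H is a domain.\<close>
    define m where "m = Max {i. i \<le> ?N \<and> c i \<noteq> 0}"
    have fin: "finite {i. i \<le> ?N \<and> c i \<noteq> 0}" by simp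
    have "m \<in> {i. i \<le> ?N \<and> c i \<noteq> 0}" unfolding m_def by (rule Max_in[OF fin]) (use c(2) in auto)
    then have m: "m \<le> ?N" "c m \<noteq> 0" by auto
    have c0: "c i = 0" if "i \<in> {Suc m..?N}" for i
      using Max_ge[OF fin, of i] that by (force simp: m_def[symmetric])
    have "(\<Sum>i\<in>{m..?N}. c i \<star> E m i) = c m \<star> E m m"
      using m(1) c0 by (simp add: sum.atLeast_Suc_atMost)
    then have Em: "E m m = 0" using sum0[OF m(1)] hmul_eq_0_iff m(2) by simp
    \<comment> \<open>Both products in the next elimination contain E m m, so every later polynomial
      vanishes.\<close>
    have "E k i = 0" if "k > m" for k i
      using that
    proof (induction k arbitrary: i)
      case (Suc k)
      then show ?case by (cases "k = m") (simp_all add: ES Em)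
    qed simp
    then have "E ?N ?N = 0" using Em m(1) by (cases "m = ?N") auto
    then show ?thesis by (simp add: free_ring_eval_sw_poly E_def)
  qed
  then show ?thesis
    unfolding PI_ring_def using H.ring_axioms lead len by auto
qed

lemma H_PI_degree:
  assumes "D1 \<noteq> 0"
  shows "has_PI_degree H p"
  unfolding has_PI_degree_def
  using H_prime H_PI[OF assms] Q_total[OF assms] Q_center_subfield Q_dimension[OF assms] by blast

end

subsection \<open>The homological integral\<close>

context hoe
begin

text \<open>The quotient of \<open>H\<close> by the normal element \<open>X1\<close> is a polynomial ring in \<open>X2\<close>; \<open>ev\<close> is the projection.\<close>

definition ev :: "'k poly poly \<Rightarrow> 'k poly"
  where "ev f = map_poly (\<lambda>r. poly.coeff r 0) f"

text \<open>This is q of the overview. Since p^s \<ge> 1, the subtraction in the exponent is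
  exact.\<close>

definition D1_quot :: "'k poly"
  where "D1_quot = (\<Sum>s \<in> {s. d s \<noteq> 0}. Polynomial.monom (d s) (p ^ s - 1))"

lemma D1_quot: "D1 = [:0, 1:] * D1_quot"
proof -
  have "Polynomial.monom (d s) (p ^ s) = [:0, 1:] * Polynomial.monom (d s) (p ^ s - 1)" for s
  proof -
    have "p ^ s = Suc (p ^ s - 1)" using char_pos by simp
    then show ?thesis by (metis monom_Suc mult.commute mult_pCons_right mult_1_right smult_0_left add_0 mult_pCons_left one_pCons mult_1)
  qed
  then show ?thesis by (simp add: D1_def D1_quot_def sum_distrib_left)
qed

lemma D1_quot_0: "poly.coeff D1_quot 0 = d 0"
proof -
  have "poly.coeff D1_quot 0 = (\<Sum>s \<in> {s. d s \<noteq> 0}. if s = 0 then d 0 else 0)"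
  proof -
    have "poly.coeff (Polynomial.monom (d s) (p ^ s - 1)) 0 = (if s = 0 then d 0 else 0)" for s
    proof (cases s)
      case (Suc n)
      have "1 < p ^ s" using p_gt_1 Suc by (metis one_less_power zero_less_Suc)
      then show ?thesis using Suc by simp
    qed simp
    then show ?thesis by (simp add: D1_quot_def coeff_sum)
  qed
  then show ?thesis using finite_support by (simp add: sum.delta)
qed

lemma D1_coeff_0: "poly.coeff D1 0 = 0"
  by (simp add: D1_quot)

lemma ev_coeff: "poly.coeff (ev f) i = poly.coeff (poly.coeff f i) 0"
  by (simp add: ev_def coeff_map_poly)

lemma ev_simps [simp]: "ev (f + g) = ev f + ev g" "ev (f - g) = ev f - ev g" "ev (- f) = - ev f" "ev 0 = 0" "ev 1 = 1"
  "ev X1 = 0" "ev X2 = [:0, 1:]" "ev [:r:] = [:poly.coeff r 0:]" "ev (Polynomial.smult r f) = Polynomial.smult (poly.coeff r 0) (ev f)"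
  by (rule poly_eqI; simp add: ev_coeff X1_def X2_def coeff_pCons coeff_mult_0 split: nat.splits)+

text \<open>D1 has no constant term, so \<delta> takes values in the multiples of X1 and disappears
  modulo X1.\<close>

lemma ev_Y: "ev (Y f) = [:0, 1:] * ev f"
  by (rule poly_eqI) (simp add: ev_coeff Y_coeff \<delta>_eq coeff_mult_0 D1_coeff_0 coeff_pCons split: nat.splits)

lemma ev_mult: "ev (f \<star> g) = ev f * ev g"
proof (induction f arbitrary: g rule: pCons_induct)
  case (pCons r f)
  have "pCons r f \<star> g = Polynomial.smult r g + f \<star> Y g"
  proof -
    have "pCons r f = [:r:] + f \<star> X2" by (simp add: X2_right)
    then show ?thesis by (simp add: hmul_add_left hmul_const_left hmul_assoc X2_left)
  qed
  moreover have "ev (pCons r f) = pCons (poly.coeff r 0) (ev f)"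
    by (rule poly_eqI) (simp add: ev_coeff coeff_pCons split: nat.splits)
  ultimately show ?case using pCons.IH by (simp add: ev_Y algebra_simps)
qed simp

lemma X2_shift_X1: "(X2 - [:D1_quot:]) \<star> X1 = X1 \<star> X2"
proof -
  have "[:D1_quot:] \<star> X1 = [:D1:]" by (simp add: X1_def hmul_const_left D1_quot mult.commute)
  then show ?thesis by (simp add: hmul_diff_left X2_X1)
qed

text \<open>X1 is normal: it can be moved from left to right at the price of replacing X2 by X2 - q.
  Hence the kernel of \<open>ev\<close> consists of left as well as right multiples of X1.\<close>

lemma X1_left_right: "\<exists>g'. X1 \<star> g = g' \<star> X1"
proof (induction g rule: pCons_induct)
  case (pCons r g)
  then obtain g' where g': "X1 \<star> g = g' \<star> X1" by blast
  have "pCons r g = [:r:] + g \<star> X2" by (simp add: X2_right)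
  moreover have "X1 \<star> [:r:] = [:r:] \<star> X1" by (simp add: X1_def hmul_const_left mult.commute)
  ultimately have "X1 \<star> pCons r g = [:r:] \<star> X1 + g' \<star> (X1 \<star> X2)"
    using g' by (simp add: hmul_add_right hmul_assoc[symmetric])
  also have "\<dots> = ([:r:] + g' \<star> (X2 - [:D1_quot:])) \<star> X1"
    unfolding X2_shift_X1[symmetric] by (simp add: hmul_add_left hmul_assoc)
  finally show ?case by blast
qed (auto intro: exI[of _ 0])

lemma ev_eq_0_left: "ev f = 0 \<longleftrightarrow> (\<exists>g. f = X1 \<star> g)"
proof
  assume "ev f = 0"
  then have "poly.coeff (poly.coeff f i) 0 = 0" for i by (metis ev_coeff coeff_0)
  then have "f = Polynomial.smult [:0, 1:] (map_poly (poly_shift 1) f)"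
    by (intro poly_eqI) (simp add: coeff_map_poly poly_shift_0 coeff_pCons coeff_poly_shift split: nat.splits)
  then show "\<exists>g. f = X1 \<star> g" by (metis X1_left)
next
  assume "\<exists>g. f = X1 \<star> g"
  then show "ev f = 0" by (auto simp: ev_mult)
qed

lemma ev_eq_0_right: "ev f = 0 \<longleftrightarrow> (\<exists>g. f = g \<star> X1)"
proof
  assume "ev f = 0"
  then show "\<exists>g. f = g \<star> X1" using ev_eq_0_left X1_left_right by metis
next
  assume "\<exists>g. f = g \<star> X1"
  then show "ev f = 0" by (auto simp: ev_mult)
qed

text \<open>The character killing X1 and X2. It is identified with the counit only in
  \<open>counit_eq_aug\<close>, so that this part depends on the algebra alone.\<close>

abbreviation "aug f \<equiv> poly.coeff (ev f) 0"

lemma aug_simps: "aug (f \<star> g) = aug f * aug g" "aug 1 = 1"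
  by (simp_all add: ev_mult coeff_mult_0)

lemma trivial_simps [simp]: "carrier (trivial_module H \<epsilon>) = UNIV" "a \<odot>\<^bsub>trivial_module H \<epsilon>\<^esub> x = \<epsilon> a * x"
  "\<zero>\<^bsub>trivial_module H \<epsilon>\<^esub> = 0" "x \<oplus>\<^bsub>trivial_module H \<epsilon>\<^esub> y = x + y"
  by (simp_all add: trivial_module_def)

lemma trivial_left_module: "left_module H (trivial_module H aug)"
proof -
  have "abelian_group (trivial_module H aug)"
    by (rule abelian_groupI) (auto intro: exI[of _ "- _"])
  then show ?thesis
    unfolding left_module_def left_module_axioms_def
    using H.ring_axioms by (simp add: aug_simps algebra_simps)
qed

text \<open>All exactness conditions are decided by reduction modulo X1, where H becomes the domain
  k[X2], together with cancellation of X1 in H.\<close>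

lemma koszul_trivial: "koszul H (trivial_module H aug) 1 X1 X2 (X2 - [:D1_quot:]) (- X1)"
proof (intro koszul.intro koszul_axioms.intro trivial_left_module)
  fix x assume "x \<in> carrier (trivial_module H aug)"
  show "\<exists>a \<in> carrier H. x = a \<odot>\<^bsub>trivial_module H aug\<^esub> 1"
    by (rule bexI[of _ "[:[:x:]:]"]) simp_all
next
  fix a assume "a \<odot>\<^bsub>trivial_module H aug\<^esub> 1 = \<zero>\<^bsub>trivial_module H aug\<^esub>"
  then have a0: "aug a = 0" by simp
  obtain r a' where a: "a = pCons r a'" by (cases a)
  have r: "poly.coeff r 0 = 0" using a0 by (simp add: a ev_coeff)
  then have "ev [:r:] = 0" by simp
  then obtain u where u: "[:r:] = u \<star> X1" using ev_eq_0_right by blast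
  have "a = u \<star> X1 + a' \<star> X2" by (simp add: a X2_right u[symmetric])
  then show "\<exists>u \<in> carrier H. \<exists>v \<in> carrier H. a = u \<star> X1 \<oplus>\<^bsub>H\<^esub> v \<star> X2" by auto
next
  show "(X2 - [:D1_quot:]) \<star> X1 \<oplus>\<^bsub>H\<^esub> (- X1) \<star> X2 = \<zero>\<^bsub>H\<^esub>"
    by (simp add: X2_shift_X1 hmul_uminus)
next
  fix a b assume "a \<star> X1 \<oplus>\<^bsub>H\<^esub> b \<star> X2 = \<zero>\<^bsub>H\<^esub>"
  then have eq: "a \<star> X1 + b \<star> X2 = 0" by simp
  \<comment> \<open>Modulo X1 the relation becomes ev b times X2 = 0, so b = c X1; moving X1 past X2
    and cancelling it determines a.\<close>
  have "ev (a \<star> X1 + b \<star> X2) = ev b * [:0, 1:]" by (simp add: ev_mult)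
  then have "ev b = 0" using eq by simp
  then obtain c where c: "b = c \<star> X1" using ev_eq_0_right by blast
  have "a \<star> X1 = - (c \<star> (X1 \<star> X2))" using eq c by (simp add: hmul_assoc eq_neg_iff_add_eq_0)
  also have "\<dots> = (- c \<star> (X2 - [:D1_quot:])) \<star> X1"
    unfolding X2_shift_X1[symmetric] by (simp add: hmul_assoc hmul_uminus)
  finally have "a = - c \<star> (X2 - [:D1_quot:])" using hmul_cancel(1)[of X1] by (simp add: X1_def)
  moreover have "b = - c \<star> - X1" using c by (simp add: hmul_uminus)
  ultimately show "\<exists>c \<in> carrier H. a = c \<star> (X2 - [:D1_quot:]) \<and> b = c \<star> - X1" by auto
next
  fix c assume "c \<star> - X1 = \<zero>\<^bsub>H\<^esub>"
  then show "c = \<zero>\<^bsub>H\<^esub>" by (simp add: hmul_uminus hmul_eq_0_iff X1_def)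
next
  fix r assume "X1 \<star> r = \<zero>\<^bsub>H\<^esub>"
  then show "r = \<zero>\<^bsub>H\<^esub>" by (simp add: hmul_eq_0_iff X1_def)
next
  fix a b assume "(X2 - [:D1_quot:]) \<star> a \<oplus>\<^bsub>H\<^esub> (- X1) \<star> b = \<zero>\<^bsub>H\<^esub>"
  then have eq: "(X2 - [:D1_quot:]) \<star> a = X1 \<star> b" by (simp add: hmul_uminus)
  \<comment> \<open>Modulo X1 the left factor becomes the nonzero polynomial X2 - d_0, so a must
    vanish there. This also shows where d_0 = q(0) enters the integral.\<close>
  have "ev (X2 - [:D1_quot:]) = [:- d 0, 1:]" by (simp add: D1_quot_0)
  then have "[:- d 0, 1:] * ev a = 0" using arg_cong[OF eq, of ev] by (simp only: ev_mult ev_simps mult_zero_left)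
  then have "ev a = 0" by (metis mult_eq_0_iff pCons_eq_0_iff one_neq_zero)
  then obtain n where n: "a = X1 \<star> n" using ev_eq_0_left by blast
  have "X1 \<star> b = X1 \<star> (X2 \<star> n)" unfolding eq[symmetric] n by (simp add: hmul_assoc[symmetric] X2_shift_X1)
  then have "b = X2 \<star> n" using hmul_cancel(2)[of X1] by (simp add: X1_def)
  then show "\<exists>n \<in> carrier H. a = X1 \<star> n \<and> b = X2 \<star> n" using n by auto
qed (simp_all)

text \<open>The character with X1 \<mapsto> 0 and X2 \<mapsto> d_0. Its kernel is at once the right
  ideal of coboundary values and the two-sided ideal of the quotient in the theorem.\<close>

abbreviation "char0 f \<equiv> poly (ev f) (d 0)"

lemma char0_kernel: "char0 f = 0 \<longleftrightarrow> (\<exists>x y. f = (X2 - [:D1_quot:]) \<star> x + - X1 \<star> y)"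
proof
  assume "char0 f = 0"
  then obtain g where g: "ev f = [:- d 0, 1:] * g" by (metis poly_eq_0_iff_dvd dvdE)
  \<comment> \<open>A lift of g along \<open>ev\<close> with coefficients in k.\<close>
  let ?x = "map_poly (\<lambda>c. [:c:]) g"
  have "ev ?x = g" by (rule poly_eqI) (simp add: ev_coeff coeff_map_poly)
  then have "ev (f - (X2 - [:D1_quot:]) \<star> ?x) = 0" by (simp add: ev_mult D1_quot_0 g)
  then obtain y where "f - (X2 - [:D1_quot:]) \<star> ?x = X1 \<star> y" using ev_eq_0_left by blast
  then have "f = (X2 - [:D1_quot:]) \<star> ?x + - X1 \<star> (- y)" by (simp add: hmul_uminus algebra_simps)
  then show "\<exists>x y. f = (X2 - [:D1_quot:]) \<star> x + - X1 \<star> y" by blast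
qed (auto simp: ev_mult D1_quot_0)

lemma char0_ideal: "Idl\<^bsub>H\<^esub> {X1, X2 \<ominus>\<^bsub>H\<^esub> d 0 \<odot>\<^bsub>H\<^esub> \<one>\<^bsub>H\<^esub>} = {f. char0 f = 0}" (is "?I = ?K")
proof
  interpret I: ideal ?I H by (rule H.genideal_ideal) simp
  have K: "ideal ?K H"
  proof (rule idealI[OF H.ring_axioms])
    show "subgroup ?K (add_monoid H)"
      by (rule H.add.subgroupI) (auto intro: exI[of _ 0])
  qed (auto simp: ev_mult)
  show "?I \<subseteq> ?K"
    by (rule H.genideal_minimal[OF K]) (simp add: ev_coeff)
  have mem: "X1 \<in> ?I" "X2 - [:[:d 0:]:] \<in> ?I"
    using H.genideal_self[of "{X1, X2 \<ominus>\<^bsub>H\<^esub> d 0 \<odot>\<^bsub>H\<^esub> \<one>\<^bsub>H\<^esub>}"] by auto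
  have add: "f + g \<in> ?I" if "f \<in> ?I" "g \<in> ?I" for f g using I.a_closed[OF that] by simp
  \<comment> \<open>q - d_0 vanishes at zero, so X2 - q and X2 - d_0 differ by a multiple of
    X1.\<close>
  have "ev [:D1_quot - [:d 0:]:] = 0" by (simp add: D1_quot_0)
  then obtain u where u: "[:D1_quot - [:d 0:]:] = u \<star> X1" using ev_eq_0_right by blast
  have "X2 - [:D1_quot:] = X2 - [:[:d 0:]:] + (- u) \<star> X1" by (simp add: hmul_uminus u[symmetric])
  then have B1: "X2 - [:D1_quot:] \<in> ?I"
    by (rule ssubst) (rule add[OF mem(2) I.I_l_closed[OF mem(1)]], simp)
  have B2: "- X1 \<in> ?I" using I.a_inv_closed[OF mem(1)] by simp
  show "?K \<subseteq> ?I"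
  proof
    fix f assume "f \<in> ?K"
    then obtain x y where "f = (X2 - [:D1_quot:]) \<star> x + - X1 \<star> y" using char0_kernel by auto
    then show "f \<in> ?I" using add I.I_r_closed[OF B1, of x] I.I_r_closed[OF B2, of y] by simp
  qed
qed

lemma with_actions_simps [simp]:
  "carrier (with_actions M l r) = carrier M" "add (with_actions M l r) = add M" "zero (with_actions M l r) = zero M"
  "smult (with_actions M l r) = l" "rsmult (with_actions M l r) = r"
  by (simp_all add: with_actions_def with_action_def ring.defs module.defs bimodule.defs)

text \<open>\<open>Ext_two\<close> is applied to the projection onto H/I; its naturality for right
  multiplications makes the resulting bijection one of right modules.\<close>

theorem homological_integral:
  fixes \<epsilon> assumes "\<epsilon> = aug"
  defines "I \<equiv> Idl\<^bsub>H\<^esub> {X1, X2 \<ominus>\<^bsub>H\<^esub> d 0 \<odot>\<^bsub>H\<^esub> \<one>\<^bsub>H\<^esub>}"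
  shows "one_dimensional H (left_homological_integral 2 H \<epsilon>)"
    "left_trivial H \<epsilon> (left_homological_integral 2 H \<epsilon>)"
    "right_module_iso H (left_homological_integral 2 H \<epsilon>) (quotient_bimodule H I)"
proof -
  interpret K: koszul H "trivial_module H aug" 1 X1 X2 "X2 - [:D1_quot:]" "- X1" by (rule koszul_trivial)
  interpret I: ideal I H unfolding I_def by (rule H.genideal_ideal) simp
  let ?Q = "H Quot I"
  interpret Q: ring ?Q by (rule I.quotient_is_ring)
  have I_eq: "I = {f. char0 f = 0}" unfolding I_def by (rule char0_ideal)
  have mem_I: "f \<in> I \<longleftrightarrow> char0 f = 0" for f by (simp add: I_eq)
  define \<kappa> where "\<kappa> f = I +>\<^bsub>H\<^esub> f" for f
  have \<kappa>_hom: "\<kappa> \<in> ring_hom H ?Q" unfolding \<kappa>_def by (rule I.rcos_ring_hom)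
  have \<kappa>: "\<kappa> f \<in> carrier ?Q" "\<kappa> (f + g) = \<kappa> f \<oplus>\<^bsub>?Q\<^esub> \<kappa> g" "\<kappa> (f \<star> g) = \<kappa> f \<otimes>\<^bsub>?Q\<^esub> \<kappa> g" for f g
    using ring_hom_closed[OF \<kappa>_hom, of f] ring_hom_add[OF \<kappa>_hom, of f g] ring_hom_mult[OF \<kappa>_hom, of f g] by simp_all
  have zero: "\<zero>\<^bsub>?Q\<^esub> = I" by (simp add: FactRing_def)
  have \<kappa>0: "\<kappa> f = \<zero>\<^bsub>?Q\<^esub> \<longleftrightarrow> f \<in> I" for f
    unfolding zero \<kappa>_def using I.a_rcos_const[of f] I.a_rcos_self[of f] by auto
  obtain \<Phi> where bij: "bij_betw \<Phi> (carrier (Ext H 2 (trivial_module H aug) (regular_module H))) (carrier ?Q)"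
    and add: "\<And>X W. \<lbrakk>X \<in> carrier (Ext H 2 (trivial_module H aug) (regular_module H));
        W \<in> carrier (Ext H 2 (trivial_module H aug) (regular_module H))\<rbrakk> \<Longrightarrow>
      \<Phi> (X \<oplus>\<^bsub>Ext H 2 (trivial_module H aug) (regular_module H)\<^esub> W) = \<Phi> X \<oplus>\<^bsub>?Q\<^esub> \<Phi> W"
    and nat: "\<And>g X r. \<lbrakk>g \<in> module_hom H (regular_module H) (regular_module H);
        X \<in> carrier (Ext H 2 (trivial_module H aug) (regular_module H)); r \<in> carrier H; \<Phi> X = \<kappa> r\<rbrakk> \<Longrightarrow>
      Ext_map_right H 2 (trivial_module H aug) (regular_module H) g X \<in> carrier (Ext H 2 (trivial_module H aug) (regular_module H)) \<and>
      \<Phi> (Ext_map_right H 2 (trivial_module H aug) (regular_module H) g X) = \<kappa> (g r)"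
    and \<Phi>0: "\<Phi> \<zero>\<^bsub>Ext H 2 (trivial_module H aug) (regular_module H)\<^esub> = \<zero>\<^bsub>?Q\<^esub>"
  proof (rule K.Ext_two[of ?Q \<kappa>])
    show "abelian_group ?Q" ..
    show "\<exists>a\<in>carrier H. \<kappa> a = y" if "y \<in> carrier ?Q" for y
      using that by (auto simp: FactRing_def A_RCOSETS_def' \<kappa>_def)
    show "\<kappa> a = \<zero>\<^bsub>?Q\<^esub> \<longleftrightarrow> (\<exists>x\<in>carrier H. \<exists>y\<in>carrier H. a = (X2 - [:D1_quot:]) \<star> x \<oplus>\<^bsub>H\<^esub> - X1 \<star> y)" for a
      unfolding \<kappa>0[of a] mem_I char0_kernel by simp
  qed (auto simp: \<kappa>)
  let ?E = "Ext H 2 (trivial_module H aug) (regular_module H)"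
  have rm: "(\<lambda>a. a \<star> h) \<in> module_hom H (regular_module H) (regular_module H)" for h
    by (rule module_homI) (auto simp: hmul_add_left hmul_assoc)
  define J where "J = left_homological_integral 2 H \<epsilon>"
  have J: "carrier J = carrier ?E" "add J = add ?E" "zero J = zero ?E"
    "rsmult J \<xi> h = Ext_map_right H 2 (trivial_module H aug) (regular_module H) (\<lambda>a. a \<star> h) \<xi>"
    "smult J h \<xi> = Ext_map_left H 2 (trivial_module H aug) (trivial_module H aug) (regular_module H) (\<lambda>x. x * aug h) \<xi>" for \<xi> h
    by (simp_all add: J_def left_homological_integral_def Let_def assms)
  \<comment> \<open>A preimage r of the value turns the action of h into r h, whose class is the
    product in the quotient.\<close>
  have Jr: "rsmult J \<xi> h \<in> carrier J" "\<Phi> (rsmult J \<xi> h) = \<Phi> \<xi> \<otimes>\<^bsub>?Q\<^esub> \<kappa> h" if \<xi>: "\<xi> \<in> carrier J" for \<xi> h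
  proof -
    have "\<Phi> \<xi> \<in> carrier ?Q" using bij \<xi> J by (auto simp: bij_betw_def)
    then obtain r where r: "\<Phi> \<xi> = \<kappa> r" by (auto simp: FactRing_def A_RCOSETS_def' \<kappa>_def)
    show "rsmult J \<xi> h \<in> carrier J" "\<Phi> (rsmult J \<xi> h) = \<Phi> \<xi> \<otimes>\<^bsub>?Q\<^esub> \<kappa> h"
      using nat[OF rm[of h] _ _ r] \<xi> by (simp_all add: J \<kappa> r)
  qed
  have inj: "inj_on \<Phi> (carrier J)" using bij J by (simp add: bij_betw_def)
  show "right_module_iso H (left_homological_integral 2 H \<epsilon>) (quotient_bimodule H I)"
    unfolding J_def[symmetric] right_module_iso_def
  proof (intro exI[of _ \<Phi>] conjI ballI)
    show "bij_betw \<Phi> (carrier J) (carrier (quotient_bimodule H I))"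
      using bij by (simp add: J quotient_bimodule_def Let_def)
    show "\<Phi> (x \<oplus>\<^bsub>J\<^esub> y) = \<Phi> x \<oplus>\<^bsub>quotient_bimodule H I\<^esub> \<Phi> y" if "x \<in> carrier J" "y \<in> carrier J" for x y
      using add that by (simp add: J quotient_bimodule_def Let_def)
    show "\<Phi> (rsmult J x a) = rsmult (quotient_bimodule H I) (\<Phi> x) a" if "x \<in> carrier J" for x a
      using Jr(2)[OF that] by (simp add: quotient_bimodule_def Let_def \<kappa>_def)
  qed
  \<comment> \<open>Every class in the quotient is that of a scalar, namely of its value under the
    character; this is one-dimensionality.\<close>
  have scal: "\<kappa> f = \<kappa> [:[:char0 f:]:]" for f
  proof -
    have "f - [:[:char0 f:]:] \<in> I" unfolding mem_I by simp
    then have "\<kappa> (f - [:[:char0 f:]:]) = \<zero>\<^bsub>?Q\<^esub>" using \<kappa>0 by simp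
    then have "\<kappa> (f - [:[:char0 f:]:] + [:[:char0 f:]:]) = \<kappa> [:[:char0 f:]:]"
      unfolding \<kappa>(2) by (simp add: \<kappa>(1))
    then show ?thesis by (simp only: diff_add_cancel)
  qed
  show "one_dimensional H (left_homological_integral 2 H \<epsilon>)"
    unfolding J_def[symmetric] one_dimensional_def
  proof -
    have "\<kappa> 1 \<in> \<Phi> ` carrier J" using bij \<kappa>(1)[of 1] unfolding bij_betw_def J(1) by argo
    then obtain v where v: "v \<in> carrier J" "\<Phi> v = \<kappa> 1" by fastforce
    have "v \<noteq> \<zero>\<^bsub>J\<^esub>"
    proof
      assume "v = \<zero>\<^bsub>J\<^esub>"
      then have "\<kappa> 1 = \<zero>\<^bsub>?Q\<^esub>" using v(2) \<Phi>0 J(3) by argo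
      then show False unfolding \<kappa>0 mem_I by simp
    qed
    moreover have "carrier J = range (\<lambda>r. rsmult J v (r \<odot>\<^bsub>H\<^esub> \<one>\<^bsub>H\<^esub>))"
    proof (intro Set.set_eqI iffI)
      fix x assume x: "x \<in> carrier J"
      have "\<Phi> x \<in> carrier ?Q" using bij x J by (auto simp: bij_betw_def)
      then obtain f where f: "\<Phi> x = \<kappa> f" by (auto simp: FactRing_def A_RCOSETS_def' \<kappa>_def)
      have "\<Phi> x = \<Phi> (rsmult J v [:[:char0 f:]:])"
        using Jr(2)[OF v(1), of "[:[:char0 f:]:]"] scal[of f] f v \<kappa>(3)[of 1 "[:[:char0 f:]:]"] by simp
      then have "x = rsmult J v [:[:char0 f:]:]" using inj x Jr(1)[OF v(1)] by (auto dest: inj_onD)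
      then show "x \<in> range (\<lambda>r. rsmult J v (r \<odot>\<^bsub>H\<^esub> \<one>\<^bsub>H\<^esub>))" by auto
    next
      fix x assume "x \<in> range (\<lambda>r. rsmult J v (r \<odot>\<^bsub>H\<^esub> \<one>\<^bsub>H\<^esub>))"
      then show "x \<in> carrier J" using Jr(1)[OF v(1)] by auto
    qed
    ultimately show "\<exists>v\<in>carrier J. v \<noteq> \<zero>\<^bsub>J\<^esub> \<and> carrier J = range (\<lambda>r. rsmult J v (r \<odot>\<^bsub>H\<^esub> \<one>\<^bsub>H\<^esub>))"
      using v(1) by blast
  qed
  show "left_trivial H \<epsilon> (left_homological_integral 2 H \<epsilon>)"
    unfolding J_def[symmetric] left_trivial_def
  proof (intro ballI)
    fix h v assume v: "v \<in> carrier J"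
    \<comment> \<open>Right multiplication by h on the trivial module is multiplication by a scalar.
      Lifted to H, this scalar is central and acts on both arguments of Ext.\<close>
    let ?e = "[:[:aug h:]:]"
    have e: "?e \<star> f = f \<star> ?e" for f using hmul_scal(1)[of "aug h" 1 f] hmul_scal(2)[of f "aug h" 1] by simp
    have "Ext_map_left H 2 (trivial_module H aug) (trivial_module H aug) (regular_module H) (\<lambda>x. x * aug h) v =
        Ext_map_right H 2 (trivial_module H aug) (regular_module H) (\<lambda>a. a \<star> ?e) v"
      by (rule K.E.Ext_map_left_central[of ?e]) (use e v J rm in auto)
    then show "h \<odot>\<^bsub>J\<^esub> v = rsmult J v (\<epsilon> h \<odot>\<^bsub>H\<^esub> \<one>\<^bsub>H\<^esub>)" by (simp add: J assms)
  qed
qed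

end

subsection \<open>Evaluation of polynomials in an algebra\<close>

context k_algebra
begin

definition ev1 :: "'a \<Rightarrow> 'k poly \<Rightarrow> 'a"
  where "ev1 a f = fold_coeffs (\<lambda>c y. c \<odot> \<one> \<oplus> a \<otimes> y) f \<zero>"

text \<open>Values of the coefficients stand on the left and powers of b on the right, matching the
  normal form in the Ore extension.\<close>

definition ev2 :: "'a \<Rightarrow> 'a \<Rightarrow> 'k poly poly \<Rightarrow> 'a"
  where "ev2 a b f = fold_coeffs (\<lambda>r y. ev1 a r \<oplus> y \<otimes> b) f \<zero>"

lemma ev1_0 [simp]: "ev1 a 0 = \<zero>"
  by (simp add: ev1_def)

lemma ev1_pCons:
  assumes "a \<in> carrier A"
  shows "ev1 a (pCons c f) = c \<odot> \<one> \<oplus> a \<otimes> ev1 a f"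
proof (cases "c = 0 \<and> f = 0")
  case False
  then show ?thesis
    unfolding ev1_def by (cases "c = 0") simp_all
qed (use assms in simp)

lemma ev1_closed [simp]: "a \<in> carrier A \<Longrightarrow> ev1 a f \<in> carrier A"
  by (induction f rule: pCons_induct) (simp_all add: ev1_pCons scal_closed)

lemma ev1_add: "a \<in> carrier A \<Longrightarrow> ev1 a (f + g) = ev1 a f \<oplus> ev1 a g"
proof (induction f arbitrary: g rule: pCons_induct)
  case (pCons c f)
  obtain e h where g: "g = pCons e h" by (cases g)
  show ?case
    using pCons by (simp add: g ev1_pCons scal_add_left scal_closed r_distr a_ac)
qed simp

lemma ev1_smult: "a \<in> carrier A \<Longrightarrow> ev1 a (Polynomial.smult c f) = c \<odot> ev1 a f"
  by (induction f rule: pCons_induct)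
    (simp_all add: ev1_pCons scal_add_right scal_closed scal_mult_right scal_scal)

lemma ev1_mult: "a \<in> carrier A \<Longrightarrow> ev1 a (f * g) = ev1 a f \<otimes> ev1 a g"
  by (induction f rule: pCons_induct)
    (simp_all add: ev1_pCons ev1_add ev1_smult scal_closed l_distr scal_mult_left m_assoc)

lemma ev1_simps: "a \<in> carrier A \<Longrightarrow> ev1 a [:c:] = c \<odot> \<one>" "a \<in> carrier A \<Longrightarrow> ev1 a 1 = \<one>"
  "a \<in> carrier A \<Longrightarrow> ev1 a [:0, 1:] = a" "a \<in> carrier A \<Longrightarrow> ev1 a (- f) = \<ominus> ev1 a f"
proof -
  show 1: "a \<in> carrier A \<Longrightarrow> ev1 a [:c:] = c \<odot> \<one>" for c by (simp add: ev1_pCons scal_closed)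
  show "a \<in> carrier A \<Longrightarrow> ev1 a 1 = \<one>" by (simp add: one_pCons 1 scal_one)
  show "a \<in> carrier A \<Longrightarrow> ev1 a [:0, 1:] = a" by (simp add: ev1_pCons scal_closed scal_one)
  show "a \<in> carrier A \<Longrightarrow> ev1 a (- f) = \<ominus> ev1 a f"
    using ev1_add[of a "- f" f] by (simp add: minus_equality)
qed

lemma ev1_monom: "a \<in> carrier A \<Longrightarrow> ev1 a (Polynomial.monom c n) = c \<odot> (a [^] n)"
proof (induction n)
  case (Suc n)
  have "a [^] Suc n = a \<otimes> a [^] n" by (rule nat_pow_Suc2) (use Suc in simp)
  then show ?case using Suc by (simp add: monom_Suc ev1_pCons scal_mult_right scal_closed)
qed (simp add: monom_0 ev1_simps)

lemma ev1_commute: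
  assumes "a \<in> carrier A" "b \<in> carrier A" "b \<otimes> a = a \<otimes> b"
  shows "b \<otimes> ev1 a f = ev1 a f \<otimes> b"
proof (induction f rule: pCons_induct)
  case (pCons c f)
  have "b \<otimes> (a \<otimes> ev1 a f) = a \<otimes> ev1 a f \<otimes> b"
    using assms pCons by (metis ev1_closed m_assoc)
  then show ?case using assms by (simp add: ev1_pCons scal_closed l_distr r_distr scal_mult_left scal_mult_right)
qed (use assms in simp)

lemma ev2_0 [simp]: "ev2 a b 0 = \<zero>"
  by (simp add: ev2_def)

lemma ev2_pCons:
  assumes "a \<in> carrier A" "b \<in> carrier A"
  shows "ev2 a b (pCons r f) = ev1 a r \<oplus> ev2 a b f \<otimes> b"
proof (cases "r = 0 \<and> f = 0")
  case False
  then show ?thesis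
    unfolding ev2_def by (cases "r = 0") simp_all
qed (use assms in simp)

lemma ev2_closed [simp]: "a \<in> carrier A \<Longrightarrow> b \<in> carrier A \<Longrightarrow> ev2 a b f \<in> carrier A"
  by (induction f rule: pCons_induct) (simp_all add: ev2_pCons)

lemma ev2_add: "a \<in> carrier A \<Longrightarrow> b \<in> carrier A \<Longrightarrow> ev2 a b (f + g) = ev2 a b f \<oplus> ev2 a b g"
proof (induction f arbitrary: g rule: pCons_induct)
  case (pCons c f)
  obtain e h where g: "g = pCons e h" by (cases g)
  show ?case
    using pCons by (simp add: g ev2_pCons ev1_add l_distr a_ac)
qed simp

lemma ev2_smult: "a \<in> carrier A \<Longrightarrow> b \<in> carrier A \<Longrightarrow> ev2 a b (Polynomial.smult r f) = ev1 a r \<otimes> ev2 a b f"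
  by (induction f rule: pCons_induct) (simp_all add: ev2_pCons ev1_mult r_distr m_assoc)

lemma ev2_scal: "a \<in> carrier A \<Longrightarrow> b \<in> carrier A \<Longrightarrow> ev2 a b (Polynomial.smult [:c:] f) = c \<odot> ev2 a b f"
  by (simp add: ev2_smult ev1_simps scal_mult_left)

lemma ev2_simps: "a \<in> carrier A \<Longrightarrow> b \<in> carrier A \<Longrightarrow> ev2 a b [:r:] = ev1 a r"
  "a \<in> carrier A \<Longrightarrow> b \<in> carrier A \<Longrightarrow> ev2 a b 1 = \<one>"
  "a \<in> carrier A \<Longrightarrow> b \<in> carrier A \<Longrightarrow> ev2 a b X1 = a" "a \<in> carrier A \<Longrightarrow> b \<in> carrier A \<Longrightarrow> ev2 a b X2 = b"
proof -
  show 1: "a \<in> carrier A \<Longrightarrow> b \<in> carrier A \<Longrightarrow> ev2 a b [:r:] = ev1 a r" for r by (simp add: ev2_pCons)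
  show "a \<in> carrier A \<Longrightarrow> b \<in> carrier A \<Longrightarrow> ev2 a b 1 = \<one>"
    by (simp add: one_pCons 1 ev1_simps scal_one)
  show "a \<in> carrier A \<Longrightarrow> b \<in> carrier A \<Longrightarrow> ev2 a b X1 = a" by (simp add: X1_def 1 ev1_simps)
  show "a \<in> carrier A \<Longrightarrow> b \<in> carrier A \<Longrightarrow> ev2 a b X2 = b" by (simp add: X2_def ev2_pCons ev1_simps)
qed

lemma ev2_commutative_mult:
  assumes ab: "a \<in> carrier A" "b \<in> carrier A" "b \<otimes> a = a \<otimes> b"
  shows "ev2 a b (f * g) = ev2 a b f \<otimes> ev2 a b g"
proof -
  have comm: "b \<otimes> ev2 a b g = ev2 a b g \<otimes> b"
  proof (induction g rule: pCons_induct)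
    case (pCons r g)
    have "b \<otimes> (ev2 a b g \<otimes> b) = ev2 a b g \<otimes> b \<otimes> b" using ab pCons by (simp add: m_assoc[symmetric])
    then show ?case using ab ev1_commute[OF ab] by (simp add: ev2_pCons l_distr r_distr)
  qed (use ab in simp)
  show ?thesis
  proof (induction f rule: pCons_induct)
    case (pCons r f)
    have "ev2 a b (pCons r f * g) = ev1 a r \<otimes> ev2 a b g \<oplus> ev2 a b f \<otimes> ev2 a b g \<otimes> b"
      using ab pCons by (simp add: ev2_add ev2_smult ev2_pCons)
    also have "\<dots> = ev2 a b (pCons r f) \<otimes> ev2 a b g"
      using ab by (simp add: ev2_pCons l_distr m_assoc comm)
    finally show ?case .
  qed (use ab in simp)
qed

text \<open>For commuting a and b the map \<open>ev2\<close> is multiplicative on the commutative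
  ring k[x][y], so the identity (x + y)^(p^s) = x^(p^s) + y^(p^s) is transported from there into an
  algebra that need not be commutative.\<close>

lemma frobenius_add:
  assumes ab: "a \<in> carrier A" "b \<in> carrier A" "b \<otimes> a = a \<otimes> b" and p: "prime CHAR('k)"
  shows "(a \<oplus> b) [^] (CHAR('k) ^ s) = a [^] (CHAR('k) ^ s) \<oplus> b [^] (CHAR('k) ^ s)"
proof -
  have pow: "ev2 a b (f ^ n) = ev2 a b f [^] n" for f and n :: nat
  proof (induction n)
    case (Suc n)
    have "ev2 a b (f ^ Suc n) = ev2 a b (f ^ n * f)" by (simp add: mult.commute)
    also have "\<dots> = ev2 a b (f ^ n) \<otimes> ev2 a b f" by (rule ev2_commutative_mult[OF ab])
    finally show ?case using Suc by simp
  qed (use ab in \<open>simp add: ev2_simps\<close>)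
  have "(X1 + X2 :: 'k poly poly) ^ (CHAR('k) ^ s) = X1 ^ (CHAR('k) ^ s) + X2 ^ (CHAR('k) ^ s)"
    by (rule freshmans_dream') (use p in simp_all)
  from arg_cong[OF this, of "ev2 a b"] show ?thesis
    using ab by (simp add: ev2_add pow ev2_simps)
qed

end

context hoe
begin

lemma ev1_D1_add:
  assumes B: "k_algebra (B :: ('k, 'b, 'z) module_scheme)"
    and ab: "a \<in> carrier B" "b \<in> carrier B" "b \<otimes>\<^bsub>B\<^esub> a = a \<otimes>\<^bsub>B\<^esub> b"
  shows "k_algebra.ev1 B (a \<oplus>\<^bsub>B\<^esub> b) D1 = k_algebra.ev1 B a D1 \<oplus>\<^bsub>B\<^esub> k_algebra.ev1 B b D1"
proof -
  interpret B: k_algebra B by fact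
  let ?m = "\<lambda>s. Polynomial.monom (d s) (p ^ s)"
  have "B.ev1 (a \<oplus>\<^bsub>B\<^esub> b) (\<Sum>s\<in>S. ?m s) = B.ev1 a (\<Sum>s\<in>S. ?m s) \<oplus>\<^bsub>B\<^esub> B.ev1 b (\<Sum>s\<in>S. ?m s)" for S
  proof (induction S rule: infinite_finite_induct)
    case (insert s S)
    have "B.ev1 (a \<oplus>\<^bsub>B\<^esub> b) (?m s) = B.ev1 a (?m s) \<oplus>\<^bsub>B\<^esub> B.ev1 b (?m s)"
      using ab B.frobenius_add[OF ab, of s] prime_p by (simp add: B.ev1_monom char_p B.scal_add_right)
    then show ?case using insert ab by (simp add: B.ev1_add B.a_ac)
  qed (use ab in simp_all)
  then show ?thesis by (simp add: D1_def)
qed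

text \<open>Derived from additivity at -a and a, which treats even and odd characteristic
  alike.\<close>

lemma ev1_D1_uminus:
  assumes B: "k_algebra (B :: ('k, 'b, 'z) module_scheme)" and a: "a \<in> carrier B"
  shows "k_algebra.ev1 B (\<ominus>\<^bsub>B\<^esub> a) D1 = \<ominus>\<^bsub>B\<^esub> k_algebra.ev1 B a D1"
proof -
  interpret B: k_algebra B by fact
  have "B.ev1 \<zero>\<^bsub>B\<^esub> D1 = \<zero>\<^bsub>B\<^esub>"
    unfolding D1_quot by (simp add: B.ev1_mult B.ev1_simps del: mult_pCons_left)
  then have "B.ev1 (\<ominus>\<^bsub>B\<^esub> a) D1 \<oplus>\<^bsub>B\<^esub> B.ev1 a D1 = \<zero>\<^bsub>B\<^esub>"
    using ev1_D1_add[OF B, of "\<ominus>\<^bsub>B\<^esub> a" a] a by (simp add: B.l_neg B.l_minus B.r_minus)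
  then show ?thesis using a by (simp add: B.minus_equality)
qed

text \<open>The universal property of the Ore extension: the single relation b a = a b + D1(a) makes
  substitution multiplicative.\<close>

lemma ev2_hmul:
  assumes B: "k_algebra (B :: ('k, 'b, 'z) module_scheme)"
    and ab: "a \<in> carrier B" "b \<in> carrier B" "b \<otimes>\<^bsub>B\<^esub> a = a \<otimes>\<^bsub>B\<^esub> b \<oplus>\<^bsub>B\<^esub> k_algebra.ev1 B a D1"
  shows "k_algebra.ev2 B a b (f \<star> g) = k_algebra.ev2 B a b f \<otimes>\<^bsub>B\<^esub> k_algebra.ev2 B a b g"
proof -
  interpret B: k_algebra B by fact
  \<comment> \<open>The relation for the generator extends to all polynomials in a because \<delta>
    obeys the product rule.\<close>
  have \<delta>: "b \<otimes>\<^bsub>B\<^esub> B.ev1 a r = B.ev1 a r \<otimes>\<^bsub>B\<^esub> b \<oplus>\<^bsub>B\<^esub> B.ev1 a (\<delta> r)" for r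
  proof (induction r rule: pCons_induct)
    case (pCons c r)
    have "pCons c r = [:c:] + [:0, 1:] * r" by simp
    then have dr: "\<delta> (pCons c r) = D1 * r + [:0, 1:] * \<delta> r" by (simp only: \<delta>_add \<delta>_mult \<delta>_simps add_0)
    have "b \<otimes>\<^bsub>B\<^esub> (a \<otimes>\<^bsub>B\<^esub> B.ev1 a r) = (a \<otimes>\<^bsub>B\<^esub> b \<oplus>\<^bsub>B\<^esub> B.ev1 a D1) \<otimes>\<^bsub>B\<^esub> B.ev1 a r"
      using ab by (simp add: B.m_assoc[symmetric])
    also have "\<dots> = a \<otimes>\<^bsub>B\<^esub> (b \<otimes>\<^bsub>B\<^esub> B.ev1 a r) \<oplus>\<^bsub>B\<^esub> B.ev1 a D1 \<otimes>\<^bsub>B\<^esub> B.ev1 a r"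
      using ab by (simp add: B.l_distr B.m_assoc)
    finally show ?case
      using ab by (simp add: B.ev1_pCons dr pCons B.ev1_add B.ev1_mult[of a D1] B.ev1_mult[of a "[:0, 1:]"] B.ev1_simps
        B.r_distr B.l_distr B.scal_closed B.scal_mult_left B.scal_mult_right B.m_assoc B.a_ac B.scal_one del: mult_pCons_left)
  qed (use ab in simp)
  have Y: "B.ev2 a b (Y f) = b \<otimes>\<^bsub>B\<^esub> B.ev2 a b f" for f
  proof (induction f rule: pCons_induct)
    case (pCons r f)
    have "Y (pCons r f) = pCons (\<delta> r) ([:r:] + Y f)"
      by (rule poly_eqI) (auto simp: Y_coeff coeff_pCons split: nat.splits)
    then have "B.ev2 a b (Y (pCons r f)) = B.ev1 a (\<delta> r) \<oplus>\<^bsub>B\<^esub> (B.ev1 a r \<oplus>\<^bsub>B\<^esub> b \<otimes>\<^bsub>B\<^esub> B.ev2 a b f) \<otimes>\<^bsub>B\<^esub> b"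
      using ab pCons by (simp add: B.ev2_pCons B.ev2_add B.ev2_simps)
    then show ?case
      using ab by (simp add: B.ev2_pCons \<delta> B.l_distr B.r_distr B.m_assoc B.a_ac)
  qed (use ab in simp)
  show ?thesis
  proof (induction f arbitrary: g rule: pCons_induct)
    case (pCons r f)
    have "pCons r f = [:r:] + f \<star> X2" by (simp add: X2_right)
    then have "pCons r f \<star> g = Polynomial.smult r g + f \<star> Y g"
      by (simp add: hmul_add_left hmul_const_left hmul_assoc X2_left)
    then show ?case
      using ab pCons by (simp add: B.ev2_add B.ev2_smult B.ev2_pCons Y B.l_distr B.m_assoc)
  qed (use ab in simp)
qed

end

subsection \<open>The enveloping algebra\<close>

lemma k_algebra_opposite:
  fixes A (structure)
  assumes "k_algebra A"
  shows "k_algebra (opposite_algebra A)"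
proof -
  interpret k_algebra A by fact
  have eqs [simp]: "carrier (opposite_algebra A) = carrier A" "x \<otimes>\<^bsub>opposite_algebra A\<^esub> y = y \<otimes> x"
    "\<one>\<^bsub>opposite_algebra A\<^esub> = \<one>" "\<zero>\<^bsub>opposite_algebra A\<^esub> = \<zero>" "x \<oplus>\<^bsub>opposite_algebra A\<^esub> y = x \<oplus> y"
    "r \<odot>\<^bsub>opposite_algebra A\<^esub> x = r \<odot> x" for x y r
    by (simp_all add: opposite_algebra_def)
  have "ring (opposite_algebra A)"
  proof (rule ringI)
    show "abelian_group (opposite_algebra A)"
      by (rule abelian_groupI) (auto simp: a_ac intro: bexI[of _ "\<ominus> _"] l_neg)
    show "monoid (opposite_algebra A)" by (rule monoidI) (simp_all add: m_assoc)
  qed (simp_all add: l_distr r_distr)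
  then show ?thesis
    unfolding k_algebra_def k_algebra_axioms_def
    by (simp add: scal_closed scal_add_left scal_add_right scal_scal scal_one scal_mult_left scal_mult_right)
qed

context hoe
begin

abbreviation "Hop \<equiv> opposite_algebra H"

lemma Hop_simps [simp]: "carrier Hop = UNIV" "f \<otimes>\<^bsub>Hop\<^esub> g = g \<star> f"
  "\<one>\<^bsub>Hop\<^esub> = 1" "\<zero>\<^bsub>Hop\<^esub> = 0" "f \<oplus>\<^bsub>Hop\<^esub> g = f + g" "r \<odot>\<^bsub>Hop\<^esub> f = Polynomial.smult [:r:] f"
  using H_simps by (simp_all add: opposite_algebra_def)

sublocale EE: two_algebras H Hop
  by (rule two_algebras.intro[OF H.k_algebra_axioms k_algebra_opposite[OF H.k_algebra_axioms]])

sublocale BB: two_algebras H H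
  by (rule two_algebras.intro[OF H.k_algebra_axioms H.k_algebra_axioms])

abbreviation "E \<equiv> tensor H Hop"
abbreviation "B \<equiv> tensor H H"
abbreviation "pe \<equiv> pure H Hop"
abbreviation "pb \<equiv> pure H H"

sublocale E: k_algebra E by (rule EE.T_algebra)

sublocale B: k_algebra B by (rule BB.T_algebra)

lemma pe_simps [simp]: "pe u v \<in> carrier E" "pe u v \<otimes>\<^bsub>E\<^esub> pe u' v' = pe (u \<star> u') (v' \<star> v)"
  using EE.pure_closed[of u v] EE.pure_mult[of u v u' v'] by simp_all

lemma pb_simps [simp]: "pb u v \<in> carrier B" "pb u v \<otimes>\<^bsub>B\<^esub> pb u' v' = pb (u \<star> u') (v \<star> v')"
  using BB.pure_closed[of u v] BB.pure_mult[of u v u' v'] by simp_all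

lemma pe_linear: "pe (u + u') v = pe u v \<oplus>\<^bsub>E\<^esub> pe u' v" "pe u (v + v') = pe u v \<oplus>\<^bsub>E\<^esub> pe u v'"
  "pe (Polynomial.smult [:r:] u) v = r \<odot>\<^bsub>E\<^esub> pe u v" "pe u (Polynomial.smult [:r:] v) = r \<odot>\<^bsub>E\<^esub> pe u v"
  "pe 1 1 = \<one>\<^bsub>E\<^esub>"
  using EE.pure_add_left[of u u' v] EE.pure_add_right[of u v v'] EE.pure_scal_left[of u v r] EE.pure_scal_right[of u v r]
    EE.pure_one by simp_all

lemma pb_linear: "pb (u + u') v = pb u v \<oplus>\<^bsub>B\<^esub> pb u' v" "pb u (v + v') = pb u v \<oplus>\<^bsub>B\<^esub> pb u v'"
  "pb (Polynomial.smult [:r:] u) v = r \<odot>\<^bsub>B\<^esub> pb u v" "pb u (Polynomial.smult [:r:] v) = r \<odot>\<^bsub>B\<^esub> pb u v"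
  "pb 1 1 = \<one>\<^bsub>B\<^esub>"
  using BB.pure_add_left[of u u' v] BB.pure_add_right[of u v v'] BB.pure_scal_left[of u v r] BB.pure_scal_right[of u v r]
    BB.pure_one by simp_all

lemma pe_zero [simp]: "pe 0 v = \<zero>\<^bsub>E\<^esub>" "pe u 0 = \<zero>\<^bsub>E\<^esub>"
  using pe_linear(3)[of 0 0 v] pe_linear(4)[of u 0 0] by simp_all

lemma pb_zero [simp]: "pb 0 v = \<zero>\<^bsub>B\<^esub>" "pb u 0 = \<zero>\<^bsub>B\<^esub>"
  using pb_linear(3)[of 0 0 v] pb_linear(4)[of u 0 0] by simp_all

lemma pure_const [simp]: "pe [:[:c:]:] 1 = c \<odot>\<^bsub>E\<^esub> \<one>\<^bsub>E\<^esub>" "pe 1 [:[:c:]:] = c \<odot>\<^bsub>E\<^esub> \<one>\<^bsub>E\<^esub>"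
  "pb [:[:c:]:] 1 = c \<odot>\<^bsub>B\<^esub> \<one>\<^bsub>B\<^esub>" "pb 1 [:[:c:]:] = c \<odot>\<^bsub>B\<^esub> \<one>\<^bsub>B\<^esub>"
  using pe_linear(3)[of c 1 1] pe_linear(4)[of 1 c 1] pb_linear(3)[of c 1 1] pb_linear(4)[of 1 c 1] pe_linear(5) pb_linear(5)
  by (simp_all add: smult_one)

lemma ev1_pe: "E.ev1 (pe X1 1) r = pe [:r:] 1" "E.ev1 (pe 1 X1) r = pe 1 [:r:]"
proof (induction r rule: pCons_induct)
  case (pCons c r)
  \<comment> \<open>The second form, with X1 on the right, serves the opposite factor, where
    products are reversed.\<close>
  have "[:pCons c r:] = Polynomial.smult [:c:] 1 + X1 \<star> [:r:]" "[:pCons c r:] = Polynomial.smult [:c:] 1 + [:r:] \<star> X1"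
    by (simp_all add: X1_left X1_def hmul_const_left one_pCons)
  note eqs = this
  { case 1 show ?case using pCons by (subst eqs(1)) (simp add: E.ev1_pCons pe_linear) }
  { case 2 show ?case using pCons by (subst eqs(2)) (simp add: E.ev1_pCons pe_linear) }
qed simp_all

lemma ev1_pb: "B.ev1 (pb X1 1) r = pb [:r:] 1" "B.ev1 (pb 1 X1) r = pb 1 [:r:]"
proof (induction r rule: pCons_induct)
  case (pCons c r)
  have "[:pCons c r:] = Polynomial.smult [:c:] 1 + X1 \<star> [:r:]"
    by (simp add: X1_left one_pCons)
  note eqs = this
  { case 1 show ?case using pCons by (subst eqs) (simp add: B.ev1_pCons pb_linear) }
  { case 2 show ?case using pCons by (subst eqs) (simp add: B.ev1_pCons pb_linear) }
qed simp_all

section \<open>The commutation relation in the enveloping algebra and in H \<otimes> H\<close>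

definition al1 where "al1 = pe X1 1 \<oplus>\<^bsub>E\<^esub> \<ominus>\<^bsub>E\<^esub> pe 1 X1"
definition al2 where "al2 = pe X2 1 \<oplus>\<^bsub>E\<^esub> \<ominus>\<^bsub>E\<^esub> pe 1 X2"
definition be1 where "be1 = pb X1 1 \<oplus>\<^bsub>B\<^esub> pb 1 X1"
definition be2 where "be2 = pb X2 1 \<oplus>\<^bsub>B\<^esub> pb 1 X2"

lemma al_closed [simp]: "al1 \<in> carrier E" "al2 \<in> carrier E" "be1 \<in> carrier B" "be2 \<in> carrier B"
  by (simp_all add: al1_def al2_def be1_def be2_def)

lemma al_relation: "al2 \<otimes>\<^bsub>E\<^esub> al1 = al1 \<otimes>\<^bsub>E\<^esub> al2 \<oplus>\<^bsub>E\<^esub> E.ev1 al1 D1"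
proof -
  have "E.ev1 al1 D1 = E.ev1 (pe X1 1) D1 \<oplus>\<^bsub>E\<^esub> E.ev1 (\<ominus>\<^bsub>E\<^esub> pe 1 X1) D1"
    unfolding al1_def by (rule ev1_D1_add[OF E.k_algebra_axioms]) (simp_all add: E.l_minus E.r_minus)
  also have "\<dots> = pe [:D1:] 1 \<oplus>\<^bsub>E\<^esub> \<ominus>\<^bsub>E\<^esub> pe 1 [:D1:]"
    by (simp add: ev1_D1_uminus[OF E.k_algebra_axioms] ev1_pe)
  finally have ev: "E.ev1 al1 D1 = pe [:D1:] 1 \<oplus>\<^bsub>E\<^esub> \<ominus>\<^bsub>E\<^esub> pe 1 [:D1:]" .
  \<comment> \<open>The term to cancel is \<open>pe 1 [:D1:]\<close>: it comes once from rewriting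
    X2 X1 in the opposite factor and once, negatively, from D1 at \<open>al1\<close>. In this fact p
    is a local variable, not the characteristic.\<close>
  have cancel: "p \<oplus>\<^bsub>E\<^esub> (a \<oplus>\<^bsub>E\<^esub> (e \<oplus>\<^bsub>E\<^esub> (f \<oplus>\<^bsub>E\<^esub> (g \<oplus>\<^bsub>E\<^esub> \<ominus>\<^bsub>E\<^esub> p)))) = a \<oplus>\<^bsub>E\<^esub> (e \<oplus>\<^bsub>E\<^esub> (f \<oplus>\<^bsub>E\<^esub> g))"
    if c: "p \<in> carrier E" "a \<in> carrier E" "e \<in> carrier E" "f \<in> carrier E" "g \<in> carrier E" for p a e f g
  proof -
    have "p \<oplus>\<^bsub>E\<^esub> (a \<oplus>\<^bsub>E\<^esub> (e \<oplus>\<^bsub>E\<^esub> (f \<oplus>\<^bsub>E\<^esub> (g \<oplus>\<^bsub>E\<^esub> \<ominus>\<^bsub>E\<^esub> p)))) = (p \<oplus>\<^bsub>E\<^esub> \<ominus>\<^bsub>E\<^esub> p) \<oplus>\<^bsub>E\<^esub> (a \<oplus>\<^bsub>E\<^esub> (e \<oplus>\<^bsub>E\<^esub> (f \<oplus>\<^bsub>E\<^esub> g)))"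
      using c by (simp only: E.a_ac E.a_closed E.a_inv_closed)
    then show ?thesis using c by (simp add: E.r_neg)
  qed
  show ?thesis
    unfolding ev by (simp add: al1_def al2_def E.l_distr E.r_distr E.l_minus E.r_minus X2_X1 pe_linear E.minus_add E.a_ac cancel)
qed

lemma be_relation: "be2 \<otimes>\<^bsub>B\<^esub> be1 = be1 \<otimes>\<^bsub>B\<^esub> be2 \<oplus>\<^bsub>B\<^esub> B.ev1 be1 D1"
proof -
  have "B.ev1 be1 D1 = pb [:D1:] 1 \<oplus>\<^bsub>B\<^esub> pb 1 [:D1:]"
    unfolding be1_def by (simp add: ev1_D1_add[OF B.k_algebra_axioms] ev1_pb)
  then show ?thesis
    by (simp add: be1_def be2_def B.l_distr B.r_distr X2_X1 pb_linear B.a_ac)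
qed

text \<open>If w were zero, \<theta>' would be the coproduct and \<theta> the map h \<mapsto> \<Sum>
  h_1 \<otimes> S(h_2). The construction depends on d alone and is available for every w.\<close>

abbreviation "\<theta> \<equiv> E.ev2 al1 al2"
abbreviation "\<theta>' \<equiv> B.ev2 be1 be2"

lemma \<theta>_mult: "\<theta> (f \<star> g) = \<theta> f \<otimes>\<^bsub>E\<^esub> \<theta> g" "\<theta>' (f \<star> g) = \<theta>' f \<otimes>\<^bsub>B\<^esub> \<theta>' g"
  by (rule ev2_hmul[OF E.k_algebra_axioms] ev2_hmul[OF B.k_algebra_axioms]; simp add: al_relation be_relation)+

lemma \<theta>_simps [simp]: "\<theta> 1 = \<one>\<^bsub>E\<^esub>" "\<theta> X1 = al1" "\<theta> X2 = al2" "\<theta> (f + g) = \<theta> f \<oplus>\<^bsub>E\<^esub> \<theta> g" "\<theta> f \<in> carrier E"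
  "\<theta> (Polynomial.smult [:r:] f) = r \<odot>\<^bsub>E\<^esub> \<theta> f" "\<theta>' (Polynomial.smult [:r:] f) = r \<odot>\<^bsub>B\<^esub> \<theta>' f"
  "\<theta>' 1 = \<one>\<^bsub>B\<^esub>" "\<theta>' X1 = be1" "\<theta>' X2 = be2" "\<theta>' (f + g) = \<theta>' f \<oplus>\<^bsub>B\<^esub> \<theta>' g" "\<theta>' f \<in> carrier B"
  by (simp_all add: E.ev2_simps E.ev2_add B.ev2_simps B.ev2_add E.ev2_scal B.ev2_scal)

text \<open>
  \<open>twist\<close> inverts \<open>untwist\<close>, which turns left multiplication by \<open>X\<^sub>k \<otimes> 1 - 1 \<otimes> X\<^sub>k\<close> on
  the enveloping algebra into left multiplication by \<open>X\<^sub>k \<otimes> 1\<close> on \<open>H \<otimes> H\<close>. Statements about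
  these elements are thereby reduced to statements about \<open>X\<^sub>1\<close> and \<open>X\<^sub>2\<close> in \<open>H\<close>.
\<close>

definition "untwist = tensor_lift B (\<lambda>u v. pb 1 v \<otimes>\<^bsub>B\<^esub> \<theta>' u)"
definition "twist = tensor_lift E (\<lambda>h v. \<theta> h \<otimes>\<^bsub>E\<^esub> pe 1 v)"

lemma untwist_bilinear: "bilinear H Hop B (\<lambda>u v. pb 1 v \<otimes>\<^bsub>B\<^esub> \<theta>' u)"
  by (rule bilinearI) (simp_all add: pb_linear B.l_distr B.r_distr B.scal_mult_left B.scal_mult_right)

lemma twist_bilinear: "bilinear H H E (\<lambda>h v. \<theta> h \<otimes>\<^bsub>E\<^esub> pe 1 v)"
  by (rule bilinearI) (simp_all add: pe_linear E.l_distr E.r_distr E.scal_mult_left E.scal_mult_right)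

lemma untwist_simps [simp]: "untwist (pe u v) = pb 1 v \<otimes>\<^bsub>B\<^esub> \<theta>' u" "untwist \<zero>\<^bsub>E\<^esub> = \<zero>\<^bsub>B\<^esub>"
  "X \<in> carrier E \<Longrightarrow> W \<in> carrier E \<Longrightarrow> untwist (X \<oplus>\<^bsub>E\<^esub> W) = untwist X \<oplus>\<^bsub>B\<^esub> untwist W"
  "X \<in> carrier E \<Longrightarrow> untwist X \<in> carrier B" "X \<in> carrier E \<Longrightarrow> untwist (r \<odot>\<^bsub>E\<^esub> X) = r \<odot>\<^bsub>B\<^esub> untwist X"
  unfolding untwist_def
  using EE.tensor_lift_pure[OF B.k_space_axioms untwist_bilinear] EE.tensor_lift_zero[OF B.k_space_axioms untwist_bilinear]
    EE.tensor_lift_add[OF B.k_space_axioms untwist_bilinear] EE.tensor_lift_closed[OF B.k_space_axioms untwist_bilinear]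
    EE.tensor_lift_scal[OF B.k_space_axioms untwist_bilinear]
  by simp_all

lemma twist_simps [simp]: "twist (pb u v) = \<theta> u \<otimes>\<^bsub>E\<^esub> pe 1 v" "twist \<zero>\<^bsub>B\<^esub> = \<zero>\<^bsub>E\<^esub>"
  "X \<in> carrier B \<Longrightarrow> W \<in> carrier B \<Longrightarrow> twist (X \<oplus>\<^bsub>B\<^esub> W) = twist X \<oplus>\<^bsub>E\<^esub> twist W"
  "X \<in> carrier B \<Longrightarrow> twist X \<in> carrier E" "X \<in> carrier B \<Longrightarrow> twist (r \<odot>\<^bsub>B\<^esub> X) = r \<odot>\<^bsub>E\<^esub> twist X"
  unfolding twist_def
  using BB.tensor_lift_pure[OF E.k_space_axioms twist_bilinear] BB.tensor_lift_zero[OF E.k_space_axioms twist_bilinear]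
    BB.tensor_lift_add[OF E.k_space_axioms twist_bilinear] BB.tensor_lift_closed[OF E.k_space_axioms twist_bilinear]
    BB.tensor_lift_scal[OF E.k_space_axioms twist_bilinear]
  by simp_all

lemma twist_left: "X \<in> carrier B \<Longrightarrow> twist (pb h 1 \<otimes>\<^bsub>B\<^esub> X) = \<theta> h \<otimes>\<^bsub>E\<^esub> twist X"
  by (rule BB.tensor_additive_eqI[OF E.abelian_group_axioms])
    (simp_all add: B.r_distr E.r_distr \<theta>_mult E.m_assoc)

lemma twist_right: "X \<in> carrier B \<Longrightarrow> twist (pb 1 v \<otimes>\<^bsub>B\<^esub> X) = twist X \<otimes>\<^bsub>E\<^esub> pe 1 v"
  by (rule BB.tensor_additive_eqI[OF E.abelian_group_axioms])
    (simp_all add: B.r_distr E.l_distr E.m_assoc)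

lemma \<theta>'_X: "\<theta>' X1 = pb X1 1 \<oplus>\<^bsub>B\<^esub> pb 1 X1" "\<theta>' X2 = pb X2 1 \<oplus>\<^bsub>B\<^esub> pb 1 X2"
  unfolding \<theta>_simps by (rule be1_def be2_def)+

lemma twist_left_X: "X \<in> carrier B \<Longrightarrow> twist (pb X1 1 \<otimes>\<^bsub>B\<^esub> X) = (pe X1 1 \<oplus>\<^bsub>E\<^esub> \<ominus>\<^bsub>E\<^esub> pe 1 X1) \<otimes>\<^bsub>E\<^esub> twist X"
  "X \<in> carrier B \<Longrightarrow> twist (pb X2 1 \<otimes>\<^bsub>B\<^esub> X) = (pe X2 1 \<oplus>\<^bsub>E\<^esub> \<ominus>\<^bsub>E\<^esub> pe 1 X2) \<otimes>\<^bsub>E\<^esub> twist X"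
  using twist_left[of X X1] twist_left[of X X2] unfolding \<theta>_simps al1_def[symmetric] al2_def[symmetric] by simp_all

text \<open>On u \<otimes> v the element h \<otimes> 1 - 1 \<otimes> h gives hu \<otimes> v - u
  \<otimes> vh. Under \<open>untwist\<close> the part 1 \<otimes> h of \<theta>' h turns the first
  term into an extra 1 \<otimes> vh, which the second term removes.\<close>

lemma untwist_left:
  assumes X: "X \<in> carrier E"
  shows "untwist (al1 \<otimes>\<^bsub>E\<^esub> X) = pb X1 1 \<otimes>\<^bsub>B\<^esub> untwist X" "untwist (al2 \<otimes>\<^bsub>E\<^esub> X) = pb X2 1 \<otimes>\<^bsub>B\<^esub> untwist X"
proof -
  have um: "untwist (\<ominus>\<^bsub>E\<^esub> W) = \<ominus>\<^bsub>B\<^esub> untwist W" if "W \<in> carrier E" for W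
    using untwist_simps(5)[OF that, of "-1"] that by (simp add: E.vs_minus E.vs_one B.vs_minus B.vs_one)
  have pure: "untwist ((pe h 1 \<oplus>\<^bsub>E\<^esub> \<ominus>\<^bsub>E\<^esub> pe 1 h) \<otimes>\<^bsub>E\<^esub> pe u v) = pb h 1 \<otimes>\<^bsub>B\<^esub> untwist (pe u v)"
    if h: "\<theta>' h = pb h 1 \<oplus>\<^bsub>B\<^esub> pb 1 h" for h u v
  proof -
    have "untwist ((pe h 1 \<oplus>\<^bsub>E\<^esub> \<ominus>\<^bsub>E\<^esub> pe 1 h) \<otimes>\<^bsub>E\<^esub> pe u v) =
        pb 1 v \<otimes>\<^bsub>B\<^esub> ((pb h 1 \<oplus>\<^bsub>B\<^esub> pb 1 h) \<otimes>\<^bsub>B\<^esub> \<theta>' u) \<ominus>\<^bsub>B\<^esub> pb 1 (v \<star> h) \<otimes>\<^bsub>B\<^esub> \<theta>' u"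
      by (simp add: E.l_distr E.l_minus um \<theta>_mult h a_minus_def)
    also have "pb 1 (v \<star> h) = pb 1 v \<otimes>\<^bsub>B\<^esub> pb 1 h" by simp
    also have "pb 1 v \<otimes>\<^bsub>B\<^esub> ((pb h 1 \<oplus>\<^bsub>B\<^esub> pb 1 h) \<otimes>\<^bsub>B\<^esub> \<theta>' u) \<ominus>\<^bsub>B\<^esub> pb 1 v \<otimes>\<^bsub>B\<^esub> pb 1 h \<otimes>\<^bsub>B\<^esub> \<theta>' u =
        pb 1 v \<otimes>\<^bsub>B\<^esub> pb h 1 \<otimes>\<^bsub>B\<^esub> \<theta>' u"
      by (simp add: B.l_distr B.r_distr B.m_assoc[symmetric] a_minus_def B.a_assoc B.r_neg)
    also have "\<dots> = pb h 1 \<otimes>\<^bsub>B\<^esub> untwist (pe u v)"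
      by (simp add: B.m_assoc[symmetric])
    finally show ?thesis .
  qed
  show "untwist (al1 \<otimes>\<^bsub>E\<^esub> X) = pb X1 1 \<otimes>\<^bsub>B\<^esub> untwist X"
    by (rule EE.tensor_additive_eqI[OF B.abelian_group_axioms X])
      (simp_all add: pure[OF \<theta>'_X(1), folded al1_def] B.r_distr E.r_distr del: untwist_simps(1))
  show "untwist (al2 \<otimes>\<^bsub>E\<^esub> X) = pb X2 1 \<otimes>\<^bsub>B\<^esub> untwist X"
    by (rule EE.tensor_additive_eqI[OF B.abelian_group_axioms X])
      (simp_all add: pure[OF \<theta>'_X(2), folded al2_def] B.r_distr E.r_distr del: untwist_simps(1))
qed

text \<open>Generalised from w = 1 to arbitrary w over f \<otimes> 1, so that the two induction
  hypotheses for a product can be applied one after the other.\<close>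

lemma twist_\<theta>':
  "w \<in> carrier B \<Longrightarrow> twist w = pe f 1 \<Longrightarrow> twist (\<theta>' u \<otimes>\<^bsub>B\<^esub> w) = pe (u \<star> f) 1"
proof (induction u arbitrary: w f rule: H_induct)
  case X1
  then show ?case
    by (simp del: \<theta>_simps(9) add: \<theta>'_X B.l_distr twist_left_X twist_right E.l_distr E.l_minus E.a_assoc E.l_neg)
next
  case X2
  then show ?case
    by (simp del: \<theta>_simps(10) add: \<theta>'_X B.l_distr twist_left_X twist_right E.l_distr E.l_minus E.a_assoc E.l_neg)
next
  case (mult g h)
  have "twist (\<theta>' h \<otimes>\<^bsub>B\<^esub> w) = pe (h \<star> f) 1" by (rule mult.IH(2)[OF mult.prems])
  from mult.IH(1)[OF _ this] mult.prems show ?case by (simp add: \<theta>_mult B.m_assoc hmul_assoc)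
qed (simp_all add: B.l_distr hmul_add_left pe_linear hmul_scal B.scal_mult_left)

lemma twist_untwist: "X \<in> carrier E \<Longrightarrow> twist (untwist X) = X"
proof (rule EE.tensor_additive_eqI[OF E.abelian_group_axioms])
  fix u v
  have "twist \<one>\<^bsub>B\<^esub> = pe 1 1" using twist_simps(1)[of 1 1] by (simp add: pb_linear pe_linear)
  from twist_\<theta>'[OF B.one_closed this, of u] show "twist (untwist (pe u v)) = pe u v"
    by (simp add: twist_right)
qed simp_all

text \<open>The coordinates of \<open>H \<otimes> H\<close> as a free left module over its first factor.\<close>

definition "crd i j = tensor_lift H (\<lambda>h v. Polynomial.smult [:poly.coeff (poly.coeff v j) i:] h)"

lemma crd_bilinear: "bilinear H H H (\<lambda>h v. Polynomial.smult [:poly.coeff (poly.coeff v j) i:] h)"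
  by (rule bilinearI) (simp_all add: smult_add_right smult_add_left[symmetric] mult.commute)

lemma crd_simps [simp]: "crd i j (pb u v) = Polynomial.smult [:poly.coeff (poly.coeff v j) i:] u" "crd i j \<zero>\<^bsub>B\<^esub> = 0"
  "X \<in> carrier B \<Longrightarrow> W \<in> carrier B \<Longrightarrow> crd i j (X \<oplus>\<^bsub>B\<^esub> W) = crd i j X + crd i j W"
  "X \<in> carrier B \<Longrightarrow> crd i j (r \<odot>\<^bsub>B\<^esub> X) = Polynomial.smult [:r:] (crd i j X)"
  unfolding crd_def
  using BB.tensor_lift_pure[OF H.k_space_axioms crd_bilinear] BB.tensor_lift_zero[OF H.k_space_axioms crd_bilinear]
    BB.tensor_lift_add[OF H.k_space_axioms crd_bilinear] BB.tensor_lift_scal[OF H.k_space_axioms crd_bilinear]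
  by simp_all

lemma crd_left: "X \<in> carrier B \<Longrightarrow> crd i j (pb h 1 \<otimes>\<^bsub>B\<^esub> X) = h \<star> crd i j X"
  by (rule BB.tensor_additive_eqI[OF H.abelian_group_axioms])
    (simp_all add: B.r_distr hmul_add_right hmul_scal)

abbreviation "hbasis \<equiv> \<lambda>(i, j). Polynomial.monom (Polynomial.monom 1 i) j :: 'k poly poly"

text \<open>The expansion is claimed for all sufficiently large boxes of exponents, so that two
  elements can be expanded over the same box in the additive case.\<close>

lemma crd_expansion:
  assumes "X \<in> carrier B"
  shows "\<exists>N. \<forall>n\<ge>N. X = (\<Oplus>\<^bsub>B\<^esub>s \<in> {..<n} \<times> {..<n}. pb (crd (fst s) (snd s) X) (hbasis s))"
  using assms
proof (induction X rule: BB.tensor_induct)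
  case (pure u v)
  define N where "N = Suc (degree v + (\<Sum>j\<le>degree v. degree (poly.coeff v j)))"
  have big: "poly.coeff (poly.coeff v j) i = 0" if "i \<ge> N \<or> j \<ge> N" for i j
  proof (cases "j \<le> degree v")
    case True
    then have "degree (poly.coeff v j) \<le> (\<Sum>j\<le>degree v. degree (poly.coeff v j))" by (intro member_le_sum) auto
    then show ?thesis using that True by (intro coeff_eq_0) (simp add: N_def)
  qed (simp add: coeff_eq_0)
  have "pb u v = (\<Oplus>\<^bsub>B\<^esub>s \<in> {..<n} \<times> {..<n}. pb (crd (fst s) (snd s) (pb u v)) (hbasis s))" if n: "n \<ge> N" for n
  proof -
    let ?S = "{..<n} \<times> {..<n}"
    let ?g = "\<lambda>s. Polynomial.smult [:poly.coeff (poly.coeff v (snd s)) (fst s):] (hbasis s)"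
    have "v = sum ?g ?S"
    proof (intro poly_eqI)
      fix j i
      have "poly.coeff (poly.coeff (sum ?g ?S) j) i =
          (\<Sum>s\<in>?S. if s = (i, j) then poly.coeff (poly.coeff v j) i else 0)"
        unfolding coeff_sum by (rule sum.cong) (auto simp: split_beta)
      also have "\<dots> = poly.coeff (poly.coeff v j) i"
        using big[of i j] n by (auto simp: sum.delta)
      finally show "poly.coeff (poly.coeff v j) i = poly.coeff (poly.coeff (sum ?g ?S) j) i" by simp
    qed
    then have "pb u v = pb u (sum ?g ?S)" by (rule arg_cong)
    have fin: "pb u (sum ?g T) = (\<Oplus>\<^bsub>B\<^esub>s \<in> T. pb u (?g s))" if "finite T" for T
      using that by (induction T rule: finite_induct) (simp_all add: pb_linear(2) split_beta)
    have "pb u v = (\<Oplus>\<^bsub>B\<^esub>s \<in> ?S. pb u (?g s))"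
      by (rule trans[OF \<open>pb u v = pb u (sum ?g ?S)\<close> fin]) simp
    also have "\<dots> = (\<Oplus>\<^bsub>B\<^esub>s \<in> ?S. pb (crd (fst s) (snd s) (pb u v)) (hbasis s))"
      by (rule B.finsum_cong') (simp_all add: pb_linear B.scal_closed)
    finally show ?thesis .
  qed
  then show ?case by blast
next
  case (add X W)
  then obtain M N where M: "\<forall>n\<ge>M. X = (\<Oplus>\<^bsub>B\<^esub>s \<in> {..<n} \<times> {..<n}. pb (crd (fst s) (snd s) X) (hbasis s))"
    and N: "\<forall>n\<ge>N. W = (\<Oplus>\<^bsub>B\<^esub>s \<in> {..<n} \<times> {..<n}. pb (crd (fst s) (snd s) W) (hbasis s))" by blast
  have "X \<oplus>\<^bsub>B\<^esub> W = (\<Oplus>\<^bsub>B\<^esub>s \<in> {..<n} \<times> {..<n}. pb (crd (fst s) (snd s) (X \<oplus>\<^bsub>B\<^esub> W)) (hbasis s))" if n: "n \<ge> max M N" for n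
  proof -
    have "(\<Oplus>\<^bsub>B\<^esub>s \<in> {..<n} \<times> {..<n}. pb (crd (fst s) (snd s) (X \<oplus>\<^bsub>B\<^esub> W)) (hbasis s)) =
        (\<Oplus>\<^bsub>B\<^esub>s \<in> {..<n} \<times> {..<n}. pb (crd (fst s) (snd s) X) (hbasis s) \<oplus>\<^bsub>B\<^esub> pb (crd (fst s) (snd s) W) (hbasis s))"
      using add by (simp add: pb_linear)
    also have "\<dots> = X \<oplus>\<^bsub>B\<^esub> W" using M N n by (subst B.finsum_addf) auto
    finally show ?thesis ..
  qed
  then show ?case by blast
qed (simp add: B.add.finprod_one_eqI)

lemma B_left_zero:
  assumes X: "X \<in> carrier B" and 0: "pb X1 1 \<otimes>\<^bsub>B\<^esub> X = \<zero>\<^bsub>B\<^esub>"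
  shows "X = \<zero>\<^bsub>B\<^esub>"
proof -
  have "crd i j X = 0" for i j
    using crd_left[OF X, of i j X1] 0 by (simp add: hmul_eq_0_iff X1_def)
  then show ?thesis using crd_expansion[OF X] by (auto simp: B.add.finprod_one_eqI)
qed

text \<open>Coordinate by coordinate this is the argument in k[X2] used for the trivial module. The
  polynomial t is left open since both t = 0 and t = q occur.\<close>

lemma B_left_divisible:
  assumes X: "X \<in> carrier B" "W \<in> carrier B" and eq: "pb (X2 - [:t:]) 1 \<otimes>\<^bsub>B\<^esub> X = pb X1 1 \<otimes>\<^bsub>B\<^esub> W"
  shows "\<exists>n \<in> carrier B. X = pb X1 1 \<otimes>\<^bsub>B\<^esub> n"
proof -
  have "\<exists>n. crd i j X = X1 \<star> n" for i j
  proof -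
    have eq': "(X2 - [:t:]) \<star> crd i j X = X1 \<star> crd i j W"
      using arg_cong[OF eq, of "crd i j"] X by (simp add: crd_left)
    have "[:- poly.coeff t 0, 1:] * ev (crd i j X) = 0"
      using arg_cong[OF eq', of ev] by (simp only: ev_mult ev_simps mult_zero_left) simp
    then have "ev (crd i j X) = 0" by (metis mult_eq_0_iff pCons_eq_0_iff one_neq_zero)
    then show ?thesis using ev_eq_0_left by blast
  qed
  then obtain n where n: "crd i j X = X1 \<star> n i j" for i j by metis
  obtain N where "X = (\<Oplus>\<^bsub>B\<^esub>s \<in> {..<N} \<times> {..<N}. pb (crd (fst s) (snd s) X) (hbasis s))"
    using crd_expansion[OF X(1)] by blast
  also have "\<dots> = (\<Oplus>\<^bsub>B\<^esub>s \<in> {..<N} \<times> {..<N}. pb X1 1 \<otimes>\<^bsub>B\<^esub> pb (n (fst s) (snd s)) (hbasis s))"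
    by (rule B.finsum_cong') (simp_all add: n)
  also have "\<dots> = pb X1 1 \<otimes>\<^bsub>B\<^esub> (\<Oplus>\<^bsub>B\<^esub>s \<in> {..<N} \<times> {..<N}. pb (n (fst s) (snd s)) (hbasis s))"
    by (rule B.finsum_rdistr[symmetric]) auto
  finally show ?thesis by (intro bexI) auto
qed

lemma al1_left_zero: "X \<in> carrier E \<Longrightarrow> al1 \<otimes>\<^bsub>E\<^esub> X = \<zero>\<^bsub>E\<^esub> \<Longrightarrow> X = \<zero>\<^bsub>E\<^esub>"
  by (metis B_left_zero twist_simps(2) twist_untwist untwist_left(1) untwist_simps(2,4))

lemma ev1_al1_untwist: "X \<in> carrier E \<Longrightarrow> untwist (E.ev1 al1 t \<otimes>\<^bsub>E\<^esub> X) = pb [:t:] 1 \<otimes>\<^bsub>B\<^esub> untwist X"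
proof (induction t rule: pCons_induct)
  case (pCons c t)
  have "[:pCons c t:] = Polynomial.smult [:c:] 1 + X1 \<star> [:t:]" by (simp add: X1_left one_pCons)
  then have "pb [:pCons c t:] 1 \<otimes>\<^bsub>B\<^esub> untwist X = c \<odot>\<^bsub>B\<^esub> untwist X \<oplus>\<^bsub>B\<^esub> pb X1 1 \<otimes>\<^bsub>B\<^esub> (pb [:t:] 1 \<otimes>\<^bsub>B\<^esub> untwist X)"
    using pCons by (simp add: pb_linear B.l_distr B.scal_mult_left B.scal_closed B.m_assoc[symmetric])
  then show ?case using pCons
    by (simp add: E.ev1_pCons E.l_distr E.scal_mult_left E.m_assoc untwist_left E.scal_closed)
qed simp

lemma al_left_divisible:
  assumes X: "X \<in> carrier E" "W \<in> carrier E" and eq: "(al2 \<ominus>\<^bsub>E\<^esub> E.ev1 al1 t) \<otimes>\<^bsub>E\<^esub> X = al1 \<otimes>\<^bsub>E\<^esub> W"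
  shows "\<exists>n \<in> carrier E. X = al1 \<otimes>\<^bsub>E\<^esub> n"
proof -
  have "al2 \<otimes>\<^bsub>E\<^esub> X = al1 \<otimes>\<^bsub>E\<^esub> W \<oplus>\<^bsub>E\<^esub> E.ev1 al1 t \<otimes>\<^bsub>E\<^esub> X"
    unfolding eq[symmetric] using X by (simp add: a_minus_def E.l_distr E.l_minus E.a_assoc E.l_neg)
  from arg_cong[OF this, of untwist] have "pb X2 1 \<otimes>\<^bsub>B\<^esub> untwist X = pb X1 1 \<otimes>\<^bsub>B\<^esub> untwist W \<oplus>\<^bsub>B\<^esub> pb [:t:] 1 \<otimes>\<^bsub>B\<^esub> untwist X"
    using X by (simp add: untwist_left ev1_al1_untwist)
  moreover have "pb X2 1 = pb (X2 - [:t:]) 1 \<oplus>\<^bsub>B\<^esub> pb [:t:] 1" using pb_linear(1)[of "X2 - [:t:]" "[:t:]" 1] by simp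
  ultimately have "pb (X2 - [:t:]) 1 \<otimes>\<^bsub>B\<^esub> untwist X = pb X1 1 \<otimes>\<^bsub>B\<^esub> untwist W"
    using X by (simp add: B.l_distr)
  from B_left_divisible[OF _ _ this] X obtain n where n: "n \<in> carrier B" "untwist X = pb X1 1 \<otimes>\<^bsub>B\<^esub> n" by auto
  have "X = twist (pb X1 1 \<otimes>\<^bsub>B\<^esub> n)" using twist_untwist[OF X(1)] n(2) by simp
  then show ?thesis
    using n by (intro bexI[of _ "twist n"]) (simp_all add: twist_left)
qed

end

subsection \<open>The Nakayama automorphism\<close>

context hoe
begin

text \<open>The anti-automorphism exchanging the factors of H^e. It negates both \<open>al1\<close>
  and \<open>al2\<close>, so every statement on left multiplication by them yields one on right
  multiplication.\<close>

definition "flip = tensor_lift E (\<lambda>u v. pe v u)"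

lemma flip_bilinear: "bilinear H Hop E (\<lambda>u v. pe v u)"
  by (rule bilinearI) (simp_all add: pe_linear)

lemma flip_simps [simp]: "flip (pe u v) = pe v u" "flip \<zero>\<^bsub>E\<^esub> = \<zero>\<^bsub>E\<^esub>"
  "X \<in> carrier E \<Longrightarrow> W \<in> carrier E \<Longrightarrow> flip (X \<oplus>\<^bsub>E\<^esub> W) = flip X \<oplus>\<^bsub>E\<^esub> flip W"
  "X \<in> carrier E \<Longrightarrow> flip X \<in> carrier E"
  unfolding flip_def
  using EE.tensor_lift_pure[OF E.k_space_axioms flip_bilinear] EE.tensor_lift_zero[OF E.k_space_axioms flip_bilinear]
    EE.tensor_lift_add[OF E.k_space_axioms flip_bilinear] EE.tensor_lift_closed[OF E.k_space_axioms flip_bilinear]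
  by simp_all

lemma flip_flip: "X \<in> carrier E \<Longrightarrow> flip (flip X) = X"
  by (rule EE.tensor_additive_eqI[OF E.abelian_group_axioms]) simp_all

lemma flip_uminus: "X \<in> carrier E \<Longrightarrow> flip (\<ominus>\<^bsub>E\<^esub> X) = \<ominus>\<^bsub>E\<^esub> flip X"
  using flip_simps(3)[of "\<ominus>\<^bsub>E\<^esub> X" X] by (simp add: E.l_neg E.minus_equality)

lemma flip_mult:
  assumes X: "X \<in> carrier E" and W: "W \<in> carrier E"
  shows "flip (X \<otimes>\<^bsub>E\<^esub> W) = flip W \<otimes>\<^bsub>E\<^esub> flip X"
proof (rule EE.tensor_additive_eqI[OF E.abelian_group_axioms W])
  fix u v
  show "flip (X \<otimes>\<^bsub>E\<^esub> pe u v) = flip (pe u v) \<otimes>\<^bsub>E\<^esub> flip X"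
    by (rule EE.tensor_additive_eqI[OF E.abelian_group_axioms X]) (simp_all add: E.l_distr E.r_distr)
qed (use X in \<open>simp_all add: E.l_distr E.r_distr\<close>)

lemma flip_al: "flip al1 = \<ominus>\<^bsub>E\<^esub> al1" "flip al2 = \<ominus>\<^bsub>E\<^esub> al2"
  by (simp_all add: al1_def al2_def flip_uminus E.minus_add E.a_comm)

lemma ev1_X1: "H.ev1 X1 r = [:r:]"
proof (induction r rule: pCons_induct)
  case (pCons c r)
  then show ?case by (simp add: H.ev1_pCons X1_left)
qed simp

text \<open>Adding a scalar to X2 respects the relation of H, so this is an automorphism for every
  c. The value c = 0 serves the action on H and c = d_0 the Nakayama automorphism.\<close>

abbreviation "shift c \<equiv> H.ev2 X1 (X2 + [:[:c:]:])"

lemma shift_mult: "shift c (f \<star> g) = shift c f \<star> shift c g"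
proof (rule ev2_hmul[OF H.k_algebra_axioms])
  have "[:[:c:]:] \<star> X1 = X1 \<star> [:[:c:]:]" by (simp add: hmul_const_left X1_def mult.commute)
  then show "(X2 + [:[:c:]:]) \<star> X1 = X1 \<star> (X2 + [:[:c:]:]) \<oplus>\<^bsub>H\<^esub> H.ev1 X1 D1"
    by (simp add: hmul_add_left hmul_add_right X2_X1 ev1_X1)
qed simp_all

lemma shift_simps [simp]: "shift c 1 = 1" "shift c X1 = X1" "shift c X2 = X2 + [:[:c:]:]" "shift c (f + g) = shift c f + shift c g"
  "shift c (Polynomial.smult [:r:] f) = Polynomial.smult [:r:] (shift c f)"
  using H.ev2_simps(2)[of X1 "X2 + [:[:c:]:]"] H.ev2_simps(3)[of X1 "X2 + [:[:c:]:]"] H.ev2_simps(4)[of X1 "X2 + [:[:c:]:]"]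
    H.ev2_add[of X1 "X2 + [:[:c:]:]" f g] H.ev2_scal[of X1 "X2 + [:[:c:]:]" r f]
  by simp_all

lemma shift_inverse: "shift c (shift (- c) f) = f"
proof (induction f rule: H_induct)
  case X2
  have "shift c [:[:- c:]:] = [:[:- c:]:]" using shift_simps(5)[of c "- c" 1] by (simp add: smult_one)
  then show ?case by simp
qed (simp_all add: shift_mult)

lemma shift_0: "shift 0 f = f"
  by (induction f rule: H_induct) (simp_all only: shift_mult shift_simps, simp_all)

lemma shift_automorphism: "shift c \<in> alg_automorphisms H"
proof -
  have "bij (shift c)"
    by (rule bij_betw_byWitness[where f' = "shift (- c)"]) (use shift_inverse[of c] shift_inverse[of "- c"] in auto)
  then show ?thesis
    by (auto simp: alg_automorphisms_def alg_hom_def ring_hom_def shift_mult)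
qed

definition "\<kappa> c = tensor_lift H (\<lambda>u v. v \<star> shift c u)"

lemma \<kappa>_bilinear: "bilinear H Hop H (\<lambda>u v. v \<star> shift c u)"
  by (rule bilinearI) (simp_all add: hmul_add_left hmul_add_right hmul_scal)

lemma \<kappa>_simps [simp]: "\<kappa> c (pe u v) = v \<star> shift c u" "\<kappa> c \<zero>\<^bsub>E\<^esub> = 0"
  "X \<in> carrier E \<Longrightarrow> W \<in> carrier E \<Longrightarrow> \<kappa> c (X \<oplus>\<^bsub>E\<^esub> W) = \<kappa> c X + \<kappa> c W"
  "X \<in> carrier E \<Longrightarrow> \<kappa> c (r \<odot>\<^bsub>E\<^esub> X) = Polynomial.smult [:r:] (\<kappa> c X)"
  unfolding \<kappa>_def
  using EE.tensor_lift_pure[OF H.k_space_axioms \<kappa>_bilinear] EE.tensor_lift_zero[OF H.k_space_axioms \<kappa>_bilinear]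
    EE.tensor_lift_add[OF H.k_space_axioms \<kappa>_bilinear] EE.tensor_lift_scal[OF H.k_space_axioms \<kappa>_bilinear]
  by simp_all

lemma \<kappa>_uminus: "X \<in> carrier E \<Longrightarrow> \<kappa> c (\<ominus>\<^bsub>E\<^esub> X) = - \<kappa> c X"
  using \<kappa>_simps(3)[of "\<ominus>\<^bsub>E\<^esub> X" X c] by (simp add: E.l_neg eq_neg_iff_add_eq_0)

lemma \<kappa>_al:
  assumes X: "X \<in> carrier E"
  shows "\<kappa> c (al1 \<otimes>\<^bsub>E\<^esub> X) = 0" "\<kappa> c (al2 \<otimes>\<^bsub>E\<^esub> X) = Polynomial.smult [:c:] (\<kappa> c X)"
proof -
  show "\<kappa> c (al1 \<otimes>\<^bsub>E\<^esub> X) = 0"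
    by (rule EE.tensor_additive_eqI[OF H.abelian_group_axioms X])
      (simp_all add: al1_def E.l_distr E.r_distr E.l_minus \<kappa>_uminus shift_mult hmul_assoc)
  have scal: "v \<star> ([:[:c:]:] \<star> f) = Polynomial.smult [:c:] (v \<star> f)" for v f
    by (simp add: hmul_const_left hmul_scal)
  show "\<kappa> c (al2 \<otimes>\<^bsub>E\<^esub> X) = Polynomial.smult [:c:] (\<kappa> c X)"
    by (rule EE.tensor_additive_eqI[OF H.abelian_group_axioms X])
      (simp_all add: al2_def E.l_distr E.r_distr E.l_minus \<kappa>_uminus shift_mult hmul_assoc hmul_add_left hmul_add_right smult_add_right scal)
qed

lemma ev1_al1: "E.ev1 al1 t = poly.coeff t 0 \<odot>\<^bsub>E\<^esub> \<one>\<^bsub>E\<^esub> \<oplus>\<^bsub>E\<^esub> al1 \<otimes>\<^bsub>E\<^esub> E.ev1 al1 (poly_shift 1 t)"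
proof -
  have "t = pCons (poly.coeff t 0) (poly_shift 1 t)"
    by (rule poly_eqI) (simp add: coeff_pCons coeff_poly_shift split: nat.splits)
  then have "E.ev1 al1 t = E.ev1 al1 (pCons (poly.coeff t 0) (poly_shift 1 t))" by (rule arg_cong)
  also have "\<dots> = poly.coeff t 0 \<odot>\<^bsub>E\<^esub> \<one>\<^bsub>E\<^esub> \<oplus>\<^bsub>E\<^esub> al1 \<otimes>\<^bsub>E\<^esub> E.ev1 al1 (poly_shift 1 t)"
    by (rule E.ev1_pCons) simp
  finally show ?thesis .
qed

text \<open>Modulo the right ideal every u \<otimes> v is congruent to 1 \<otimes> v \<mu>(u), so an
  element killed by \<kappa> lies in it. Used twice: with t = 0 for the annihilator of 1 in H, and
  with t = q for Ext of degree two.\<close>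

lemma \<kappa>_kernel:
  assumes r: "r \<in> carrier E" and t: "poly.coeff t 0 = c"
  shows "\<kappa> c r = 0 \<longleftrightarrow> (\<exists>x \<in> carrier E. \<exists>y \<in> carrier E. r = (al2 \<ominus>\<^bsub>E\<^esub> E.ev1 al1 t) \<otimes>\<^bsub>E\<^esub> x \<oplus>\<^bsub>E\<^esub> al1 \<otimes>\<^bsub>E\<^esub> y)"
proof
  let ?\<beta> = "al2 \<ominus>\<^bsub>E\<^esub> E.ev1 al1 t"
  note t' = ev1_al1[of t, unfolded t]
  \<comment> \<open>Congruence modulo the right ideal, spelled out with witnesses to keep it
    directed towards the conclusion.\<close>
  define cong where "cong a b \<longleftrightarrow>
    (\<exists>x \<in> carrier E. \<exists>y \<in> carrier E. a = ?\<beta> \<otimes>\<^bsub>E\<^esub> x \<oplus>\<^bsub>E\<^esub> al1 \<otimes>\<^bsub>E\<^esub> y \<oplus>\<^bsub>E\<^esub> b)" for a b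
  have refl: "cong a a" if "a \<in> carrier E" for a
    unfolding cong_def using that by (intro bexI[of _ "\<zero>\<^bsub>E\<^esub>"]) simp_all
  have cong_add: "cong (a \<oplus>\<^bsub>E\<^esub> a') (b \<oplus>\<^bsub>E\<^esub> b')" if "cong a b" "cong a' b'" "b \<in> carrier E" "b' \<in> carrier E" for a a' b b'
  proof -
    from that obtain x y x' y' where c: "x \<in> carrier E" "y \<in> carrier E" "x' \<in> carrier E" "y' \<in> carrier E"
      and eq: "a = ?\<beta> \<otimes>\<^bsub>E\<^esub> x \<oplus>\<^bsub>E\<^esub> al1 \<otimes>\<^bsub>E\<^esub> y \<oplus>\<^bsub>E\<^esub> b" "a' = ?\<beta> \<otimes>\<^bsub>E\<^esub> x' \<oplus>\<^bsub>E\<^esub> al1 \<otimes>\<^bsub>E\<^esub> y' \<oplus>\<^bsub>E\<^esub> b'"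
      unfolding cong_def by blast
    show ?thesis unfolding cong_def
      by (rule bexI[of _ "x \<oplus>\<^bsub>E\<^esub> x'"], rule bexI[of _ "y \<oplus>\<^bsub>E\<^esub> y'"])
        (use c that in \<open>simp_all add: eq E.r_distr E.a_ac\<close>)
  qed
  have trans: "cong a e" if "cong a b" "cong b e" "e \<in> carrier E" for a b e
  proof -
    from that obtain x y x' y' where c: "x \<in> carrier E" "y \<in> carrier E" "x' \<in> carrier E" "y' \<in> carrier E"
      and eq: "a = ?\<beta> \<otimes>\<^bsub>E\<^esub> x \<oplus>\<^bsub>E\<^esub> al1 \<otimes>\<^bsub>E\<^esub> y \<oplus>\<^bsub>E\<^esub> b" "b = ?\<beta> \<otimes>\<^bsub>E\<^esub> x' \<oplus>\<^bsub>E\<^esub> al1 \<otimes>\<^bsub>E\<^esub> y' \<oplus>\<^bsub>E\<^esub> e"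
      unfolding cong_def by blast
    show ?thesis unfolding cong_def
      by (rule bexI[of _ "x \<oplus>\<^bsub>E\<^esub> x'"], rule bexI[of _ "y \<oplus>\<^bsub>E\<^esub> y'"])
        (use c that in \<open>simp_all add: eq E.r_distr E.a_ac\<close>)
  qed
  have scal: "cong (s \<odot>\<^bsub>E\<^esub> a) (s \<odot>\<^bsub>E\<^esub> b)" if "cong a b" "b \<in> carrier E" for s a b
  proof -
    from that obtain x y where c: "x \<in> carrier E" "y \<in> carrier E"
      and eq: "a = ?\<beta> \<otimes>\<^bsub>E\<^esub> x \<oplus>\<^bsub>E\<^esub> al1 \<otimes>\<^bsub>E\<^esub> y \<oplus>\<^bsub>E\<^esub> b" unfolding cong_def by blast
    show ?thesis unfolding cong_def
      by (rule bexI[of _ "s \<odot>\<^bsub>E\<^esub> x"], rule bexI[of _ "s \<odot>\<^bsub>E\<^esub> y"])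
        (use c that in \<open>simp_all add: eq E.scal_add_right E.scal_mult_right E.scal_closed\<close>)
  qed
  \<comment> \<open>A left factor f of the first slot can be moved to the right end of the second
    slot, where it becomes its shift. For X2 the shift arises because t at \<open>al1\<close> is
    congruent to its constant term c.\<close>
  have move: "cong (pe (f \<star> u) v) (pe u (v \<star> shift c f))" for f u v
  proof (induction f arbitrary: u v rule: H_induct)
    case X1
    have "pe (X1 \<star> u) v = al1 \<otimes>\<^bsub>E\<^esub> pe u v \<oplus>\<^bsub>E\<^esub> pe u (v \<star> X1)"
      by (simp add: al1_def E.l_distr E.l_minus E.a_assoc E.l_neg)
    then show ?case unfolding cong_def
      by (intro bexI[of _ "\<zero>\<^bsub>E\<^esub>"] bexI[of _ "pe u v"]) simp_all
  next
    case X2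
    let ?w = "pe u v" and ?e = "E.ev1 al1 (poly_shift 1 t)"
    have "pe (X2 \<star> u) v = al2 \<otimes>\<^bsub>E\<^esub> ?w \<oplus>\<^bsub>E\<^esub> pe u (v \<star> X2)"
      by (simp add: al2_def E.l_distr E.l_minus E.a_assoc E.l_neg)
    also have "al2 \<otimes>\<^bsub>E\<^esub> ?w = ?\<beta> \<otimes>\<^bsub>E\<^esub> ?w \<oplus>\<^bsub>E\<^esub> E.ev1 al1 t \<otimes>\<^bsub>E\<^esub> ?w"
      by (simp add: a_minus_def E.l_distr E.l_minus E.a_assoc E.l_neg)
    also have "E.ev1 al1 t \<otimes>\<^bsub>E\<^esub> ?w = c \<odot>\<^bsub>E\<^esub> ?w \<oplus>\<^bsub>E\<^esub> al1 \<otimes>\<^bsub>E\<^esub> (?e \<otimes>\<^bsub>E\<^esub> ?w)"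
      unfolding t' by (simp add: E.l_distr E.scal_closed E.scal_mult_left E.m_assoc)
    also have "?\<beta> \<otimes>\<^bsub>E\<^esub> ?w \<oplus>\<^bsub>E\<^esub> (c \<odot>\<^bsub>E\<^esub> ?w \<oplus>\<^bsub>E\<^esub> al1 \<otimes>\<^bsub>E\<^esub> (?e \<otimes>\<^bsub>E\<^esub> ?w)) \<oplus>\<^bsub>E\<^esub> pe u (v \<star> X2) =
        ?\<beta> \<otimes>\<^bsub>E\<^esub> ?w \<oplus>\<^bsub>E\<^esub> al1 \<otimes>\<^bsub>E\<^esub> (?e \<otimes>\<^bsub>E\<^esub> ?w) \<oplus>\<^bsub>E\<^esub> (pe u (v \<star> X2) \<oplus>\<^bsub>E\<^esub> c \<odot>\<^bsub>E\<^esub> ?w)"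
      by (simp add: E.a_ac E.scal_closed)
    also have "pe u (v \<star> X2) \<oplus>\<^bsub>E\<^esub> c \<odot>\<^bsub>E\<^esub> ?w = pe u (v \<star> shift c X2)"
    proof -
      have "v \<star> [:[:c:]:] = Polynomial.smult [:c:] v" using hmul_scal(2)[of v c 1] by (simp add: smult_one)
      then show ?thesis by (simp add: hmul_add_right pe_linear)
    qed
    finally show ?case unfolding cong_def
      by (intro bexI[of _ ?w] bexI[of _ "?e \<otimes>\<^bsub>E\<^esub> ?w"]) simp_all
  next
    case (mult f g)
    from trans[OF mult.IH(1)[of "g \<star> u" v] mult.IH(2)[of u "v \<star> shift c f"]]
    show ?case by (simp add: hmul_assoc shift_mult)
  qed (use refl cong_add scal in \<open>simp_all add: hmul_add_left hmul_add_right pe_linear hmul_scal\<close>)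
  have all: "cong r (pe 1 (\<kappa> c r))" if "r \<in> carrier E" for r
    using that
  proof (induction r rule: EE.tensor_induct)
    case zero
    then show ?case using refl[of "\<zero>\<^bsub>E\<^esub>"] by simp
  next
    case (pure u v)
    then show ?case using move[of u 1 v] by simp
  next
    case (add X W)
    then show ?case using cong_add[OF add.IH] by (simp add: pe_linear)
  qed
  { assume "\<kappa> c r = 0"
    then show "\<exists>x \<in> carrier E. \<exists>y \<in> carrier E. r = ?\<beta> \<otimes>\<^bsub>E\<^esub> x \<oplus>\<^bsub>E\<^esub> al1 \<otimes>\<^bsub>E\<^esub> y"
      using all[OF r] unfolding cong_def by auto }
  { assume "\<exists>x \<in> carrier E. \<exists>y \<in> carrier E. r = ?\<beta> \<otimes>\<^bsub>E\<^esub> x \<oplus>\<^bsub>E\<^esub> al1 \<otimes>\<^bsub>E\<^esub> y"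
    moreover have "\<kappa> c (?\<beta> \<otimes>\<^bsub>E\<^esub> x) = 0" if x: "x \<in> carrier E" for x
    proof -
      have "\<kappa> c (E.ev1 al1 t \<otimes>\<^bsub>E\<^esub> x) = Polynomial.smult [:c:] (\<kappa> c x)"
        unfolding t' using x by (simp add: E.l_distr E.scal_closed E.scal_mult_left E.m_assoc \<kappa>_al)
      then show ?thesis using x by (simp add: a_minus_def E.l_distr E.l_minus \<kappa>_uminus \<kappa>_al)
    qed
    ultimately show "\<kappa> c r = 0" by (auto simp: \<kappa>_al) }
qed

section \<open>The Koszul resolution of H over its enveloping algebra\<close>

abbreviation "M \<equiv> env_module H"

definition "act a m = tensor_lift H (\<lambda>x y. x \<star> m \<star> y) a"

lemma M_simps [simp]: "carrier M = UNIV" "x \<oplus>\<^bsub>M\<^esub> y = x + y" "\<zero>\<^bsub>M\<^esub> = 0" "a \<odot>\<^bsub>M\<^esub> m = act a m"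
  using H_simps by (simp_all add: env_module_def act_def with_action_def ring.defs module.defs)

lemma act_bilinear: "bilinear H Hop H (\<lambda>x y. x \<star> m \<star> y)"
  by (rule bilinearI) (simp_all add: hmul_add_left hmul_add_right hmul_scal)

lemma act_simps [simp]: "act (pe u v) m = u \<star> m \<star> v" "act \<zero>\<^bsub>E\<^esub> m = 0"
  "X \<in> carrier E \<Longrightarrow> W \<in> carrier E \<Longrightarrow> act (X \<oplus>\<^bsub>E\<^esub> W) m = act X m + act W m"
  unfolding act_def
  using EE.tensor_lift_pure[OF H.k_space_axioms act_bilinear] EE.tensor_lift_zero[OF H.k_space_axioms act_bilinear]
    EE.tensor_lift_add[OF H.k_space_axioms act_bilinear]
  by simp_all

lemma M_left_module: "left_module E M"
proof -
  have "abelian_group M"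
    by (rule abelian_groupI) (auto intro: exI[of _ "- _"])
  moreover have "act a (m + n) = act a m + act a n" if "a \<in> carrier E" for a m n
    by (rule EE.tensor_additive_eqI[OF H.abelian_group_axioms that]) (simp_all add: hmul_add_left hmul_add_right)
  moreover have "act (a \<otimes>\<^bsub>E\<^esub> a') m = act a (act a' m)" if a: "a \<in> carrier E" "a' \<in> carrier E" for a a' m
  proof (rule EE.tensor_additive_eqI[OF H.abelian_group_axioms a(1)])
    fix u v
    show "act (pe u v \<otimes>\<^bsub>E\<^esub> a') m = act (pe u v) (act a' m)"
      by (rule EE.tensor_additive_eqI[OF H.abelian_group_axioms a(2)])
        (simp_all add: E.r_distr hmul_add_left hmul_add_right hmul_assoc)
  qed (use a in \<open>simp_all add: E.l_distr\<close>)
  moreover have "act \<one>\<^bsub>E\<^esub> m = m" for m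
    unfolding pe_linear(5)[symmetric] by simp
  ultimately show ?thesis
    unfolding left_module_def left_module_axioms_def using E.ring_axioms by simp
qed

text \<open>With c = 0 the map \<kappa> is the action on 1 up to exchanging the factors, so
  \<open>\<kappa>_kernel\<close> also describes the annihilator of 1.\<close>

lemma \<kappa>_flip: "a \<in> carrier E \<Longrightarrow> \<kappa> 0 (flip a) = act a 1"
  by (rule EE.tensor_additive_eqI[OF H.abelian_group_axioms]) (use shift_0 in simp_all)

lemma E_minus_zero: "X \<in> carrier E \<Longrightarrow> \<ominus>\<^bsub>E\<^esub> X = \<zero>\<^bsub>E\<^esub> \<longleftrightarrow> X = \<zero>\<^bsub>E\<^esub>"
  by (metis E.minus_minus E.minus_zero)

lemma al1_right_zero: "X \<in> carrier E \<Longrightarrow> X \<otimes>\<^bsub>E\<^esub> al1 = \<zero>\<^bsub>E\<^esub> \<Longrightarrow> X = \<zero>\<^bsub>E\<^esub>"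
proof -
  assume X: "X \<in> carrier E" and 0: "X \<otimes>\<^bsub>E\<^esub> al1 = \<zero>\<^bsub>E\<^esub>"
  have "\<ominus>\<^bsub>E\<^esub> (al1 \<otimes>\<^bsub>E\<^esub> flip X) = \<zero>\<^bsub>E\<^esub>"
    using arg_cong[OF 0, of flip] X by (simp add: flip_mult flip_al E.l_minus)
  then have "al1 \<otimes>\<^bsub>E\<^esub> flip X = \<zero>\<^bsub>E\<^esub>" using X by (simp add: E_minus_zero)
  then have "flip X = \<zero>\<^bsub>E\<^esub>" by (rule al1_left_zero[rotated]) (use X in simp)
  then show ?thesis using flip_flip[OF X] by simp
qed

abbreviation "nu1 \<equiv> al2 \<ominus>\<^bsub>E\<^esub> E.ev1 al1 D1_quot"
abbreviation "nu2 \<equiv> \<ominus>\<^bsub>E\<^esub> al1"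

lemma nu1_al1: "nu1 \<otimes>\<^bsub>E\<^esub> al1 = al1 \<otimes>\<^bsub>E\<^esub> al2"
proof -
  have "E.ev1 al1 D1 = E.ev1 al1 D1_quot \<otimes>\<^bsub>E\<^esub> al1"
    unfolding D1_quot mult.commute[of "[:0, 1:]"] by (simp add: E.ev1_mult E.ev1_simps del: mult_pCons_right)
  then show ?thesis
    by (simp add: a_minus_def E.l_distr E.l_minus al_relation E.a_assoc E.r_neg)
qed

lemma nu_relation: "nu1 \<otimes>\<^bsub>E\<^esub> al1 \<oplus>\<^bsub>E\<^esub> nu2 \<otimes>\<^bsub>E\<^esub> al2 = \<zero>\<^bsub>E\<^esub>"
  unfolding nu1_al1 by (simp add: E.l_minus E.r_neg)

text \<open>The pattern is that of \<open>koszul_trivial\<close>. Conditions with the \<alpha>'s on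
  the left are those transported from H \<otimes> H; conditions with them on the right follow by
  \<open>flip\<close>.\<close>

lemma koszul_env: "koszul E M 1 al1 al2 nu1 nu2"
proof (intro koszul.intro koszul_axioms.intro M_left_module)
  show "\<one>\<^bsub>E\<^esub> \<noteq> \<zero>\<^bsub>E\<^esub>"
  proof
    assume "\<one>\<^bsub>E\<^esub> = \<zero>\<^bsub>E\<^esub>"
    then have "\<kappa> 0 (pe 1 1) = 0" by (simp only: pe_linear \<kappa>_simps)
    then show False using shift_simps(1)[of 0] by simp
  qed
  fix x assume "x \<in> carrier M"
  show "\<exists>a \<in> carrier E. x = a \<odot>\<^bsub>M\<^esub> 1" by (rule bexI[of _ "pe x 1"]) simp_all
next
  show "al1 \<odot>\<^bsub>M\<^esub> 1 = \<zero>\<^bsub>M\<^esub>" "al2 \<odot>\<^bsub>M\<^esub> 1 = \<zero>\<^bsub>M\<^esub>"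
    using \<kappa>_flip[of al1] \<kappa>_flip[of al2] \<kappa>_al[of "\<one>\<^bsub>E\<^esub>" 0] by (simp_all add: flip_al \<kappa>_uminus)
next
  fix a assume a: "a \<in> carrier E" "a \<odot>\<^bsub>M\<^esub> 1 = \<zero>\<^bsub>M\<^esub>"
  then have "\<kappa> 0 (flip a) = 0" by (simp add: \<kappa>_flip)
  \<comment> \<open>With t = 0 the first generator in \<open>\<kappa>_kernel\<close> is
    \<open>al2\<close> itself.\<close>
  then obtain x y where xy: "x \<in> carrier E" "y \<in> carrier E"
    "flip a = (al2 \<ominus>\<^bsub>E\<^esub> E.ev1 al1 0) \<otimes>\<^bsub>E\<^esub> x \<oplus>\<^bsub>E\<^esub> al1 \<otimes>\<^bsub>E\<^esub> y"
    using \<kappa>_kernel[of "flip a" 0 0] a by auto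
  have "flip (flip a) = flip x \<otimes>\<^bsub>E\<^esub> flip al2 \<oplus>\<^bsub>E\<^esub> flip y \<otimes>\<^bsub>E\<^esub> flip al1"
    unfolding xy(3) using xy(1,2) by (simp add: flip_mult a_minus_def)
  then have "a = \<ominus>\<^bsub>E\<^esub> flip y \<otimes>\<^bsub>E\<^esub> al1 \<oplus>\<^bsub>E\<^esub> \<ominus>\<^bsub>E\<^esub> flip x \<otimes>\<^bsub>E\<^esub> al2"
    unfolding flip_flip[OF a(1)] using xy(1,2) by (simp add: flip_al E.l_minus E.r_minus E.a_comm)
  then show "\<exists>u \<in> carrier E. \<exists>v \<in> carrier E. a = u \<otimes>\<^bsub>E\<^esub> al1 \<oplus>\<^bsub>E\<^esub> v \<otimes>\<^bsub>E\<^esub> al2"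
    by (intro bexI[of _ "\<ominus>\<^bsub>E\<^esub> flip y"] bexI[of _ "\<ominus>\<^bsub>E\<^esub> flip x"]) (use xy(1,2) in simp_all)
next
  fix a b assume a: "a \<in> carrier E" and b: "b \<in> carrier E" and eq: "a \<otimes>\<^bsub>E\<^esub> al1 \<oplus>\<^bsub>E\<^esub> b \<otimes>\<^bsub>E\<^esub> al2 = \<zero>\<^bsub>E\<^esub>"
  have "\<ominus>\<^bsub>E\<^esub> (al1 \<otimes>\<^bsub>E\<^esub> flip a) \<oplus>\<^bsub>E\<^esub> \<ominus>\<^bsub>E\<^esub> (al2 \<otimes>\<^bsub>E\<^esub> flip b) = \<zero>\<^bsub>E\<^esub>"
    using arg_cong[OF eq, of flip] a b by (simp add: flip_mult flip_al E.l_minus)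
  then have "\<ominus>\<^bsub>E\<^esub> (\<ominus>\<^bsub>E\<^esub> (al2 \<otimes>\<^bsub>E\<^esub> flip b)) = \<ominus>\<^bsub>E\<^esub> (al1 \<otimes>\<^bsub>E\<^esub> flip a)"
    using a b by (intro E.minus_equality) simp_all
  \<comment> \<open>Subtracting the zero polynomial at \<open>al1\<close> puts the equation into the
    shape of \<open>al_left_divisible\<close> with t = 0.\<close>
  then have "(al2 \<ominus>\<^bsub>E\<^esub> E.ev1 al1 0) \<otimes>\<^bsub>E\<^esub> flip b = al1 \<otimes>\<^bsub>E\<^esub> (\<ominus>\<^bsub>E\<^esub> flip a)"
    using a b by (simp add: a_minus_def E.r_minus)
  from al_left_divisible[OF _ _ this] a b obtain n where n: "n \<in> carrier E" "flip b = al1 \<otimes>\<^bsub>E\<^esub> n" by auto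
  have b': "b = flip n \<otimes>\<^bsub>E\<^esub> nu2"
    using flip_flip[OF b] n by (simp add: flip_mult flip_al)
  have "(a \<ominus>\<^bsub>E\<^esub> flip n \<otimes>\<^bsub>E\<^esub> nu1) \<otimes>\<^bsub>E\<^esub> al1 = a \<otimes>\<^bsub>E\<^esub> al1 \<ominus>\<^bsub>E\<^esub> flip n \<otimes>\<^bsub>E\<^esub> (nu1 \<otimes>\<^bsub>E\<^esub> al1)"
    using a n by (simp add: a_minus_def E.l_distr E.l_minus E.m_assoc)
  also have "\<dots> = \<zero>\<^bsub>E\<^esub>"
    using eq a n unfolding nu1_al1 b' by (simp add: a_minus_def E.l_minus E.r_minus E.m_assoc)
  finally have "a \<ominus>\<^bsub>E\<^esub> flip n \<otimes>\<^bsub>E\<^esub> nu1 = \<zero>\<^bsub>E\<^esub>" by (rule al1_right_zero[rotated]) (use a n in simp)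
  then have "a = flip n \<otimes>\<^bsub>E\<^esub> nu1" using a n by (subst (asm) E.minus_eq_zero_iff) simp_all
  then show "\<exists>c \<in> carrier E. a = c \<otimes>\<^bsub>E\<^esub> nu1 \<and> b = c \<otimes>\<^bsub>E\<^esub> nu2" using b' n by auto
next
  fix c assume c: "c \<in> carrier E" "c \<otimes>\<^bsub>E\<^esub> nu2 = \<zero>\<^bsub>E\<^esub>"
  then have "c \<otimes>\<^bsub>E\<^esub> al1 = \<zero>\<^bsub>E\<^esub>" by (simp add: E.r_minus E_minus_zero)
  then show "c = \<zero>\<^bsub>E\<^esub>" by (rule al1_right_zero[OF c(1)])
next
  fix r assume "r \<in> carrier E" "al1 \<otimes>\<^bsub>E\<^esub> r = \<zero>\<^bsub>E\<^esub>"
  then show "r = \<zero>\<^bsub>E\<^esub>" by (rule al1_left_zero)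
next
  fix a b assume a: "a \<in> carrier E" and b: "b \<in> carrier E" and eq: "nu1 \<otimes>\<^bsub>E\<^esub> a \<oplus>\<^bsub>E\<^esub> nu2 \<otimes>\<^bsub>E\<^esub> b = \<zero>\<^bsub>E\<^esub>"
  have eq': "nu1 \<otimes>\<^bsub>E\<^esub> a = al1 \<otimes>\<^bsub>E\<^esub> b"
    using E.minus_equality[OF eq] a b by (simp add: E.l_minus)
  from al_left_divisible[OF a b this] obtain n where n: "n \<in> carrier E" "a = al1 \<otimes>\<^bsub>E\<^esub> n" by auto
  have "al1 \<otimes>\<^bsub>E\<^esub> b = al1 \<otimes>\<^bsub>E\<^esub> (al2 \<otimes>\<^bsub>E\<^esub> n)"
    unfolding eq'[symmetric] n(2) using n by (simp add: E.m_assoc[symmetric] nu1_al1)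
  then have "al1 \<otimes>\<^bsub>E\<^esub> (b \<ominus>\<^bsub>E\<^esub> al2 \<otimes>\<^bsub>E\<^esub> n) = \<zero>\<^bsub>E\<^esub>"
    using b n by (simp add: a_minus_def E.r_distr E.r_minus E.r_neg)
  then have "b \<ominus>\<^bsub>E\<^esub> al2 \<otimes>\<^bsub>E\<^esub> n = \<zero>\<^bsub>E\<^esub>" by (rule al1_left_zero[rotated]) (use b n in simp)
  then have "b = al2 \<otimes>\<^bsub>E\<^esub> n" using b n by (subst (asm) E.minus_eq_zero_iff) simp_all
  then show "\<exists>n \<in> carrier E. a = al1 \<otimes>\<^bsub>E\<^esub> n \<and> b = al2 \<otimes>\<^bsub>E\<^esub> n" using n by auto
qed (simp_all add: nu_relation del: M_simps(4))

lemma enveloping_algebra_eq: "enveloping_algebra H = E"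
  by (simp add: enveloping_algebra_def)

text \<open>Kept as an explicit bijection onto H because it is used twice, for the existence of the
  Nakayama automorphism and for its uniqueness.\<close>

lemma Ext_env_2:
  "\<exists>\<Phi>. bij_betw \<Phi> (carrier (Ext_env 2 H)) UNIV \<and>
    (\<forall>\<xi> \<in> carrier (Ext_env 2 H). \<forall>\<eta> \<in> carrier (Ext_env 2 H). \<Phi> (\<xi> \<oplus>\<^bsub>Ext_env 2 H\<^esub> \<eta>) = \<Phi> \<xi> + \<Phi> \<eta>) \<and>
    (\<forall>h. \<forall>\<xi> \<in> carrier (Ext_env 2 H). h \<odot>\<^bsub>Ext_env 2 H\<^esub> \<xi> \<in> carrier (Ext_env 2 H) \<and>
      \<Phi> (h \<odot>\<^bsub>Ext_env 2 H\<^esub> \<xi>) = h \<star> \<Phi> \<xi>) \<and>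
    (\<forall>h. \<forall>\<xi> \<in> carrier (Ext_env 2 H). rsmult (Ext_env 2 H) \<xi> h \<in> carrier (Ext_env 2 H) \<and>
      \<Phi> (rsmult (Ext_env 2 H) \<xi> h) = \<Phi> \<xi> \<star> shift (d 0) h)"
proof -
  interpret K: koszul E M 1 al1 al2 nu1 nu2 by (rule koszul_env)
  let ?N = "regular_module E" and ?X = "Ext E 2 M (regular_module E)"
  obtain \<Phi> where bij: "bij_betw \<Phi> (carrier ?X) (carrier H)"
    and add: "\<And>X W. \<lbrakk>X \<in> carrier ?X; W \<in> carrier ?X\<rbrakk> \<Longrightarrow> \<Phi> (X \<oplus>\<^bsub>?X\<^esub> W) = \<Phi> X \<oplus>\<^bsub>H\<^esub> \<Phi> W"
    and nat: "\<And>g X r. \<lbrakk>g \<in> module_hom E ?N ?N; X \<in> carrier ?X; r \<in> carrier E; \<Phi> X = \<kappa> (d 0) r\<rbrakk> \<Longrightarrow>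
      Ext_map_right E 2 M ?N g X \<in> carrier ?X \<and> \<Phi> (Ext_map_right E 2 M ?N g X) = \<kappa> (d 0) (g r)"
  proof (rule K.Ext_two[of H "\<kappa> (d 0)"])
    show "\<exists>a\<in>carrier E. \<kappa> (d 0) a = y" for y by (rule bexI[of _ "pe 1 y"]) simp_all
    show "\<kappa> (d 0) a = \<zero>\<^bsub>H\<^esub> \<longleftrightarrow> (\<exists>x\<in>carrier E. \<exists>y\<in>carrier E. a = nu1 \<otimes>\<^bsub>E\<^esub> x \<oplus>\<^bsub>E\<^esub> nu2 \<otimes>\<^bsub>E\<^esub> y)"
      if a: "a \<in> carrier E" for a
    proof -
      \<comment> \<open>\<open>nu2\<close> is - \<open>al1\<close>; the sign is absorbed by the
        element multiplied.\<close>
      have swap: "(\<exists>y \<in> carrier E. P (nu2 \<otimes>\<^bsub>E\<^esub> y)) \<longleftrightarrow> (\<exists>y \<in> carrier E. P (al1 \<otimes>\<^bsub>E\<^esub> y))" for P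
      proof -
        have "nu2 \<otimes>\<^bsub>E\<^esub> y = al1 \<otimes>\<^bsub>E\<^esub> (\<ominus>\<^bsub>E\<^esub> y)" "al1 \<otimes>\<^bsub>E\<^esub> y = nu2 \<otimes>\<^bsub>E\<^esub> (\<ominus>\<^bsub>E\<^esub> y)" if "y \<in> carrier E" for y
          using that by (simp_all add: E.l_minus E.r_minus)
        then show ?thesis by (metis E.a_inv_closed)
      qed
      show ?thesis
        using \<kappa>_kernel[OF a D1_quot_0] swap[of "\<lambda>z. a = nu1 \<otimes>\<^bsub>E\<^esub> _ \<oplus>\<^bsub>E\<^esub> z"] by simp
    qed
  qed (use H.abelian_group_axioms in simp_all)
  define J where "J = Ext_env 2 H"
  have rm: "restrict (\<lambda>u. u \<otimes>\<^bsub>E\<^esub> w) (carrier ?N) \<in> module_hom E ?N ?N" if "w \<in> carrier E" for w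
    by (rule module_hom_restrictI[OF left_module_regular[OF E.ring_axioms]])
      (use that in \<open>simp_all add: E.l_distr E.m_assoc\<close>)
  \<comment> \<open>\<open>Ext_env\<close> composes with unrestricted right multiplications, while
    homomorphisms are extensional; on the values of cocycles the two agree.\<close>
  have rm_eq: "Ext_map_right E 2 M ?N (\<lambda>u. u \<otimes>\<^bsub>E\<^esub> w) X = Ext_map_right E 2 M ?N (restrict (\<lambda>u. u \<otimes>\<^bsub>E\<^esub> w) (carrier ?N)) X"
    if X: "X \<in> carrier ?X" for w X
  proof -
    have "f \<in> module_hom E (res_module E M 2) ?N" if "f \<in> X" for f
      using X that K.E.Ext_class_cocycles K.E.cocycle_hom unfolding K.E.Ext_carrier by blast
    then have "compose (carrier (res_module E M 2)) (\<lambda>u. u \<otimes>\<^bsub>E\<^esub> w) f =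
        compose (carrier (res_module E M 2)) (restrict (\<lambda>u. u \<otimes>\<^bsub>E\<^esub> w) (carrier ?N)) f" if "f \<in> X" for f
      using module_hom_closed[of f E "res_module E M 2" ?N] that by (auto simp: compose_def fun_eq_iff restrict_def)
    then show ?thesis unfolding Ext_map_right_def by (intro SUP_cong) simp_all
  qed
  have J: "carrier J = carrier ?X" "add J = add ?X"
    "smult J y \<xi> = Ext_map_right E 2 M ?N (\<lambda>u. u \<otimes>\<^bsub>E\<^esub> pe 1 y) \<xi>"
    "rsmult J \<xi> x = Ext_map_right E 2 M ?N (\<lambda>u. u \<otimes>\<^bsub>E\<^esub> pe x 1) \<xi>" for \<xi> x y
    by (simp_all add: J_def Ext_env_def Let_def enveloping_algebra_eq)
  have act: "Ext_map_right E 2 M ?N (\<lambda>u. u \<otimes>\<^bsub>E\<^esub> pe x y) \<xi> \<in> carrier ?X \<and>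
      \<Phi> (Ext_map_right E 2 M ?N (\<lambda>u. u \<otimes>\<^bsub>E\<^esub> pe x y) \<xi>) = y \<star> \<Phi> \<xi> \<star> shift (d 0) x"
    if \<xi>: "\<xi> \<in> carrier ?X" for \<xi> x y
  proof -
    \<comment> \<open>1 \<otimes> y is a representative of the value y, and multiplying it by x
      \<otimes> y' gives x \<otimes> y' y, from which both actions are read off.\<close>
    have "\<Phi> \<xi> = \<kappa> (d 0) (pe 1 (\<Phi> \<xi>))" by simp
    from nat[OF rm[of "pe x y"] \<xi> _ this] show ?thesis
      unfolding rm_eq[OF \<xi>] by (simp add: hmul_assoc)
  qed
  show ?thesis
    unfolding J_def[symmetric] by (rule exI[of _ \<Phi>]) (use bij add act in \<open>simp add: J\<close>)
qed

lemma nakayama_shift: "nakayama_automorphism 2 H (shift (d 0))"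
proof -
  interpret K: koszul E M 1 al1 al2 nu1 nu2 by (rule koszul_env)
  have "bimodule_iso H H (Ext_env 2 H) (twisted_bimodule H (shift (d 0)))"
    unfolding bimodule_iso_def twisted_bimodule_def with_actions_simps H_simps
    by (rule ex_forward[OF Ext_env_2]) simp
  moreover have "carrier (Ext_env i H) = {\<zero>\<^bsub>Ext_env i H\<^esub>}" if "i \<noteq> 2" for i
    using K.Ext_vanishes[OF that] by (simp add: Ext_env_def Let_def enveloping_algebra_eq)
  ultimately show ?thesis
    unfolding nakayama_automorphism_def using shift_automorphism by simp
qed

lemma Units_scalar: "u \<in> Units H \<Longrightarrow> \<exists>a. a \<noteq> 0 \<and> u = [:[:a:]:]"
  unfolding Units_def by (auto dest: unit_is_scalar)

lemma scalar_central: "[:[:a:]:] \<star> f = f \<star> [:[:a:]:]"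
  using hmul_scal(1)[of a 1 f] hmul_scal(2)[of f a 1] by (simp add: smult_one)

lemma inner_trivial: "inner_automorphism H \<mu> \<Longrightarrow> \<mu> f = f"
proof -
  assume "inner_automorphism H \<mu>"
  then obtain u where u: "u \<in> Units H" "\<And>x. \<mu> x = u \<star> x \<star> inv\<^bsub>H\<^esub> u"
    by (auto simp: inner_automorphism_def)
  then obtain a where "u = [:[:a:]:]" using Units_scalar by blast
  then have "u \<star> f = f \<star> u" using scalar_central by simp
  then have "u \<star> f \<star> inv\<^bsub>H\<^esub> u = f \<star> (u \<star> inv\<^bsub>H\<^esub> u)" by (simp only: hmul_assoc)
  then show ?thesis using u H.Units_r_inv[OF u(1)] by simp
qed

text \<open>The element e with \<Phi> e = 1 satisfies e f = \<mu>(f) e. Under an isomorphism \<Psi>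
  onto the bimodule twisted by \<nu> it goes to a unit, hence to a scalar, and the same equation
  then reads \<nu>(f) = \<mu>(f).\<close>

lemma nakayama_unique:
  assumes "nakayama_automorphism 2 H \<nu>"
  shows "\<nu> = shift (d 0)"
proof
  fix f
  let ?J = "Ext_env 2 H"
  obtain \<Phi> where bij: "bij_betw \<Phi> (carrier ?J) UNIV"
    and left: "\<forall>h. \<forall>\<xi> \<in> carrier ?J. h \<odot>\<^bsub>?J\<^esub> \<xi> \<in> carrier ?J \<and> \<Phi> (h \<odot>\<^bsub>?J\<^esub> \<xi>) = h \<star> \<Phi> \<xi>"
    and right: "\<forall>h. \<forall>\<xi> \<in> carrier ?J. rsmult ?J \<xi> h \<in> carrier ?J \<and> \<Phi> (rsmult ?J \<xi> h) = \<Phi> \<xi> \<star> shift (d 0) h"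
    using Ext_env_2 by (elim exE conjE) (rule that)
  have "bimodule_iso H H ?J (twisted_bimodule H \<nu>)" using assms by (simp add: nakayama_automorphism_def)
  then obtain \<Psi> where bij': "bij_betw \<Psi> (carrier ?J) UNIV"
    and \<Psi>: "\<forall>h. \<forall>\<xi> \<in> carrier ?J. \<Psi> (h \<odot>\<^bsub>?J\<^esub> \<xi>) = h \<star> \<Psi> \<xi>"
      "\<forall>h. \<forall>\<xi> \<in> carrier ?J. \<Psi> (rsmult ?J \<xi> h) = \<Psi> \<xi> \<star> \<nu> h"
    unfolding bimodule_iso_def twisted_bimodule_def with_actions_simps H_simps ball_UNIV
    by (elim exE conjE) (rule that)
  have inj: "\<xi> = \<eta>" if "\<Phi> \<xi> = \<Phi> \<eta>" "\<xi> \<in> carrier ?J" "\<eta> \<in> carrier ?J" for \<xi> \<eta>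
    by (rule inj_onD[OF bij_betw_imp_inj_on[OF bij] that])
  have "1 \<in> \<Phi> ` carrier ?J" "1 \<in> \<Psi> ` carrier ?J"
    unfolding bij_betw_imp_surj_on[OF bij] bij_betw_imp_surj_on[OF bij'] by (rule UNIV_I)+
  then obtain e y where ey: "1 = \<Phi> e" "e \<in> carrier ?J" "1 = \<Psi> y" "y \<in> carrier ?J"
    by (elim imageE) (rule that)
  note e = ey(2) ey(1)[symmetric] and y = ey(4) ey(3)[symmetric]
  \<comment> \<open>Both sides have the same image under \<Phi>, so the equation holds in Ext itself
    and can be carried over by \<Psi>.\<close>
  have "rsmult ?J e f = shift (d 0) f \<odot>\<^bsub>?J\<^esub> e" by (rule inj) (simp_all only: left[rule_format] right[rule_format] e hmul_one)
  then have "\<Psi> (rsmult ?J e f) = \<Psi> (shift (d 0) f \<odot>\<^bsub>?J\<^esub> e)" by (rule arg_cong)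
  then have eq: "\<Psi> e \<star> \<nu> f = shift (d 0) f \<star> \<Psi> e" unfolding \<Psi>(1)[rule_format, OF e(1)] \<Psi>(2)[rule_format, OF e(1)] .
  have "y = \<Phi> y \<odot>\<^bsub>?J\<^esub> e" by (rule inj) (simp_all only: left[rule_format] e y hmul_one)
  then have "\<Psi> y = \<Psi> (\<Phi> y \<odot>\<^bsub>?J\<^esub> e)" by (rule arg_cong)
  then have inv: "\<Phi> y \<star> \<Psi> e = 1" unfolding \<Psi>(1)[rule_format, OF e(1)] y(2) by (rule sym)
  \<comment> \<open>y is a left multiple of e, so \<Phi> y is a left inverse of \<Psi> e; being
    invertible on one side already makes it a scalar.\<close>
  then obtain a where a: "a \<noteq> 0" "\<Phi> y = [:[:a:]:]" using unit_is_scalar by blast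
  have "\<nu> f = \<Phi> y \<star> \<Psi> e \<star> \<nu> f" by (simp add: inv)
  also have "\<dots> = \<Phi> y \<star> shift (d 0) f \<star> \<Psi> e" by (simp add: hmul_assoc eq)
  also have "\<dots> = shift (d 0) f \<star> (\<Phi> y \<star> \<Psi> e)"
    unfolding a(2) scalar_central[of a "shift (d 0) f"] hmul_assoc ..
  finally show "\<nu> f = shift (d 0) f" by (simp add: inv)
qed

lemma calabi_yau_iff: "calabi_yau 2 H \<longleftrightarrow> d 0 = 0"
proof
  assume "calabi_yau 2 H"
  then obtain \<nu> where \<nu>: "nakayama_automorphism 2 H \<nu>" "inner_automorphism H \<nu>" by (auto simp: calabi_yau_def)
  have "shift (d 0) X2 = X2" using inner_trivial[OF \<nu>(2), of X2] unfolding nakayama_unique[OF \<nu>(1)] .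
  then show "d 0 = 0" by simp
next
  assume "d 0 = 0"
  then have "inner_automorphism H (shift (d 0))"
    unfolding inner_automorphism_def by (intro bexI[of _ "1"]) (use shift_0 H.Units_one_closed H.inv_one in auto)
  then show "calabi_yau 2 H" unfolding calabi_yau_def using nakayama_shift by blast
qed

end

subsection \<open>The antipode and cocommutativity\<close>

locale hoe_hopf_char = hoe d p + hoe_hopf d \<Delta> \<epsilon> S b c
  for d :: "nat \<Rightarrow> 'k::field" and \<Delta> \<epsilon> S b c p
begin

lemma counit_eq_aug: "\<epsilon> = aug"
proof
  fix f
  show "\<epsilon> f = aug f"
    by (induction f rule: H_induct)
      (use counit_one counit_X1 counit_X2 counit_add counit_scal counit_mult in \<open>simp_all add: ev_mult coeff_mult_0\<close>)
qed

lemma antipode_simps [simp]: "S 1 = 1" "S (f + g) = S f + S g" "S (Polynomial.smult [:a:] f) = Polynomial.smult [:a:] (S f)"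
  "S (f \<star> g) = S g \<star> S f"
  using antipode_one antipode_add[of f g] antipode_scal[of f a] antipode_mult[of f g] by simp_all

lemma antipode_zero [simp]: "S 0 = 0"
  using antipode_simps(3)[of 0 0] by simp

lemma antipode_uminus [simp]: "S (- f) = - S f"
  using antipode_simps(2)[of "- f" f] by (simp add: eq_neg_iff_add_eq_0 del: antipode_simps(2))

lemma antipode_diff: "S (f - g) = S f - S g"
  using antipode_simps(2)[of f "- g"] by simp

definition "conv_S = tensor_lift H (\<lambda>u v. S u \<star> v)"

lemma conv_S_bilinear: "bilinear H H H (\<lambda>u v. S u \<star> v)"
  by (rule bilinearI) (simp_all add: hmul_add_left hmul_add_right hmul_scal)

lemma conv_S_simps [simp]: "conv_S (pb u v) = S u \<star> v" "conv_S \<zero>\<^bsub>B\<^esub> = 0"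
  "X \<in> carrier B \<Longrightarrow> W \<in> carrier B \<Longrightarrow> conv_S (X \<oplus>\<^bsub>B\<^esub> W) = conv_S X + conv_S W"
  "X \<in> carrier B \<Longrightarrow> conv_S (r \<odot>\<^bsub>B\<^esub> X) = Polynomial.smult [:r:] (conv_S X)"
  unfolding conv_S_def
  using BB.tensor_lift_pure[OF H.k_space_axioms conv_S_bilinear] BB.tensor_lift_zero[OF H.k_space_axioms conv_S_bilinear]
    BB.tensor_lift_add[OF H.k_space_axioms conv_S_bilinear] BB.tensor_lift_scal[OF H.k_space_axioms conv_S_bilinear]
  by simp_all

lemma antipode_conv: "conv_S (\<Delta> f) = Polynomial.smult [:\<epsilon> f:] 1"
  using antipode_left[of f] by (simp add: conv_S_def)

lemma smult_neg: "Polynomial.smult [:- a :: 'k:] f = - Polynomial.smult [:a:] f"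
  using smult_minus_left[of "[:a:]" f] by simp

lemma antipode_X1: "S X1 = - X1"
  using antipode_conv[of X1] by (simp add: comult_X1 counit_X1 eq_neg_iff_add_eq_0)

section \<open>The element w and the antipode of X2\<close>

definition mo :: "nat \<Rightarrow> 'k poly poly" where "mo n = [:Polynomial.monom 1 n:]"

lemma mo_mult: "mo m \<star> mo n = mo (m + n)"
  by (simp add: mo_def hmul_const_left mult_monom)

lemma antipode_mo: "S (mo n) = Polynomial.smult [:(- 1) ^ n:] (mo n)"
proof (induction n)
  case (Suc n)
  have X: "mo (Suc 0) = X1" by (simp add: mo_def X1_def monom_altdef)
  have "S (mo (Suc n)) = S (mo (Suc 0) \<star> mo n)" by (simp add: mo_mult)
  also have "\<dots> = - Polynomial.smult [:(- 1) ^ n:] (mo n \<star> mo (Suc 0))" using Suc by (simp add: X antipode_X1 hmul_uminus hmul_scal)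
  finally show ?case by (simp add: mo_mult smult_neg)
qed (simp add: mo_def monom_0 one_pCons flip: one_pCons)

text \<open>The integer binom(p, i)/p in k; for 0 < i < p the denominator is prime to p.\<close>

definition binom_coeff :: "nat \<Rightarrow> 'k" where "binom_coeff i = of_nat (fact (p - 1)) / of_nat (fact i * fact (p - i))"

text \<open>w is split into the part fixed and the part negated by exchanging the tensor factors;
  only the second one matters for cocommutativity.\<close>

definition "w_sym = (\<Oplus>\<^bsub>B\<^esub>s \<in> {s. b s \<noteq> 0}. b s \<odot>\<^bsub>B\<^esub>
  (\<Oplus>\<^bsub>B\<^esub>i \<in> {1..p - 1}. binom_coeff i \<odot>\<^bsub>B\<^esub> pb (mo (p ^ s * i)) (mo (p ^ s * (p - i)))))"

definition "w_alt = (\<Oplus>\<^bsub>B\<^esub>j \<in> {(s, t). s < t \<and> c s t \<noteq> 0}. c (fst j) (snd j) \<odot>\<^bsub>B\<^esub>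
  (pb (mo (p ^ fst j)) (mo (p ^ snd j)) \<ominus>\<^bsub>B\<^esub> pb (mo (p ^ snd j)) (mo (p ^ fst j))))"

lemma w_closed [simp]: "w_sym \<in> carrier B" "w_alt \<in> carrier B"
  unfolding w_sym_def w_alt_def by (intro B.finsum_closed; auto intro!: B.scal_closed B.finsum_closed)+

lemma hoe_w_eq: "hoe_w d b c = w_sym \<oplus>\<^bsub>B\<^esub> w_alt"
proof -
  have pow: "mo m [^]\<^bsub>H\<^esub> n = mo (m * n)" for m n
    by (metis H.nat_pow_pow H_simps(1) UNIV_I X1_pow mo_def)
  show ?thesis
    unfolding hoe_w_def Let_def char_p w_sym_def w_alt_def binom_coeff_def
    by (simp add: X1_pow mo_def[symmetric] pow case_prod_unfold)
qed

lemma comult_X1': "\<Delta> X1 = pb X1 1 \<oplus>\<^bsub>B\<^esub> pb 1 X1"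
  using comult_X1 by simp

lemma comult_X2': "\<Delta> X2 = pb X2 1 \<oplus>\<^bsub>B\<^esub> pb 1 X2 \<oplus>\<^bsub>B\<^esub> (w_sym \<oplus>\<^bsub>B\<^esub> w_alt)"
  using comult_X2 by (simp add: hoe_w_eq)

text \<open>Evaluation of w under an arbitrary linear map, shared by the antipode computation and
  the exchange of factors.\<close>

lemma linear_w_sym:
  assumes V: "k_space V" and f: "linear_op B V f"
  shows "f w_sym = (\<Oplus>\<^bsub>V\<^esub>s \<in> {s. b s \<noteq> 0}. b s \<odot>\<^bsub>V\<^esub>
    (\<Oplus>\<^bsub>V\<^esub>i \<in> {1..p - 1}. binom_coeff i \<odot>\<^bsub>V\<^esub> f (pb (mo (p ^ s * i)) (mo (p ^ s * (p - i))))))"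
proof -
  interpret V: k_space V by fact
  interpret f: linear_op B V f by fact
  have fin: "f (finsum B g A) = finsum V (\<lambda>i. f (g i)) A" if "finite A" "\<And>i. i \<in> A \<Longrightarrow> g i \<in> carrier B" for g and A :: "nat set"
    by (rule additive_finsum[OF B.abelian_group_axioms V.abelian_group_axioms]) (use that in \<open>auto simp: f.lin_closed f.lin_add\<close>)
  have "f w_sym = (\<Oplus>\<^bsub>V\<^esub>s \<in> {s. b s \<noteq> 0}. f (b s \<odot>\<^bsub>B\<^esub>
      (\<Oplus>\<^bsub>B\<^esub>i \<in> {1..p - 1}. binom_coeff i \<odot>\<^bsub>B\<^esub> pb (mo (p ^ s * i)) (mo (p ^ s * (p - i))))))"
    unfolding w_sym_def by (rule fin[OF finite_b]) (auto intro!: B.scal_closed B.finsum_closed)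
  also have "\<dots> = (\<Oplus>\<^bsub>V\<^esub>s \<in> {s. b s \<noteq> 0}. b s \<odot>\<^bsub>V\<^esub>
    (\<Oplus>\<^bsub>V\<^esub>i \<in> {1..p - 1}. binom_coeff i \<odot>\<^bsub>V\<^esub> f (pb (mo (p ^ s * i)) (mo (p ^ s * (p - i))))))"
    by (rule V.finsum_cong')
      (auto simp: f.lin_scal fin B.scal_closed Pi_def f.lin_closed intro!: V.vs_closed V.finsum_closed B.finsum_closed)
  finally show ?thesis .
qed

lemma linear_w_alt:
  assumes V: "k_space V" and f: "linear_op B V f"
  shows "f w_alt = (\<Oplus>\<^bsub>V\<^esub>j \<in> {(s, t). s < t \<and> c s t \<noteq> 0}. c (fst j) (snd j) \<odot>\<^bsub>V\<^esub>
    f (pb (mo (p ^ fst j)) (mo (p ^ snd j)) \<ominus>\<^bsub>B\<^esub> pb (mo (p ^ snd j)) (mo (p ^ fst j))))"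
proof -
  interpret V: k_space V by fact
  interpret f: linear_op B V f by fact
  have "f w_alt = (\<Oplus>\<^bsub>V\<^esub>j \<in> {(s, t). s < t \<and> c s t \<noteq> 0}. f (c (fst j) (snd j) \<odot>\<^bsub>B\<^esub>
    (pb (mo (p ^ fst j)) (mo (p ^ snd j)) \<ominus>\<^bsub>B\<^esub> pb (mo (p ^ snd j)) (mo (p ^ fst j)))))"
    unfolding w_alt_def
    by (rule additive_finsum[OF B.abelian_group_axioms V.abelian_group_axioms _ _ finite_c])
      (auto simp: f.lin_closed f.lin_add B.scal_closed)
  also have "\<dots> = (\<Oplus>\<^bsub>V\<^esub>j \<in> {(s, t). s < t \<and> c s t \<noteq> 0}. c (fst j) (snd j) \<odot>\<^bsub>V\<^esub>
    f (pb (mo (p ^ fst j)) (mo (p ^ snd j)) \<ominus>\<^bsub>B\<^esub> pb (mo (p ^ snd j)) (mo (p ^ fst j))))"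
    by (rule V.finsum_cong') (auto simp: f.lin_scal f.lin_closed intro!: V.vs_closed)
  finally show ?thesis .
qed

lemma linear_opI:
  assumes "k_space V" "\<And>X. X \<in> carrier B \<Longrightarrow> f X \<in> carrier V"
    "\<And>X W. \<lbrakk>X \<in> carrier B; W \<in> carrier B\<rbrakk> \<Longrightarrow> f (X \<oplus>\<^bsub>B\<^esub> W) = f X \<oplus>\<^bsub>V\<^esub> f W"
    "\<And>r X. X \<in> carrier B \<Longrightarrow> f (r \<odot>\<^bsub>B\<^esub> X) = r \<odot>\<^bsub>V\<^esub> f X"
  shows "linear_op B V f"
  unfolding linear_op_def linear_op_axioms_def using assms B.k_space_axioms by simp

lemma linear_diff:
  assumes V: "k_space V" and f: "linear_op B V f" and X: "X \<in> carrier B" "W \<in> carrier B"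
  shows "f (X \<ominus>\<^bsub>B\<^esub> W) = f X \<ominus>\<^bsub>V\<^esub> f W"
proof -
  interpret V: k_space V by fact
  interpret f: linear_op B V f by fact
  have "f (\<ominus>\<^bsub>B\<^esub> W) = \<ominus>\<^bsub>V\<^esub> f W"
    using f.lin_scal[OF X(2), of "- 1"] X f.lin_closed by (simp add: B.vs_minus B.vs_one V.vs_minus V.vs_one)
  then show ?thesis using X by (simp add: a_minus_def f.lin_add f.lin_closed)
qed

lemma minus_one_pow_p: "(- 1 :: 'k) ^ p = - 1"
proof (cases "p = 2")
  case True
  \<comment> \<open>For p = 2 the power is 1, which equals -1 in this characteristic.\<close>
  have "(of_nat p :: 'k) = 0" by simp
  then have "(1 :: 'k) + 1 = 0" using True by simp
  then show ?thesis using True by (simp add: eq_neg_iff_add_eq_0)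
next
  case False
  then have "odd p" using prime_p prime_odd_nat p_gt_1 by (metis less_2_cases_iff linorder_neqE_nat not_less_zero prime_nat_iff)
  then show ?thesis by simp
qed

lemma binom_coeff_sym: "i \<in> {1..p - 1} \<Longrightarrow> binom_coeff (p - i) = binom_coeff i"
  by (auto simp: binom_coeff_def mult.commute)

lemma smult_sum_right: "Polynomial.smult r (sum g A) = (\<Sum>i \<in> A. Polynomial.smult r (g i))"
  by (induction A rule: infinite_finite_induct) (simp_all add: smult_add_right)

lemma antipode_antipode_X2: "S (S X2) = X2"
proof -
  have lin: "linear_op B H conv_S" by (rule linear_opI[OF H.k_space_axioms]) simp_all
  have pow: "(- 1 :: 'k) ^ (p ^ s) = - 1" for s
    by (induction s) (simp_all add: power_mult minus_one_pow_p)
  \<comment> \<open>S negates X1^(p^s), so both tensors of a pair (s, t) are sent to minus the same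
    power of X1 and their difference vanishes.\<close>
  have alt: "conv_S w_alt = 0"
    unfolding linear_w_alt[OF H.k_space_axioms lin] H_finsum
    by (rule sum.neutral)
      (auto simp: linear_diff[OF H.k_space_axioms lin] antipode_mo hmul_scal mo_mult pow add.commute)
  define \<gamma> :: 'k where "\<gamma> = (\<Sum>i = 1..p - 1. binom_coeff i * (- 1) ^ i)"
  have "(- 1 :: 'k) ^ (p - i) = - ((- 1) ^ i)" if "i \<in> {1..p - 1}" for i
  proof -
    have "p - i + i = p" using that by auto
    then have "(- 1 :: 'k) ^ (p - i) * (- 1) ^ i = - 1" by (metis power_add minus_one_pow_p)
    then show ?thesis by (cases "even i") auto
  qed
  \<comment> \<open>Replacing i by p - i keeps the coefficient and changes the sign of (-1)^i. The
    argument is uniform in p: for odd p it gives \<gamma> = 0, for p = 2 the sign is immaterial and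
    \<gamma> need not vanish.\<close>
  then have "\<gamma> = (\<Sum>i = 1..p - 1. - (binom_coeff (p - i) * (- 1) ^ (p - i)))"
    unfolding \<gamma>_def by (intro sum.cong) (simp_all add: binom_coeff_sym)
  also have "\<dots> = (\<Sum>i = 1..p - 1. - (binom_coeff i * (- 1) ^ i))"
    by (rule sum.reindex_bij_witness[of _ "\<lambda>i. p - i" "\<lambda>i. p - i"]) auto
  finally have \<gamma>: "\<gamma> = - \<gamma>" by (simp add: \<gamma>_def sum_negf)
  define u where "u = (\<Sum>s \<in> {s. b s \<noteq> 0}. Polynomial.smult [:b s:] (mo (p ^ Suc s)))"
  have "conv_S w_sym = Polynomial.smult [:\<gamma>:] u"
  proof -
    have inner: "(\<Sum>i = 1..p - 1. Polynomial.smult [:binom_coeff i:] (conv_S (pb (mo (p ^ s * i)) (mo (p ^ s * (p - i)))))) =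
        Polynomial.smult [:\<gamma>:] (mo (p ^ Suc s))" for s
    proof -
      have "p ^ s * i + p ^ s * (p - i) = p ^ Suc s" if "i \<in> {1..p - 1}" for i
        using that by (auto simp flip: distrib_left)
      then have "(\<Sum>i = 1..p - 1. Polynomial.smult [:binom_coeff i:] (conv_S (pb (mo (p ^ s * i)) (mo (p ^ s * (p - i)))))) =
          (\<Sum>i = 1..p - 1. Polynomial.smult [:binom_coeff i * (- 1) ^ i:] (mo (p ^ Suc s)))"
        by (intro sum.cong) (simp_all add: antipode_mo hmul_scal mo_mult power_mult pow mult.commute[of "binom_coeff _"])
      also have "\<dots> = Polynomial.smult [:\<gamma>:] (mo (p ^ Suc s))"
      proof -
        have "[:\<gamma>:] = (\<Sum>i = 1..p - 1. [:binom_coeff i * (- 1) ^ i:])"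
          unfolding \<gamma>_def by (rule poly_eqI) (simp add: coeff_sum coeff_pCons split: nat.splits)
        then show ?thesis by (simp add: smult_sum)
      qed
      finally show ?thesis .
    qed
    show ?thesis
      unfolding linear_w_sym[OF H.k_space_axioms lin] H_finsum H_simps inner u_def
      by (simp add: smult_sum_right mult.commute)
  qed
  then have "S X2 + (X2 + Polynomial.smult [:\<gamma>:] u) = 0"
    using antipode_conv[of X2] alt by (simp add: comult_X2' counit_X2 add.assoc)
  then have S: "S X2 = - X2 - Polynomial.smult [:\<gamma>:] u"
    by (metis add.commute add_eq_0_iff2 diff_conv_add_uminus minus_add_distrib)
  have "S u = - u"
  proof -
    have "S (\<Sum>s \<in> A. Polynomial.smult [:b s:] (mo (p ^ Suc s))) = - (\<Sum>s \<in> A. Polynomial.smult [:b s:] (mo (p ^ Suc s)))" for A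
      by (induction A rule: infinite_finite_induct) (simp_all add: antipode_mo pow smult_neg del: power_Suc)
    then show ?thesis by (simp add: u_def)
  qed
  then have "S (Polynomial.smult [:\<gamma>:] u) = Polynomial.smult [:- \<gamma>:] u" by (simp add: smult_neg)
  then have "S (Polynomial.smult [:\<gamma>:] u) = Polynomial.smult [:\<gamma>:] u" unfolding \<gamma>[symmetric] .
  then have "S (- X2 - Polynomial.smult [:\<gamma>:] u) = - S X2 - Polynomial.smult [:\<gamma>:] u"
    by (simp only: antipode_diff antipode_uminus)
  then have "S (S X2) = - S X2 - Polynomial.smult [:\<gamma>:] u" by (simp only: S[symmetric])
  also have "\<dots> = X2" unfolding S by simp
  finally show ?thesis .
qed

lemma antipode_antipode: "S (S f) = f"
  by (induction f rule: H_induct) (simp_all add: antipode_X1 antipode_antipode_X2)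

section \<open>Cocommutativity\<close>

definition "tau = tensor_lift B (\<lambda>u v. pb v u)"

lemma tau_bilinear: "bilinear H H B (\<lambda>u v. pb v u)"
  by (rule bilinearI) (simp_all add: pb_linear)

lemma tau_simps [simp]: "tau (pb u v) = pb v u" "tau \<zero>\<^bsub>B\<^esub> = \<zero>\<^bsub>B\<^esub>"
  "X \<in> carrier B \<Longrightarrow> W \<in> carrier B \<Longrightarrow> tau (X \<oplus>\<^bsub>B\<^esub> W) = tau X \<oplus>\<^bsub>B\<^esub> tau W"
  "X \<in> carrier B \<Longrightarrow> tau X \<in> carrier B" "X \<in> carrier B \<Longrightarrow> tau (r \<odot>\<^bsub>B\<^esub> X) = r \<odot>\<^bsub>B\<^esub> tau X"
  unfolding tau_def
  using BB.tensor_lift_pure[OF B.k_space_axioms tau_bilinear] BB.tensor_lift_zero[OF B.k_space_axioms tau_bilinear]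
    BB.tensor_lift_add[OF B.k_space_axioms tau_bilinear] BB.tensor_lift_closed[OF B.k_space_axioms tau_bilinear]
    BB.tensor_lift_scal[OF B.k_space_axioms tau_bilinear]
  by simp_all

lemma tau_one: "tau \<one>\<^bsub>B\<^esub> = \<one>\<^bsub>B\<^esub>"
  unfolding pb_linear(5)[symmetric] by simp

text \<open>Since exchanging the factors is an algebra homomorphism, cocommutativity has to be
  checked on X1 and X2 only.\<close>

lemma tau_mult:
  assumes X: "X \<in> carrier B" and W: "W \<in> carrier B"
  shows "tau (X \<otimes>\<^bsub>B\<^esub> W) = tau X \<otimes>\<^bsub>B\<^esub> tau W"
proof (rule BB.tensor_additive_eqI[OF B.abelian_group_axioms W])
  fix u v
  show "tau (X \<otimes>\<^bsub>B\<^esub> pb u v) = tau X \<otimes>\<^bsub>B\<^esub> tau (pb u v)"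
    by (rule BB.tensor_additive_eqI[OF B.abelian_group_axioms X]) (simp_all add: B.l_distr)
qed (use X in \<open>simp_all add: B.r_distr\<close>)

lemma tau_w: "tau w_sym = w_sym" "tau w_alt = \<ominus>\<^bsub>B\<^esub> w_alt"
proof -
  have lin: "linear_op B B tau" by (rule linear_opI[OF B.k_space_axioms]) simp_all
  have "(\<Oplus>\<^bsub>B\<^esub>i \<in> {1..p - 1}. binom_coeff i \<odot>\<^bsub>B\<^esub> pb (mo (p ^ s * (p - i))) (mo (p ^ s * i))) =
      (\<Oplus>\<^bsub>B\<^esub>i \<in> {1..p - 1}. binom_coeff i \<odot>\<^bsub>B\<^esub> pb (mo (p ^ s * i)) (mo (p ^ s * (p - i))))" for s
  proof -
    let ?A = "{1..p - 1}" and ?g = "\<lambda>i. binom_coeff i \<odot>\<^bsub>B\<^esub> pb (mo (p ^ s * i)) (mo (p ^ s * (p - i)))"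
    \<comment> \<open>Exchanging the factors replaces i by p - i, and the coefficients are symmetric
      under this substitution.\<close>
    have "(\<lambda>i. p - i) ` ?A = ?A"
    proof
      show "?A \<subseteq> (\<lambda>i. p - i) ` ?A"
      proof
        fix i assume "i \<in> ?A"
        then show "i \<in> (\<lambda>i. p - i) ` ?A" by (intro image_eqI[of _ _ "p - i"]) auto
      qed
    qed auto
    then have "finsum B ?g ?A = finsum B ?g ((\<lambda>i. p - i) ` ?A)" by simp
    also have "\<dots> = (\<Oplus>\<^bsub>B\<^esub>i \<in> ?A. ?g (p - i))"
      by (rule B.finsum_reindex) (auto simp: B.scal_closed inj_on_def)
    also have "\<dots> = (\<Oplus>\<^bsub>B\<^esub>i \<in> ?A. binom_coeff i \<odot>\<^bsub>B\<^esub> pb (mo (p ^ s * (p - i))) (mo (p ^ s * i)))"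
      by (rule B.finsum_cong') (auto simp: B.scal_closed binom_coeff_sym)
    finally show ?thesis ..
  qed
  then show "tau w_sym = w_sym"
    unfolding linear_w_sym[OF B.k_space_axioms lin] by (simp add: w_sym_def)
  have "\<ominus>\<^bsub>B\<^esub> w_alt = (\<Oplus>\<^bsub>B\<^esub>j \<in> {(s, t). s < t \<and> c s t \<noteq> 0}. \<ominus>\<^bsub>B\<^esub> (c (fst j) (snd j) \<odot>\<^bsub>B\<^esub>
      (pb (mo (p ^ fst j)) (mo (p ^ snd j)) \<ominus>\<^bsub>B\<^esub> pb (mo (p ^ snd j)) (mo (p ^ fst j)))))"
    unfolding w_alt_def
    by (rule additive_finsum[OF B.abelian_group_axioms B.abelian_group_axioms _ _ finite_c])
      (auto simp: B.minus_add B.scal_closed B.a_comm)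
  also have "\<dots> = (\<Oplus>\<^bsub>B\<^esub>j \<in> {(s, t). s < t \<and> c s t \<noteq> 0}. c (fst j) (snd j) \<odot>\<^bsub>B\<^esub>
      tau (pb (mo (p ^ fst j)) (mo (p ^ snd j)) \<ominus>\<^bsub>B\<^esub> pb (mo (p ^ snd j)) (mo (p ^ fst j))))"
  proof (rule B.finsum_cong')
    fix j
    let ?x = "pb (mo (p ^ fst j)) (mo (p ^ snd j))" and ?y = "pb (mo (p ^ snd j)) (mo (p ^ fst j))"
    have "\<ominus>\<^bsub>B\<^esub> (?x \<ominus>\<^bsub>B\<^esub> ?y) = ?y \<ominus>\<^bsub>B\<^esub> ?x" by (simp add: a_minus_def B.minus_add B.a_comm)
    moreover have "\<ominus>\<^bsub>B\<^esub> (r \<odot>\<^bsub>B\<^esub> z) = r \<odot>\<^bsub>B\<^esub> \<ominus>\<^bsub>B\<^esub> z" if "z \<in> carrier B" for r z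
    proof -
      have "r \<odot>\<^bsub>B\<^esub> ((- 1) \<odot>\<^bsub>B\<^esub> z) = (- r) \<odot>\<^bsub>B\<^esub> z" using that by (simp add: B.scal_scal)
      then show ?thesis using that by (simp add: B.vs_minus B.vs_one)
    qed
    ultimately show "\<ominus>\<^bsub>B\<^esub> (c (fst j) (snd j) \<odot>\<^bsub>B\<^esub> (?x \<ominus>\<^bsub>B\<^esub> ?y)) = c (fst j) (snd j) \<odot>\<^bsub>B\<^esub> tau (?x \<ominus>\<^bsub>B\<^esub> ?y)"
      by (simp add: linear_diff[OF B.k_space_axioms lin])
  qed (auto simp: B.scal_closed)
  also have "\<dots> = tau w_alt" by (rule linear_w_alt[OF B.k_space_axioms lin, symmetric])
  finally show "tau w_alt = \<ominus>\<^bsub>B\<^esub> w_alt" ..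
qed

text \<open>The coordinate selects X1^(p^t) in the second factor. A reversed tensor with that second
  factor has a first factor X1^(p^r) with r > t, so the coefficient at p^s with s < t sees the pair
  (s, t) alone.\<close>

lemma w_alt_coeff:
  assumes st: "s < t"
  shows "poly.coeff (poly.coeff (crd (p ^ t) 0 w_alt) 0) (p ^ s) = c s t"
proof -
  have lin: "linear_op B H (crd i j)" for i j by (rule linear_opI[OF H.k_space_axioms]) simp_all
  have inj: "p ^ m = p ^ n \<longleftrightarrow> m = n" for m n using p_gt_1 by simp
  have coeff: "poly.coeff (poly.coeff (mo n) 0) m = (if m = n then 1 else 0)" for m n by (simp add: mo_def)
  have "poly.coeff (poly.coeff (crd (p ^ t) 0 w_alt) 0) (p ^ s) =
      (\<Sum>j \<in> {(s, t). s < t \<and> c s t \<noteq> 0}. if j = (s, t) then c s t else 0)"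
    unfolding linear_w_alt[OF H.k_space_axioms lin] H_finsum coeff_sum
    by (rule sum.cong) (use st in \<open>auto simp: linear_diff[OF H.k_space_axioms lin] coeff inj\<close>)
  also have "\<dots> = c s t" using finite_c st by (auto simp: sum.delta)
  finally show ?thesis .
qed

text \<open>All parts of the coproduct of X2 but \<open>w_alt\<close> are symmetric, so the
  condition is that \<open>w_alt\<close> equals its negative; comparing coefficients gives 2 c s t =
  0.\<close>

lemma cocommutative_iff: "cocommutative H \<Delta> \<longleftrightarrow> (\<forall>s t. s < t \<longrightarrow> c s t = 0) \<or> p = 2"
proof -
  have "cocommutative H \<Delta> \<longleftrightarrow> tau (\<Delta> X2) = \<Delta> X2"
  proof
    assume X2: "tau (\<Delta> X2) = \<Delta> X2"
    have "tau (\<Delta> f) = \<Delta> f" for f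
    proof (induction f rule: H_induct)
      case X1
      then show ?case by (simp add: comult_X1' B.a_comm)
    next
      case X2
      then show ?case by fact
    next
      case (add f g)
      then show ?case using comult(1)[of f] comult(1)[of g] comult(2)[of f g] by simp
    next
      case (scal a f)
      then show ?case using comult(1)[of f] comult(5)[of f a] by simp
    next
      case (mult f g)
      then show ?case using comult(1)[of f] comult(1)[of g] comult(3)[of f g] by (simp add: tau_mult)
    qed (use comult(4) tau_one in simp)
    then show "cocommutative H \<Delta>" by (simp add: cocommutative_def tau_def)
  qed (simp add: cocommutative_def tau_def)
  also have "\<dots> \<longleftrightarrow> w_alt = \<ominus>\<^bsub>B\<^esub> w_alt"
  proof -
    have "tau (\<Delta> X2) = pb X2 1 \<oplus>\<^bsub>B\<^esub> pb 1 X2 \<oplus>\<^bsub>B\<^esub> w_sym \<oplus>\<^bsub>B\<^esub> \<ominus>\<^bsub>B\<^esub> w_alt"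
      by (simp add: comult_X2' tau_w B.a_ac)
    moreover have "\<Delta> X2 = pb X2 1 \<oplus>\<^bsub>B\<^esub> pb 1 X2 \<oplus>\<^bsub>B\<^esub> w_sym \<oplus>\<^bsub>B\<^esub> w_alt"
      by (simp add: comult_X2' B.a_assoc)
    moreover have "a \<oplus>\<^bsub>B\<^esub> X = a \<oplus>\<^bsub>B\<^esub> W \<longleftrightarrow> X = W" if "a \<in> carrier B" "X \<in> carrier B" "W \<in> carrier B" for a X W
    proof
      assume "a \<oplus>\<^bsub>B\<^esub> X = a \<oplus>\<^bsub>B\<^esub> W"
      then have "\<ominus>\<^bsub>B\<^esub> a \<oplus>\<^bsub>B\<^esub> (a \<oplus>\<^bsub>B\<^esub> X) = \<ominus>\<^bsub>B\<^esub> a \<oplus>\<^bsub>B\<^esub> (a \<oplus>\<^bsub>B\<^esub> W)" by simp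
      then show "X = W" unfolding B.r_neg1[OF that(1,2)] B.r_neg1[OF that(1,3)] .
    qed simp
    ultimately show ?thesis by (simp add: eq_commute[of w_alt])
  qed
  also have "\<dots> \<longleftrightarrow> (\<forall>s t. s < t \<longrightarrow> c s t = 0) \<or> p = 2"
  proof
    assume eq: "w_alt = \<ominus>\<^bsub>B\<^esub> w_alt"
    have "c s t = 0" if "s < t" "p \<noteq> 2" for s t
    proof -
      have "\<ominus>\<^bsub>B\<^esub> w_alt = (- 1) \<odot>\<^bsub>B\<^esub> w_alt" by (simp add: B.vs_minus B.vs_one)
      with eq have "w_alt = (- 1) \<odot>\<^bsub>B\<^esub> w_alt" by (rule trans)
      then have "crd (p ^ t) 0 w_alt = crd (p ^ t) 0 ((- 1) \<odot>\<^bsub>B\<^esub> w_alt)" by (rule arg_cong)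
      also have "\<dots> = - crd (p ^ t) 0 w_alt" unfolding crd_simps(4)[OF w_closed(2)] by (simp add: smult_neg pCons_one)
      finally have "poly.coeff (poly.coeff (crd (p ^ t) 0 w_alt) 0) (p ^ s) =
          poly.coeff (poly.coeff (- crd (p ^ t) 0 w_alt) 0) (p ^ s)" by (rule arg_cong)
      then have "c s t = - c s t" unfolding coeff_minus w_alt_coeff[OF that(1)] .
      then have "of_nat 2 * c s t = 0" by (simp add: eq_neg_iff_add_eq_0)
      moreover have "(of_nat 2 :: 'k) \<noteq> 0"
        unfolding of_nat_eq_0 using that(2) p_gt_1 dvd_imp_le[of p 2] by auto
      ultimately show ?thesis by simp
    qed
    then show "(\<forall>s t. s < t \<longrightarrow> c s t = 0) \<or> p = 2" by blast
  next
    assume "(\<forall>s t. s < t \<longrightarrow> c s t = 0) \<or> p = 2"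
    then show "w_alt = \<ominus>\<^bsub>B\<^esub> w_alt"
    proof
      assume "\<forall>s t. s < t \<longrightarrow> c s t = 0"
      then have empty: "{(s, t). s < t \<and> c s t \<noteq> 0} = {}" by auto
      show ?thesis unfolding w_alt_def empty by simp
    next
      assume "p = 2"
      then have "(1 :: 'k) = - 1" using minus_one_pow_p by simp
      then have "1 \<odot>\<^bsub>B\<^esub> w_alt = (- 1) \<odot>\<^bsub>B\<^esub> w_alt" by (rule arg_cong)
      then show ?thesis unfolding B.vs_minus[OF w_closed(2)] B.vs_one[OF w_closed(2)] .
    qed
  qed
  finally show ?thesis .
qed

end

theorem proposition8p1:
  fixes d b :: "nat \<Rightarrow> 'k::alg_closed_field" and c :: "nat \<Rightarrow> nat \<Rightarrow> 'k"
    and \<Delta> :: "'k poly poly \<Rightarrow> ('k poly poly \<times> 'k poly poly \<Rightarrow>\<^sub>0 'k) set"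
    and \<epsilon> :: "'k poly poly \<Rightarrow> 'k" and S :: "'k poly poly \<Rightarrow> 'k poly poly"
  defines "H \<equiv> hoe_algebra d" and "p \<equiv> CHAR('k)"
  assumes "CHAR('k) > 0"
    and "hoe_hopf d \<Delta> \<epsilon> S b c"
  shows
    "(\<forall>h \<in> carrier H. S (S h) = h) \<and>
     (cring H \<longleftrightarrow> (\<forall>s. d s = 0)) \<and>
     (cocommutative H \<Delta> \<longleftrightarrow> (\<forall>s t. s < t \<longrightarrow> c s t = 0) \<or> p = 2) \<and>
     (\<not> cring H \<longrightarrow>
        ring_center H = generated_subalgebra H
          {X1 [^]\<^bsub>H\<^esub> p, X2 [^]\<^bsub>H\<^esub> p \<ominus>\<^bsub>H\<^esub> (d 0 ^ (p - 1)) \<odot>\<^bsub>H\<^esub> X2} \<and>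
        has_PI_degree H p) \<and>
     ((\<exists>!\<mu>. nakayama_automorphism 2 H \<mu>) \<and>
      (\<forall>\<mu>. nakayama_automorphism 2 H \<mu> \<longrightarrow>
         \<mu> X1 = X1 \<and> \<mu> X2 = X2 \<oplus>\<^bsub>H\<^esub> d 0 \<odot>\<^bsub>H\<^esub> \<one>\<^bsub>H\<^esub>) \<and>
      (calabi_yau 2 H \<longleftrightarrow> d 0 = 0)) \<and>
     (one_dimensional H (left_homological_integral 2 H \<epsilon>) \<and>
      left_trivial H \<epsilon> (left_homological_integral 2 H \<epsilon>) \<and>
      right_module_iso H (left_homological_integral 2 H \<epsilon>)
        (quotient_bimodule H (Idl\<^bsub>H\<^esub> {X1, X2 \<ominus>\<^bsub>H\<^esub> d 0 \<odot>\<^bsub>H\<^esub> \<one>\<^bsub>H\<^esub>})))"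
proof -
  interpret hoe_hopf d \<Delta> \<epsilon> S b c by fact
  interpret hoe_hopf_char d \<Delta> \<epsilon> S b c p
    by unfold_locales (use assms(3) finite_d in \<open>simp_all add: p_def\<close>)
  have noncomm: "ring_center H = generated_subalgebra H
      {X1 [^]\<^bsub>H\<^esub> p, X2 [^]\<^bsub>H\<^esub> p \<ominus>\<^bsub>H\<^esub> (d 0 ^ (p - 1)) \<odot>\<^bsub>H\<^esub> X2} \<and> has_PI_degree H p" if "\<not> cring H"
  proof -
    have D: "D1 \<noteq> 0" using that by (simp add: H_def cring_iff D1_eq_0_iff)
    show ?thesis unfolding H_def using center_eq[OF D] H_PI_degree[OF D] by blast
  qed
  have "\<mu> X1 = X1 \<and> \<mu> X2 = X2 \<oplus>\<^bsub>hoe_algebra d\<^esub> d 0 \<odot>\<^bsub>hoe_algebra d\<^esub> \<one>\<^bsub>hoe_algebra d\<^esub>"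
    if "nakayama_automorphism 2 (hoe_algebra d) \<mu>" for \<mu>
    unfolding nakayama_unique[OF that] by (simp add: smult_one)
  then have "(\<exists>!\<mu>. nakayama_automorphism 2 H \<mu>) \<and>
      (\<forall>\<mu>. nakayama_automorphism 2 H \<mu> \<longrightarrow> \<mu> X1 = X1 \<and> \<mu> X2 = X2 \<oplus>\<^bsub>H\<^esub> d 0 \<odot>\<^bsub>H\<^esub> \<one>\<^bsub>H\<^esub>) \<and>
      (calabi_yau 2 H \<longleftrightarrow> d 0 = 0)"
    unfolding H_def using nakayama_shift nakayama_unique calabi_yau_iff by blast
  then show ?thesis
    using antipode_antipode cring_iff cocommutative_iff noncomm homological_integral[OF counit_eq_aug]
    unfolding H_def by blast
qed

end
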